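(* Let $X$ be a compact geodesic space with basepoint $\bullet$ and let $r>0$. If $\sigma\in\overline{\mathrm{Rips}}(X,r)$ with vertices $x_1,x_2,x_3$ is a critical triangle, with $\alpha_\sigma$ the corresponding filling of the closed sequence $x_1,x_2,x_3,x_1$, then: (1) the points $x_1,x_2,x_3$ are at pairwise distance $r$; (2) no $\alpha_\sigma$-lasso is contained in $\mathcal{L}(X,3r,\pi_1)$, and $\alpha_\sigma$ has length $3r$. Furthermore, if $r<r'$ are consecutive critical values of the persistence $\{\pi_1(\mathrm{Rips}(X,s),\bullet)\}_{s>0}$, then the kernel of $\pi_1(\mathrm{Rips}(X,r),\bullet)\to\pi_1(\mathrm{Rips}(X,r'),\bullet)$ is generated by (the classes represented by $r$-samples of) all $\alpha'$-lassos, where $\alpha'$ ranges through the fillings of the vertices of each of the critical triangles in $\overline{\mathrm{Rips}}(X,r)$. Conversely, if $\alpha$ is a loop in $X$ of length $3r$ such that some (equivalently, each) $\alpha$-lasso is not contained in $\mathcal{L}(X,3r,\pi_1)$, then $\alpha$ is a geodesic circle, $r$ is a critical value of this persistence, and any three equidistant points on $\alpha$ form the vertices of a critical triangle $\sigma\in\overline{\mathrm{Rips}}(X,r)$.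
   Context: A metric space $(X,d)$ is geodesic if any $x,y\in X$ are joined by a path (a geodesic) of length $d(x,y)$. A geodesic circle is an isometrically embedded circle (with its geodesic metric) of positive circumference. $\mathrm{Rips}(X,r)$ (resp. $\overline{\mathrm{Rips}}(X,r)$) is the simplicial complex with vertex set $X$ in which a finite nonempty $\sigma\subset X$ is a simplex iff $\operatorname{diam}(\sigma)<r$ (resp. $\le r$). Bonding maps are induced by inclusions. Samples and fillings: an $r$-loop is a sequence $(x_0,\dots,x_k,x_{k+1}=x_0)$ in $X$ with $d(x_i,x_{i+1})<r$, viewed as a simplicial loop in $\mathrm{Rips}(X,r)$. A filling of a closed sequence of points is a loop in $X$ obtained by connecting consecutive points by geodesics. An $r$-sample of a loop $\alpha:[0,a]\to X$ is a choice $0\le t_0<\dots<t_m\le a$ with $\operatorname{diam}\alpha([t_i,t_{i+1}])<r$ for all $i<m$ and $\operatorname{diam}(\alpha([0,t_0]\cup[t_m,a]))<r$ (with $t_0=0$ for based loops), identified with the $r$-loop $(\alpha(t_0),\dots,\alpha(t_m),\alpha(t_0))$. Lassos: an $l$-lasso is a based loop $\gamma*\beta*\gamma^-$, where $\gamma$ is a finite-length path starting at $\bullet$, $\gamma^-$ its reverse, and $\beta$ a loop of length $l$ based at the endpoint of $\gamma$. For a finite-length closed curve $\alpha$, an $\alpha$-lasso is (the homotopy class of) a loop $\gamma*\alpha*\gamma^-$ with $\gamma$ a finite-length path from $\bullet$ to a point of $\alpha$ (the concatenation taking place at that point). $\mathcal L(X,r,\pi_1)\le\pi_1(X,\bullet)$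 is generated by all $l$-lassos with $l<r$. Critical triangle: a triangle $\sigma\in\overline{\mathrm{Rips}}(X,r)$ with vertices $x_1,x_2,x_3$ is critical if the kernel of the inclusion-induced map $\pi_1(\mathrm{Rips}(X,r),\bullet)\to\pi_1(\mathrm{Rips}(X,r)\cup\sigma,\bullet)$ is nontrivial, where $\mathrm{Rips}(X,r)\cup\sigma$ denotes the space obtained from $\mathrm{Rips}(X,r)$ by attaching a $2$-disc along the closed edge path given by some $(r/2)$-sample of some filling $\alpha_\sigma$ of the $2r$-loop $x_1,x_2,x_3,x_1$. Critical values: $p>0$ is left critical if for all small enough $\varepsilon>0$ the bonding map from $p-\varepsilon$ to $p$ is not an isomorphism; right critical if for all $\varepsilon>0$ the bonding map from $p$ to $p+\varepsilon$ is not an isomorphism; critical if left or right critical. Consecutive means there is no critical value strictly in between. *)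

theory Defs
  imports "HOL-Analysis.Analysis" "HOL-Algebra.Generated_Groups"
begin

section \<open>Curves in a metric space\<close>

definition curve_length :: "real \<Rightarrow> real \<Rightarrow> (real \<Rightarrow> 'a::metric_space) \<Rightarrow> ennreal" where
  "curve_length a b g =
     (SUP ts \<in> {ts. sorted ts \<and> set ts \<subseteq> {a..b}}.
        \<Sum>i < length ts - 1. ennreal (dist (g (ts ! i)) (g (ts ! Suc i))))"

definition geodesic_on :: "'a::metric_space set \<Rightarrow> real \<Rightarrow> real \<Rightarrow> (real \<Rightarrow> 'a) \<Rightarrow> bool" where
  "geodesic_on X a b g \<longleftrightarrow>
     continuous_on {a..b} g \<and> g ` {a..b} \<subseteq> X \<and>
     curve_length a b g = ennreal (dist (g a) (g b))"

definition geodesic_space :: "'a::metric_space set \<Rightarrow> bool" where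
  "geodesic_space X \<longleftrightarrow>
     (\<forall>x\<in>X. \<forall>y\<in>X. \<exists>g. geodesic_on X 0 1 g \<and> pathstart g = x \<and> pathfinish g = y)"

definition loop_in :: "'a::topological_space set \<Rightarrow> (real \<Rightarrow> 'a) \<Rightarrow> bool" where
  "loop_in X g \<longleftrightarrow> path g \<and> path_image g \<subseteq> X \<and> pathfinish g = pathstart g"

text \<open>The circle of circumference \<open>c\<close> is the interval \<open>{0..c}\<close> with identified endpoints,
  with arc-length metric \<open>min \<bar>s - t\<bar> (c - \<bar>s - t\<bar>)\<close>.\<close>

definition isometric_circle :: "'a::metric_space set \<Rightarrow> real \<Rightarrow> (real \<Rightarrow> 'a) \<Rightarrow> bool" where
  "isometric_circle X c e \<longleftrightarrow>
     c > 0 \<and> e ` {0..c} \<subseteq> X \<and>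
     (\<forall>s\<in>{0..c}. \<forall>t\<in>{0..c}. dist (e s) (e t) = min \<bar>s - t\<bar> (c - \<bar>s - t\<bar>))"

text \<open>A loop need not be parametrised by arc length, so it is called a geodesic circle if it
  runs exactly once around an isometrically embedded circle, up to a monotone change of
  parameter.\<close>

definition geodesic_circle :: "'a::metric_space set \<Rightarrow> (real \<Rightarrow> 'a) \<Rightarrow> bool" where
  "geodesic_circle X g \<longleftrightarrow>
     (\<exists>c e \<phi>. isometric_circle X c e \<and>
        continuous_on {0..1} \<phi> \<and> mono_on {0..1} \<phi> \<and> \<phi> 0 = 0 \<and> \<phi> 1 = c \<and>
        (\<forall>t\<in>{0..1}. g t = e (\<phi> t)))"

text \<open>The closed sequence is the full list \<open>[x\<^sub>0, \<dots>, x\<^sub>k, x\<^sub>0]\<close>; any subdivision of the unit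
  interval may be used to concatenate the geodesics.\<close>

definition filling :: "'a::metric_space set \<Rightarrow> 'a list \<Rightarrow> (real \<Rightarrow> 'a) \<Rightarrow> bool" where
  "filling X xs g \<longleftrightarrow>
     loop_in X g \<and>
     (\<exists>ts. ts \<noteq> [] \<and> length ts = length xs \<and> sorted_wrt (<) ts \<and> hd ts = 0 \<and> last ts = 1 \<and>
        (\<forall>i < length xs. g (ts ! i) = xs ! i) \<and>
        (\<forall>i. Suc i < length xs \<longrightarrow> geodesic_on X (ts ! i) (ts ! Suc i) g))"

text \<open>The parameters \<open>t\<^sub>0 < \<dots> < t\<^sub>m\<close> of an \<open>r\<close>-sample, and the \<open>r\<close>-loop it is identified with.\<close>

definition sample :: "real \<Rightarrow> (real \<Rightarrow> 'a::metric_space) \<Rightarrow> real list \<Rightarrow> bool" where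
  "sample r g ts \<longleftrightarrow>
     ts \<noteq> [] \<and> sorted_wrt (<) ts \<and> set ts \<subseteq> {0..1} \<and>
     (\<forall>i. Suc i < length ts \<longrightarrow> diameter (g ` {ts ! i..ts ! Suc i}) < r) \<and>
     diameter (g ` ({0..hd ts} \<union> {last ts..1})) < r"

definition based_sample :: "real \<Rightarrow> (real \<Rightarrow> 'a::metric_space) \<Rightarrow> real list \<Rightarrow> bool" where
  "based_sample r g ts \<longleftrightarrow> sample r g ts \<and> hd ts = 0"

definition sample_loop :: "(real \<Rightarrow> 'a) \<Rightarrow> real list \<Rightarrow> 'a list" where
  "sample_loop g ts = map g ts @ [g (hd ts)]"

section \<open>Fundamental groups\<close>

text \<open>Loops are functions on all of \<^typ>\<open>real\<close>, of which only the values on \<open>{0..1}\<close> matter: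
  a homotopy class contains all extensions of its members.\<close>

definition loop_class :: "'b topology \<Rightarrow> 'b \<Rightarrow> (real \<Rightarrow> 'b) \<Rightarrow> (real \<Rightarrow> 'b) set" where
  "loop_class T b p =
     {q. homotopic_with (\<lambda>f. f 0 = b \<and> f 1 = b) (top_of_set {0..1}) T p q}"

definition fundamental_group :: "'b topology \<Rightarrow> 'b \<Rightarrow> (real \<Rightarrow> 'b) set monoid" where
  "fundamental_group T b =
     \<lparr>carrier = loop_class T b ` {p. pathin T p \<and> p 0 = b \<and> p 1 = b},
      mult = (\<lambda>A B. \<Union>p\<in>A. \<Union>q\<in>B.
                loop_class T b (\<lambda>t. if t \<le> 1/2 then p (2 * t) else q (2 * t - 1))),
      one = loop_class T b (\<lambda>_. b)\<rparr>"

text \<open>The map induced by \<open>f\<close>, where \<open>T\<close> and \<open>b\<close> are the codomain of \<open>f\<close> and its basepoint.\<close>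

definition induced_map ::
  "'c topology \<Rightarrow> 'c \<Rightarrow> ('b \<Rightarrow> 'c) \<Rightarrow> (real \<Rightarrow> 'b) set \<Rightarrow> (real \<Rightarrow> 'c) set" where
  "induced_map T b f A = (\<Union>p\<in>A. loop_class T b (f \<circ> p))"

section \<open>Lassos\<close>

definition finite_path_from :: "'a::metric_space set \<Rightarrow> 'a \<Rightarrow> (real \<Rightarrow> 'a) \<Rightarrow> bool" where
  "finite_path_from X b \<gamma> \<longleftrightarrow>
     path \<gamma> \<and> path_image \<gamma> \<subseteq> X \<and> pathstart \<gamma> = b \<and> curve_length 0 1 \<gamma> < \<infinity>"

definition lassos :: "'a::metric_space set \<Rightarrow> 'a \<Rightarrow> ennreal \<Rightarrow> (real \<Rightarrow> 'a) set" where
  "lassos X b l =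
     {\<gamma> +++ \<beta> +++ reversepath \<gamma> | \<gamma> \<beta>.
        finite_path_from X b \<gamma> \<and> loop_in X \<beta> \<and> pathstart \<beta> = pathfinish \<gamma> \<and>
        curve_length 0 1 \<beta> = l}"

definition curve_lassos :: "'a::metric_space set \<Rightarrow> 'a \<Rightarrow> (real \<Rightarrow> 'a) \<Rightarrow> (real \<Rightarrow> 'a) set" where
  "curve_lassos X b \<alpha> =
     {\<gamma> +++ shiftpath t \<alpha> +++ reversepath \<gamma> | \<gamma> t.
        finite_path_from X b \<gamma> \<and> t \<in> {0..1} \<and> pathfinish \<gamma> = \<alpha> t}"

definition lasso_group :: "'a::metric_space set \<Rightarrow> 'a \<Rightarrow> real \<Rightarrow> (real \<Rightarrow> 'a) set set" where
  "lasso_group X b r =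
     generate (fundamental_group (top_of_set X) b)
       (loop_class (top_of_set X) b ` (\<Union>l\<in>{..<ennreal r}. lassos X b l))"

section \<open>Geometric realisations and attached discs\<close>

definition realised_simplex :: "'a set \<Rightarrow> ('a \<Rightarrow> real) set" where
  "realised_simplex \<sigma> = {f. (\<forall>v. 0 \<le> f v) \<and> (\<forall>v. v \<notin> \<sigma> \<longrightarrow> f v = 0) \<and> sum f \<sigma> = 1}"

text \<open>Barycentric coordinates with the weak topology.  For finite \<open>\<sigma>\<close>, the product topology on
  functions restricts to the Euclidean topology of the closed simplex \<open>\<sigma>\<close>.\<close>

definition realisation :: "'a set set \<Rightarrow> ('a \<Rightarrow> real) topology" where
  "realisation K = topology (\<lambda>U. U \<subseteq> \<Union> (realised_simplex ` K) \<and>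
     (\<forall>\<sigma>\<in>K. openin (top_of_set (realised_simplex \<sigma>)) (U \<inter> realised_simplex \<sigma>)))"

lemma openin_realisation:
  "openin (realisation K) U \<longleftrightarrow> U \<subseteq> \<Union> (realised_simplex ` K) \<and>
     (\<forall>\<sigma>\<in>K. openin (top_of_set (realised_simplex \<sigma>)) (U \<inter> realised_simplex \<sigma>))"
proof -
  have "istopology (\<lambda>U. U \<subseteq> \<Union> (realised_simplex ` K) \<and>
     (\<forall>\<sigma>\<in>K. openin (top_of_set (realised_simplex \<sigma>)) (U \<inter> realised_simplex \<sigma>)))"
    unfolding istopology_def
  proof (intro conjI allI impI ballI; (elim conjE)?)
    fix S T :: "('a \<Rightarrow> real) set" and \<sigma>
    assume "\<sigma> \<in> K"
      and "\<forall>\<sigma>\<in>K. openin (top_of_set (realised_simplex \<sigma>)) (S \<inter> realised_simplex \<sigma>)"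
      and "\<forall>\<sigma>\<in>K. openin (top_of_set (realised_simplex \<sigma>)) (T \<inter> realised_simplex \<sigma>)"
    then have "openin (top_of_set (realised_simplex \<sigma>))
        ((S \<inter> realised_simplex \<sigma>) \<inter> (T \<inter> realised_simplex \<sigma>))"
      by (metis openin_Int)
    moreover have "(S \<inter> realised_simplex \<sigma>) \<inter> (T \<inter> realised_simplex \<sigma>) = S \<inter> T \<inter> realised_simplex \<sigma>"
      by auto
    ultimately show "openin (top_of_set (realised_simplex \<sigma>)) (S \<inter> T \<inter> realised_simplex \<sigma>)"
      by simp
  next
    fix \<K> :: "('a \<Rightarrow> real) set set" and \<sigma>
    assume "\<sigma> \<in> K" and *: "\<forall>S\<in>\<K>. S \<subseteq> \<Union> (realised_simplex ` K) \<and>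
      (\<forall>\<sigma>\<in>K. openin (top_of_set (realised_simplex \<sigma>)) (S \<inter> realised_simplex \<sigma>))"
    then have "openin (top_of_set (realised_simplex \<sigma>)) (\<Union>S\<in>\<K>. S \<inter> realised_simplex \<sigma>)"
      by (intro openin_Union) auto
    then show "openin (top_of_set (realised_simplex \<sigma>)) (\<Union>\<K> \<inter> realised_simplex \<sigma>)"
      by simp
  qed auto
  then show ?thesis
    by (simp add: realisation_def topology_inverse')
qed

lemma topspace_realisation: "topspace (realisation K) = \<Union> (realised_simplex ` K)"
proof
  show "topspace (realisation K) \<subseteq> \<Union> (realised_simplex ` K)"
    using openin_topspace[of "realisation K"] unfolding openin_realisation by blast
  have "\<Union> (realised_simplex ` K) \<inter> realised_simplex \<sigma> = realised_simplex \<sigma>" if "\<sigma> \<in> K" for \<sigma>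
    using that by auto
  then have "openin (realisation K) (\<Union> (realised_simplex ` K))"
    by (simp add: openin_realisation)
  then show "\<Union> (realised_simplex ` K) \<subseteq> topspace (realisation K)"
    by (rule openin_subset)
qed

definition vertex :: "'a \<Rightarrow> 'a \<Rightarrow> real" where
  "vertex v = indicator {v}"

fun edge_path :: "'a list \<Rightarrow> real \<Rightarrow> ('a \<Rightarrow> real)" where
  "edge_path [] = (\<lambda>_ _. 0)"
| "edge_path [v] = (\<lambda>_. vertex v)"
| "edge_path (v # w # vs) =
     (\<lambda>t u. (1 - t) * vertex v u + t * vertex w u) +++ edge_path (w # vs)"

text \<open>Attaching a 2-disc to \<open>T\<close> along \<open>\<phi>\<close>: the quotient of the disjoint union of \<open>T\<close> and the
  closed unit disc by \<open>z \<sim> \<phi> z\<close> for \<open>cmod z = 1\<close>.  Its points are represented by the points of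
  \<open>T\<close> (tagged \<^const>\<open>Inl\<close>) and of the open disc (tagged \<^const>\<open>Inr\<close>).\<close>

definition disc_map :: "(complex \<Rightarrow> 'b) \<Rightarrow> complex \<Rightarrow> 'b + complex" where
  "disc_map \<phi> z = (if cmod z < 1 then Inr z else Inl (\<phi> z))"

definition attach_disc :: "'b topology \<Rightarrow> (complex \<Rightarrow> 'b) \<Rightarrow> ('b + complex) topology" where
  "attach_disc T \<phi> = topology (\<lambda>U. U \<subseteq> Inl ` topspace T \<union> Inr ` ball 0 1 \<and>
     openin T {x \<in> topspace T. Inl x \<in> U} \<and>
     openin (top_of_set (cball 0 1)) {z \<in> cball 0 1. disc_map \<phi> z \<in> U})"

lemma openin_attach_disc:
  "openin (attach_disc T \<phi>) U \<longleftrightarrow> U \<subseteq> Inl ` topspace T \<union> Inr ` ball 0 1 \<and>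
     openin T {x \<in> topspace T. Inl x \<in> U} \<and>
     openin (top_of_set (cball 0 1)) {z \<in> cball 0 1. disc_map \<phi> z \<in> U}"
proof -
  have *: "{x \<in> A. f x \<in> S \<inter> S'} = {x \<in> A. f x \<in> S} \<inter> {x \<in> A. f x \<in> S'}"
    "{x \<in> A. f x \<in> \<Union>\<K>} = (\<Union>S\<in>\<K>. {x \<in> A. f x \<in> S})"
    for A :: "'c set" and f :: "'c \<Rightarrow> 'd" and S S' \<K>
    by auto
  have "istopology (\<lambda>U. U \<subseteq> Inl ` topspace T \<union> Inr ` ball 0 1 \<and>
     openin T {x \<in> topspace T. Inl x \<in> U} \<and>
     openin (top_of_set (cball 0 1)) {z \<in> cball 0 1. disc_map \<phi> z \<in> U})"
    unfolding istopology_def *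
    by (intro conjI allI impI openin_Int openin_Union) auto
  then show ?thesis
    by (simp add: attach_disc_def topology_inverse')
qed

lemma topspace_attach_disc:
  assumes "\<phi> ` sphere 0 1 \<subseteq> topspace T"
  shows "topspace (attach_disc T \<phi>) = Inl ` topspace T \<union> Inr ` ball 0 1"
proof
  show "topspace (attach_disc T \<phi>) \<subseteq> Inl ` topspace T \<union> Inr ` ball 0 1"
    using openin_topspace[of "attach_disc T \<phi>"] unfolding openin_attach_disc by blast
  have "{x \<in> topspace T. Inl x \<in> Inl ` topspace T \<union> Inr ` ball (0::complex) 1} = topspace T"
    by auto
  moreover have "{z \<in> cball 0 1. disc_map \<phi> z \<in> Inl ` topspace T \<union> Inr ` ball 0 1} = cball 0 1"
    using assms by (force simp: disc_map_def)
  ultimately have "openin (attach_disc T \<phi>) (Inl ` topspace T \<union> Inr ` ball 0 1)"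
    by (simp only: openin_attach_disc subset_refl openin_topspace simp_thms)
       simp
  then show "Inl ` topspace T \<union> Inr ` ball 0 1 \<subseteq> topspace (attach_disc T \<phi>)"
    by (rule openin_subset)
qed

definition attach_disc_along :: "'a set set \<Rightarrow> 'a list \<Rightarrow> (('a \<Rightarrow> real) + complex) topology" where
  "attach_disc_along K vs =
     attach_disc (realisation K) (\<lambda>z. edge_path vs (Arg2pi z / (2 * pi)))"

section \<open>Rips complexes and their persistence\<close>

definition rips :: "'a::metric_space set \<Rightarrow> real \<Rightarrow> 'a set set" where
  "rips X r = {\<sigma>. \<sigma> \<subseteq> X \<and> finite \<sigma> \<and> \<sigma> \<noteq> {} \<and> diameter \<sigma> < r}"

definition closed_rips :: "'a::metric_space set \<Rightarrow> real \<Rightarrow> 'a set set" where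
  "closed_rips X r = {\<sigma>. \<sigma> \<subseteq> X \<and> finite \<sigma> \<and> \<sigma> \<noteq> {} \<and> diameter \<sigma> \<le> r}"

definition rips_group ::
  "'a::metric_space set \<Rightarrow> 'a \<Rightarrow> real \<Rightarrow> (real \<Rightarrow> 'a \<Rightarrow> real) set monoid" where
  "rips_group X b r = fundamental_group (realisation (rips X r)) (vertex b)"

definition rips_class ::
  "'a::metric_space set \<Rightarrow> 'a \<Rightarrow> real \<Rightarrow> 'a list \<Rightarrow> (real \<Rightarrow> 'a \<Rightarrow> real) set" where
  "rips_class X b r vs = loop_class (realisation (rips X r)) (vertex b) (edge_path vs)"

text \<open>The bonding map into the Rips complex at scale \<open>s\<close>, from any smaller scale.\<close>

definition bonding_map ::
  "'a::metric_space set \<Rightarrow> 'a \<Rightarrow> real \<Rightarrow> (real \<Rightarrow> 'a \<Rightarrow> real) set \<Rightarrow> (real \<Rightarrow> 'a \<Rightarrow> real) set" where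
  "bonding_map X b s = induced_map (realisation (rips X s)) (vertex b) id"

definition left_critical :: "'a::metric_space set \<Rightarrow> 'a \<Rightarrow> real \<Rightarrow> bool" where
  "left_critical X b p \<longleftrightarrow> p > 0 \<and>
     (\<forall>\<^sub>F \<epsilon> in at_right 0.
        bonding_map X b p \<notin> iso (rips_group X b (p - \<epsilon>)) (rips_group X b p))"

definition right_critical :: "'a::metric_space set \<Rightarrow> 'a \<Rightarrow> real \<Rightarrow> bool" where
  "right_critical X b p \<longleftrightarrow> p > 0 \<and>
     (\<forall>\<epsilon>>0. bonding_map X b (p + \<epsilon>) \<notin> iso (rips_group X b p) (rips_group X b (p + \<epsilon>)))"

definition critical_value :: "'a::metric_space set \<Rightarrow> 'a \<Rightarrow> real \<Rightarrow> bool" where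
  "critical_value X b p \<longleftrightarrow> left_critical X b p \<or> right_critical X b p"

definition consecutive_critical_values :: "'a::metric_space set \<Rightarrow> 'a \<Rightarrow> real \<Rightarrow> real \<Rightarrow> bool" where
  "consecutive_critical_values X b p q \<longleftrightarrow>
     critical_value X b p \<and> critical_value X b q \<and> p < q \<and>
     \<not> (\<exists>s. p < s \<and> s < q \<and> critical_value X b s)"

section \<open>Critical triangles\<close>

text \<open>The triangle with vertices \<open>x\<^sub>1, x\<^sub>2, x\<^sub>3\<close> is critical, as witnessed by the filling \<open>\<alpha>\<close>
  (and by some sample of \<open>\<alpha>\<close>).\<close>

definition critical_triangle_via ::
  "'a::metric_space set \<Rightarrow> 'a \<Rightarrow> real \<Rightarrow> 'a \<Rightarrow> 'a \<Rightarrow> 'a \<Rightarrow> (real \<Rightarrow> 'a) \<Rightarrow> bool" where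
  "critical_triangle_via X b r x1 x2 x3 \<alpha> \<longleftrightarrow>
     {x1, x2, x3} \<in> closed_rips X r \<and> distinct [x1, x2, x3] \<and>
     filling X [x1, x2, x3, x1] \<alpha> \<and>
     (\<exists>ts. sample (r / 2) \<alpha> ts \<and>
        (let T = attach_disc_along (rips X r) (sample_loop \<alpha> ts);
             c = Inl (vertex b)
         in kernel (rips_group X b r) (fundamental_group T c) (induced_map T c Inl)
              \<noteq> {\<one>\<^bsub>rips_group X b r\<^esub>}))"

definition critical_triangle :: "'a::metric_space set \<Rightarrow> 'a \<Rightarrow> real \<Rightarrow> 'a set \<Rightarrow> bool" where
  "critical_triangle X b r \<sigma> \<longleftrightarrow>
     (\<exists>x1 x2 x3 \<alpha>. \<sigma> = {x1, x2, x3} \<and> critical_triangle_via X b r x1 x2 x3 \<alpha>)"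

end

theory Submission
  imports Defs
begin

text \<open>
  Edges of \<open>Rips(X, s)\<close> form a local cocycle on \<open>X\<close>, and its product along a fine subdivision of a
  path depends only on the homotopy class of the path.  This gives a functor \<open>\<Psi>\<close> from paths in
  \<open>X\<close> to \<open>\<pi>\<^sub>1(Rips(X, s))\<close>.  It is already onto on rectifiable loops, since loops in the realisation
  are homotopic to edge paths, and these can be filled with geodesics.  On rectifiable loops its
  kernel is \<open>\<L>(X, 3s, \<pi>\<^sub>1)\<close>: a loop shorter than \<open>3s\<close> can be sampled by three points
  that span a simplex; conversely, geodesics modulo \<open>\<L>(X, 3s, \<pi>\<^sub>1)\<close> form an edge cocycle on \<open>Rips(X, s)\<close>, whose product along
  an edge loop is trivial as soon as the loop is null.  The
  restriction to rectifiable loops is essential, since \<open>X\<close> need not be locally nice: an arbitrarily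
  small loop of infinite length has trivial samples, but need not be a product of finitely many
  lassos of finite length.

  Consequently the bonding map from \<open>s\<close> to \<open>s'\<close> is an isomorphism iff
  \<open>\<L>(X, 3s', \<pi>\<^sub>1) = \<L>(X, 3s, \<pi>\<^sub>1)\<close>, and attaching a disc along a sample of \<open>\<alpha>\<close> has a
  nontrivial kernel iff \<open>\<alpha>\<close>-lassos lie outside \<open>\<L>(X, 3r, \<pi>\<^sub>1)\<close>.  For such an \<open>\<alpha>\<close> of length \<open>3r\<close> no chord
  can be shorter than both of its arcs, because it would split \<open>\<alpha>\<close> into two loops shorter than
  \<open>3r\<close>; so \<open>\<alpha>\<close> is a geodesic circle.  The kernel of the bonding map after \<open>r\<close> is generated by lassos
  slightly longer than \<open>3r\<close>, and by compactness these have the same \<open>\<Psi>\<close>-value as lassos of length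
  at most \<open>3r\<close>.
\<close>

section \<open>Paths and path homotopies in abstract topological spaces\<close>

text \<open>One principle is used twice: a cocycle that is multiplicative on the members of a cover
  can be multiplied along paths, with a homotopy-invariant result. On \<open>X\<close> the members
  are the sets of diameter below \<open>s\<close> and the values are edge classes. On a realisation
  they are the open stars of vertices and the values lie in any group; the kernel of \<Psi> is found
  by taking this group to be \<open>rect_group\<close> modulo a lasso group. A lasso group is shown
  to be normal only inside \<open>rect_group\<close>, because the tails of lassos have finite
  length. Both directions meet in the same constant: three geodesics over a simplex of
  \<open>Rips(X, s)\<close> have total length below \<open>3 * s\<close>, and a shorter loop falls
  into three arcs shorter than \<open>s\<close>. Loops that converge uniformly need not become
  homotopic in \<open>X\<close>. The compactness argument therefore compares only \<Psi>-values,
  which are conjugate for close loops because the strip between fine samples consists of simplices.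
  A limit loop has length at most \<open>3 * s\<close>; if its value is nontrivial it has length
  exactly \<open>3 * s\<close> and is its own filling of a critical triangle, which is how critical
  triangles enter the kernel.\<close>

definition homotopic_pathsin :: "'b topology \<Rightarrow> (real \<Rightarrow> 'b) \<Rightarrow> (real \<Rightarrow> 'b) \<Rightarrow> bool" where
  "homotopic_pathsin T p q \<longleftrightarrow>
     homotopic_with (\<lambda>f. f 0 = p 0 \<and> f 1 = p 1) (top_of_set {0..1}) T p q"

definition joinin :: "(real \<Rightarrow> 'b) \<Rightarrow> (real \<Rightarrow> 'b) \<Rightarrow> real \<Rightarrow> 'b" where
  "joinin p q = (\<lambda>t. if t \<le> 1/2 then p (2 * t) else q (2 * t - 1))"

definition reversein :: "(real \<Rightarrow> 'b) \<Rightarrow> real \<Rightarrow> 'b" where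
  "reversein p = (\<lambda>t. p (1 - t))"

definition subpathin :: "real \<Rightarrow> real \<Rightarrow> (real \<Rightarrow> 'b) \<Rightarrow> real \<Rightarrow> 'b" where
  "subpathin s t p = (\<lambda>u. p (s + u * (t - s)))"

lemma joinpaths_eq_joinin: "p +++ q = joinin p q"
  by (simp add: joinpaths_def joinin_def)

lemma reversepath_eq_reversein: "reversepath p = reversein p"
  by (simp add: reversepath_def reversein_def)

lemma joinin_ends [simp]: "joinin p q 0 = p 0" "joinin p q 1 = q 1"
  by (auto simp: joinin_def)

lemma reversein_ends [simp]: "reversein p 0 = p 1" "reversein p 1 = p 0"
  by (auto simp: reversein_def)

lemma subpathin_ends [simp]: "subpathin s t p 0 = p s" "subpathin s t p 1 = p t"
  by (auto simp: subpathin_def)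

lemma subpathin_0_1 [simp]: "subpathin 0 1 p = p"
  by (auto simp: subpathin_def)

lemma homotopic_pathsinI:
  fixes h :: "real \<times> real \<Rightarrow> 'b"
  assumes h: "continuous_map (top_of_set ({0..1} \<times> {0..1})) T h"
    and "\<And>x. x \<in> {0..1} \<Longrightarrow> h (0, x) = p x" "\<And>x. x \<in> {0..1} \<Longrightarrow> h (1, x) = q x"
    and "\<And>t. t \<in> {0..1} \<Longrightarrow> h (t, 0) = p 0" "\<And>t. t \<in> {0..1} \<Longrightarrow> h (t, 1) = p 1"
  shows "homotopic_pathsin T p q"
proof -
  \<comment> \<open>\<open>homotopic_with\<close> prescribes the two end maps at every real
    argument, while \<open>h\<close> is controlled only on the unit square. Off the square the
    values are reset to those of \<open>p\<close> and \<open>q\<close>.\<close>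
  define k :: "real \<times> real \<Rightarrow> 'b" where "k = (\<lambda>(t, x). if x \<in> {0..1} then h (t, x) else if t = 0
      then p x else q x)"
  have "continuous_map (top_of_set ({0..1} \<times> {0..1})) T k"
    using h by (rule continuous_map_eq) (auto simp: k_def)
  then show ?thesis
    unfolding homotopic_pathsin_def homotopic_with_def
    using assms by (intro exI[of _ k]) (auto simp: k_def)
qed

lemma homotopic_pathsinE:
  fixes p q :: "real \<Rightarrow> 'b"
  assumes "homotopic_pathsin T p q"
  obtains h :: "real \<times> real \<Rightarrow> 'b" where "continuous_map (top_of_set ({0..1} \<times> {0..1})) T h"
    "\<And>x. h (0, x) = p x" "\<And>x. h (1, x) = q x"
    "\<And>t. t \<in> {0..1} \<Longrightarrow> h (t, 0) = p 0" "\<And>t. t \<in> {0..1} \<Longrightarrow> h (t, 1) = p 1"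
proof -
  from assms obtain h :: "real \<times> real \<Rightarrow> 'b" where "continuous_map (prod_topology (top_of_set
      {0..1}) (top_of_set {0..1})) T h"
    and "\<forall>x. h (0, x) = p x" "\<forall>x. h (1, x) = q x"
    and "\<forall>t\<in>{0..1}. h (t, 0) = p 0 \<and> h (t, 1) = p 1"
    unfolding homotopic_pathsin_def homotopic_with_def by blast
  then show thesis by (intro that[of h]) simp_all
qed

lemma homotopic_pathsin_imp_pathin:
  assumes "homotopic_pathsin T p q"
  shows "pathin T p" "pathin T q"
  using homotopic_with_imp_continuous_maps[OF assms[unfolded homotopic_pathsin_def]]
  by (simp_all add: pathin_def)

lemma homotopic_pathsin_imp_ends:
  assumes "homotopic_pathsin T p q"
  shows "p 0 = q 0" "p 1 = q 1"
  using homotopic_with_imp_property[OF assms[unfolded homotopic_pathsin_def]] by simp_all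

lemma homotopic_pathsin_refl: "pathin T p \<Longrightarrow> homotopic_pathsin T p p"
  by (simp add: homotopic_pathsin_def pathin_def)

lemma homotopic_pathsin_sym:
  assumes "homotopic_pathsin T p q"
  shows "homotopic_pathsin T q p"
proof -
  have "homotopic_with (\<lambda>f. f 0 = p 0 \<and> f 1 = p 1) (top_of_set {0..1}) T q p"
    using assms unfolding homotopic_pathsin_def by (rule homotopic_with_symD)
  then show ?thesis
    unfolding homotopic_pathsin_def homotopic_pathsin_imp_ends[OF assms] .
qed

lemma homotopic_pathsin_trans [trans]:
  assumes pq: "homotopic_pathsin T p q" and qr: "homotopic_pathsin T q r"
  shows "homotopic_pathsin T p r"
  using homotopic_with_trans[OF pq[unfolded homotopic_pathsin_def]]
    qr[unfolded homotopic_pathsin_def, folded homotopic_pathsin_imp_ends[OF pq]]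
  unfolding homotopic_pathsin_def by blast

lemma homotopic_pathsin_eq:
  assumes "pathin T p" "\<And>t. t \<in> {0..1} \<Longrightarrow> p t = q t"
  shows "homotopic_pathsin T p q"
proof (rule homotopic_pathsinI)
  have "continuous_map (top_of_set ({0..1} \<times> {0..1::real})) (top_of_set {0..1}) (snd :: real \<times>
      real \<Rightarrow> real)"
    by (auto simp: continuous_on_snd continuous_on_id)
  then show "continuous_map (top_of_set ({0..1} \<times> {0..1})) T (p \<circ> (snd :: real \<times> real \<Rightarrow> real))"
    using assms(1) unfolding pathin_def by (rule continuous_map_compose)
qed (use assms in auto)

lemma homotopic_pathsin_image:
  assumes "homotopic_pathsin T p q" "continuous_map T T' f"
  shows "homotopic_pathsin T' (f \<circ> p) (f \<circ> q)"
  using assms unfolding homotopic_pathsin_def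
  by (auto elim!: homotopic_with_compose_continuous_map_left)

lemma pathin_topspace: "pathin T p \<Longrightarrow> t \<in> {0..1} \<Longrightarrow> p t \<in> topspace T"
  by (auto simp: pathin_def continuous_map_def)

lemma pathin_cong: "pathin T p \<Longrightarrow> (\<And>t. t \<in> {0..1} \<Longrightarrow> p t = q t) \<Longrightarrow> pathin T q"
  unfolding pathin_def by (erule continuous_map_eq) auto

lemma pathin_reparam:
  assumes "pathin T p" "continuous_on {0..1} \<phi>" "\<phi> ` {0..1} \<subseteq> {0..1}"
  shows "pathin T (p \<circ> \<phi>)"
proof -
  have "continuous_map (top_of_set {0..1::real}) (top_of_set {0..1}) \<phi>"
    using assms by auto
  then show ?thesis
    using assms(1) unfolding pathin_def by (rule continuous_map_compose)
qed

text \<open>The straight-line homotopy between two parametrisations is the source of all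
  groupoid laws for paths.\<close>

lemma homotopic_pathsin_reparam:
  assumes p: "pathin T p"
    and \<phi>: "continuous_on {0..1} \<phi>" "\<phi> ` {0..1} \<subseteq> {0..1}"
    and \<psi>: "continuous_on {0..1} \<psi>" "\<psi> ` {0..1} \<subseteq> {0..1}"
    and ends: "\<phi> 0 = \<psi> 0" "\<phi> 1 = \<psi> 1"
  shows "homotopic_pathsin T (p \<circ> \<phi>) (p \<circ> \<psi>)"
proof (rule homotopic_pathsinI)
  let ?k = "\<lambda>z. (1 - fst z) * \<phi> (snd z) + fst z * \<psi> (snd z)"
  have "continuous_on ({0..1} \<times> {0..1}) ?k"
    by (intro continuous_intros continuous_on_compose2[OF \<phi>(1)] continuous_on_compose2[OF \<psi>(1)]) auto
  moreover have "?k ` ({0..1} \<times> {0..1}) \<subseteq> {0..1}"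
  proof clarify
    fix t x :: real assume tx: "t \<in> {0..1}" "x \<in> {0..1}"
    have "\<phi> x \<in> {0..1}" "\<psi> x \<in> {0..1}" using \<phi>(2) \<psi>(2) tx by blast+
    then have "(1 - t) *\<^sub>R \<phi> x + t *\<^sub>R \<psi> x \<in> {0..1}"
      by (intro convexD[OF convex_real_interval(5)]) (use tx in auto)
    then show "(1 - fst (t, x)) * \<phi> (snd (t, x)) + fst (t, x) * \<psi> (snd (t, x)) \<in> {0..1}"
      by simp
  qed
  ultimately have "continuous_map (top_of_set ({0..1} \<times> {0..1})) (top_of_set {0..1}) ?k"
    by auto
  then show "continuous_map (top_of_set ({0..1} \<times> {0..1})) T (p \<circ> ?k)"
    using p unfolding pathin_def by (rule continuous_map_compose)
qed (use ends in \<open>auto simp: algebra_simps\<close>)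

lemma pathin_const: "x \<in> topspace T \<Longrightarrow> pathin T (\<lambda>_. x)"
  by (simp add: pathin_def)

lemma pathin_reversein: "pathin T p \<Longrightarrow> pathin T (reversein p)"
  using pathin_reparam[of T p "\<lambda>t. 1 - t"]
  by (force simp: reversein_def comp_def intro: continuous_intros)

lemma pathin_subpathin:
  assumes "pathin T p" "s \<in> {0..1}" "t \<in> {0..1}"
  shows "pathin T (subpathin s t p)"
proof -
  have "s + u * (t - s) \<in> {0..1}" if "u \<in> {0..1}" for u
    using convexD[OF convex_real_interval(5), of s 0 1 t "1 - u" u] assms that
    by (simp add: algebra_simps)
  then have "(\<lambda>u. s + u * (t - s)) ` {0..1} \<subseteq> {0..1}" by blast
  then show ?thesis
    using pathin_reparam[OF assms(1), of "\<lambda>u. s + u * (t - s)"]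
    by (simp add: subpathin_def comp_def continuous_intros)
qed

text \<open>The extra factor \<open>A\<close> lets one pasting argument serve twice: it is the
  homotopy parameter when two homotopies are joined, and a dummy coordinate when two single paths
  are joined.\<close>

lemma continuous_map_joinin:
  assumes f: "continuous_map (top_of_set (A \<times> {0..1::real})) T f"
    and g: "continuous_map (top_of_set (A \<times> {0..1::real})) T g"
    and fg: "\<And>a. a \<in> A \<Longrightarrow> f (a, 1) = g (a, 0)"
  shows "continuous_map (top_of_set (A \<times> {0..1})) T
    (\<lambda>z. if snd z \<le> 1/2 then f (fst z, 2 * snd z) else g (fst z, 2 * snd z - 1))"
proof (rule continuous_map_cases_le)
  let ?D = "top_of_set (A \<times> {0..1::real})"
  show "continuous_map ?D euclideanreal snd" "continuous_map ?D euclideanreal (\<lambda>_. 1/2)"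
    by (auto simp: continuous_on_snd continuous_on_id)
  have 1: "subtopology ?D {x \<in> topspace ?D. snd x \<le> 1/2} = top_of_set (A \<times> {0..1/2})"
    unfolding subtopology_subtopology by (rule arg_cong[where f=top_of_set]) auto
  have "continuous_map (top_of_set (A \<times> {0..1/2})) ?D (\<lambda>z. (fst z, 2 * snd z))"
    by (auto intro!: continuous_intros)
  then show "continuous_map (subtopology ?D {x \<in> topspace ?D. snd x \<le> 1/2}) T (\<lambda>z. f (fst z, 2 *
      snd z))"
    unfolding 1 using continuous_map_compose[OF _ f] unfolding comp_def by blast
  have 2: "subtopology ?D {x \<in> topspace ?D. 1/2 \<le> snd x} = top_of_set (A \<times> {1/2..1})"
    unfolding subtopology_subtopology by (rule arg_cong[where f=top_of_set]) auto
  have "continuous_map (top_of_set (A \<times> {1/2..1})) ?D (\<lambda>z. (fst z, 2 * snd z - 1))"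
    by (auto intro!: continuous_intros)
  then show "continuous_map (subtopology ?D {x \<in> topspace ?D. 1/2 \<le> snd x}) T (\<lambda>z. g (fst z, 2 *
      snd z - 1))"
    unfolding 2 using continuous_map_compose[OF _ g] unfolding comp_def by blast
next
  fix z assume z: "z \<in> topspace (top_of_set (A \<times> {0..1::real}))" "snd z = 1/2"
  then have "2 * snd z = 1" "2 * snd z - 1 = 0" by simp_all
  then show "f (fst z, 2 * snd z) = g (fst z, 2 * snd z - 1)"
    using fg[of "fst z"] z(1) by auto
qed

lemma continuous_map_top_of_set_compose:
  assumes "continuous_map (top_of_set S) T f" "continuous_on R g" "g ` R \<subseteq> S"
  shows "continuous_map (top_of_set R) T (\<lambda>x. f (g x))"
proof -
  have "continuous_map (top_of_set R) (top_of_set S) g"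
    using assms by auto
  then show ?thesis
    using continuous_map_compose[OF _ assms(1)] unfolding comp_def by blast
qed

lemma pathin_joinin:
  assumes "pathin T p" "pathin T q" "p 1 = q 0"
  shows "pathin T (joinin p q)"
proof -
  have snd: "continuous_on ({0..1} \<times> {0..1}) (snd :: real \<times> real \<Rightarrow> real)"
    by (intro continuous_intros)
  have "continuous_map (top_of_set ({0..1} \<times> {0..1})) T (\<lambda>z::real\<times>real. p (snd z))"
    "continuous_map (top_of_set ({0..1} \<times> {0..1})) T (\<lambda>z::real\<times>real. q (snd z))"
    using continuous_map_top_of_set_compose[OF _ snd] assms unfolding pathin_def by auto
  from continuous_map_joinin[OF this] assms(3)
  have "continuous_map (top_of_set ({0..1} \<times> {0..1})) T (\<lambda>z::real\<times>real. joinin p q (snd z))"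
    by (simp add: joinin_def del: le_divide_eq_numeral1 cong: if_cong)
  then have "continuous_map (top_of_set {0..1}) T (\<lambda>x. joinin p q (snd (0::real, x)))"
    by (rule continuous_map_top_of_set_compose) (auto intro!: continuous_intros)
  then show ?thesis by (simp add: pathin_def)
qed

lemma homotopic_pathsin_join:
  fixes p q :: "real \<Rightarrow> 'b"
  assumes p: "homotopic_pathsin T p p'" and q: "homotopic_pathsin T q q'" and pq: "p 1 = q 0"
  shows "homotopic_pathsin T (joinin p q) (joinin p' q')"
proof -
  obtain h :: "real \<times> real \<Rightarrow> 'b" where h: "continuous_map (top_of_set ({0..1} \<times> {0..1})) T h"
    "\<And>x. h (0, x) = p x" "\<And>x. h (1, x) = p' x"
    "\<And>t. t \<in> {0..1} \<Longrightarrow> h (t, 0) = p 0" "\<And>t. t \<in> {0..1} \<Longrightarrow> h (t, 1) = p 1"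
    using p by (rule homotopic_pathsinE) blast
  obtain k :: "real \<times> real \<Rightarrow> 'b" where k: "continuous_map (top_of_set ({0..1} \<times> {0..1})) T k"
    "\<And>x. k (0, x) = q x" "\<And>x. k (1, x) = q' x"
    "\<And>t. t \<in> {0..1} \<Longrightarrow> k (t, 0) = q 0" "\<And>t. t \<in> {0..1} \<Longrightarrow> k (t, 1) = q 1"
    using q by (rule homotopic_pathsinE) blast
  show ?thesis
    by (rule homotopic_pathsinI[OF continuous_map_joinin[OF h(1) k(1)]])
       (use h k pq in \<open>auto simp: joinin_def\<close>)
qed

lemma homotopic_pathsin_assoc:
  assumes "pathin T p" "pathin T q" "pathin T r" "p 1 = q 0" "q 1 = r 0"
  shows "homotopic_pathsin T (joinin (joinin p q) r) (joinin p (joinin q r))"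
proof -
  \<comment> \<open>The intervals \<open>[0, 1/2]\<close>, \<open>[1/2, 3/4]\<close>,
    \<open>[3/4, 1]\<close> on which the right-hand side runs through \<open>p\<close>,
    \<open>q\<close>, \<open>r\<close> are mapped affinely to \<open>[0, 1/4]\<close>,
    \<open>[1/4, 1/2]\<close>, \<open>[1/2, 1]\<close>, where the left-hand side does so.\<close>
  let ?\<phi> = "\<lambda>t::real. if t \<le> 1/2 then t / 2 else if t \<le> 3/4 then t - 1/4 else 2 * t - 1"
  let ?P = "joinin (joinin p q) r"
  have eq: "joinin p (joinin q r) = ?P \<circ> ?\<phi>"
  proof
    fix t :: real
    have "2 * (2 * (t - 1/4)) - 1 = 2 * (2 * t - 1)" "2 * (2 * t - 1) - 1 = 4 * t - 3" by simp_all
    then show "joinin p (joinin q r) t = (?P \<circ> ?\<phi>) t"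
      by (auto simp: joinin_def)
  qed
  have 1: "continuous_on {0..1} (\<lambda>t::real. if t \<le> 3/4 then t - 1/4 else 2 * t - 1)"
    by (rule continuous_on_cases_le) (auto intro!: continuous_intros)
  have "continuous_on {0..1} ?\<phi>"
    by (rule continuous_on_cases_le)
      (auto intro!: continuous_intros continuous_on_subset[OF 1] simp del: le_divide_eq_numeral1)
  moreover have "?\<phi> ` {0..1} \<subseteq> {0..1}" by auto
  ultimately show ?thesis
    unfolding eq using homotopic_pathsin_reparam[of T ?P "\<lambda>t. t" ?\<phi>] assms
    by (auto simp: pathin_joinin comp_def continuous_on_id)
qed

lemma homotopic_pathsin_lid:
  assumes "pathin T p" "x = p 0"
  shows "homotopic_pathsin T (joinin (\<lambda>_. x) p) p"
proof -
  let ?\<phi> = "\<lambda>t::real. max 0 (2 * t - 1)"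
  have eq: "joinin (\<lambda>_. x) p = p \<circ> ?\<phi>"
  proof
    fix t :: real
    show "joinin (\<lambda>_. x) p t = (p \<circ> ?\<phi>) t"
      using assms by (cases "2 * t \<le> 1") (auto simp: joinin_def)
  qed
  have "homotopic_pathsin T (p \<circ> ?\<phi>) (p \<circ> (\<lambda>t. t))"
    using assms by (intro homotopic_pathsin_reparam) (auto intro!: continuous_intros)
  then show ?thesis unfolding eq by (simp add: comp_def)
qed

lemma homotopic_pathsin_rid:
  assumes "pathin T p" "x = p 1"
  shows "homotopic_pathsin T (joinin p (\<lambda>_. x)) p"
proof -
  let ?\<phi> = "\<lambda>t::real. min 1 (2 * t)"
  have eq: "joinin p (\<lambda>_. x) = p \<circ> ?\<phi>"
  proof
    fix t :: real
    show "joinin p (\<lambda>_. x) t = (p \<circ> ?\<phi>) t"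
      using assms by (cases "2 * t \<le> 1") (auto simp: joinin_def)
  qed
  have "homotopic_pathsin T (p \<circ> ?\<phi>) (p \<circ> (\<lambda>t. t))"
    using assms by (intro homotopic_pathsin_reparam) (auto intro!: continuous_intros)
  then show ?thesis unfolding eq by (simp add: comp_def)
qed

lemma homotopic_pathsin_rinv:
  assumes "pathin T p"
  shows "homotopic_pathsin T (joinin p (reversein p)) (\<lambda>_. p 0)"
proof -
  \<comment> \<open>Going forth and back along \<open>p\<close> is \<open>p\<close> after a tent
    map. The tent map is 0 at both ends, so it can be contracted linearly to the constant 0 with
    ends fixed.\<close>
  let ?\<phi> = "\<lambda>t::real. if t \<le> 1/2 then 2 * t else 2 - 2 * t"
  have eq: "joinin p (reversein p) = p \<circ> ?\<phi>"
    by (rule ext) (auto simp: joinin_def reversein_def)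
  have "continuous_on {0..1} ?\<phi>"
    by (rule continuous_on_cases_le) (auto intro!: continuous_intros)
  then have "homotopic_pathsin T (p \<circ> ?\<phi>) (p \<circ> (\<lambda>_. 0))"
    using assms by (intro homotopic_pathsin_reparam) auto
  then show ?thesis unfolding eq by (simp add: comp_def)
qed

lemma reversein_reversein [simp]: "reversein (reversein p) = p"
  by (simp add: reversein_def)

lemma homotopic_pathsin_linv:
  assumes "pathin T p"
  shows "homotopic_pathsin T (joinin (reversein p) p) (\<lambda>_. p 1)"
  using homotopic_pathsin_rinv[OF pathin_reversein[OF assms]] by simp

text \<open>No order of \<open>s\<close>, \<open>m\<close>, \<open>t\<close> is assumed: both sides
  are \<open>p\<close> after parameter maps with the same ends, and such maps are joined by straight
  lines inside the unit interval.\<close>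

lemma homotopic_pathsin_subpath_join:
  assumes p: "pathin T p" and "s \<in> {0..1}" "m \<in> {0..1}" "t \<in> {0..1}"
  shows "homotopic_pathsin T (joinin (subpathin s m p) (subpathin m t p)) (subpathin s t p)"
proof -
  let ?\<phi> = "\<lambda>u::real. if u \<le> 1/2 then s + 2 * u * (m - s) else m + (2 * u - 1) * (t - m)"
  let ?\<psi> = "\<lambda>u::real. s + u * (t - s)"
  have cv: "x + u * (y - x) \<in> {0..1}" if "x \<in> {0..1}" "y \<in> {0..1}" "u \<in> {0..1}" for x y u :: real
    using convexD[OF convex_real_interval(5), of x 0 1 y "1 - u" u] that
    by (simp add: algebra_simps)
  have "s + 2 * u * (m - s) = m + (2 * u - 1) * (t - m)" if "u = 1/2" for u
    unfolding that by simp
  then have "continuous_on {0..1} ?\<phi>"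
    by (intro continuous_on_cases_le) (auto intro!: continuous_intros simp del: eq_divide_eq_numeral1)
  moreover have "?\<phi> ` {0..1} \<subseteq> {0..1}"
  proof (rule image_subsetI)
    fix u :: real assume "u \<in> {0..1}"
    then show "?\<phi> u \<in> {0..1}"
      using cv[of s m "2*u"] cv[of m t "2*u-1"] assms by (cases "u \<le> 1/2") auto
  qed
  moreover have "?\<psi> ` {0..1} \<subseteq> {0..1}"
    using cv[of s t] assms by blast
  ultimately have "homotopic_pathsin T (p \<circ> ?\<phi>) (p \<circ> ?\<psi>)"
    by (intro homotopic_pathsin_reparam[OF p]) (auto intro!: continuous_intros)
  moreover have "joinin (subpathin s m p) (subpathin m t p) = p \<circ> ?\<phi>"
    by (rule ext) (auto simp: joinin_def subpathin_def)
  moreover have "subpathin s t p = p \<circ> ?\<psi>"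
    by (rule ext) (auto simp: subpathin_def)
  ultimately show ?thesis by simp
qed

section \<open>The fundamental group of an abstract topological space\<close>

definition loopsin :: "'b topology \<Rightarrow> 'b \<Rightarrow> (real \<Rightarrow> 'b) set" where
  "loopsin T b = {p. pathin T p \<and> p 0 = b \<and> p 1 = b}"

lemma loop_class_iff:
  "p \<in> loopsin T b \<Longrightarrow> q \<in> loop_class T b p \<longleftrightarrow> homotopic_pathsin T p q"
  by (simp add: loop_class_def homotopic_pathsin_def loopsin_def)

lemma homotopic_pathsin_loopsin:
  "homotopic_pathsin T p q \<Longrightarrow> p \<in> loopsin T b \<Longrightarrow> q \<in> loopsin T b"
  by (simp add: loopsin_def homotopic_pathsin_imp_pathin(2)
      flip: homotopic_pathsin_imp_ends[of T p q])

lemma loop_class_eq_iff: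
  assumes "p \<in> loopsin T b" "q \<in> loopsin T b"
  shows "loop_class T b p = loop_class T b q \<longleftrightarrow> homotopic_pathsin T p q"
proof -
  have "q \<in> loop_class T b q"
    using assms loop_class_iff[OF assms(2)] by (simp add: loopsin_def homotopic_pathsin_refl)
  moreover have "loop_class T b p = loop_class T b q" if "homotopic_pathsin T p q"
    using homotopic_pathsin_trans[OF that] homotopic_pathsin_trans[OF homotopic_pathsin_sym[OF that]]
    by (auto simp: loop_class_iff[OF assms(1)] loop_class_iff[OF assms(2)])
  ultimately show ?thesis
    unfolding loop_class_iff[OF assms(1), symmetric] by blast
qed

lemma loop_class_eq_if_homotopic:
  assumes "homotopic_pathsin T p q" "p \<in> loopsin T b"
  shows "loop_class T b p = loop_class T b q"
  using assms loop_class_eq_iff[OF assms(2) homotopic_pathsin_loopsin[OF assms]] by simp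

lemma carrier_fundamental_group: "carrier (fundamental_group T b) = loop_class T b ` loopsin T b"
  by (simp add: fundamental_group_def loopsin_def)

lemma one_fundamental_group: "\<one>\<^bsub>fundamental_group T b\<^esub> = loop_class T b (\<lambda>_. b)"
  by (simp add: fundamental_group_def)

lemma joinin_loopsin: "p \<in> loopsin T b \<Longrightarrow> q \<in> loopsin T b \<Longrightarrow> joinin p q \<in> loopsin T b"
  by (auto simp: loopsin_def pathin_joinin)

lemma reversein_loopsin: "p \<in> loopsin T b \<Longrightarrow> reversein p \<in> loopsin T b"
  by (auto simp: loopsin_def pathin_reversein)

lemma const_loopsin: "b \<in> topspace T \<Longrightarrow> (\<lambda>_. b) \<in> loopsin T b"
  by (auto simp: loopsin_def)

text \<open>Products and induced maps of classes are defined as unions over all representatives.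
  This lemma collapses such a union once the operation is known to respect homotopy.\<close>

lemma loop_class_UN:
  assumes p: "p \<in> loopsin T b" and f: "\<And>q. homotopic_pathsin T p q \<Longrightarrow> f q = f p"
  shows "(\<Union>q\<in>loop_class T b p. f q) = f p"
proof -
  have "p \<in> loop_class T b p"
    using p loop_class_iff[OF p] by (simp add: loopsin_def homotopic_pathsin_refl)
  moreover have "f q = f p" if "q \<in> loop_class T b p" for q
    using that f by (simp add: loop_class_iff[OF p])
  ultimately show ?thesis by blast
qed

lemma mult_fundamental_group:
  assumes p: "p \<in> loopsin T b" and q: "q \<in> loopsin T b"
  shows "loop_class T b p \<otimes>\<^bsub>fundamental_group T b\<^esub> loop_class T b q = loop_class T b (joinin p q)"
proof -
  have eq: "loop_class T b (joinin p' q') = loop_class T b (joinin p q)"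
    if "homotopic_pathsin T p p'" "homotopic_pathsin T q q'" for p' q'
    using that p q
    by (intro loop_class_eq_if_homotopic[symmetric] homotopic_pathsin_join joinin_loopsin)
       (auto simp: loopsin_def)
  have "loop_class T b p \<otimes>\<^bsub>fundamental_group T b\<^esub> loop_class T b q =
      (\<Union>p'\<in>loop_class T b p. \<Union>q'\<in>loop_class T b q. loop_class T b (joinin p' q'))"
    by (simp add: fundamental_group_def joinin_def)
  also have "\<dots> = (\<Union>p'\<in>loop_class T b p. loop_class T b (joinin p' q))"
  proof (rule SUP_cong[OF refl])
    fix p' assume "p' \<in> loop_class T b p"
    then have "homotopic_pathsin T p p'" using p by (simp add: loop_class_iff)
    with p show "(\<Union>q'\<in>loop_class T b q. loop_class T b (joinin p' q')) = loop_class T b (joinin p' q)"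
      using eq by (intro loop_class_UN[OF q]) (metis homotopic_pathsin_refl
          homotopic_pathsin_imp_pathin(1))
  qed
  also have "\<dots> = loop_class T b (joinin p q)"
    using eq q by (intro loop_class_UN[OF p]) (simp add: homotopic_pathsin_refl loopsin_def)
  finally show ?thesis .
qed

lemma induced_map_loop_class:
  assumes p: "p \<in> loopsin T b" and f: "continuous_map T T' f" and b': "b' = f b"
  shows "induced_map T' b' f (loop_class T b p) = loop_class T' b' (f \<circ> p)"
  unfolding induced_map_def
proof (rule loop_class_UN[OF p])
  fix q assume "homotopic_pathsin T p q"
  then have "homotopic_pathsin T' (f \<circ> p) (f \<circ> q)" using f by (rule homotopic_pathsin_image)
  moreover have "f \<circ> p \<in> loopsin T' b'"
    using p f b' by (auto simp: loopsin_def pathin_compose)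
  ultimately show "loop_class T' b' (f \<circ> q) = loop_class T' b' (f \<circ> p)"
    using loop_class_eq_if_homotopic by metis
qed

lemma group_fundamental_group:
  assumes b: "b \<in> topspace T"
  shows "group (fundamental_group T b)"
proof (rule groupI)
  let ?G = "fundamental_group T b"
  have lc: "loop_class T b p \<in> carrier ?G" if "p \<in> loopsin T b" for p
    using that by (simp add: carrier_fundamental_group)
  note lp = joinin_loopsin const_loopsin[OF b] reversein_loopsin
  show "\<one>\<^bsub>?G\<^esub> \<in> carrier ?G"
    using lc lp by (simp add: one_fundamental_group)
  fix x assume "x \<in> carrier ?G"
  then obtain p where p: "p \<in> loopsin T b" "x = loop_class T b p"
    by (auto simp: carrier_fundamental_group)
  show "\<one>\<^bsub>?G\<^esub> \<otimes>\<^bsub>?G\<^esub> x = x"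
  proof -
    have "homotopic_pathsin T (joinin (\<lambda>_. b) p) p"
      using p by (intro homotopic_pathsin_lid) (auto simp: loopsin_def)
    then have "loop_class T b (joinin (\<lambda>_. b) p) = loop_class T b p"
      using p lp by (intro loop_class_eq_if_homotopic) auto
    then show ?thesis
      using p lp by (simp add: one_fundamental_group mult_fundamental_group)
  qed
  show "\<exists>y\<in>carrier ?G. y \<otimes>\<^bsub>?G\<^esub> x = \<one>\<^bsub>?G\<^esub>"
  proof (rule bexI)
    show "loop_class T b (reversein p) \<otimes>\<^bsub>?G\<^esub> x = \<one>\<^bsub>?G\<^esub>"
    proof -
      have "homotopic_pathsin T (joinin (reversein p) p) (\<lambda>_. b)"
        using p homotopic_pathsin_linv[of T p] by (auto simp: loopsin_def)
      then have "loop_class T b (joinin (reversein p) p) = loop_class T b (\<lambda>_. b)"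
        using lp(1)[OF lp(3)[OF p(1)] p(1)] by (intro loop_class_eq_if_homotopic)
      then show ?thesis
        unfolding p(2) one_fundamental_group mult_fundamental_group[OF lp(3)[OF p(1)] p(1)] .
    qed
  qed (use lc[OF lp(3)[OF p(1)]] in simp)
  fix y assume "y \<in> carrier ?G"
  then obtain q where q: "q \<in> loopsin T b" "y = loop_class T b q"
    by (auto simp: carrier_fundamental_group)
  show "x \<otimes>\<^bsub>?G\<^esub> y \<in> carrier ?G"
    using lc[OF joinin_loopsin[OF p(1) q(1)]] p q by (simp add: mult_fundamental_group)
  fix z assume "z \<in> carrier ?G"
  then obtain r where r: "r \<in> loopsin T b" "z = loop_class T b r"
    by (auto simp: carrier_fundamental_group)
  have "homotopic_pathsin T (joinin (joinin p q) r) (joinin p (joinin q r))"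
    using p q r by (intro homotopic_pathsin_assoc) (auto simp: loopsin_def)
  then show "x \<otimes>\<^bsub>?G\<^esub> y \<otimes>\<^bsub>?G\<^esub> z = x \<otimes>\<^bsub>?G\<^esub> (y \<otimes>\<^bsub>?G\<^esub> z)"
    using p q r joinin_loopsin[OF p(1) q(1)] joinin_loopsin[OF q(1) r(1)]
        loop_class_eq_if_homotopic[OF _ joinin_loopsin[OF joinin_loopsin[OF p(1) q(1)] r(1)]]
    by (simp add: mult_fundamental_group)
qed

text \<open>A choice of paths \<open>\<tau> x\<close> from the basepoint to all points turns the fundamental groupoid
  into the fundamental group.\<close>

locale based_space =
  fixes T :: "'b topology" and b :: 'b and \<tau> :: "'b \<Rightarrow> real \<Rightarrow> 'b"
  assumes tau: "\<And>x. x \<in> topspace T \<Longrightarrow> pathin T (\<tau> x)" "\<And>x. x \<in> topspace T \<Longrightarrow> \<tau> x 0 = b"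
      "\<And>x. x \<in> topspace T \<Longrightarrow> \<tau> x 1 = x"
    and tau_base: "\<tau> b = (\<lambda>_. b)"
    and base: "b \<in> topspace T"
begin

sublocale group "fundamental_group T b"
  by (rule group_fundamental_group[OF base])

text \<open>Conjugation by the chosen paths gives every path, closed or not, a value in the group,
  so that products over subdivisions make sense. Because \<open>\<tau> b\<close> is constant, a loop
  at \<open>b\<close> keeps its own class.\<close>

definition pclass :: "(real \<Rightarrow> 'b) \<Rightarrow> (real \<Rightarrow> 'b) set" where
  "pclass p = loop_class T b (joinin (joinin (\<tau> (p 0)) p) (reversein (\<tau> (p 1))))"

lemma pathin_ends: "pathin T p \<Longrightarrow> p 0 \<in> topspace T" "pathin T p \<Longrightarrow> p 1 \<in> topspace T"
  by (auto intro!: pathin_topspace)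

lemma based_loop:
  assumes "pathin T p"
  shows "joinin (joinin (\<tau> (p 0)) p) (reversein (\<tau> (p 1))) \<in> loopsin T b"
  using assms pathin_ends[OF assms]
  by (auto simp: loopsin_def tau intro!: pathin_joinin pathin_reversein)

lemma pclass_closed [simp]: "pathin T p \<Longrightarrow> pclass p \<in> carrier (fundamental_group T b)"
  using based_loop by (auto simp: carrier_fundamental_group pclass_def)

lemma pclass_homotopic:
  assumes "homotopic_pathsin T p q"
  shows "pclass p = pclass q"
proof -
  note pq = homotopic_pathsin_imp_pathin[OF assms] homotopic_pathsin_imp_ends[OF assms]
  then show ?thesis
    using based_loop[of p] pathin_ends[of p] assms unfolding pclass_def
    by (intro loop_class_eq_if_homotopic homotopic_pathsin_join)
       (auto simp: tau intro!: homotopic_pathsin_refl pathin_reversein)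
qed

lemma pclass_loop:
  assumes "p \<in> loopsin T b"
  shows "pclass p = loop_class T b p"
proof -
  have p: "pathin T p" "p 0 = b" "p 1 = b" using assms by (auto simp: loopsin_def)
  have "homotopic_pathsin T (joinin (joinin (\<lambda>_. b) p) (\<lambda>_. b)) (joinin p (\<lambda>_. b))"
    using p by (intro homotopic_pathsin_join homotopic_pathsin_lid homotopic_pathsin_refl)
      (auto simp: base)
  also have "homotopic_pathsin T (joinin p (\<lambda>_. b)) p"
    using p by (intro homotopic_pathsin_rid) auto
  finally show ?thesis
    using based_loop[OF p(1)] p unfolding pclass_def
    by (intro loop_class_eq_if_homotopic) (auto simp: tau_base reversein_def)
qed

lemma pclass_join:
  assumes p: "pathin T p" and q: "pathin T q" and pq: "p 1 = q 0"
  shows "pclass (joinin p q) = pclass p \<otimes>\<^bsub>fundamental_group T b\<^esub> pclass q"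
proof -
  note e = pathin_ends[OF p] pathin_ends[OF q]
  let ?a = "\<tau> (p 0)" and ?m = "\<tau> (p 1)" and ?z = "\<tau> (q 1)"
  let ?H = "homotopic_pathsin T"
  note J = homotopic_pathsin_join and R = homotopic_pathsin_refl
  note [simp] = tau e pathin_reversein p q pathin_joinin pq
  have "?H (joinin (joinin (joinin ?a p) (reversein ?m)) (joinin (joinin ?m q) (reversein ?z)))
      (joinin (joinin ?a p) (joinin (reversein ?m) (joinin (joinin ?m q) (reversein ?z))))"
    by (rule homotopic_pathsin_assoc) (use pq e in auto)
  also have "?H \<dots> (joinin (joinin ?a p) (joinin (reversein ?m) (joinin ?m (joinin q (reversein
      ?z)))))"
    by (intro J R homotopic_pathsin_assoc) (use pq e in auto)
  also have "?H \<dots> (joinin (joinin ?a p) (joinin (joinin (reversein ?m) ?m) (joinin q (reversein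
      ?z))))"
    by (intro J R homotopic_pathsin_sym[OF homotopic_pathsin_assoc]) (use pq e in auto)
  also have "?H \<dots> (joinin (joinin ?a p) (joinin (\<lambda>_. ?m 1) (joinin q (reversein ?z))))"
    by (intro J R homotopic_pathsin_linv) (use pq e in auto)
  also have "?H \<dots> (joinin (joinin ?a p) (joinin q (reversein ?z)))"
    by (intro J R homotopic_pathsin_lid) (use pq e in auto)
  also have "?H \<dots> (joinin (joinin (joinin ?a p) q) (reversein ?z))"
    by (intro homotopic_pathsin_sym[OF homotopic_pathsin_assoc]) (use pq e in auto)
  also have "?H \<dots> (joinin (joinin ?a (joinin p q)) (reversein ?z))"
    by (intro J R homotopic_pathsin_assoc) (use pq e in auto)
  finally have H: "?H (joinin (joinin (joinin ?a p) (reversein ?m)) (joinin (joinin ?m q)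
      (reversein ?z)))
      (joinin (joinin ?a (joinin p q)) (reversein ?z))" .
  have "pclass p \<otimes>\<^bsub>fundamental_group T b\<^esub> pclass q =
      loop_class T b (joinin (joinin (joinin ?a p) (reversein ?m)) (joinin (joinin ?m q)
          (reversein ?z)))"
    unfolding pclass_def using based_loop[OF p] based_loop[OF q] pq by (simp add:
        mult_fundamental_group)
  also have "\<dots> = pclass (joinin p q)"
    unfolding pclass_def using H based_loop[OF p] based_loop[OF q] pq
    by (intro loop_class_eq_if_homotopic) (auto intro: joinin_loopsin)
  finally show ?thesis by simp
qed

lemma pclass_const [simp]:
  assumes "x \<in> topspace T"
  shows "pclass (\<lambda>_. x) = \<one>\<^bsub>fundamental_group T b\<^esub>"
proof -
  have "pclass (joinin (\<lambda>_. x) (\<lambda>_. x)) = pclass (\<lambda>_. x) \<otimes>\<^bsub>fundamental_group T b\<^esub> pclass (\<lambda>_. x)"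
    using assms by (intro pclass_join) auto
  moreover have "joinin (\<lambda>_. x) (\<lambda>_. x) = (\<lambda>_. x)" by (auto simp: joinin_def)
  ultimately show ?thesis using assms by (metis pathin_const pclass_closed l_cancel_one)
qed

lemma pclass_reverse:
  assumes "pathin T p"
  shows "pclass (reversein p) = inv\<^bsub>fundamental_group T b\<^esub> pclass p"
proof -
  have "pclass (reversein p) \<otimes>\<^bsub>fundamental_group T b\<^esub> pclass p = pclass (joinin (reversein p) p)"
    using assms by (intro pclass_join[symmetric]) (auto simp: pathin_reversein)
  also have "\<dots> = \<one>\<^bsub>fundamental_group T b\<^esub>"
    using assms pathin_ends[OF assms] homotopic_pathsin_linv by (subst pclass_homotopic) auto
  finally show ?thesis using assms by (metis inv_equality pathin_reversein pclass_closed)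
qed

lemma pclass_cong: "pathin T p \<Longrightarrow> (\<And>t. t \<in> {0..1} \<Longrightarrow> p t = q t) \<Longrightarrow> pclass p = pclass q"
  by (rule pclass_homotopic) (rule homotopic_pathsin_eq)

lemma pclass_subpath_join:
  assumes "pathin T p" "s \<in> {0..1}" "m \<in> {0..1}" "t \<in> {0..1}"
  shows "pclass (subpathin s t p) = pclass (subpathin s m p) \<otimes>\<^bsub>fundamental_group T b\<^esub> pclass
      (subpathin m t p)"
  using pclass_homotopic[OF homotopic_pathsin_subpath_join[OF assms]]
    pclass_join[OF pathin_subpathin[OF assms(1,2,3)] pathin_subpathin[OF assms(1,3,4)]]
  by simp

lemma carrier_pclass: "carrier (fundamental_group T b) = pclass ` loopsin T b"
  by (auto simp: carrier_fundamental_group pclass_loop)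

text \<open>Triviality of the class speaks of the loop conjugated to \<open>b\<close>; inserting the
  tail and its reverse on both sides of \<open>p\<close> turns it into a null-homotopy at the own
  base point of \<open>p\<close>. Such a null-homotopy is what a map on an attached disc is made
  of.\<close>

lemma pclass_eq_one_imp_homotopic:
  assumes p: "pathin T p" and loop: "p 1 = p 0" and one: "pclass p = \<one>\<^bsub>fundamental_group T b\<^esub>"
  shows "homotopic_pathsin T p (\<lambda>_. p 0)"
proof -
  let ?a = "\<tau> (p 0)" and ?H = "homotopic_pathsin T"
  let ?r = "reversein ?a"
  note J = homotopic_pathsin_join and R = homotopic_pathsin_refl
  note e = pathin_ends[OF p]
  note [simp] = tau e pathin_reversein p pathin_joinin loop
  have null: "?H (joinin (joinin ?a p) ?r) (\<lambda>_. b)"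
    using one loop_class_eq_iff[OF based_loop[OF p] const_loopsin[OF base]]
    unfolding pclass_def one_fundamental_group loop by blast
  have "?H p (joinin (\<lambda>_. ?a 1) p)"
    by (intro homotopic_pathsin_sym[OF homotopic_pathsin_lid]) (use e in auto)
  also have "?H \<dots> (joinin (joinin ?r ?a) p)"
    by (intro J R homotopic_pathsin_sym[OF homotopic_pathsin_linv]) (use e in auto)
  also have "?H \<dots> (joinin ?r (joinin ?a p))"
    by (intro homotopic_pathsin_assoc) (use e in auto)
  also have "?H \<dots> (joinin ?r (joinin (joinin ?a p) (\<lambda>_. ?a 1)))"
    by (intro J R homotopic_pathsin_sym[OF homotopic_pathsin_rid]) (use e in auto)
  also have "?H \<dots> (joinin ?r (joinin (joinin ?a p) (joinin ?r ?a)))"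
    by (intro J R homotopic_pathsin_sym[OF homotopic_pathsin_linv]) (use e in auto)
  also have "?H \<dots> (joinin ?r (joinin (joinin (joinin ?a p) ?r) ?a))"
    by (intro J R homotopic_pathsin_sym[OF homotopic_pathsin_assoc]) (use e in auto)
  also have "?H \<dots> (joinin ?r (joinin (\<lambda>_. b) ?a))"
    by (intro J R null) (use e in auto)
  also have "?H \<dots> (joinin ?r ?a)"
    by (intro J R homotopic_pathsin_lid) (use e in auto)
  also have "?H \<dots> (\<lambda>_. p 0)"
    using homotopic_pathsin_linv[of T ?a] by simp
  finally show ?thesis .
qed

end

section \<open>Transport along paths by a local cocycle\<close>

fun cocycle_prod :: "('g, 'm) monoid_scheme \<Rightarrow> ('y \<Rightarrow> 'y \<Rightarrow> 'g) \<Rightarrow> 'y list \<Rightarrow> 'g" where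
  "cocycle_prod G c (x # y # xs) = c x y \<otimes>\<^bsub>G\<^esub> cocycle_prod G c (y # xs)"
| "cocycle_prod G c _ = \<one>\<^bsub>G\<^esub>"

text \<open>Data of this kind describe a principal covering of \<open>T\<close> that is trivialised
  over each member of \<open>\<U>\<close>; the covering itself is not formed, only its sections
  along paths. By \<open>nbhd\<close> every point has an open neighbourhood inside some
  member.\<close>

locale local_cocycle = group G for G (structure) +
  fixes T :: "'y topology" and \<U> :: "'y set set" and c :: "'y \<Rightarrow> 'y \<Rightarrow> 'a"
  assumes c_closed: "\<And>U x y. U \<in> \<U> \<Longrightarrow> x \<in> U \<Longrightarrow> y \<in> U \<Longrightarrow> c x y \<in> carrier G"
    and c_mult: "\<And>U x y z. U \<in> \<U> \<Longrightarrow> x \<in> U \<Longrightarrow> y \<in> U \<Longrightarrow> z \<in> U \<Longrightarrow> c x y \<otimes> c y z = c x z"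
    and nbhd: "\<And>x. x \<in> topspace T \<Longrightarrow> \<exists>V U. openin T V \<and> x \<in> V \<and> U \<in> \<U> \<and> V \<subseteq> U"
begin

text \<open>A section along \<open>p\<close> of the covering described by \<open>c\<close>.
  Smallness is required of the image of the whole interval \<open>{s..t}\<close>: if it were asked
  only of the end points, \<open>F\<close> would have to agree wherever \<open>p\<close> returns to
  the same point, and monodromy would be lost.\<close>

definition lift :: "(real \<Rightarrow> 'y) \<Rightarrow> real \<Rightarrow> real \<Rightarrow> (real \<Rightarrow> 'a) \<Rightarrow> bool" where
  "lift p a z F \<longleftrightarrow> (\<forall>t\<in>{a..z}. F t \<in> carrier G) \<and>
     (\<forall>s t U. a \<le> s \<and> s \<le> t \<and> t \<le> z \<and> U \<in> \<U> \<and> p ` {s..t} \<subseteq> U \<longrightarrow> F t = F s \<otimes> c (p s) (p t))"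

lemma lift_closed: "lift p a z F \<Longrightarrow> a \<le> t \<Longrightarrow> t \<le> z \<Longrightarrow> F t \<in> carrier G"
  by (simp add: lift_def)

lemma lift_step:
  "lift p a z F \<Longrightarrow> U \<in> \<U> \<Longrightarrow> p ` {s..t} \<subseteq> U \<Longrightarrow> a \<le> s \<Longrightarrow> s \<le> t \<Longrightarrow> t \<le> z \<Longrightarrow>
    F t = F s \<otimes> c (p s) (p t)"
  unfolding lift_def by blast

lemma c_refl: "U \<in> \<U> \<Longrightarrow> x \<in> U \<Longrightarrow> c x x = \<one>"
  using c_mult[of U x x x] c_closed[of U x x] by (metis l_cancel_one)

lemma path_nbhd:
  assumes p: "pathin T p" and x: "x \<in> {0..1}"
  shows "\<exists>d>0. \<exists>U\<in>\<U>. \<forall>t\<in>{0..1}. \<bar>t - x\<bar> < d \<longrightarrow> p t \<in> U"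
proof -
  obtain V U where VU: "openin T V" "p x \<in> V" "U \<in> \<U>" "V \<subseteq> U"
    using nbhd[OF pathin_topspace[OF p x]] by blast
  have "openin (top_of_set {0..1}) {t \<in> {0..1}. p t \<in> V}"
    using openin_continuous_map_preimage[OF p[unfolded pathin_def] VU(1)] by simp
  then obtain d where "d > 0" "\<forall>t\<in>{0..1}. dist t x < d \<longrightarrow> p t \<in> V"
    using x VU(2) unfolding openin_euclidean_subtopology_iff by auto
  then show ?thesis
    using VU by (intro exI[of _ d]) (auto simp: dist_real_def)
qed

lemma path_interval_nbhd:
  assumes p: "pathin T p" and x: "x \<in> {0..1}"
  shows "\<exists>d>0. \<exists>U\<in>\<U>. \<forall>u v. u \<le> x \<and> x \<le> v \<and> v - u < d \<and> 0 \<le> u \<and> v \<le> 1 \<longrightarrow> p ` {u..v} \<subseteq> U"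
proof -
  obtain d U where d: "d > 0" "U \<in> \<U>" "\<forall>t\<in>{0..1}. \<bar>t - x\<bar> < d \<longrightarrow> p t \<in> U"
    using path_nbhd[OF assms] by blast
  then show ?thesis
    by (intro exI[of _ d] conjI bexI[of _ U] allI impI image_subsetI) auto
qed

lemma lift_unique:
  assumes p: "pathin T p" and F: "lift p 0 1 F" and F': "lift p 0 1 F'"
    and "0 \<le> a" "a \<le> z" "z \<le> 1" "F a = F' a"
  shows "F z = F' z"
proof -
  have "0 \<le> a \<and> z \<le> 1 \<longrightarrow> F a = F' a \<longrightarrow> F z = F' z"
  \<comment> \<open>Bolzano's bisection principle: a property of intervals that passes to adjacent
    unions and holds for all short intervals around each point holds for the whole interval. Several
    later passages from local to global along an interval use it in the same way.\<close>
  proof (rule Bolzano[OF \<open>a \<le> z\<close>])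
    fix x assume x: "a \<le> x" "x \<le> z"
    obtain d U where d: "d > 0" "U \<in> \<U>"
      "\<forall>u v. u \<le> x \<and> x \<le> v \<and> v - u < d \<and> 0 \<le> u \<and> v \<le> 1 \<longrightarrow> p ` {u..v} \<subseteq> U"
      using path_interval_nbhd[OF p, of x] x assms by auto
    then show "\<exists>d>0. \<forall>a b. a \<le> x \<and> x \<le> b \<and> b - a < d \<longrightarrow> 0 \<le> a \<and> b \<le> 1 \<longrightarrow> F a = F' a \<longrightarrow> F b = F' b"
      using lift_step[OF F d(2)] lift_step[OF F' d(2)]
      by (intro exI[of _ d]) (metis order.trans)
  qed auto
  then show ?thesis using assms by auto
qed

lemma lift_exists:
  assumes p: "pathin T p"
  obtains F where "lift p 0 1 F" "F 0 = \<one>"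
proof -
  have "0 \<le> (0::real) \<and> (1::real) \<le> 1 \<longrightarrow> (\<exists>F. lift p 0 1 F)"
  proof (rule Bolzano[of 0 1 "\<lambda>u v. 0 \<le> u \<and> v \<le> 1 \<longrightarrow> (\<exists>F. lift p u v F)"])
    fix a b z :: real
    assume 1: "0 \<le> a \<and> b \<le> 1 \<longrightarrow> (\<exists>F. lift p a b F)" "0 \<le> b \<and> z \<le> 1 \<longrightarrow> (\<exists>F. lift p b z F)"
      and ab: "a \<le> b" "b \<le> z"
    show "0 \<le> a \<and> z \<le> 1 \<longrightarrow> (\<exists>F. lift p a z F)"
    proof
      assume "0 \<le> a \<and> z \<le> 1"
      then obtain F F' where F: "lift p a b F" and F': "lift p b z F'" using 1 ab by force
      \<comment> \<open>Increments act from the right, so a lift stays a lift under left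
        multiplication. The factor \<open>k\<close> moves the second lift so that it agrees with the
        first at \<open>b\<close>.\<close>
      define k where "k = F b \<otimes> inv (F' b)"
      define H where "H t = (if t \<le> b then F t else k \<otimes> F' t)" for t
      have k: "k \<in> carrier G" "k \<otimes> F' b = F b"
        using lift_closed[OF F, of b] lift_closed[OF F', of b] ab by (auto simp: k_def m_assoc)
      have "lift p a z H"
        unfolding lift_def
      proof (intro conjI ballI allI impI)
        fix t assume "t \<in> {a..z}"
        then show "H t \<in> carrier G"
          using lift_closed[OF F] lift_closed[OF F'] ab k by (auto simp: H_def)
      next
        fix s t U assume A: "a \<le> s \<and> s \<le> t \<and> t \<le> z \<and> U \<in> \<U> \<and> p ` {s..t} \<subseteq> U"
        consider "t \<le> b" | "b < s" | "s \<le> b" "b < t" by linarith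
        then show "H t = H s \<otimes> c (p s) (p t)"
        proof cases
          case 1
          then show ?thesis using A lift_step[OF F, of U s t] by (auto simp: H_def)
        next
          case 2
          have "p s \<in> U" "p t \<in> U" using A by auto
          moreover have "F' t = F' s \<otimes> c (p s) (p t)"
            using 2 A by (intro lift_step[OF F', of U]) auto
          ultimately show ?thesis
            using 2 A k lift_closed[OF F', of s] c_closed[of U "p s" "p t"] by (simp add: H_def
                m_assoc)
        next
          case 3
          have in_U: "p s \<in> U" "p t \<in> U" "p b \<in> U" using A 3 by auto
          have "F' t = F' b \<otimes> c (p b) (p t)"
            using 3 A by (intro lift_step[OF F', of U]) auto
          then have "H t = k \<otimes> F' b \<otimes> c (p b) (p t)"
            using 3 k(1) A lift_closed[OF F', of b] c_closed[of U "p b" "p t"] in_U ab by (simp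
                add: H_def m_assoc)
          also have "k \<otimes> F' b = F b" by (rule k)
          also have "F b = F s \<otimes> c (p s) (p b)"
            using 3 A by (intro lift_step[OF F, of U]) auto
          also have "F s \<otimes> c (p s) (p b) \<otimes> c (p b) (p t) = F s \<otimes> c (p s) (p t)"
            using A in_U 3 lift_closed[OF F, of s] c_closed[of U] c_mult[of U "p s" "p b" "p t"]
            by (simp add: m_assoc)
          finally show ?thesis using 3 by (simp add: H_def)
        qed
      qed
      then show "\<exists>F. lift p a z F" by blast
    qed
  next
    fix x :: real assume x: "0 \<le> x" "x \<le> 1"
    obtain d U where d: "d > 0" "U \<in> \<U>"
      "\<forall>u v. u \<le> x \<and> x \<le> v \<and> v - u < d \<and> 0 \<le> u \<and> v \<le> 1 \<longrightarrow> p ` {u..v} \<subseteq> U"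
      using path_interval_nbhd[OF p, of x] x by auto
    have "lift p u v (\<lambda>t. c (p u) (p t))" if "u \<le> x \<and> x \<le> v \<and> v - u < d" "0 \<le> u \<and> v \<le> 1" for u v
    proof -
      have "p t \<in> U" if "t \<in> {u..v}" for t
        using that d(3) \<open>0 \<le> u \<and> v \<le> 1\<close> \<open>u \<le> x \<and> x \<le> v \<and> v - u < d\<close> by blast
      then show ?thesis
        unfolding lift_def using c_closed[OF d(2)] c_mult[OF d(2)] by auto
    qed
    then show "\<exists>d>0. \<forall>a b. a \<le> x \<and> x \<le> b \<and> b - a < d \<longrightarrow> 0 \<le> a \<and> b \<le> 1 \<longrightarrow> (\<exists>F. lift p a b F)"
      using d(1) by (intro exI[of _ d]) blast
  qed auto
  then obtain F where F: "lift p 0 1 F" by auto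
  have "lift p 0 1 (\<lambda>t. inv (F 0) \<otimes> F t)"
    unfolding lift_def
  proof (intro conjI ballI allI impI)
    fix t :: real assume "t \<in> {0..1}"
    then show "inv (F 0) \<otimes> F t \<in> carrier G"
      using lift_closed[OF F] by auto
  next
    fix s t :: real and U assume A: "0 \<le> s \<and> s \<le> t \<and> t \<le> 1 \<and> U \<in> \<U> \<and> p ` {s..t} \<subseteq> U"
    then have "F t = F s \<otimes> c (p s) (p t)" by (intro lift_step[OF F, of U]) auto
    moreover have "c (p s) (p t) \<in> carrier G" using A by (intro c_closed[of U]) auto
    ultimately show "inv (F 0) \<otimes> F t = inv (F 0) \<otimes> F s \<otimes> c (p s) (p t)"
      using A lift_closed[OF F, of 0] lift_closed[OF F, of s] by (simp add: m_assoc)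
  qed
  moreover have "inv (F 0) \<otimes> F 0 = \<one>" using lift_closed[OF F, of 0] by simp
  ultimately show thesis using that by blast
qed

section \<open>Transport along paths: functoriality and homotopy invariance\<close>

definition transport :: "(real \<Rightarrow> 'y) \<Rightarrow> 'a" where
  "transport p = (SOME F. lift p 0 1 F \<and> F 0 = \<one>) 1"

lemma transport_lift:
  assumes p: "pathin T p"
  obtains F where "lift p 0 1 F" "F 0 = \<one>" "F 1 = transport p"
proof -
  let ?F = "SOME F. lift p 0 1 F \<and> F 0 = \<one>"
  have "lift p 0 1 ?F \<and> ?F 0 = \<one>"
  proof (rule someI_ex[of "\<lambda>F. lift p 0 1 F \<and> F 0 = \<one>"])
    obtain F where "lift p 0 1 F" "F 0 = \<one>" using lift_exists[OF p] .
    then show "\<exists>F. lift p 0 1 F \<and> F 0 = \<one>" by blast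
  qed
  then have "lift p 0 1 ?F" "?F 0 = \<one>" by blast+
  then show thesis using that[of ?F] unfolding transport_def by blast
qed

lemma transport_closed [simp]:
  assumes p: "pathin T p"
  shows "transport p \<in> carrier G"
proof -
  obtain F where F: "lift p 0 1 F" "F 1 = transport p"
    using transport_lift[OF p] .
  show ?thesis using lift_closed[OF F(1), of 1] F(2) by simp
qed

lemma transport_eq:
  assumes p: "pathin T p" and F: "lift p 0 1 F"
  shows "F 1 = F 0 \<otimes> transport p"
proof -
  obtain F' where F': "lift p 0 1 F'" "F' 0 = \<one>" "F' 1 = transport p"
    using transport_lift[OF p] by blast
  have F0: "F 0 \<in> carrier G" using lift_closed[OF F, of 0] by simp
  have "lift p 0 1 (\<lambda>t. F 0 \<otimes> F' t)"
    unfolding lift_def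
  proof (intro conjI ballI allI impI)
    fix t :: real assume "t \<in> {0..1}"
    then show "F 0 \<otimes> F' t \<in> carrier G"
      using lift_closed[OF F'(1)] F0 by auto
  next
    fix s t :: real and U assume A: "0 \<le> s \<and> s \<le> t \<and> t \<le> 1 \<and> U \<in> \<U> \<and> p ` {s..t} \<subseteq> U"
    then have "F' t = F' s \<otimes> c (p s) (p t)" by (intro lift_step[OF F'(1), of U]) auto
    moreover have "c (p s) (p t) \<in> carrier G" using A by (intro c_closed[of U]) auto
    ultimately show "F 0 \<otimes> F' t = F 0 \<otimes> F' s \<otimes> c (p s) (p t)"
      using A F0 lift_closed[OF F'(1), of s] by (simp add: m_assoc)
  qed
  from lift_unique[OF p F this, of 0 1] F' F0 show ?thesis by simp
qed

lemma transport_eqI: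
  assumes "pathin T p" "lift p 0 1 F" "F 0 = \<one>"
  shows "transport p = F 1"
  using transport_eq[OF assms(1,2)] assms by simp

lemma lift_compose:
  assumes F: "lift p 0 1 F" and \<phi>: "continuous_on {0..1} \<phi>" "mono_on {0..1} \<phi>" "\<phi> ` {0..1} \<subseteq> {0..1}"
    and q: "\<And>t. t \<in> {0..1} \<Longrightarrow> q t = p (\<phi> t)"
  shows "lift q 0 1 (\<lambda>t. F (\<phi> t))"
  unfolding lift_def
proof (intro conjI ballI allI impI)
  fix t :: real assume "t \<in> {0..1}"
  then have "\<phi> t \<in> {0..1}" using \<phi>(3) by blast
  then show "F (\<phi> t) \<in> carrier G" using lift_closed[OF F] by auto
next
  fix s t :: real and U assume A: "0 \<le> s \<and> s \<le> t \<and> t \<le> 1 \<and> U \<in> \<U> \<and> q ` {s..t} \<subseteq> U"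
  \<comment> \<open>Smallness is known for the values of \<open>q\<close>, that is, of
    \<open>p\<close> on the image of \<open>{s..t}\<close> under \<phi>. By the intermediate value
    theorem this image skips no parameter between \<open>\<phi> s\<close> and
    \<open>\<phi> t\<close>.\<close>
  have "{\<phi> s..\<phi> t} \<subseteq> \<phi> ` {s..t}"
  proof
    fix y assume "y \<in> {\<phi> s..\<phi> t}"
    then show "y \<in> \<phi> ` {s..t}"
      using IVT'[of \<phi> s y t] A continuous_on_subset[OF \<phi>(1), of "{s..t}"] by auto
  qed
  then have "p ` {\<phi> s..\<phi> t} \<subseteq> (p \<circ> \<phi>) ` {s..t}" by auto
  also have "(p \<circ> \<phi>) ` {s..t} = q ` {s..t}" using A by (intro image_cong) (auto simp: q)
  finally have "p ` {\<phi> s..\<phi> t} \<subseteq> U" using A by blast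
  moreover have "s \<in> {0..1}" "t \<in> {0..1}" using A by auto
  then have "\<phi> s \<in> {0..1}" "\<phi> t \<in> {0..1}" using \<phi>(3) by blast+
  moreover have "\<phi> s \<le> \<phi> t" using mono_onD[OF \<phi>(2), of s t] A by auto
  ultimately have "F (\<phi> t) = F (\<phi> s) \<otimes> c (p (\<phi> s)) (p (\<phi> t))"
    using A by (intro lift_step[OF F, of U]) simp_all
  then show "F (\<phi> t) = F (\<phi> s) \<otimes> c (q s) (q t)" using A by (simp add: q)
qed

lemma transport_cong:
  assumes p: "pathin T p" and eq: "\<And>t. t \<in> {0..1} \<Longrightarrow> p t = q t"
  shows "transport q = transport p"
proof -
  obtain F where F: "lift p 0 1 F" "F 0 = \<one>" "F 1 = transport p"
    using transport_lift[OF p] by blast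
  have "lift q 0 1 (\<lambda>t. F t)"
    using eq by (intro lift_compose[OF F(1), of "\<lambda>t. t"]) (auto simp: mono_on_def continuous_on_id)
  with F show ?thesis using transport_eqI[OF pathin_cong[OF p eq]] by simp
qed

lemma lift_transport_subpath:
  assumes p: "pathin T p" and F: "lift p 0 1 F" and st: "0 \<le> s" "s \<le> t" "t \<le> 1"
  shows "F t = F s \<otimes> transport (subpathin s t p)"
proof -
  have "0 \<le> s + u * (t - s)" "s + u * (t - s) \<le> 1" if "0 \<le> u" "u \<le> 1" for u
  proof -
    show "0 \<le> s + u * (t - s)" using st that by simp
    have "u * (t - s) \<le> 1 * (t - s)" using st that by (intro mult_right_mono) auto
    then show "s + u * (t - s) \<le> 1" using st by simp
  qed
  then have "lift (subpathin s t p) 0 1 (\<lambda>u. F (s + u * (t - s)))"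
    using st by (intro lift_compose[OF F]) (auto intro!: continuous_intros mono_onI
        mult_right_mono simp: subpathin_def)
  from transport_eq[OF _ this] show ?thesis using pathin_subpathin[OF p, of s t] st by simp
qed

lemma transport_subpath_join:
  assumes p: "pathin T p" and st: "0 \<le> s" "s \<le> m" "m \<le> t" "t \<le> 1"
  shows "transport (subpathin s t p) = transport (subpathin s m p) \<otimes> transport (subpathin m t p)"
proof -
  obtain F where F: "lift p 0 1 F" "F 0 = \<one>" "F 1 = transport p"
    using transport_lift[OF p] by blast
  have cl: "F s \<in> carrier G" "transport (subpathin s m p) \<in> carrier G" "transport (subpathin m t
      p) \<in> carrier G"
    "transport (subpathin s t p) \<in> carrier G"
    using st lift_closed[OF F(1), of s] by (auto intro!: transport_closed pathin_subpathin p)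
  have "F s \<otimes> transport (subpathin s t p) = F t"
    using lift_transport_subpath[OF p F(1), of s t] st by simp
  also have "\<dots> = F s \<otimes> transport (subpathin s m p) \<otimes> transport (subpathin m t p)"
    using lift_transport_subpath[OF p F(1), of s m] lift_transport_subpath[OF p F(1), of m t] st
        by simp
  finally show ?thesis using cl by (simp add: m_assoc)
qed

lemma transport_join:
  assumes p: "pathin T p" and q: "pathin T q" and pq: "p 1 = q 0"
  shows "transport (joinin p q) = transport p \<otimes> transport q"
proof -
  let ?j = "joinin p q"
  have j: "pathin T ?j" using assms by (rule pathin_joinin)
  have "transport ?j = transport (subpathin 0 (1/2) ?j) \<otimes> transport (subpathin (1/2) 1 ?j)"
    using transport_subpath_join[OF j, of 0 "1/2" 1] by simp
  also have "transport (subpathin 0 (1/2) ?j) = transport p"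
    by (rule transport_cong[OF p]) (auto simp: subpathin_def joinin_def)
  also have "transport (subpathin (1/2) 1 ?j) = transport q"
  proof (rule transport_cong[OF q])
    fix t :: real assume t: "t \<in> {0..1}"
    show "q t = subpathin (1/2) 1 ?j t"
      using t pq by (cases "t = 0") (auto simp: subpathin_def joinin_def)
  qed
  finally show ?thesis .
qed

lemma transport_small:
  assumes p: "pathin T p" and U: "U \<in> \<U>" "p ` {0..1} \<subseteq> U"
  shows "transport p = c (p 0) (p 1)"
proof -
  obtain F where F: "lift p 0 1 F" "F 0 = \<one>" "F 1 = transport p"
    using transport_lift[OF p] by blast
  have "c (p 0) (p 1) \<in> carrier G" using U by (intro c_closed[of U]) auto
  then show ?thesis using lift_step[OF F(1) U(1), of 0 1] U(2) F by simp
qed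

lemma transport_const [simp]: "x \<in> topspace T \<Longrightarrow> transport (\<lambda>_. x) = \<one>"
proof -
  assume x: "x \<in> topspace T"
  then obtain U where U: "U \<in> \<U>" "x \<in> U" using nbhd[of x] by blast
  then show ?thesis using transport_small[OF pathin_const[OF x] U(1)] c_refl[OF U] by auto
qed

text \<open>The transport along \<open>h (t, _)\<close> is locally constant in \<open>t\<close>: the
  lifts at two nearby times differ by the cocycle across the narrow strip between them, and this
  difference cannot change along the strip. Connectedness of the interval of times does the
  rest.\<close>

lemma transport_homotopic:
  assumes "homotopic_pathsin T p q"
  shows "transport p = transport q"
proof -
  obtain h :: "real \<times> real \<Rightarrow> 'y" where h: "continuous_map (top_of_set ({0..1} \<times> {0..1})) T h"
    and h0: "\<And>x. h (0, x) = p x" and h1: "\<And>x. h (1, x) = q x"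
    and ends: "\<And>t. t \<in> {0..1} \<Longrightarrow> h (t, 0) = p 0" "\<And>t. t \<in> {0..1} \<Longrightarrow> h (t, 1) = p 1"
    using assms by (rule homotopic_pathsinE) blast
  have ph: "pathin T (\<lambda>x. h (t, x))" if "t \<in> {0..1}" for t
    unfolding pathin_def
    by (rule continuous_map_top_of_set_compose[OF h]) (use that in \<open>auto intro!: continuous_intros\<close>)
  have "\<forall>t\<in>{0..1}. \<exists>F. lift (\<lambda>x. h (t, x)) 0 1 F \<and> F 0 = \<one> \<and> F 1 = transport (\<lambda>x. h (t, x))"
  proof
    fix t :: real assume "t \<in> {0..1}"
    then obtain F where "lift (\<lambda>x. h (t, x)) 0 1 F" "F 0 = \<one>" "F 1 = transport (\<lambda>x. h (t, x))"
      using transport_lift[OF ph] by blast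
    then show "\<exists>F. lift (\<lambda>x. h (t, x)) 0 1 F \<and> F 0 = \<one> \<and> F 1 = transport (\<lambda>x. h (t, x))" by blast
  qed
  then obtain F where F: "\<And>t. t \<in> {0..1} \<Longrightarrow> lift (\<lambda>x. h (t, x)) 0 1 (F t)"
    "\<And>t. t \<in> {0..1} \<Longrightarrow> F t 0 = \<one>" "\<And>t. t \<in> {0..1} \<Longrightarrow> F t 1 = transport (\<lambda>x. h (t, x))"
    by metis
  \<comment> \<open>A member of the cover contains the image of a whole box around
    \<open>(t0, s0)\<close>; halving the radius passes from the product metric to the two
    coordinates.\<close>
  have box: "\<exists>d>0. \<exists>U\<in>\<U>. \<forall>t\<in>{0..1}. \<forall>s\<in>{0..1}. \<bar>t - t0\<bar> < d \<and> \<bar>s - s0\<bar> < d \<longrightarrow> h (t, s) \<in> U"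
    if t0: "t0 \<in> {0..1}" and s0: "s0 \<in> {0..1}" for t0 s0
  proof -
    have "h (t0, s0) \<in> topspace T"
      using h t0 s0 by (auto simp: continuous_map_def)
    then obtain V U where VU: "openin T V" "h (t0, s0) \<in> V" "U \<in> \<U>" "V \<subseteq> U"
      using nbhd by blast
    have "openin (top_of_set ({0..1} \<times> {0..1})) {z \<in> {0..1} \<times> {0..1}. h z \<in> V}"
      using openin_continuous_map_preimage[OF h VU(1)] by simp
    moreover have "(t0, s0) \<in> {z \<in> {0..1} \<times> {0..1}. h z \<in> V}" using t0 s0 VU(2) by simp
    ultimately obtain d where d: "d > 0" "\<forall>z\<in>{0..1} \<times> {0..1}. dist z (t0, s0) < d \<longrightarrow> h z \<in> V"
      unfolding openin_euclidean_subtopology_iff by (metis (no_types, lifting) mem_Collect_eq)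
    have "h (t, s) \<in> U" if "t \<in> {0..1}" "s \<in> {0..1}" "\<bar>t - t0\<bar> < d / 2" "\<bar>s - s0\<bar> < d / 2" for t s
    proof -
      have "dist (t, s) (t0, s0) \<le> dist t t0 + dist s s0"
        by (simp add: dist_Pair_Pair sqrt_sum_squares_le_sum)
      then show ?thesis using d that VU by (auto simp: dist_real_def)
    qed
    then show ?thesis using d(1) VU(3) by (intro exI[of _ "d/2"] conjI bexI[of _ U] ballI impI)
        simp_all
  qed
  have const: "\<exists>d>0. \<forall>t\<in>{0..1}. \<bar>t - t0\<bar> < d \<longrightarrow> F t 1 = F t0 1" if t0: "t0 \<in> {0..1}" for t0
  proof -
    \<comment> \<open>\<open>W t s\<close> is the discrepancy at position \<open>s\<close> between
      the lift at time \<open>t\<close>, carried across to time \<open>t0\<close>, and the lift at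
      \<open>t0\<close>. Over a box the two ways round a small rectangle have equal products, so
      \<open>W t\<close> does not change there. It is trivial at \<open>s = 0\<close>, and as the
      homotopy fixes the end points, at \<open>s = 1\<close> it is the quotient of the two
      transports.\<close>
    define W where "W t s = F t s \<otimes> c (h (t, s)) (h (t0, s)) \<otimes> inv (F t0 s)" for t s
    have "0 \<le> (0::real) \<and> (1::real) \<le> 1 \<longrightarrow> (\<exists>d>0. \<forall>t\<in>{0..1}. \<bar>t - t0\<bar> < d \<longrightarrow> W t 0 = W t 1)"
    proof (rule Bolzano[of 0 1 "\<lambda>u v. 0 \<le> u \<and> v \<le> 1 \<longrightarrow> (\<exists>d>0. \<forall>t\<in>{0..1}. \<bar>t - t0\<bar> < d \<longrightarrow> W t u = W t
        v)"])
      fix u m v :: real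
      assume 1: "0 \<le> u \<and> m \<le> 1 \<longrightarrow> (\<exists>d>0. \<forall>t\<in>{0..1}. \<bar>t - t0\<bar> < d \<longrightarrow> W t u = W t m)"
        and 2: "0 \<le> m \<and> v \<le> 1 \<longrightarrow> (\<exists>d>0. \<forall>t\<in>{0..1}. \<bar>t - t0\<bar> < d \<longrightarrow> W t m = W t v)"
        and le: "u \<le> m" "m \<le> v"
      show "0 \<le> u \<and> v \<le> 1 \<longrightarrow> (\<exists>d>0. \<forall>t\<in>{0..1}. \<bar>t - t0\<bar> < d \<longrightarrow> W t u = W t v)"
      proof
        assume "0 \<le> u \<and> v \<le> 1"
        then obtain d d' where "d > 0" "\<forall>t\<in>{0..1}. \<bar>t - t0\<bar> < d \<longrightarrow> W t u = W t m"
          "d' > 0" "\<forall>t\<in>{0..1}. \<bar>t - t0\<bar> < d' \<longrightarrow> W t m = W t v" using 1 2 le by force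
        then show "\<exists>d>0. \<forall>t\<in>{0..1}. \<bar>t - t0\<bar> < d \<longrightarrow> W t u = W t v"
          by (intro exI[of _ "min d d'"]) auto
      qed
    next
      fix s0 :: real assume s0: "0 \<le> s0" "s0 \<le> 1"
      obtain d U where d: "d > 0" "U \<in> \<U>"
        "\<forall>t\<in>{0..1}. \<forall>s\<in>{0..1}. \<bar>t - t0\<bar> < d \<and> \<bar>s - s0\<bar> < d \<longrightarrow> h (t, s) \<in> U"
        using box[OF t0, of s0] s0 by auto
      have "W t u = W t v"
        if uv: "u \<le> s0" "s0 \<le> v" "v - u < d" "0 \<le> u" "v \<le> 1" and t: "t \<in> {0..1}" "\<bar>t - t0\<bar> < d"
            for u v t
      proof -
        have in_U: "h (t', s) \<in> U" if "t' = t \<or> t' = t0" "s \<in> {u..v}" for t' s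
          using that d t0 t uv by (elim disjE) auto
        note cl = c_closed[OF d(2) in_U in_U]
        have step: "F t' v = F t' u \<otimes> c (h (t', u)) (h (t', v))" if "t' = t \<or> t' = t0" for t'
          using that t t0 uv in_U by (intro lift_step[OF F(1) d(2)]) auto
        have Fc: "F t u \<in> carrier G" "F t0 u \<in> carrier G"
          using lift_closed[OF F(1)[OF t(1)]] lift_closed[OF F(1)[OF t0]] uv by auto
        have "c (h (t, u)) (h (t, v)) \<otimes> c (h (t, v)) (h (t0, v)) = c (h (t, u)) (h (t0, v))"
          using uv by (intro c_mult[OF d(2)] in_U) auto
        also have "\<dots> = c (h (t, u)) (h (t0, u)) \<otimes> c (h (t0, u)) (h (t0, v))"
          using uv by (intro c_mult[OF d(2), symmetric] in_U) auto
        finally have sq: "c (h (t, u)) (h (t, v)) \<otimes> c (h (t, v)) (h (t0, v)) =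
          c (h (t, u)) (h (t0, u)) \<otimes> c (h (t0, u)) (h (t0, v))" .
        have uv': "u \<in> {u..v}" "v \<in> {u..v}" using uv by auto
        note cls = cl[of t u t v] cl[of t v t0 v] cl[of t u t0 u] cl[of t0 u t0 v]
        have "W t v = F t u \<otimes> (c (h (t, u)) (h (t, v)) \<otimes> c (h (t, v)) (h (t0, v))) \<otimes>
            (inv (c (h (t0, u)) (h (t0, v))) \<otimes> inv (F t0 u))"
          using cls uv' Fc by (simp add: W_def step inv_mult_group m_assoc)
        also have "\<dots> = W t u"
          unfolding sq W_def using cls uv' Fc by (simp add: m_assoc inv_solve_left flip:
              m_assoc[of _ "inv (c (h (t0, u)) (h (t0, v)))"])
        finally show ?thesis by simp
      qed
      then show "\<exists>d>0. \<forall>u v. u \<le> s0 \<and> s0 \<le> v \<and> v - u < d \<longrightarrow> 0 \<le> u \<and> v \<le> 1 \<longrightarrow>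
          (\<exists>d>0. \<forall>t\<in>{0..1}. \<bar>t - t0\<bar> < d \<longrightarrow> W t u = W t v)"
        using d(1) by (intro exI[of _ d]) blast
    qed auto
    then obtain d where d: "d > 0" "\<forall>t\<in>{0..1}. \<bar>t - t0\<bar> < d \<longrightarrow> W t 0 = W t 1" by auto
    have "F t 1 = F t0 1" if t: "t \<in> {0..1}" "\<bar>t - t0\<bar> < d" for t
    proof -
      have "c x x = \<one>" if "x \<in> topspace T" for x using nbhd[OF that] c_refl[of _ x] by blast
      then have cc: "c (p 0) (p 0) = \<one>" "c (p 1) (p 1) = \<one>"
        using pathin_topspace[OF homotopic_pathsin_imp_pathin(1)[OF assms]] by simp_all
      have cl: "F t 1 \<in> carrier G" "F t0 1 \<in> carrier G"
        using lift_closed[OF F(1)[OF t(1)]] lift_closed[OF F(1)[OF t0]] by auto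
      have "W t 0 = W t 1" using d t by blast
      moreover have "W t 0 = \<one>" using F(2)[OF t(1)] F(2)[OF t0] ends t(1) t0 cc by (simp add: W_def)
      moreover have "W t 1 = F t 1 \<otimes> inv (F t0 1)" using ends t(1) t0 cc cl by (simp add: W_def)
      ultimately have "F t 1 \<otimes> inv (F t0 1) = \<one>" by simp
      then show ?thesis using cl by (metis inv_equality inv_inv inv_closed)
    qed
    then show ?thesis using d(1) by blast
  qed
  have "0 \<le> (0::real) \<and> (1::real) \<le> 1 \<longrightarrow> F 0 1 = F 1 1"
  proof (rule Bolzano[of 0 1 "\<lambda>u v. 0 \<le> u \<and> v \<le> 1 \<longrightarrow> F u 1 = F v 1"])
    fix x :: real assume x: "0 \<le> x" "x \<le> 1"
    obtain d where "d > 0" "\<forall>t\<in>{0..1}. \<bar>t - x\<bar> < d \<longrightarrow> F t 1 = F x 1"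
      using const[of x] x by auto
    moreover from this have "F a 1 = F b 1" if "a \<le> x" "x \<le> b" "b - a < d" "0 \<le> a" "b \<le> 1" for a b
    proof -
      have "\<bar>a - x\<bar> < d" "\<bar>b - x\<bar> < d" "a \<in> {0..1}" "b \<in> {0..1}" using that by auto
      then show ?thesis using calculation(2) by metis
    qed
    ultimately show "\<exists>d>0. \<forall>a b. a \<le> x \<and> x \<le> b \<and> b - a < d \<longrightarrow> 0 \<le> a \<and> b \<le> 1 \<longrightarrow> F a 1 = F b 1"
      by blast
  qed auto
  then show ?thesis using F(3)[of 0] F(3)[of 1] h0 h1 by simp
qed

lemma transport_reverse:
  assumes p: "pathin T p"
  shows "transport (reversein p) = inv (transport p)"
proof -
  have "transport (reversein p) \<otimes> transport p = transport (joinin (reversein p) p)"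
    using assms by (intro transport_join[symmetric]) (auto simp: pathin_reversein)
  also have "\<dots> = transport (\<lambda>_. p 1)"
    using assms by (intro transport_homotopic homotopic_pathsin_linv)
  also have "\<dots> = \<one>" using pathin_topspace[OF p, of 1] by simp
  finally show ?thesis using assms by (metis inv_equality pathin_reversein transport_closed)
qed

lemma lift_cocycle_prod:
  assumes F: "lift p a z F" and "ts \<noteq> []" "sorted ts" "set ts \<subseteq> {a..z}"
    and "\<And>i. Suc i < length ts \<Longrightarrow> \<exists>U\<in>\<U>. p ` {ts ! i..ts ! Suc i} \<subseteq> U"
  shows "cocycle_prod G c (map p ts) \<in> carrier G \<and>
    F (last ts) = F (hd ts) \<otimes> cocycle_prod G c (map p ts)"
  using assms(2-)
proof (induction ts)
  case (Cons t ts)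
  show ?case
  proof (cases ts)
    case Nil
    then show ?thesis using Cons.prems lift_closed[OF F, of t] by simp
  next
    case (Cons t' ts')
    have IH: "cocycle_prod G c (map p ts) \<in> carrier G"
      "F (last ts) = F t' \<otimes> cocycle_prod G c (map p ts)"
      using Cons.IH Cons.prems(2,3) Cons.prems(4)[of "Suc i" for i] Cons by auto
    obtain U where U: "U \<in> \<U>" "p ` {t..t'} \<subseteq> U"
      using Cons.prems(4)[of 0] Cons by auto
    have t: "a \<le> t" "t \<le> t'" "t' \<le> z" using Cons.prems(2,3) Cons by auto
    have cl: "c (p t) (p t') \<in> carrier G" using U t by (intro c_closed[OF U(1)]) auto
    have "F t' = F t \<otimes> c (p t) (p t')" using lift_step[OF F U t] .
    then show ?thesis
      using IH cl lift_closed[OF F, of t] t Cons by (simp add: m_assoc)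
  qed
qed simp

text \<open>Any subdivision subordinate to the cover computes the transport, so all fine samples of
  one path have the same product. This is the passage from continuous paths to vertex
  sequences.\<close>

lemma transport_cocycle_prod:
  assumes p: "pathin T p" and ts: "ts \<noteq> []" "sorted ts" "hd ts = 0" "last ts = 1"
    and small: "\<And>i. Suc i < length ts \<Longrightarrow> \<exists>U\<in>\<U>. p ` {ts ! i..ts ! Suc i} \<subseteq> U"
  shows "transport p = cocycle_prod G c (map p ts)"
proof -
  have "set ts \<subseteq> {0..1}"
  proof
    fix t assume "t \<in> set ts"
    then obtain i where i: "i < length ts" "t = ts ! i" by (auto simp: in_set_conv_nth)
    then show "t \<in> {0..1}"
      using ts sorted_nth_mono[OF ts(2), of 0 i] sorted_nth_mono[OF ts(2), of i "length ts - 1"]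
      by (auto simp: hd_conv_nth last_conv_nth)
  qed
  moreover obtain F where F: "lift p 0 1 F" "F 0 = \<one>" "F 1 = transport p"
    using transport_lift[OF p] by blast
  ultimately show ?thesis
    using lift_cocycle_prod[OF F(1) ts(1,2) _ small] ts F by auto
qed

lemma subdivision_exists:
  assumes p: "pathin T p" and e: "e > 0"
  obtains ts where "ts \<noteq> []" "sorted_wrt (<) ts" "hd ts = 0" "last ts = 1" "set ts \<subseteq> {0..1}"
    "\<And>i. Suc i < length ts \<Longrightarrow> ts ! Suc i - ts ! i < e \<and> (\<exists>U\<in>\<U>. p ` {ts ! i..ts ! Suc i} \<subseteq> U)"
proof -
  let ?S = "\<lambda>u v ts. ts \<noteq> [] \<and> sorted_wrt (<) ts \<and> hd ts = u \<and> last ts = v \<and>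
    (\<forall>i. Suc i < length ts \<longrightarrow> ts ! Suc i - ts ! i < e \<and> (\<exists>U\<in>\<U>. p ` {ts ! i..ts ! Suc i} \<subseteq> U))"
  have "0 \<le> (0::real) \<and> (1::real) \<le> 1 \<longrightarrow> (\<exists>ts. ?S 0 1 ts)"
  proof (rule Bolzano[of 0 1 "\<lambda>u v. 0 \<le> u \<and> v \<le> 1 \<longrightarrow> (\<exists>ts. ?S u v ts)"])
    fix u m v :: real
    assume 1: "0 \<le> u \<and> m \<le> 1 \<longrightarrow> (\<exists>ts. ?S u m ts)" and 2: "0 \<le> m \<and> v \<le> 1 \<longrightarrow> (\<exists>ts. ?S m v ts)"
      and le: "u \<le> m" "m \<le> v"
    show "0 \<le> u \<and> v \<le> 1 \<longrightarrow> (\<exists>ts. ?S u v ts)"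
    proof
      assume "0 \<le> u \<and> v \<le> 1"
      then obtain ts ts' where A: "?S u m ts" and B: "?S m v ts'" using 1 2 le by auto
      have ts'_eq: "ts' = m # tl ts'" using B by (cases ts') auto
      have ts_eq: "ts = butlast ts @ [m]" using A append_butlast_last_id[of ts] by simp
      have m_le: "m < y" if "y \<in> set (tl ts')" for y
        using B ts'_eq that by (metis sorted_wrt.simps(2))
      have le_m: "y \<le> m" if "y \<in> set ts" for y
      proof -
        have "sorted_wrt (<) (butlast ts @ [m])" using A ts_eq by metis
        then have "\<forall>y\<in>set (butlast ts). y < m" by (auto simp: sorted_wrt_append)
        moreover have "y \<in> set (butlast ts @ [m])" using that ts_eq by metis
        ultimately show ?thesis by auto
      qed
      have sm: "ts ! Suc i - ts ! i < e \<and> (\<exists>U\<in>\<U>. p ` {ts ! i..ts ! Suc i} \<subseteq> U)" if "Suc i < length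
          ts" for i
        using A that by blast
      have sm': "ts' ! Suc i - ts' ! i < e \<and> (\<exists>U\<in>\<U>. p ` {ts' ! i..ts' ! Suc i} \<subseteq> U)" if "Suc i <
          length ts'" for i
        using B that by blast
      \<comment> \<open>The two subdivisions share the point \<open>m\<close>. Dropping one copy
        with \<open>tl\<close> keeps the list strictly increasing, and the pair straddling the seam
        is then the first pair of \<open>ts'\<close>.\<close>
      have "?S u v (ts @ tl ts')"
      proof (intro conjI allI impI)
        show "ts @ tl ts' \<noteq> []" "hd (ts @ tl ts') = u" using A by auto
        show "last (ts @ tl ts') = v"
          using A B ts'_eq by (metis append_Nil2 last_append last_tl last_ConsL)
        show "sorted_wrt (<) (ts @ tl ts')"
        proof -
          have "sorted_wrt (<) (tl ts')" using B ts'_eq by (metis sorted_wrt.simps(2))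
          then show ?thesis using A m_le le_m by (auto simp: sorted_wrt_append intro: le_less_trans)
        qed
      next
        fix i assume i: "Suc i < length (ts @ tl ts')"
        let ?zs = "ts @ tl ts'"
        consider "Suc i < length ts" | "length ts \<le> Suc i" by linarith
        then have "\<exists>l j. (l = ts \<or> l = ts') \<and> Suc j < length l \<and> ?zs ! Suc i = l ! Suc j \<and> ?zs ! i
            = l ! j"
        proof cases
          case 1
          then show ?thesis by (intro exI[of _ ts] exI[of _ i]) (auto simp: nth_append)
        next
          case 2
          define j where "j = Suc i - length ts"
          have "?zs ! Suc i = ts' ! Suc j" "Suc j < length ts'"
            using 2 i by (auto simp: nth_append j_def nth_tl)
          moreover have "?zs ! i = ts' ! j"
          proof (cases "j = 0")
            case True
            then have "i = length ts - 1" using 2 by (auto simp: j_def)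
            then show ?thesis
              using A True ts'_eq by (metis append_butlast_last_id butlast_append hd_conv_nth
                  last_conv_nth
                  nth_append diff_less length_greater_0_conv list.sel(1) list.discI zero_less_one)
          next
            case False
            then have "i - length ts = j - 1" "\<not> i < length ts" by (auto simp: j_def)
            then show ?thesis using False calculation by (simp add: nth_append nth_tl)
          qed
          ultimately show ?thesis by blast
        qed
        then show "?zs ! Suc i - ?zs ! i < e" "\<exists>U\<in>\<U>. p ` {?zs ! i..?zs ! Suc i} \<subseteq> U"
          using sm sm' by metis+
      qed
      then show "\<exists>ts. ?S u v ts" by blast
    qed
  next
    fix x :: real assume x: "0 \<le> x" "x \<le> 1"
    obtain d U where d: "d > 0" "U \<in> \<U>"
      "\<forall>u v. u \<le> x \<and> x \<le> v \<and> v - u < d \<and> 0 \<le> u \<and> v \<le> 1 \<longrightarrow> p ` {u..v} \<subseteq> U"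
      using path_interval_nbhd[OF p, of x] x by auto
    have "\<exists>ts. ?S u v ts" if "u \<le> x" "x \<le> v" "v - u < min d e" "0 \<le> u" "v \<le> 1" for u v
    \<comment> \<open>A degenerate interval is subdivided by one point only, since the list has to
      be strictly increasing.\<close>
    proof (cases "u = v")
      case True
      then show ?thesis by (intro exI[of _ "[u]"]) auto
    next
      case False
      have "p ` {u..v} \<subseteq> U" using d(3)[rule_format, of u v] that by simp
      then show ?thesis
        using False that d(2) by (intro exI[of _ "[u, v]"]) auto
    qed
    then show "\<exists>d>0. \<forall>a b. a \<le> x \<and> x \<le> b \<and> b - a < d \<longrightarrow> 0 \<le> a \<and> b \<le> 1 \<longrightarrow> (\<exists>ts. ?S a b ts)"
      using d(1) e by (intro exI[of _ "min d e"]) auto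
  qed auto
  then obtain ts where ts: "?S 0 1 ts" by auto
  have "set ts \<subseteq> {0..1}"
  proof
    fix t assume "t \<in> set ts"
    then obtain i where i: "i < length ts" "t = ts ! i" by (auto simp: in_set_conv_nth)
    have "sorted ts" using ts strict_sorted_imp_sorted by blast
    then show "t \<in> {0..1}"
      using ts i sorted_nth_mono[of ts 0 i] sorted_nth_mono[of ts i "length ts - 1"]
      by (auto simp: hd_conv_nth last_conv_nth)
  qed
  then show thesis using that[of ts] ts by blast
qed

end

lemma cocycle_prod_closed:
  assumes "group G" and "\<And>i. Suc i < length xs \<Longrightarrow> c (xs ! i) (xs ! Suc i) \<in> carrier G"
  shows "cocycle_prod G c xs \<in> carrier G"
proof -
  interpret group G by fact
  show ?thesis
    using assms(2)
  proof (induction xs)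
    case (Cons x xs)
    show ?case
    proof (cases xs)
      case (Cons y ys)
      have "cocycle_prod G c xs \<in> carrier G"
        using Cons.IH Cons.prems[of "Suc i" for i] by simp
      then show ?thesis using Cons.prems[of 0] Cons by simp
    qed simp
  qed simp
qed

lemma cocycle_prod_append:
  assumes "group G" and "xs \<noteq> []" "ys \<noteq> []" "last xs = hd ys"
    and "\<And>i. Suc i < length xs \<Longrightarrow> c (xs ! i) (xs ! Suc i) \<in> carrier G"
    and "\<And>i. Suc i < length ys \<Longrightarrow> c (ys ! i) (ys ! Suc i) \<in> carrier G"
  shows "cocycle_prod G c (xs @ tl ys) = cocycle_prod G c xs \<otimes>\<^bsub>G\<^esub> cocycle_prod G c ys"
proof -
  interpret group G by fact
  have ys: "cocycle_prod G c ys \<in> carrier G"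
    using assms(6) by (rule cocycle_prod_closed[OF \<open>group G\<close>])
  show ?thesis
    using assms(2,4,5)
  proof (induction xs)
    case (Cons x xs)
    show ?case
    proof (cases xs)
      case Nil
      then have "x # tl ys = ys" using Cons.prems assms(3) by (cases ys) auto
      then show ?thesis using ys Nil by simp
    next
      case (Cons y zs)
      have "cocycle_prod G c (xs @ tl ys) = cocycle_prod G c xs \<otimes>\<^bsub>G\<^esub> cocycle_prod G c ys"
        using Cons.IH Cons.prems(2) Cons.prems(3)[of "Suc i" for i] Cons by simp
      moreover have "cocycle_prod G c xs \<in> carrier G"
        using Cons.prems(3)[of "Suc i" for i] by (intro cocycle_prod_closed[OF \<open>group G\<close>]) auto
      ultimately show ?thesis using Cons.prems(3)[of 0] Cons ys by (simp add: m_assoc)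
    qed
  qed simp
qed

section \<open>Simplicial complexes and their edge paths\<close>

text \<open>The two ways round the boundary are images under \<open>h\<close> of paths
  \<open>a\<close> and \<open>a'\<close> from corner \<open>(0, 0)\<close> to corner
  \<open>(1, 1)\<close>. As the square is convex, straight lines join \<open>a\<close> to
  \<open>a'\<close> with fixed ends.\<close>

lemma (in based_space) pclass_square:
  fixes h :: "real \<times> real \<Rightarrow> 'b"
  assumes h: "continuous_map (top_of_set ({0..1} \<times> {0..1})) T h"
  shows "pclass (\<lambda>x. h (x, 0)) \<otimes>\<^bsub>fundamental_group T b\<^esub> pclass (\<lambda>x. h (1, x)) =
    pclass (\<lambda>x. h (0, x)) \<otimes>\<^bsub>fundamental_group T b\<^esub> pclass (\<lambda>x. h (x, 1))"
proof -
  have p: "pathin T (\<lambda>x. h (x, s))" "pathin T (\<lambda>x. h (s, x))" if "s \<in> {0..1}" for s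
    unfolding pathin_def
    by (rule continuous_map_top_of_set_compose[OF h]; use that in \<open>auto intro!: continuous_intros\<close>)+
  define a where "a = (\<lambda>t::real. (min 1 (2 * t), max 0 (2 * t - 1)))"
  define a' where "a' = (\<lambda>t::real. (max 0 (2 * t - 1), min 1 (2 * t)))"
  define k where "k = (\<lambda>z::real\<times>real. (1 - fst z) *\<^sub>R a (snd z) + fst z *\<^sub>R a' (snd z))"
  have ka: "a t \<in> {0..1} \<times> {0..1}" "a' t \<in> {0..1} \<times> {0..1}" if "t \<in> {0..1}" for t
    using that by (auto simp: a_def a'_def)
  have k: "k ` ({0..1} \<times> {0..1}) \<subseteq> {0..1} \<times> {0..1}"
  proof clarify
    fix s t :: real and x y assume st: "s \<in> {0..1}" "t \<in> {0..1}" and xy: "(x, y) = k (s, t)"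
    have "convex ({0..1::real} \<times> {0..1::real})" by (intro convex_Times convex_real_interval)
    then have "k (s, t) \<in> {0..1} \<times> {0..1}"
      unfolding k_def using ka[OF st(2)] st(1) by (intro convexD) auto
    then show "x \<in> {0..1} \<and> y \<in> {0..1}" using xy by auto
  qed
  have "continuous_on ({0..1} \<times> {0..1}) k"
    unfolding k_def a_def a'_def by (intro continuous_intros)
  from continuous_map_top_of_set_compose[OF h this k]
  have hk: "continuous_map (top_of_set ({0..1} \<times> {0..1})) T (\<lambda>z. h (k z))" .
  have ja: "joinin (\<lambda>x. h (x, 0)) (\<lambda>x. h (1, x)) t = h (a t)" for t
    by (cases "2 * t \<le> 1") (auto simp: joinin_def a_def)
  have ja': "joinin (\<lambda>x. h (0, x)) (\<lambda>x. h (x, 1)) t = h (a' t)" for t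
    by (cases "2 * t \<le> 1") (auto simp: joinin_def a'_def)
  have ends: "a 0 = (0, 0)" "a' 0 = (0, 0)" "a 1 = (1, 1)" "a' 1 = (1, 1)"
    by (auto simp: a_def a'_def)
  have "homotopic_pathsin T (joinin (\<lambda>x. h (x, 0)) (\<lambda>x. h (1, x))) (joinin (\<lambda>x. h (0, x)) (\<lambda>x. h
      (x, 1)))"
    by (rule homotopic_pathsinI[OF hk]; simp add: ja ja' ends k_def)
  then have "pclass (joinin (\<lambda>x. h (x, 0)) (\<lambda>x. h (1, x))) = pclass (joinin (\<lambda>x. h (0, x)) (\<lambda>x. h
      (x, 1)))"
    by (rule pclass_homotopic)
  then show ?thesis using p by (simp add: pclass_join)
qed

definition support :: "('a \<Rightarrow> real) \<Rightarrow> 'a set" where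
  "support f = {v. f v \<noteq> 0}"

definition linear_path :: "('a \<Rightarrow> real) \<Rightarrow> ('a \<Rightarrow> real) \<Rightarrow> real \<Rightarrow> 'a \<Rightarrow> real" where
  "linear_path f g = (\<lambda>t u. (1 - t) * f u + t * g u)"

lemma linear_path_ends [simp]: "linear_path f g 0 = f" "linear_path f g 1 = g"
  by (auto simp: linear_path_def)

lemma reversein_linear_path: "reversein (linear_path f g) = linear_path g f"
  by (simp add: linear_path_def reversein_def add.commute)

lemma linear_path_refl [simp]: "linear_path f f = (\<lambda>_. f)"
  by (auto simp: linear_path_def algebra_simps)

lemma linear_path_simplex:
  assumes "f \<in> realised_simplex \<sigma>" "g \<in> realised_simplex \<sigma>" "t \<in> {0..1}"
  shows "linear_path f g t \<in> realised_simplex \<sigma>"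
  using assms
  by (auto simp: linear_path_def realised_simplex_def sum.distrib simp flip: sum_distrib_left)

lemma continuous_on_linear_path: "continuous_on S (linear_path f g)"
  unfolding linear_path_def by (intro continuous_on_coordinatewise_then_product continuous_intros)

lemma vertex_apply: "vertex v u = (if u = v then 1 else 0)"
  by (auto simp: vertex_def indicator_def)

lemma vertex_simplex: "finite \<sigma> \<Longrightarrow> v \<in> \<sigma> \<Longrightarrow> vertex v \<in> realised_simplex \<sigma>"
  by (auto simp: realised_simplex_def vertex_apply)

lemma closed_realised_simplex:
  fixes \<sigma> :: "'a set"
  shows "closed (realised_simplex \<sigma>)"
proof -
  have 1: "continuous_on UNIV (\<lambda>f::'a \<Rightarrow> real. f v)" for v
    by (rule continuous_on_product_coordinates)
  have "continuous_on UNIV (\<lambda>f::'a \<Rightarrow> real. sum f \<sigma>)"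
    by (intro continuous_on_sum 1)
  then show ?thesis
    unfolding realised_simplex_def
    by (intro closed_Collect_conj closed_Collect_all closed_Collect_imp closed_Collect_le
        closed_Collect_eq
        continuous_on_const 1) auto
qed

lemma edge_path_Cons2: "edge_path (v # w # vs) = joinin (linear_path (vertex v) (vertex w))
    (edge_path (w # vs))"
  by (simp add: joinpaths_eq_joinin linear_path_def)

lemma edge_path_ends:
  assumes "vs \<noteq> []"
  shows "edge_path vs 0 = vertex (hd vs)" "edge_path vs 1 = vertex (last vs)"
proof -
  have "edge_path vs 0 = vertex (hd vs) \<and> edge_path vs 1 = vertex (last vs)"
    using assms
  proof (induction vs rule: edge_path.induct)
    case (3 v w vs)
    then show ?case unfolding edge_path_Cons2 by simp
  qed auto
  then show "edge_path vs 0 = vertex (hd vs)" "edge_path vs 1 = vertex (last vs)" by auto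
qed

text \<open>A single vertex is a chain, and repetitions are allowed because \<open>{v, v}\<close> is
  the simplex \<open>{v}\<close>; hence a sample may visit the same point at successive
  parameters.\<close>

definition chain :: "'a set set \<Rightarrow> 'a list \<Rightarrow> bool" where
  "chain K vs \<longleftrightarrow> vs \<noteq> [] \<and> (\<forall>v\<in>set vs. {v} \<in> K) \<and>
     (\<forall>i. Suc i < length vs \<longrightarrow> {vs ! i, vs ! Suc i} \<in> K)"

lemma chain_Cons2: "chain K (v # w # vs) \<longleftrightarrow> {v} \<in> K \<and> {v, w} \<in> K \<and> chain K (w # vs)"
  by (auto simp: chain_def All_less_Suc2)

lemma chain_append:
  assumes "chain K xs" "chain K ys" "last xs = hd ys"
  shows "chain K (xs @ tl ys)"
  using assms
proof (induction xs rule: edge_path.induct)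
  case (2 v)
  then show ?case by (cases ys) (auto simp: chain_def)
next
  case (3 v w vs)
  then show ?case by (simp add: chain_Cons2)
qed (simp add: chain_def)

section \<open>Continuity and compactness in the weak topology\<close>

locale simplicial_complex =
  fixes K :: "'a set set"
  assumes finite_simplex: "\<sigma> \<in> K \<Longrightarrow> finite \<sigma>" and nonempty_simplex: "\<sigma> \<in> K \<Longrightarrow> \<sigma> \<noteq> {}"
    and face: "\<sigma> \<in> K \<Longrightarrow> \<tau> \<subseteq> \<sigma> \<Longrightarrow> \<tau> \<noteq> {} \<Longrightarrow> \<tau> \<in> K"
begin

abbreviation "\<R> \<equiv> realisation K"

definition star :: "'a \<Rightarrow> ('a \<Rightarrow> real) set" where
  "star v = {f \<in> topspace \<R>. f v > 0}"

lemma support_simplex: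
  assumes f: "f \<in> realised_simplex \<sigma>" and \<sigma>: "\<sigma> \<in> K"
  shows "support f \<subseteq> \<sigma>" "support f \<in> K" "f \<in> realised_simplex (support f)"
proof -
  show sub: "support f \<subseteq> \<sigma>" using f by (auto simp: support_def realised_simplex_def)
  have "sum f (support f) = sum f \<sigma>"
    using finite_simplex[OF \<sigma>] sub by (intro sum.mono_neutral_left) (auto simp: support_def)
  then have 1: "sum f (support f) = 1" using f by (simp add: realised_simplex_def)
  then have "support f \<noteq> {}" by auto
  then show "support f \<in> K" using face[OF \<sigma> sub] by blast
  show "f \<in> realised_simplex (support f)"
    using f 1 by (auto simp: realised_simplex_def support_def)
qed

lemma topspace_support:
  assumes "f \<in> topspace \<R>"
  shows "support f \<in> K" "f \<in> realised_simplex (support f)"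
  using assms support_simplex unfolding topspace_realisation by blast+

lemma nonneg: "f \<in> topspace \<R> \<Longrightarrow> 0 \<le> f v"
  by (auto simp: topspace_realisation realised_simplex_def)

lemma support_pos: "f \<in> topspace \<R> \<Longrightarrow> v \<in> support f \<longleftrightarrow> f v > 0"
  using nonneg[of f v] by (auto simp: support_def)

lemma ex_pos:
  assumes "f \<in> topspace \<R>"
  obtains v where "f v > 0"
  using topspace_support(1)[OF assms, THEN nonempty_simplex] support_pos[OF assms] by auto

lemma simplex_subset_topspace: "\<sigma> \<in> K \<Longrightarrow> realised_simplex \<sigma> \<subseteq> topspace \<R>"
  by (auto simp: topspace_realisation)

lemma vertex_topspace: "{v} \<in> K \<Longrightarrow> vertex v \<in> topspace \<R>"
  using vertex_simplex[of "{v}" v] simplex_subset_topspace[of "{v}"] by auto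

text \<open>The weak topology is finer than the product topology. This makes coordinates continuous,
  so that open stars are open and paths in the realisation are continuous in each
  coordinate.\<close>

lemma continuous_map_id_euclidean: "continuous_map \<R> euclidean (\<lambda>f. f)"
  unfolding continuous_map_def
proof (intro conjI allI impI)
  fix U :: "('a \<Rightarrow> real) set" assume "openin euclidean U"
  then have U: "open U" by simp
  show "openin \<R> {f \<in> topspace \<R>. f \<in> U}"
    unfolding openin_realisation
  proof (intro conjI ballI)
    fix \<sigma> assume "\<sigma> \<in> K"
    then have "{f \<in> topspace \<R>. f \<in> U} \<inter> realised_simplex \<sigma> = realised_simplex \<sigma> \<inter> U"
      using simplex_subset_topspace by auto
    then show "openin (top_of_set (realised_simplex \<sigma>)) ({f \<in> topspace \<R>. f \<in> U} \<inter>
        realised_simplex \<sigma>)"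
      using U by auto
  qed (auto simp: topspace_realisation)
qed simp

lemma openin_star: "openin \<R> (star v)"
proof -
  have "open {f::'a \<Rightarrow> real. 0 < f v}"
    by (intro open_Collect_less continuous_on_const continuous_on_product_coordinates)
  then have "openin euclidean {f::'a \<Rightarrow> real. 0 < f v}" by simp
  from openin_continuous_map_preimage[OF continuous_map_id_euclidean this]
  show ?thesis by (simp add: star_def)
qed

text \<open>The converse passage, from the product topology to the finer weak one, is secured by
  confinement to finitely many simplices: the preimage of the complement of an open set is then a
  finite union of closed sets.\<close>

lemma continuous_map_finite_union:
  fixes f :: "'z::topological_space \<Rightarrow> 'a \<Rightarrow> real"
  assumes F: "finite F" "F \<subseteq> K" and f: "continuous_on S f" "f ` S \<subseteq> \<Union> (realised_simplex ` F)"
  shows "continuous_map (top_of_set S) \<R> f"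
  unfolding continuous_map_def
proof (intro conjI allI impI)
  show "f \<in> topspace (top_of_set S) \<rightarrow> topspace \<R>"
    using f(2) F(2) by (auto simp: topspace_realisation image_subset_iff)
  fix U assume U: "openin \<R> U"
  have "closedin (top_of_set S) {x \<in> S. f x \<in> realised_simplex \<sigma> - U}" if "\<sigma> \<in> F" for \<sigma>
  proof -
    have "openin (top_of_set (realised_simplex \<sigma>)) (U \<inter> realised_simplex \<sigma>)"
      using U that F(2) by (auto simp: openin_realisation)
    then have "closedin (top_of_set (realised_simplex \<sigma>)) (realised_simplex \<sigma> - U \<inter>
        realised_simplex \<sigma>)"
      by (auto simp: closedin_def Diff_Diff_Int intro: back_subst[of "openin _"])
    then have "closed (realised_simplex \<sigma> - U \<inter> realised_simplex \<sigma>)"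
      using closed_realised_simplex closedin_closed_trans by blast
    moreover have "realised_simplex \<sigma> - U \<inter> realised_simplex \<sigma> = realised_simplex \<sigma> - U" by auto
    ultimately have "closed (realised_simplex \<sigma> - U)" by simp
    from continuous_closedin_preimage[OF f(1) this] show ?thesis
      by (simp add: vimage_def Int_def)
  qed
  then have "closedin (top_of_set S) (\<Union>\<sigma>\<in>F. {x \<in> S. f x \<in> realised_simplex \<sigma> - U})"
    using F(1) by (intro closedin_Union) auto
  moreover have "(\<Union>\<sigma>\<in>F. {x \<in> S. f x \<in> realised_simplex \<sigma> - U}) = S - {x \<in> S. f x \<in> U}"
    using f(2) by auto
  ultimately have "closedin (top_of_set S) (S - {x \<in> S. f x \<in> U})" by simp
  then show "openin (top_of_set S) {x \<in> topspace (top_of_set S). f x \<in> U}"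
    by (simp add: openin_closedin_eq)
qed

lemma continuous_map_simplex:
  fixes f :: "'z::topological_space \<Rightarrow> 'a \<Rightarrow> real"
  assumes "\<sigma> \<in> K" "continuous_on S f" "f ` S \<subseteq> realised_simplex \<sigma>"
  shows "continuous_map (top_of_set S) \<R> f"
  using continuous_map_finite_union[of "{\<sigma>}" S f] assms by auto

text \<open>A compact set meets only finitely many open simplices. Pick one point for each support
  that occurs; every subset of the selection \<open>D\<close> meets a simplex in finitely many
  points and is therefore closed. So \<open>D\<close> is closed and discrete in a compact set, hence
  finite.\<close>

lemma compactin_finite_supports:
  assumes C: "compactin \<R> C"
  shows "finite (support ` C)"
proof -
  define D where "D = inv_into C support ` (support ` C)"
  have CT: "C \<subseteq> topspace \<R>" using C by (simp add: compactin_def)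
  have DC: "D \<subseteq> C" unfolding D_def using inv_into_into[of _ support C] by blast
  have supD: "support ` D = support ` C"
    unfolding D_def by (auto simp: image_image f_inv_into_f)
  have injD: "inj_on support D"
    unfolding D_def by (rule inj_onI) (auto simp: f_inv_into_f)
  have op: "openin \<R> (topspace \<R> - A)" if "A \<subseteq> D" for A
    unfolding openin_realisation
  proof (intro conjI ballI)
    fix \<sigma> assume \<sigma>: "\<sigma> \<in> K"
    have "support ` (A \<inter> realised_simplex \<sigma>) \<subseteq> Pow \<sigma>"
      using support_simplex(1)[OF _ \<sigma>] by auto
    then have "finite (support ` (A \<inter> realised_simplex \<sigma>))"
      using finite_simplex[OF \<sigma>] finite_subset by blast
    moreover have "inj_on support (A \<inter> realised_simplex \<sigma>)"
      using injD by (rule inj_on_subset) (use that in auto)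
    ultimately have fin: "finite (A \<inter> realised_simplex \<sigma>)" by (rule finite_imageD)
    have "closed {x}" for x :: "'a \<Rightarrow> real"
    proof -
      have "closed {f. \<forall>v. f v = x v}"
        by (intro closed_Collect_all closed_Collect_eq continuous_on_const
            continuous_on_product_coordinates)
      also have "{f. \<forall>v. f v = x v} = {x}" by auto
      finally show ?thesis .
    qed
    then have "closed (\<Union>x\<in>A \<inter> realised_simplex \<sigma>. {x})"
      using fin by (intro closed_UN) auto
    then have "open (- (A \<inter> realised_simplex \<sigma>))" by (simp add: closed_def)
    moreover have "(topspace \<R> - A) \<inter> realised_simplex \<sigma> = realised_simplex \<sigma> \<inter> - (A \<inter>
        realised_simplex \<sigma>)"
      using simplex_subset_topspace[OF \<sigma>] by auto
    ultimately show "openin (top_of_set (realised_simplex \<sigma>)) ((topspace \<R> - A) \<inter> realised_simplex \<sigma>)"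
      by auto
  qed (auto simp: topspace_realisation)
  let ?\<C> = "(\<lambda>d. topspace \<R> - (D - {d})) ` D \<union> {topspace \<R> - D}"
  have "\<forall>U\<in>?\<C>. openin \<R> U" using op[OF Diff_subset] op[OF subset_refl] by blast
  moreover have "C \<subseteq> \<Union> ?\<C>" using CT by auto
  ultimately obtain \<F> where \<F>: "finite \<F>" "\<F> \<subseteq> ?\<C>" "C \<subseteq> \<Union> \<F>"
    using C[unfolded compactin_def] by meson
  have "finite (U \<inter> D)" if "U \<in> \<F>" for U
  proof -
    have "U \<in> ?\<C>" using that \<F>(2) by blast
    then obtain d where "U \<inter> D \<subseteq> {d}" by blast
    then show ?thesis using finite_subset by blast
  qed
  then have "finite (\<Union>U\<in>\<F>. U \<inter> D)" using \<F>(1) by blast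
  moreover have "D \<subseteq> (\<Union>U\<in>\<F>. U \<inter> D)" using \<F>(3) DC by blast
  ultimately have "finite D" by (rule rev_finite_subset)
  then show ?thesis using supD by (metis finite_imageI)
qed

lemma pathin_finite_supports: "pathin \<R> p \<Longrightarrow> finite (support ` p ` {0..1})"
  unfolding pathin_def
  by (intro compactin_finite_supports image_compactin) (auto simp: compactin_subtopology)

lemma pathin_continuous_on:
  assumes "pathin \<R> p"
  shows "continuous_on {0..1} p"
  using continuous_map_compose[OF assms[unfolded pathin_def] continuous_map_id_euclidean]
  by (simp add: comp_def)

lemma homotopic_in_simplex:
  assumes \<sigma>: "\<sigma> \<in> K" and p: "pathin \<R> p" "p ` {0..1} \<subseteq> realised_simplex \<sigma>"
    and q: "pathin \<R> q" "q ` {0..1} \<subseteq> realised_simplex \<sigma>" and ends: "p 0 = q 0" "p 1 = q 1"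
  shows "homotopic_pathsin \<R> p q"
proof (rule homotopic_pathsinI)
  let ?h = "\<lambda>z. linear_path (p (snd z)) (q (snd z)) (fst z)"
  have *: "continuous_on ({0..1} \<times> {0..1::real}) (\<lambda>z. f (snd z) u)" if "pathin \<R> f" for f u
    using continuous_on_product_then_coordinatewise[OF pathin_continuous_on[OF that]]
    by (rule continuous_on_compose2) (auto intro!: continuous_intros)
  have "continuous_on ({0..1} \<times> {0..1}) ?h"
    unfolding linear_path_def
    by (intro continuous_on_coordinatewise_then_product continuous_intros * p q)
  moreover have "?h ` ({0..1} \<times> {0..1}) \<subseteq> realised_simplex \<sigma>"
    using p(2) q(2) by (auto intro!: linear_path_simplex)
  ultimately show "continuous_map (top_of_set ({0..1} \<times> {0..1})) \<R> ?h"
    by (rule continuous_map_simplex[OF \<sigma>])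
qed (use ends in auto)

lemma pathin_linear_path:
  assumes "\<sigma> \<in> K" "f \<in> realised_simplex \<sigma>" "g \<in> realised_simplex \<sigma>"
  shows "pathin \<R> (linear_path f g)"
  unfolding pathin_def using assms
  by (intro continuous_map_simplex[OF assms(1)] continuous_on_linear_path) (auto intro!:
      linear_path_simplex)

lemma pathin_edge: "{u, v} \<in> K \<Longrightarrow> pathin \<R> (linear_path (vertex u) (vertex v))"
  by (rule pathin_linear_path[of "{u, v}"]) (auto intro!: vertex_simplex)

lemma pathin_edge_path:
  assumes "chain K vs"
  shows "pathin \<R> (edge_path vs)"
  using assms
proof (induction vs rule: edge_path.induct)
  case (2 v)
  then show ?case by (simp add: chain_def vertex_topspace)
next
  case (3 v w vs)
  then show ?case
    unfolding edge_path_Cons2 chain_Cons2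
    by (intro pathin_joinin) (auto simp: edge_path_ends pathin_edge)
qed (simp add: chain_def)

end

section \<open>Edge classes and the reduction of paths to edge paths\<close>

locale based_complex = simplicial_complex K + based_space "realisation K" "vertex b" \<tau>
  for K :: "'a set set" and b :: 'a and \<tau>
begin

abbreviation "\<Gamma> \<equiv> fundamental_group \<R> (vertex b)"

definition edge_class :: "'a \<Rightarrow> 'a \<Rightarrow> (real \<Rightarrow> 'a \<Rightarrow> real) set" where
  "edge_class u v = pclass (linear_path (vertex u) (vertex v))"

lemma edge_class_closed: "{u, v} \<in> K \<Longrightarrow> edge_class u v \<in> carrier \<Gamma>"
  by (simp add: edge_class_def pathin_edge)

lemma pclass_linear_path_mult:
  assumes \<sigma>: "\<sigma> \<in> K" "f \<in> realised_simplex \<sigma>" "g \<in> realised_simplex \<sigma>" "h \<in> realised_simplex \<sigma>"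
  shows "pclass (linear_path f g) \<otimes>\<^bsub>\<Gamma>\<^esub> pclass (linear_path g h) = pclass (linear_path f h)"
proof -
  note p = pathin_linear_path[OF \<sigma>(1)]
  have "homotopic_pathsin \<R> (joinin (linear_path f g) (linear_path g h)) (linear_path f h)"
    using \<sigma> by (intro homotopic_in_simplex[OF \<sigma>(1)] pathin_joinin p)
      (auto simp: joinin_def intro!: linear_path_simplex)
  then show ?thesis using \<sigma> p pclass_homotopic pclass_join by (metis linear_path_ends)
qed

lemma edge_class_mult: "{u, v, w} \<in> K \<Longrightarrow> edge_class u v \<otimes>\<^bsub>\<Gamma>\<^esub> edge_class v w = edge_class u w"
  unfolding edge_class_def by (rule pclass_linear_path_mult[of "{u, v, w}"]) (auto intro!:
      vertex_simplex)

lemma pclass_edge_path: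
  assumes "chain K vs"
  shows "pclass (edge_path vs) = cocycle_prod \<Gamma> edge_class vs"
  using assms
proof (induction vs rule: edge_path.induct)
  case (2 v)
  then show ?case by (simp add: chain_def vertex_topspace)
next
  case (3 v w vs)
  then have "pclass (edge_path (v # w # vs)) = edge_class v w \<otimes>\<^bsub>\<Gamma>\<^esub> pclass (edge_path (w # vs))"
    unfolding edge_path_Cons2 chain_Cons2 edge_class_def
    by (intro pclass_join) (auto simp: edge_path_ends pathin_edge pathin_edge_path)
  then show ?case using 3 by (simp add: chain_Cons2)
qed (simp add: chain_def)

text \<open>Inside an open star every path can be coned off to the centre.\<close>

lemma pclass_in_star:
  assumes p: "pathin \<R> p" and star: "p ` {0..1} \<subseteq> star w"
  shows "pclass p = pclass (linear_path (p 0) (vertex w)) \<otimes>\<^bsub>\<Gamma>\<^esub> pclass (linear_path (vertex w) (p 1))"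
proof -
  define h where "h = (\<lambda>z. linear_path (p (fst z)) (vertex w) (snd z))"
  have w: "w \<in> support (p x)" "support (p x) \<in> K" "p x \<in> realised_simplex (support (p x))"
    "vertex w \<in> realised_simplex (support (p x))" if "x \<in> {0..1}" for x
  proof -
    have "p x \<in> star w" using star that by blast
    then have x: "p x \<in> topspace \<R>" "p x w > 0" by (auto simp: star_def)
    then show 1: "w \<in> support (p x)" by (simp add: support_pos)
    show 2: "support (p x) \<in> K" "p x \<in> realised_simplex (support (p x))"
      using topspace_support[OF x(1)] by auto
    show "vertex w \<in> realised_simplex (support (p x))"
      using 1 2 finite_simplex by (intro vertex_simplex) auto
  qed
  have *: "continuous_on ({0..1} \<times> {0..1::real}) (\<lambda>z. p (fst z) u)" for u
    using continuous_on_product_then_coordinatewise[OF pathin_continuous_on[OF p]]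
    by (rule continuous_on_compose2) (auto intro!: continuous_intros)
  have "continuous_on ({0..1} \<times> {0..1}) h"
    unfolding linear_path_def h_def
    by (intro continuous_on_coordinatewise_then_product continuous_intros *)
  \<comment> \<open>The cone over a point of the path stays in the simplex carrying that point.
    Compactness leaves finitely many such simplices, which gives continuity of \<open>h\<close> for
    the weak topology.\<close>
  moreover have "h ` ({0..1} \<times> {0..1}) \<subseteq> \<Union> (realised_simplex ` (support ` p ` {0..1}))"
  proof clarify
    fix x s :: real assume xs: "x \<in> {0..1}" "s \<in> {0..1}"
    have "h (x, s) \<in> realised_simplex (support (p x))"
      unfolding h_def using w[OF xs(1)] xs(2) by (auto intro!: linear_path_simplex)
    then show "h (x, s) \<in> \<Union> (realised_simplex ` (support ` p ` {0..1}))" using xs by blast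
  qed
  moreover have "support ` p ` {0..1} \<subseteq> K" using w(2) by blast
  ultimately have "continuous_map (top_of_set ({0..1} \<times> {0..1})) \<R> h"
    by (intro continuous_map_finite_union[OF pathin_finite_supports[OF p]])
  from pclass_square[OF this]
  have "pclass p \<otimes>\<^bsub>\<Gamma>\<^esub> pclass (linear_path (p 1) (vertex w)) =
      pclass (linear_path (p 0) (vertex w)) \<otimes>\<^bsub>\<Gamma>\<^esub> pclass (\<lambda>_. vertex w)"
    by (simp add: h_def cong: if_cong)
  moreover have "vertex w \<in> topspace \<R>" using w[of 0] simplex_subset_topspace by auto
  moreover have c: "pathin \<R> (linear_path (p x) (vertex w))" if "x \<in> {0..1}" for x
    using pathin_linear_path w[OF that] by blast
  moreover have "pclass (linear_path (vertex w) (p 1)) = inv\<^bsub>\<Gamma>\<^esub> pclass (linear_path (p 1) (vertex w))"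
    using pclass_reverse[OF c[of 1]] by (simp add: reversein_linear_path)
  ultimately show ?thesis
    using p c[of 0] c[of 1] by (simp flip: inv_solve_right)
qed

lemma pclass_in_star_subpath:
  assumes p: "pathin \<R> p" and uv: "0 \<le> u" "u \<le> v" "v \<le> 1" and star: "p ` {u..v} \<subseteq> star w"
  shows "pclass (subpathin u v p) = pclass (linear_path (p u) (vertex w)) \<otimes>\<^bsub>\<Gamma>\<^esub> pclass (linear_path
      (vertex w) (p v))"
proof -
  have "subpathin u v p ` {0..1} \<subseteq> p ` {u..v}"
  proof (rule image_subsetI)
    fix x :: real assume "x \<in> {0..1}"
    then have "x * (v - u) \<le> v - u" "0 \<le> x * (v - u)" using uv by (auto intro!: mult_left_le_one_le)
    then show "subpathin u v p x \<in> p ` {u..v}" by (auto simp: subpathin_def)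
  qed
  then show ?thesis using pclass_in_star[OF pathin_subpathin[OF p, of u v]] star uv by auto
qed

text \<open>Simplicial approximation in dimension one, on the level of classes: a short piece of the
  path lies in one open star and is equivalent to going through its centre.\<close>

theorem path_class_edge_path:
  assumes p: "pathin \<R> p" and ends: "p 0 = vertex x" "p 1 = vertex y"
  obtains vs where "chain K vs" "hd vs = x" "last vs = y" "pclass p = cocycle_prod \<Gamma> edge_class vs"
proof -
  \<comment> \<open>The intermediate points \<open>p u\<close>, \<open>p v\<close> are not vertices,
    so straight segments to vertices are attached. Allowing every vertex with positive coordinate
    lets two adjacent pieces be glued at a common vertex of the simplex carrying
    \<open>p m\<close>.\<close>
  define P where "P u v \<longleftrightarrow> (\<forall>x y. p u x > 0 \<and> p v y > 0 \<longrightarrow> (\<exists>vs. chain K vs \<and> hd vs = x \<and> last vs = y \<and>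
    pclass (linear_path (vertex x) (p u)) \<otimes>\<^bsub>\<Gamma>\<^esub> pclass (subpathin u v p) \<otimes>\<^bsub>\<Gamma>\<^esub> pclass (linear_path (p v)
        (vertex y)) =
    cocycle_prod \<Gamma> edge_class vs))" for u v
  have top: "p t \<in> topspace \<R>" if "0 \<le> t" "t \<le> 1" for t
    using pathin_topspace[OF p] that by auto
  have supp: "support (p t) \<in> K" "p t \<in> realised_simplex (support (p t))"
    "w \<in> support (p t)" "vertex w \<in> realised_simplex (support (p t))"
    if "0 \<le> t" "t \<le> 1" "p t w > 0" for t w
  proof -
    show 1: "support (p t) \<in> K" "p t \<in> realised_simplex (support (p t))"
      using topspace_support[OF top] that by auto
    show "w \<in> support (p t)" using support_pos[OF top] that by auto
    then show "vertex w \<in> realised_simplex (support (p t))"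
      by (rule vertex_simplex[OF finite_simplex[OF 1(1)]])
  qed
  have lin: "pathin \<R> (linear_path (vertex w) (p t))" "pathin \<R> (linear_path (p t) (vertex w))"
    if "0 \<le> t" "t \<le> 1" "p t w > 0" for t w
    using pathin_linear_path supp[OF that] by blast+
  have "0 \<le> (0::real) \<and> (1::real) \<le> 1 \<longrightarrow> P 0 1"
  proof (rule Bolzano[of 0 1 "\<lambda>u v. 0 \<le> u \<and> v \<le> 1 \<longrightarrow> P u v"])
    fix u m v :: real
    assume 1: "0 \<le> u \<and> m \<le> 1 \<longrightarrow> P u m" and 2: "0 \<le> m \<and> v \<le> 1 \<longrightarrow> P m v" and le: "u \<le> m" "m \<le> v"
    show "0 \<le> u \<and> v \<le> 1 \<longrightarrow> P u v"
    proof
      assume uv: "0 \<le> u \<and> v \<le> 1"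
      show "P u v"
        unfolding P_def
      proof (intro allI impI)
        fix x y assume xy: "p u x > 0 \<and> p v y > 0"
        obtain w where w: "p m w > 0" using ex_pos[OF top[of m]] uv le by auto
        obtain vs where vs: "chain K vs" "hd vs = x" "last vs = w"
          "pclass (linear_path (vertex x) (p u)) \<otimes>\<^bsub>\<Gamma>\<^esub> pclass (subpathin u m p) \<otimes>\<^bsub>\<Gamma>\<^esub>
            pclass (linear_path (p m) (vertex w)) = cocycle_prod \<Gamma> edge_class vs"
          using 1[rule_format, unfolded P_def, rule_format, of x w] uv le xy w by auto
        obtain vs' where vs': "chain K vs'" "hd vs' = w" "last vs' = y"
          "pclass (linear_path (vertex w) (p m)) \<otimes>\<^bsub>\<Gamma>\<^esub> pclass (subpathin m v p) \<otimes>\<^bsub>\<Gamma>\<^esub>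
            pclass (linear_path (p v) (vertex y)) = cocycle_prod \<Gamma> edge_class vs'"
          using 2[rule_format, unfolded P_def, rule_format, of w y] uv le xy w by auto
        have ch: "chain K (vs @ tl vs')" using chain_append vs vs' by metis
        have ne: "vs \<noteq> []" "vs' \<noteq> []" using vs vs' by (auto simp: chain_def)
        have "hd (vs @ tl vs') = x" using ne vs by simp
        moreover have "last (vs @ tl vs') = y"
          using ne vs vs' by (cases vs') (auto simp: last_append)
        moreover have "pclass (linear_path (vertex x) (p u)) \<otimes>\<^bsub>\<Gamma>\<^esub> pclass (subpathin u v p) \<otimes>\<^bsub>\<Gamma>\<^esub> pclass
            (linear_path (p v) (vertex y)) =
          cocycle_prod \<Gamma> edge_class (vs @ tl vs')"
        proof -
          have sub: "pathin \<R> (subpathin s t p)" if "0 \<le> s" "s \<le> 1" "0 \<le> t" "t \<le> 1" for s t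
            using that p by (intro pathin_subpathin) auto
          have m: "0 \<le> m" "m \<le> 1" "u \<le> 1" "0 \<le> v" using uv le by auto
          \<comment> \<open>The excursion from \<open>p m\<close> to the vertex \<open>w\<close> and
            back, which arises when the two edge paths are glued, is trivial.\<close>
          have i: "pclass (linear_path (p m) (vertex w)) \<otimes>\<^bsub>\<Gamma>\<^esub> pclass (linear_path (vertex w) (p m))
              = \<one>\<^bsub>\<Gamma>\<^esub>"
            using pclass_linear_path_mult[OF supp(1)[OF m(1,2) w]] supp[OF m(1,2) w] top m by simp
          have "cocycle_prod \<Gamma> edge_class (vs @ tl vs') = cocycle_prod \<Gamma> edge_class vs \<otimes>\<^bsub>\<Gamma>\<^esub>
              cocycle_prod \<Gamma> edge_class vs'"
            using vs vs' ne edge_class_closed unfolding chain_def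
            by (intro cocycle_prod_append is_group) auto
          also have "\<dots> = pclass (linear_path (vertex x) (p u)) \<otimes>\<^bsub>\<Gamma>\<^esub> pclass (subpathin u m p) \<otimes>\<^bsub>\<Gamma>\<^esub>
              (pclass (linear_path (p m) (vertex w)) \<otimes>\<^bsub>\<Gamma>\<^esub> pclass (linear_path (vertex w) (p m))) \<otimes>\<^bsub>\<Gamma>\<^esub>
              pclass (subpathin m v p) \<otimes>\<^bsub>\<Gamma>\<^esub> pclass (linear_path (p v) (vertex y))"
            unfolding vs(4)[symmetric] vs'(4)[symmetric]
            using lin xy w uv m sub by (simp add: m_assoc)
          also have "\<dots> = pclass (linear_path (vertex x) (p u)) \<otimes>\<^bsub>\<Gamma>\<^esub> (pclass (subpathin u m p) \<otimes>\<^bsub>\<Gamma>\<^esub>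
              pclass (subpathin m v p)) \<otimes>\<^bsub>\<Gamma>\<^esub> pclass (linear_path (p v) (vertex y))"
            unfolding i using lin xy w uv m sub by (simp add: m_assoc)
          also have "pclass (subpathin u m p) \<otimes>\<^bsub>\<Gamma>\<^esub> pclass (subpathin m v p) = pclass (subpathin u v p)"
            using pclass_subpath_join[OF p, of u m v] uv m by simp
          finally show ?thesis by simp
        qed
        ultimately show "\<exists>vs. chain K vs \<and> hd vs = x \<and> last vs = y \<and>
          pclass (linear_path (vertex x) (p u)) \<otimes>\<^bsub>\<Gamma>\<^esub> pclass (subpathin u v p) \<otimes>\<^bsub>\<Gamma>\<^esub> pclass (linear_path
              (p v) (vertex y)) =
          cocycle_prod \<Gamma> edge_class vs" using ch by blast
      qed
    qed
  next
    fix t :: real assume t: "0 \<le> t" "t \<le> 1"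
    obtain w where w: "p t w > 0" using ex_pos[OF top[OF t]] by blast
    have "openin (top_of_set {0..1}) {s \<in> {0..1}. p s \<in> star w}"
      using openin_continuous_map_preimage[OF p[unfolded pathin_def] openin_star] by simp
    moreover have "t \<in> {s \<in> {0..1}. p s \<in> star w}" using t w top by (simp add: star_def)
    ultimately obtain d where d: "d > 0" "\<And>s. s \<in> {0..1} \<Longrightarrow> dist s t < d \<Longrightarrow> p s \<in> star w"
      unfolding openin_euclidean_subtopology_iff by (metis (no_types, lifting) mem_Collect_eq)
    have "P u v" if uv: "u \<le> t" "t \<le> v" "v - u < d" "0 \<le> u" "v \<le> 1" for u v
      unfolding P_def
    proof (intro allI impI)
      fix x y assume xy: "p u x > 0 \<and> p v y > 0"
      have in_star: "p s \<in> star w" if "s \<in> {u..v}" for s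
        using that uv by (intro d(2)) (auto simp: dist_real_def)
      then have w: "p u w > 0" "p v w > 0" using uv by (auto simp: star_def)
      have b: "0 \<le> u" "u \<le> 1" "0 \<le> v" "v \<le> 1" using uv by auto
      note sx = supp[OF b(1,2) conjunct1[OF xy]] and sy = supp[OF b(3,4) conjunct2[OF xy]]
        and swu = supp[OF b(1,2) w(1)] and swv = supp[OF b(3,4) w(2)]
      \<comment> \<open>\<open>x\<close> and \<open>w\<close> have positive coordinates at
        \<open>p u\<close>, hence span a face of the simplex carrying it; likewise \<open>w\<close>
        and \<open>y\<close> at \<open>p v\<close>.\<close>
      have K: "{x, w} \<in> K" "{w, y} \<in> K" "{x} \<in> K" "{w} \<in> K" "{y} \<in> K"
        using face[OF sx(1)] face[OF sy(1)] sx(3) sy(3) swu(3) swv(3) by auto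
      have "pclass (subpathin u v p) = pclass (linear_path (p u) (vertex w)) \<otimes>\<^bsub>\<Gamma>\<^esub> pclass
          (linear_path (vertex w) (p v))"
        using in_star uv by (intro pclass_in_star_subpath[OF p]) auto
      then have "pclass (linear_path (vertex x) (p u)) \<otimes>\<^bsub>\<Gamma>\<^esub> pclass (subpathin u v p) \<otimes>\<^bsub>\<Gamma>\<^esub> pclass
          (linear_path (p v) (vertex y)) =
        (pclass (linear_path (vertex x) (p u)) \<otimes>\<^bsub>\<Gamma>\<^esub> pclass (linear_path (p u) (vertex w))) \<otimes>\<^bsub>\<Gamma>\<^esub>
        (pclass (linear_path (vertex w) (p v)) \<otimes>\<^bsub>\<Gamma>\<^esub> pclass (linear_path (p v) (vertex y)))"
        using lin b xy w by (simp add: m_assoc)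
      also have "\<dots> = edge_class x w \<otimes>\<^bsub>\<Gamma>\<^esub> edge_class w y"
        unfolding edge_class_def
        using pclass_linear_path_mult[OF sx(1) sx(4) sx(2) swu(4)]
          pclass_linear_path_mult[OF sy(1) swv(4) sy(2) sy(4)] by simp
      also have "\<dots> = cocycle_prod \<Gamma> edge_class [x, w, y]"
        using K edge_class_closed by simp
      finally have "pclass (linear_path (vertex x) (p u)) \<otimes>\<^bsub>\<Gamma>\<^esub> pclass (subpathin u v p) \<otimes>\<^bsub>\<Gamma>\<^esub> pclass
          (linear_path (p v) (vertex y)) = \<dots>" .
      moreover have "chain K [x, w, y]" using K by (simp add: chain_Cons2) (simp add: chain_def)
      ultimately show "\<exists>vs. chain K vs \<and> hd vs = x \<and> last vs = y \<and>
          pclass (linear_path (vertex x) (p u)) \<otimes>\<^bsub>\<Gamma>\<^esub> pclass (subpathin u v p) \<otimes>\<^bsub>\<Gamma>\<^esub> pclass (linear_path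
              (p v) (vertex y)) =
          cocycle_prod \<Gamma> edge_class vs" by (intro exI[of _ "[x, w, y]"]) simp
    qed
    then show "\<exists>d>0. \<forall>u v. u \<le> t \<and> t \<le> v \<and> v - u < d \<longrightarrow> 0 \<le> u \<and> v \<le> 1 \<longrightarrow> P u v"
      using d(1) by (intro exI[of _ d]) blast
  qed auto
  then have "P 0 1" by simp
  moreover have "p 0 x > 0" "p 1 y > 0" using ends by (auto simp: vertex_apply)
  ultimately obtain vs where "chain K vs" "hd vs = x" "last vs = y"
    "pclass (linear_path (vertex x) (p 0)) \<otimes>\<^bsub>\<Gamma>\<^esub> pclass (subpathin 0 1 p) \<otimes>\<^bsub>\<Gamma>\<^esub> pclass (linear_path (p
        1) (vertex y)) =
    cocycle_prod \<Gamma> edge_class vs" unfolding P_def by blast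
  then show thesis using that[of vs] ends p top[of 0] top[of 1] by simp
qed

end

section \<open>Cocycle products and homotopies of edge paths\<close>

context simplicial_complex
begin

text \<open>The homotopy consists of continuous paths, so the cocycle is first extended to all points of the
  realisation by choosing for each of them a vertex with positive coordinate.\<close>

theorem edge_path_homotopic_cocycle_prod:
  fixes G (structure) and c :: "'a \<Rightarrow> 'a \<Rightarrow> 'g"
  assumes G: "group G"
    and c_closed: "\<And>u v. {u, v} \<in> K \<Longrightarrow> c u v \<in> carrier G"
    and c_mult: "\<And>u v w. {u, v, w} \<in> K \<Longrightarrow> c u v \<otimes> c v w = c u w"
    and chains: "chain K vs" "chain K ws" and hom: "homotopic_pathsin \<R> (edge_path vs) (edge_path ws)"
  shows "cocycle_prod G c vs = cocycle_prod G c ws"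
proof -
  interpret group G by fact
  define sv where "sv f = (SOME v. f v > 0)" for f :: "'a \<Rightarrow> real"
  define cv where "cv f h = (let w = SOME w. f w > 0 \<and> h w > 0 in c (sv f) w \<otimes> c w (sv h))" for f
      h :: "'a \<Rightarrow> real"
  have sv: "f (sv f) > 0" if "f \<in> topspace \<R>" for f
    using ex_pos[OF that] someI[of "\<lambda>v. f v > 0"] unfolding sv_def by metis
  have edge: "{u, v, w} \<in> K" if "f \<in> topspace \<R>" "f u > 0" "f v > 0" "f w > 0" for f u v w
    using face[OF topspace_support(1)[OF that(1)], of "{u, v, w}"] support_pos[OF that(1)] that by
        auto
  have edge2: "{u, v} \<in> K" if "f \<in> topspace \<R>" "f u > 0" "f v > 0" for f u v
    using edge[OF that(1,2,3,3)] by simp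
  have c_refl: "c u u = \<one>" if "{u} \<in> K" for u
    using c_mult[of u u u] c_closed[of u u] that by (simp add: l_cancel_one)
  \<comment> \<open>The value does not depend on the common vertex \<open>w\<close>: both candidates
    and \<open>sv f\<close> are vertices of the simplex carrying \<open>f\<close>, both candidates
    and \<open>sv h\<close> of the one carrying \<open>h\<close>, and on each simplex
    \<open>c\<close> is multiplicative.\<close>
  have cv_eq: "cv f h = c (sv f) w \<otimes> c w (sv h)"
    if fh: "f \<in> topspace \<R>" "h \<in> topspace \<R>" and w: "f w > 0" "h w > 0" for f h w
  proof -
    define w' where "w' = (SOME w. f w > 0 \<and> h w > 0)"
    have w': "f w' > 0" "h w' > 0"
      using someI[of "\<lambda>w. f w > 0 \<and> h w > 0" w] w unfolding w'_def by auto
    have cl: "c w' w \<in> carrier G" "c (sv f) w' \<in> carrier G" "c w (sv h) \<in> carrier G"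
      using fh w w' sv by (auto intro!: c_closed intro: edge2)
    have "c (sv f) w = c (sv f) w' \<otimes> c w' w"
      using fh w w' sv[OF fh(1)] by (intro c_mult[symmetric] edge[of f]) auto
    moreover have "c w' w \<otimes> c w (sv h) = c w' (sv h)"
      using fh w w' sv[OF fh(2)] by (intro c_mult edge[of h]) auto
    ultimately have "c (sv f) w \<otimes> c w (sv h) = c (sv f) w' \<otimes> c w' (sv h)"
      using cl by (simp add: m_assoc)
    then show ?thesis by (simp add: cv_def w'_def[symmetric])
  qed
  have cv_closed: "cv f h \<in> carrier G"
    if "f \<in> star w" "h \<in> star w" for f h w
    using that sv[of f] sv[of h] unfolding star_def
    by (subst cv_eq[of f h w]) (auto intro!: c_closed intro: edge2)
  interpret L: local_cocycle G \<R> "range star" cv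
  proof
    fix U x y assume "U \<in> range star" "x \<in> U" "y \<in> U"
    then show "cv x y \<in> carrier G" using cv_closed by blast
  next
    fix U x y z assume "U \<in> range star" "x \<in> U" "y \<in> U" "z \<in> U"
    then obtain w where w: "x w > 0" "y w > 0" "z w > 0" and t: "x \<in> topspace \<R>" "y \<in> topspace \<R>"
        "z \<in> topspace \<R>"
      by (auto simp: star_def)
    have cl: "c w (sv y) \<in> carrier G" "c (sv x) w \<in> carrier G" "c w (sv z) \<in> carrier G" "c (sv y)
        w \<in> carrier G"
      using w t sv by (auto intro!: c_closed intro: edge2)
    have "c w (sv y) \<otimes> c (sv y) w = c w w"
      using w t sv[OF t(2)] by (intro c_mult edge[of y]) auto
    also have "\<dots> = \<one>" using edge[OF t(1) w(1) w(1) w(1)] by (intro c_refl) simp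
    finally have 1: "c w (sv y) \<otimes> (c (sv y) w \<otimes> c w (sv z)) = c w (sv z)"
      using cl by (simp flip: m_assoc)
    show "cv x y \<otimes> cv y z = cv x z"
      using 1 cl by (simp add: cv_eq[OF t(1,2) w(1,2)] cv_eq[OF t(2,3) w(2,3)] cv_eq[OF t(1,3)
          w(1,3)] m_assoc)
  next
    fix x assume "x \<in> topspace \<R>"
    then obtain v where "x \<in> star v" using ex_pos by (auto simp: star_def)
    then show "\<exists>V U. openin \<R> V \<and> x \<in> V \<and> U \<in> range star \<and> V \<subseteq> U"
      using openin_star by blast
  qed
  have single: "L.transport (linear_path (vertex u) (vertex v)) = c u v" if uv: "{u, v} \<in> K" for u v
  proof -
    let ?p = "linear_path (vertex u) (vertex v)"
    have p: "pathin \<R> ?p" using uv by (rule pathin_edge)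
    have in_uv: "w = u \<or> w = v" if "?p t w > 0" for t w
      using that by (auto simp: linear_path_def vertex_apply split: if_splits)
    have top: "?p t \<in> topspace \<R>" if "0 \<le> t" "t \<le> 1" for t using pathin_topspace[OF p] that by auto
    have svp: "sv (?p t) = u \<or> sv (?p t) = v" if "0 \<le> t" "t \<le> 1" for t
      using in_uv sv[OF top] that by blast
    have cK: "{x, y, z} \<in> K" if "x \<in> {u, v}" "y \<in> {u, v}" "z \<in> {u, v}" for x y z
      using face[OF uv, of "{x, y, z}"] that by blast
    have cl: "c x y \<in> carrier G" if "x \<in> {u, v}" "y \<in> {u, v}" for x y
      using cK[of x y y] c_closed[of x y] that by simp
    \<comment> \<open>Along an edge a lift can be written down. The selected vertex
      \<open>sv\<close> may jump between \<open>u\<close> and \<open>v\<close>, but all values of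
      \<open>c\<close> involved belong to the one simplex \<open>{u, v}\<close>, where the cocycle
      identity absorbs the jumps.\<close>
    have "L.lift ?p 0 1 (\<lambda>t. c u (sv (?p t)))"
      unfolding L.lift_def
    proof (intro conjI ballI allI impI)
      fix t :: real assume "t \<in> {0..1}"
      then show "c u (sv (?p t)) \<in> carrier G" using svp[of t] by (intro cl) auto
    next
      fix s t :: real and U assume A: "0 \<le> s \<and> s \<le> t \<and> t \<le> 1 \<and> U \<in> range star \<and> ?p ` {s..t} \<subseteq> U"
      then obtain w where w: "?p s w > 0" "?p t w > 0" by (fastforce simp: star_def)
      have m: "sv (?p s) \<in> {u, v}" "sv (?p t) \<in> {u, v}" "w \<in> {u, v}"
        using svp[of s] svp[of t] in_uv[OF w(1)] A by auto
      have "cv (?p s) (?p t) = c (sv (?p s)) w \<otimes> c w (sv (?p t))"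
        using A w by (intro cv_eq top) auto
      also have "\<dots> = c (sv (?p s)) (sv (?p t))" using m by (intro c_mult cK) auto
      finally show "c u (sv (?p t)) = c u (sv (?p s)) \<otimes> cv (?p s) (?p t)"
        using m c_mult[OF cK[of u "sv (?p s)" "sv (?p t)"]] by simp
    qed
    from L.transport_eq[OF p this]
    have "c u (sv (?p 1)) = c u (sv (?p 0)) \<otimes> L.transport ?p" .
    moreover have "sv (vertex x) = x" for x
      unfolding sv_def by (rule some_equality) (auto simp: vertex_apply split: if_splits)
    moreover have "c u u = \<one>" using cK[of u u u] by (intro c_refl) simp
    ultimately show ?thesis using L.transport_closed[OF p] by simp
  qed
  have tr: "L.transport (edge_path vs) = cocycle_prod G c vs" if "chain K vs" for vs
    using that
  proof (induction vs rule: edge_path.induct)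
    case (2 v)
    then show ?case by (simp add: chain_def vertex_topspace)
  next
    case (3 v w vs)
    then have "L.transport (edge_path (v # w # vs)) = c v w \<otimes> L.transport (edge_path (w # vs))"
      unfolding edge_path_Cons2 chain_Cons2
      by (subst L.transport_join) (auto simp: edge_path_ends pathin_edge pathin_edge_path single)
    then show ?case using 3 by (simp add: chain_Cons2)
  qed (simp add: chain_def)
  show ?thesis using L.transport_homotopic[OF hom] tr chains by simp
qed

end

section \<open>Attaching a disc\<close>

lemma continuous_map_disc_map:
  assumes "\<phi> ` sphere 0 1 \<subseteq> topspace T"
  shows "continuous_map (top_of_set (cball 0 1)) (attach_disc T \<phi>) (disc_map \<phi>)"
  unfolding continuous_map_def
proof (intro conjI allI impI)
  show "disc_map \<phi> \<in> topspace (top_of_set (cball 0 1)) \<rightarrow> topspace (attach_disc T \<phi>)"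
    using assms unfolding topspace_attach_disc[OF assms] by (force simp: disc_map_def)
qed (simp add: openin_attach_disc)

lemma continuous_map_Inl_attach_disc:
  assumes "\<phi> ` sphere 0 1 \<subseteq> topspace T"
  shows "continuous_map T (attach_disc T \<phi>) Inl"
  unfolding continuous_map_def
  by (simp add: openin_attach_disc topspace_attach_disc[OF assms])

text \<open>For \<open>e = edge_path vs\<close> this is the attaching map of
  \<open>attach_disc_along\<close>. The jump of \<open>Arg2pi\<close> sits at 1, where the two ends
  of a closed path meet.\<close>

definition circle_map :: "(real \<Rightarrow> 'b) \<Rightarrow> complex \<Rightarrow> 'b" where
  "circle_map e = (\<lambda>z. e (Arg2pi z / (2 * pi)))"

lemma Arg2pi_rcis:
  assumes "0 < r" "0 \<le> t" "t < 1"
  shows "Arg2pi (of_real r * cis (2 * pi * t)) = 2 * pi * t"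
  using assms by (intro Arg2pi_unique[of r]) (auto simp: cis_conv_exp)

lemma circle_map_cis:
  assumes "e 0 = e 1" "t \<in> {0..1}"
  shows "circle_map e (cis (2 * pi * t)) = e t"
proof (cases "t = 1")
  case False
  then show ?thesis using Arg2pi_rcis[of 1 t] assms(2) by (simp add: circle_map_def)
qed (use assms Arg2pi_rcis[of 1 0] in \<open>simp add: circle_map_def\<close>)

lemma Arg2pi_unit: "Arg2pi z / (2 * pi) \<in> {0..1}"
  using Arg2pi_ge_0[of z] Arg2pi_lt_2pi[of z] by (simp add: divide_simps)

lemma circle_map_topspace: "pathin T e \<Longrightarrow> circle_map e z \<in> topspace T"
  unfolding circle_map_def by (intro pathin_topspace Arg2pi_unit)

text \<open>The circle is contracted linearly to its point 1 rather than to the centre of the disc.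
  Both ends of the loop sit at 1 and so remain fixed.\<close>

lemma attached_loop_null:
  assumes e: "pathin T e" "e 0 = e 1"
  shows "homotopic_pathsin (attach_disc T (circle_map e)) (Inl \<circ> e) (\<lambda>_. Inl (e 0))"
proof (rule homotopic_pathsinI)
  let ?k = "\<lambda>z::real\<times>real. (1 - fst z) *\<^sub>R cis (2 * pi * snd z) + fst z *\<^sub>R 1"
  have "continuous_on ({0..1} \<times> {0..1}) ?k"
    by (intro continuous_intros)
  moreover have "?k ` ({0..1} \<times> {0..1}) \<subseteq> cball 0 1"
  proof clarify
    fix s t :: real assume "s \<in> {0..1}" "t \<in> {0..1}"
    then show "?k (s, t) \<in> cball 0 1"
      using convexD[OF convex_cball[of 0 1], of "cis (2 * pi * t)" "1::complex" "1 - s" s] by simp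
  qed
  ultimately show "continuous_map (top_of_set ({0..1} \<times> {0..1})) (attach_disc T (circle_map e))
      (\<lambda>z. disc_map (circle_map e) (?k z))"
    using e by (intro continuous_map_top_of_set_compose[OF continuous_map_disc_map])
      (auto simp: circle_map_topspace)
  have "circle_map e 1 = e 0" using circle_map_cis[of e 0] e by simp
  then show "disc_map (circle_map e) (?k (1, t)) = Inl (e 0)" "disc_map (circle_map e) (?k (t, 0))
      = (Inl \<circ> e) 0"
    "disc_map (circle_map e) (?k (t, 1)) = (Inl \<circ> e) 1" if "t \<in> {0..1}" for t
    using e by (auto simp: disc_map_def simp flip: of_real_add simp: scaleR_conv_of_real)
  show "disc_map (circle_map e) (?k (0, t)) = (Inl \<circ> e) t" if "t \<in> {0..1}" for t
    using circle_map_cis[of e t] e that by (simp add: disc_map_def)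
qed

text \<open>A null-homotopy of \<open>e\<close> is a map on the disc in polar coordinates, time
  \<open>s\<close> corresponding to radius \<open>1 - s\<close>. Polar coordinates map a compact
  square onto a Hausdorff disc, hence form a quotient map, and the induced map \<open>D\<close> is
  continuous. On the boundary circle \<open>D\<close> is the attaching map, so it extends the
  identity of \<open>T\<close>.\<close>

lemma attach_disc_retraction:
  assumes null: "homotopic_pathsin T e (\<lambda>_. e 0)"
  obtains \<rho> where "continuous_map (attach_disc T (circle_map e)) T \<rho>" "\<And>x. \<rho> (Inl x) = x"
proof -
  obtain h :: "real \<times> real \<Rightarrow> 'a" where h: "continuous_map (top_of_set ({0..1} \<times> {0..1})) T h"
    "\<And>x. h (0, x) = e x" "\<And>x. h (1, x) = e 0"
    "\<And>t. t \<in> {0..1} \<Longrightarrow> h (t, 0) = e 0" "\<And>t. t \<in> {0..1} \<Longrightarrow> h (t, 1) = e 1"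
    using null by (rule homotopic_pathsinE) blast
  have e: "pathin T e" "e 1 = e 0"
    using homotopic_pathsin_imp_pathin(1)[OF null] homotopic_pathsin_imp_ends(2)[OF null] by auto
  define D where "D z = h (1 - cmod z, Arg2pi z / (2 * pi))" for z
  define q where "q = (\<lambda>z::real\<times>real. of_real (1 - fst z) * cis (2 * pi * snd z))"
  define S where "S = {0..1::real} \<times> {0..1::real}"
  \<comment> \<open>Two identifications have to be respected: at \<open>s = 1\<close> the whole
    segment becomes the centre, where \<open>h\<close> is constant, and the sides
    \<open>t = 0\<close> and \<open>t = 1\<close> become one radius, where \<open>h\<close> takes
    the equal values \<open>e 0\<close> and \<open>e 1\<close>.\<close>
  have Dq: "D (q z) = h z" if zS: "z \<in> S" for z
  proof -
    obtain s t where z: "z = (s, t)" "s \<in> {0..1}" "t \<in> {0..1}" using zS unfolding S_def by blast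
    have norm: "cmod (q z) = 1 - s" using z by (simp add: q_def norm_mult del: of_real_diff)
    consider "s = 1" | "s < 1" "t = 1" | "s < 1" "t < 1" using z by force
    then show ?thesis
    proof cases
      case 1
      then show ?thesis using z h(3) by (simp add: D_def q_def)
    next
      case 2
      then have "Arg2pi (q z) = 0" using Arg2pi_rcis[of "1 - s" 0] z by (simp add: q_def)
      then show ?thesis using 2 z norm h(4,5)[of s] e by (simp add: D_def)
    next
      case 3
      then have "Arg2pi (q z) = 2 * pi * t" using Arg2pi_rcis[of "1 - s" t] z by (simp add: q_def)
      then show ?thesis using z norm by (simp add: D_def)
    qed
  qed
  have q_cont: "continuous_on S q" unfolding q_def by (intro continuous_intros)
  have q_im: "q ` S = cball 0 1"
  proof
    show "q ` S \<subseteq> cball 0 1" by (auto simp: q_def S_def norm_mult simp del: of_real_diff)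
    show "cball 0 1 \<subseteq> q ` S"
    proof
      fix z :: complex assume "z \<in> cball 0 1"
      then have "(1 - cmod z, Arg2pi z / (2 * pi)) \<in> S" using Arg2pi_unit[of z] by (auto simp: S_def)
      moreover have "q (1 - cmod z, Arg2pi z / (2 * pi)) = z"
        using Arg2pi_eq[of z] by (simp add: q_def cis_conv_exp)
      ultimately show "z \<in> q ` S" by force
    qed
  qed
  have S: "compact S" unfolding S_def by (intro compact_Times compact_Icc)
  have D_cont: "continuous_map (top_of_set (cball 0 1)) T D"
    unfolding continuous_map_def
  proof (intro conjI allI impI)
    show "D \<in> topspace (top_of_set (cball 0 1)) \<rightarrow> topspace T"
    proof
      fix z assume "z \<in> topspace (top_of_set (cball (0::complex) 1))"
      then have "z \<in> q ` S" by (simp add: q_im)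
      then obtain w where "w \<in> S" "z = q w" by blast
      then show "D z \<in> topspace T" using Dq h(1) by (auto simp: continuous_map_def S_def)
    qed
    fix U assume "openin T U"
    then have "openin (top_of_set S) {z \<in> S. h z \<in> U}"
      using openin_continuous_map_preimage[OF h(1)] by (simp add: S_def)
    also have "{z \<in> S. h z \<in> U} = S \<inter> q -` {z \<in> cball 0 1. D z \<in> U}"
      using Dq q_im by auto
    finally have "openin (top_of_set S) (S \<inter> q -` {z \<in> cball 0 1. D z \<in> U})" .
    moreover have "{z \<in> cball 0 1. D z \<in> U} \<subseteq> cball 0 1" by blast
    ultimately have "openin (top_of_set (cball 0 1)) {z \<in> cball 0 1. D z \<in> U}"
      using Abstract_Topology_2.continuous_imp_quotient_map[OF q_cont q_im S] by blast
    then show "openin (top_of_set (cball 0 1)) {z \<in> topspace (top_of_set (cball 0 1)). D z \<in> U}"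
      by simp
  qed
  let ?\<phi> = "circle_map e" and ?\<rho> = "case_sum (\<lambda>x. x) D"
  have \<phi>: "?\<phi> ` sphere 0 1 \<subseteq> topspace T" using e(1) by (auto simp: circle_map_topspace)
  have D_disc: "?\<rho> (disc_map ?\<phi> z) = D z" if "z \<in> cball 0 1" for z
    using that h(2) by (auto simp: disc_map_def D_def circle_map_def)
  have "continuous_map (attach_disc T ?\<phi>) T ?\<rho>"
    unfolding continuous_map_def
  proof (intro conjI allI impI)
    show "?\<rho> \<in> topspace (attach_disc T ?\<phi>) \<rightarrow> topspace T"
      using D_cont unfolding topspace_attach_disc[OF \<phi>] by (auto simp: continuous_map_def)
    fix U assume U: "openin T U"
    let ?V = "{x \<in> topspace (attach_disc T ?\<phi>). ?\<rho> x \<in> U}"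
    have "{x \<in> topspace T. Inl x \<in> ?V} = U"
      using openin_subset[OF U] unfolding topspace_attach_disc[OF \<phi>] by auto
    moreover have "{z \<in> cball 0 1. disc_map ?\<phi> z \<in> ?V} = {z \<in> cball 0 1. D z \<in> U}"
      using D_disc continuous_map_disc_map[OF \<phi>] by (auto simp: continuous_map_def)
    moreover have "openin (top_of_set (cball 0 1)) {z \<in> cball 0 1. D z \<in> U}"
      using openin_continuous_map_preimage[OF D_cont U] by simp
    moreover have "?V \<subseteq> Inl ` topspace T \<union> Inr ` ball 0 1"
      unfolding topspace_attach_disc[OF \<phi>] by blast
    ultimately show "openin (attach_disc T ?\<phi>) ?V"
      using U unfolding openin_attach_disc by (simp only:)
  qed
  then show thesis using that[of ?\<rho>] by simp
qed

text \<open>If \<open>e\<close> is null, the retraction is a left inverse of the inclusion and the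
  kernel is trivial. If it is not, the class of \<open>e\<close> itself is a nontrivial element that
  the disc kills.\<close>

lemma (in based_space) attach_disc_kernel:
  assumes e: "pathin T e" "e 1 = e 0"
  defines "A \<equiv> attach_disc T (circle_map e)"
  shows "kernel (fundamental_group T b) (fundamental_group A (Inl b)) (induced_map A (Inl b) Inl) \<noteq>
      {\<one>\<^bsub>fundamental_group T b\<^esub>} \<longleftrightarrow> pclass e \<noteq> \<one>\<^bsub>fundamental_group T b\<^esub>"
proof -
  let ?K = "kernel (fundamental_group T b) (fundamental_group A (Inl b)) (induced_map A (Inl b) Inl)"
  have Inl: "continuous_map T A Inl"
    unfolding A_def using e(1) by (intro continuous_map_Inl_attach_disc) (auto simp:
        circle_map_topspace)
  have loop: "Inl \<circ> p \<in> loopsin A (Inl b)" if "p \<in> loopsin T b" for p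
    using that Inl by (auto simp: loopsin_def pathin_compose)
  have base': "(\<lambda>_. Inl b) \<in> loopsin A (Inl b)" using loop[OF const_loopsin[OF base]] by (simp
      add: comp_def)
  have in_kernel: "loop_class T b p \<in> ?K \<longleftrightarrow> homotopic_pathsin A (Inl \<circ> p) (\<lambda>_. Inl b)"
    if p: "p \<in> loopsin T b" for p
    using p loop_class_eq_iff[OF loop[OF p] base']
    by (simp add: kernel_def carrier_fundamental_group induced_map_loop_class[OF p Inl]
        one_fundamental_group)
  have one_in: "\<one>\<^bsub>fundamental_group T b\<^esub> \<in> ?K"
    using in_kernel[OF const_loopsin[OF base]] homotopic_pathsin_refl[of A "\<lambda>_. Inl b"] base'
    by (simp add: one_fundamental_group comp_def loopsin_def)
  show ?thesis
  proof
    assume "?K \<noteq> {\<one>\<^bsub>fundamental_group T b\<^esub>}"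
    then obtain p where p: "p \<in> loopsin T b" "loop_class T b p \<in> ?K"
        "loop_class T b p \<noteq> \<one>\<^bsub>fundamental_group T b\<^esub>"
      using one_in by (auto simp: kernel_def carrier_fundamental_group)
    show "pclass e \<noteq> \<one>\<^bsub>fundamental_group T b\<^esub>"
    proof
      assume "pclass e = \<one>\<^bsub>fundamental_group T b\<^esub>"
      then have "homotopic_pathsin T e (\<lambda>_. e 0)" using pclass_eq_one_imp_homotopic e by blast
      then obtain \<rho> where \<rho>: "continuous_map A T \<rho>" "\<And>x. \<rho> (Inl x) = x"
        unfolding A_def by (rule attach_disc_retraction) blast
      have "homotopic_pathsin T (\<rho> \<circ> (Inl \<circ> p)) (\<rho> \<circ> (\<lambda>_. Inl b))"
        using in_kernel p \<rho>(1) by (intro homotopic_pathsin_image) auto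
      then have "homotopic_pathsin T p (\<lambda>_. b)" by (simp add: comp_def \<rho>(2))
      then have "loop_class T b p = \<one>\<^bsub>fundamental_group T b\<^esub>"
        unfolding one_fundamental_group using p(1) by (rule loop_class_eq_if_homotopic)
      with p(3) show False by simp
    qed
  next
    assume ne: "pclass e \<noteq> \<one>\<^bsub>fundamental_group T b\<^esub>"
    let ?t = "Inl \<circ> \<tau> (e 0)" and ?e = "Inl \<circ> e"
    have t: "pathin T (\<tau> (e 0))" "\<tau> (e 0) 0 = b" "\<tau> (e 0) 1 = e 0"
      using tau pathin_ends[OF e(1)] by auto
    have tA: "pathin A ?t" using t(1) Inl by (rule pathin_compose)
    have null: "homotopic_pathsin A ?e (\<lambda>_. ?t 1)"
      using attached_loop_null[of T e] e t unfolding A_def by simp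
    have "homotopic_pathsin A (joinin (joinin ?t ?e) (reversein ?t)) (joinin (joinin ?t (\<lambda>_. ?t
        1)) (reversein ?t))"
      using e t tA null by (intro homotopic_pathsin_join homotopic_pathsin_refl pathin_reversein) auto
    also have "homotopic_pathsin A \<dots> (joinin ?t (reversein ?t))"
      using tA by (intro homotopic_pathsin_join homotopic_pathsin_rid homotopic_pathsin_refl
          pathin_reversein) auto
    also have "homotopic_pathsin A \<dots> (\<lambda>_. ?t 0)"
      using tA by (rule homotopic_pathsin_rinv)
    also have "joinin (joinin ?t ?e) (reversein ?t) = Inl \<circ> joinin (joinin (\<tau> (e 0)) e) (reversein
        (\<tau> (e 0)))"
      by (auto simp: joinin_def reversein_def)
    finally have "pclass e \<in> ?K"
      unfolding pclass_def using in_kernel[OF based_loop[OF e(1)]] e t by (simp add: comp_def)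
    then show "?K \<noteq> {\<one>\<^bsub>fundamental_group T b\<^esub>}" using ne by blast
  qed
qed

section \<open>Length of curves\<close>

fun polygon_length :: "(real \<Rightarrow> 'a::metric_space) \<Rightarrow> real list \<Rightarrow> ennreal" where
  "polygon_length g (s # t # ts) = ennreal (dist (g s) (g t)) + polygon_length g (t # ts)"
| "polygon_length g _ = 0"

lemma sum_eq_polygon_length:
  "(\<Sum>i < length ts - 1. ennreal (dist (g (ts ! i)) (g (ts ! Suc i)))) = polygon_length g ts"
  by (induction ts rule: induct_list012)
     (simp_all add: sum.lessThan_Suc_shift del: sum_ennreal sum.lessThan_Suc)

lemma curve_length_eq_SUP:
  "curve_length a b g = (SUP ts \<in> {ts. sorted ts \<and> set ts \<subseteq> {a..b}}. polygon_length g ts)"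
  unfolding curve_length_def sum_eq_polygon_length ..

lemma polygon_length_le: "sorted ts \<Longrightarrow> set ts \<subseteq> {a..b} \<Longrightarrow> polygon_length g ts \<le> curve_length a b g"
  unfolding curve_length_eq_SUP by (intro SUP_upper) auto

lemma curve_length_leI:
  "(\<And>ts. sorted ts \<Longrightarrow> set ts \<subseteq> {a..b} \<Longrightarrow> polygon_length g ts \<le> C) \<Longrightarrow> curve_length a b g \<le> C"
  unfolding curve_length_eq_SUP by (intro SUP_least) auto

lemma polygon_length_append_Cons:
  "polygon_length g (xs @ m # ys) = polygon_length g (xs @ [m]) + polygon_length g (m # ys)"
  by (induction g xs rule: polygon_length.induct) (auto simp: add.assoc)

lemma polygon_length_Cons_mono: "polygon_length g ts \<le> polygon_length g (t # ts)"
  by (cases ts) auto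

lemma polygon_length_insert: "polygon_length g (xs @ ys) \<le> polygon_length g (xs @ m # ys)"
proof (induction xs rule: induct_list012)
  case 1
  then show ?case by (simp add: polygon_length_Cons_mono)
next
  case (2 x)
  show ?case
  proof (cases ys)
    case (Cons y zs)
    have "ennreal (dist (g x) (g y)) \<le> ennreal (dist (g x) (g m)) + ennreal (dist (g m) (g y))"
      by (simp add: dist_triangle flip: ennreal_plus)
    then show ?thesis using Cons by (simp add: add.assoc[symmetric] add_right_mono)
  qed simp
qed (auto intro: add_left_mono)

lemma polygon_length_cong: "(\<And>t. t \<in> set ts \<Longrightarrow> f t = g t) \<Longrightarrow> polygon_length f ts = polygon_length g ts"
  by (induction ts rule: induct_list012) simp_all

lemma curve_length_cong: "(\<And>t. t \<in> {a..b} \<Longrightarrow> f t = g t) \<Longrightarrow> curve_length a b f = curve_length a b g"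
  unfolding curve_length_eq_SUP by (intro SUP_cong polygon_length_cong) auto

lemma polygon_length_append_le: "polygon_length g xs + polygon_length g ys \<le> polygon_length g (xs
    @ ys)"
proof (cases ys)
  case (Cons y zs)
  have "polygon_length g xs \<le> polygon_length g (xs @ [y])"
    using polygon_length_insert[of g xs "[]" y] by simp
  then show ?thesis
    using polygon_length_append_Cons[of g xs y zs] unfolding Cons by (simp only: add_right_mono)
qed simp

lemma sorted_split:
  assumes "sorted ts" "set ts \<subseteq> {a..b}"
  shows "\<exists>xs ys. ts = xs @ ys \<and> sorted xs \<and> sorted ys \<and> set xs \<subseteq> {a..m} \<and> set ys \<subseteq> {m..b}"
  using assms
proof (induction ts)
  case (Cons t ts)
  show ?case
  proof (cases "t \<le> m")
    case True
    obtain xs ys where xy: "ts = xs @ ys" "sorted xs" "sorted ys" "set xs \<subseteq> {a..m}" "set ys \<subseteq> {m..b}"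
      using Cons by auto
    then show ?thesis using Cons.prems True
      by (intro exI[of _ "t # xs"] exI[of _ ys]) auto
  next
    case False
    then have "set (t # ts) \<subseteq> {m..b}" using Cons.prems by (fastforce dest: order_trans[of m t])
    then show ?thesis using Cons.prems(1) by (intro exI[of _ "[]"] exI[of _ "t # ts"]) auto
  qed
qed auto

text \<open>Inserting \<open>m\<close> never shortens an inscribed polygon, by the triangle
  inequality. Polygons through \<open>m\<close> split into two halves that can be chosen
  independently, so the suprema add.\<close>

lemma curve_length_add:
  assumes "a \<le> m" "m \<le> b"
  shows "curve_length a b g = curve_length a m g + curve_length m b g"
proof (rule antisym)
  show "curve_length a b g \<le> curve_length a m g + curve_length m b g"
  proof (rule curve_length_leI)
    fix ts assume ts: "sorted ts" "set ts \<subseteq> {a..b}"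
    obtain xs ys where xy: "ts = xs @ ys" "sorted xs" "sorted ys" "set xs \<subseteq> {a..m}" "set ys \<subseteq> {m..b}"
      using sorted_split[OF ts, of m] by blast
    have "polygon_length g ts \<le> polygon_length g (xs @ [m]) + polygon_length g (m # ys)"
      unfolding xy(1) using polygon_length_insert[of g xs ys m] polygon_length_append_Cons[of g xs
          m ys] by simp
    also have "\<dots> \<le> curve_length a m g + curve_length m b g"
      using xy assms by (intro add_mono polygon_length_le) (auto simp: sorted_append)
    finally show "polygon_length g ts \<le> curve_length a m g + curve_length m b g" .
  qed
  let ?S = "\<lambda>a b. {ts. sorted ts \<and> set ts \<subseteq> {a..b}}"
  have ne: "?S a b \<noteq> {}" for a b :: real by (auto intro: exI[of _ "[]"])
  have "polygon_length g xs + polygon_length g ys \<le> curve_length a b g"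
    if "xs \<in> ?S a m" "ys \<in> ?S m b" for xs ys
  proof -
    have "polygon_length g xs + polygon_length g ys \<le> polygon_length g (xs @ ys)"
      by (rule polygon_length_append_le)
    also have "\<dots> \<le> curve_length a b g"
      using that assms by (intro polygon_length_le) (auto simp: sorted_append subset_iff intro:
          order_trans)
    finally show ?thesis .
  qed
  then have "(SUP ys\<in>?S m b. SUP xs\<in>?S a m. polygon_length g xs + polygon_length g ys) \<le>
      curve_length a b g"
    by (intro SUP_least) auto
  then show "curve_length a m g + curve_length m b g \<le> curve_length a b g"
    unfolding curve_length_eq_SUP[of a m] curve_length_eq_SUP[of m b]
      ennreal_SUP_add_left[OF ne, symmetric] ennreal_SUP_add_right[OF ne] .
qed

lemma dist_le_curve_length:
  assumes "a \<le> s" "s \<le> t" "t \<le> b"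
  shows "ennreal (dist (g s) (g t)) \<le> curve_length a b g"
  using polygon_length_le[of "[s, t]" a b g] assms by simp

lemma curve_length_mono:
  assumes "a \<le> s" "t \<le> b"
  shows "curve_length s t g \<le> curve_length a b g"
  using assms by (intro curve_length_leI polygon_length_le) auto

lemma curve_length_refl [simp]: "curve_length a a g = 0"
proof -
  have "polygon_length g ts = 0" if "set ts \<subseteq> {a}" for ts
    using that by (induction ts rule: induct_list012) auto
  then have "curve_length a a g \<le> 0" by (intro curve_length_leI) auto
  then show ?thesis by simp
qed

lemma polygon_length_map: "polygon_length (\<lambda>t. g (\<phi> t)) ts = polygon_length g (map \<phi> ts)"
  by (induction ts rule: induct_list012) auto

lemma polygon_length_rev: "polygon_length g (rev ts) = polygon_length g ts"
proof (induction ts rule: induct_list012)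
  case (3 x y zs)
  have "polygon_length g (rev (x # y # zs)) = polygon_length g (rev zs @ [y] @ [x])" by simp
  also have "\<dots> = polygon_length g (rev zs @ [y]) + polygon_length g [y, x]"
    using polygon_length_append_Cons[of g "rev zs" y "[x]"] by simp
  also have "\<dots> = polygon_length g (x # y # zs)" using 3 by (simp add: dist_commute add.commute)
  finally show ?case .
qed auto

lemma curve_length_mono_reparam:
  assumes "mono_on {a..b} \<phi>" "\<phi> ` {a..b} \<subseteq> {c..d}"
  shows "curve_length a b (\<lambda>t. g (\<phi> t)) \<le> curve_length c d g"
proof (rule curve_length_leI)
  fix ts assume ts: "sorted ts" "set ts \<subseteq> {a..b}"
  have "sorted (map \<phi> ts)"
    using ts assms(1) by (induction ts) (auto simp: mono_on_def)
  then show "polygon_length (\<lambda>t. g (\<phi> t)) ts \<le> curve_length c d g"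
    unfolding polygon_length_map using ts assms(2) by (intro polygon_length_le) auto
qed

lemma curve_length_antimono_reparam:
  assumes "\<And>s t. s \<in> {a..b} \<Longrightarrow> t \<in> {a..b} \<Longrightarrow> s \<le> t \<Longrightarrow> \<phi> t \<le> \<phi> s" "\<phi> ` {a..b} \<subseteq> {c..d}"
  shows "curve_length a b (\<lambda>t. g (\<phi> t)) \<le> curve_length c d g"
proof (rule curve_length_leI)
  fix ts assume ts: "sorted ts" "set ts \<subseteq> {a..b}"
  have "sorted (rev (map \<phi> ts))"
    using ts assms(1) by (induction ts) (auto simp: sorted_append)
  then show "polygon_length (\<lambda>t. g (\<phi> t)) ts \<le> curve_length c d g"
    unfolding polygon_length_map polygon_length_rev[of g "map \<phi> ts", symmetric]
    using ts assms(2) by (intro polygon_length_le) auto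
qed

lemma curve_length_affine:
  assumes "k > 0" "c = k * a + m" "d = k * b + m"
  shows "curve_length a b (\<lambda>t. g (k * t + m)) = curve_length c d g"
proof (rule antisym)
  show "curve_length a b (\<lambda>t. g (k * t + m)) \<le> curve_length c d g"
    using assms by (intro curve_length_mono_reparam) (auto simp: mono_on_def)
  have "curve_length c d (\<lambda>t. g (k * ((t - m) / k) + m)) \<le> curve_length a b (\<lambda>t. g (k * t + m))"
    using assms by (intro curve_length_mono_reparam[of c d "\<lambda>t. (t - m) / k" a b "\<lambda>t. g (k * t + m)"])
      (auto simp: mono_on_def divide_right_mono field_simps)
  then show "curve_length c d g \<le> curve_length a b (\<lambda>t. g (k * t + m))" using assms(1) by simp
qed

lemma curve_length_subpathin:
  assumes "s \<le> t"
  shows "curve_length 0 1 (subpathin s t p) = curve_length s t p"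
proof (cases "s = t")
  case True
  have "curve_length 0 1 (\<lambda>u. p s) \<le> curve_length s s p"
    by (intro curve_length_mono_reparam[of 0 1 "\<lambda>_. s"]) (auto simp: mono_on_def)
  then show ?thesis using True by (simp add: subpathin_def)
next
  case False
  then show ?thesis using assms curve_length_affine[of "t - s" s 0 s t 1 p]
    by (simp add: subpathin_def algebra_simps)
qed

lemma curve_length_reversein:
  "curve_length (1 - b) (1 - a) (reversein p) = curve_length a b p"
proof (rule antisym)
  show "curve_length (1 - b) (1 - a) (reversein p) \<le> curve_length a b p"
    unfolding reversein_def by (intro curve_length_antimono_reparam) auto
  have "curve_length a b (\<lambda>t. reversein p (1 - t)) \<le> curve_length (1 - b) (1 - a) (reversein p)"
    by (intro curve_length_antimono_reparam) auto
  then show "curve_length a b p \<le> curve_length (1 - b) (1 - a) (reversein p)"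
    by (simp add: reversein_def)
qed

lemma curve_length_reversein_01 [simp]: "curve_length 0 1 (reversein p) = curve_length 0 1 p"
  using curve_length_reversein[of 1 0 p] by simp

lemma curve_length_joinin:
  assumes "p 1 = q 0"
  shows "curve_length 0 1 (joinin p q) = curve_length 0 1 p + curve_length 0 1 q"
proof -
  have "curve_length 0 1 (joinin p q) = curve_length 0 (1/2) (joinin p q) + curve_length (1/2) 1
      (joinin p q)"
    by (intro curve_length_add) auto
  also have "curve_length 0 (1/2) (joinin p q) = curve_length 0 (1/2) (\<lambda>t. p (2 * t + 0))"
    by (intro curve_length_cong) (auto simp: joinin_def)
  also have "\<dots> = curve_length 0 1 p"
    by (intro curve_length_affine) auto
  also have "curve_length (1/2) 1 (joinin p q) = curve_length (1/2) 1 (\<lambda>t. q (2 * t + -1))"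
  proof (intro curve_length_cong)
    fix t :: real assume t: "t \<in> {1/2..1}"
    show "joinin p q t = q (2 * t + -1)"
    proof (cases "t = 1/2")
      case True
      show ?thesis unfolding True by (simp add: joinin_def assms)
    qed (use t in \<open>auto simp: joinin_def\<close>)
  qed
  also have "\<dots> = curve_length 0 1 q"
    by (intro curve_length_affine) auto
  finally show ?thesis .
qed

lemma curve_length_const [simp]: "curve_length a b (\<lambda>_. x) = 0"
proof -
  have "polygon_length (\<lambda>_. x) ts = 0" for ts
    by (induction ts rule: induct_list012) auto
  then have "curve_length a b (\<lambda>_. x) \<le> 0" by (intro curve_length_leI) auto
  then show ?thesis by simp
qed

text \<open>Take a polygon that nearly realises the length from \<open>x\<close> to 1. If
  \<open>v\<close> lies before its first point beyond \<open>x\<close>, the polygon gains only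
  \<open>dist (p x) (p v)\<close> on \<open>{x..v}\<close>; everything else is at most the length
  from \<open>v\<close>. So little length is left over between \<open>x\<close> and
  \<open>v\<close>.\<close>

lemma curve_length_right_continuous:
  fixes p :: "real \<Rightarrow> 'a::metric_space"
  assumes p: "continuous_on {0..1} p" and fin: "curve_length 0 1 p < \<infinity>" and x: "0 \<le> x" "x \<le> 1" and
      e: "e > 0"
  shows "\<exists>d>0. \<forall>v. x \<le> v \<and> v \<le> 1 \<and> v - x < d \<longrightarrow> curve_length x v p < ennreal e"
proof -
  define C where "C = curve_length x 1 p"
  have C: "C < \<infinity>"
    using le_less_trans[OF curve_length_mono[of 0 x 1 1 p] fin] x by (simp add: C_def)
  obtain ts where ts: "sorted ts" "set ts \<subseteq> {x..1}" and C_le: "C \<le> polygon_length p ts + ennreal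
      (e / 2)"
  \<comment> \<open>Extended subtraction is truncated at 0, so \<open>C - e / 2 < C\<close> requires
    \<open>C\<close> to be nonzero. For \<open>C = 0\<close> the empty polygon will do.\<close>
  proof (cases "C = 0")
    case True
    then show thesis using that[of "[]"] by simp
  next
    case False
    then have "C - ennreal (e / 2) < C"
      using C e by (intro ennreal_between) (auto simp: zero_less_iff_neq_zero)
    then obtain ts where "sorted ts" "set ts \<subseteq> {x..1}" "C - ennreal (e / 2) < polygon_length p ts"
      unfolding C_def curve_length_eq_SUP less_SUP_iff by auto
    moreover from less_imp_le[OF this(3)] have "C \<le> polygon_length p ts + ennreal (e / 2)"
      using ennreal_minus_le_iff[of C "ennreal (e / 2)" "polygon_length p ts"] by (simp add:
          add.commute)
    ultimately show thesis using that by blast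
  qed
  obtain d0 where d0: "d0 > 0" "\<And>v. v \<in> {0..1} \<Longrightarrow> dist v x < d0 \<Longrightarrow> dist (p v) (p x) < e / 2"
    using p[unfolded continuous_on_iff, rule_format, of x "e / 2"] x e by auto
  \<comment> \<open>Up to distance \<open>d\<close> to the right of \<open>x\<close> the polygon has
    no vertex other than \<open>x\<close>, and by continuity \<open>p\<close> moves by less than
    \<open>e / 2\<close>.\<close>
  define d where "d = Min (insert d0 ((\<lambda>t. t - x) ` {t \<in> set ts. t > x}))"
  have d: "d > 0" "d \<le> d0" "\<And>t. t \<in> set ts \<Longrightarrow> t > x \<Longrightarrow> d \<le> t - x"
    unfolding d_def using d0(1) by (auto simp: Min_gr_iff Min_le)
  have "curve_length x v p < ennreal e" if v: "x \<le> v" "v \<le> 1" "v - x < d" for v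
  proof -
    obtain xs ys where xy: "ts = xs @ ys" "sorted xs" "sorted ys" "set xs \<subseteq> {x..v}" "set ys \<subseteq> {v..1}"
      using sorted_split[OF ts, of v] by blast
    have xs: "set xs \<subseteq> {x}"
    proof
      fix t assume t: "t \<in> set xs"
      then have "x \<le> t" "t \<le> v" "t \<in> set ts" using xy by auto
      then show "t \<in> {x}" using d(3)[of t] v(3) by fastforce
    qed
    then have "polygon_length p (xs @ [v]) \<le> ennreal (dist (p x) (p v))"
      by (induction xs rule: induct_list012) auto
    also have "\<dots> < ennreal (e / 2)"
      using d0(2)[of v] v d(2) x e by (auto simp: dist_real_def dist_commute intro!: ennreal_lessI)
    finally have 1: "polygon_length p (xs @ [v]) < ennreal (e / 2)" .
    have "C \<le> polygon_length p (xs @ v # ys) + ennreal (e / 2)"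
      using C_le polygon_length_insert[of p xs ys v] xy(1) by (meson add_right_mono order_trans)
    also have "\<dots> = polygon_length p (xs @ [v]) + (polygon_length p (v # ys) + ennreal (e / 2))"
      by (simp add: polygon_length_append_Cons[of p xs v ys] add.assoc)
    also have "\<dots> \<le> polygon_length p (xs @ [v]) + (curve_length v 1 p + ennreal (e / 2))"
      using xy v by (intro add_left_mono add_right_mono polygon_length_le) auto
    also have "\<dots> < ennreal (e / 2) + (curve_length v 1 p + ennreal (e / 2))"
    proof -
      have "curve_length v 1 p < \<infinity>"
        using le_less_trans[OF curve_length_mono[of x v 1 1 p] C[unfolded C_def]] v by simp
      then have "curve_length v 1 p + ennreal (e / 2) \<noteq> \<infinity>" by auto
      then show ?thesis using 1 by (simp add: ennreal_add_left_cancel_less add.commute[of _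
          "curve_length v 1 p + ennreal (e / 2)"])
    qed
    also have "\<dots> = ennreal e + curve_length v 1 p"
      using e by (simp add: ac_simps flip: ennreal_plus)
    finally have "curve_length x v p + curve_length v 1 p < ennreal e + curve_length v 1 p"
      using curve_length_add[of x v 1 p] v by (simp add: C_def)
    then show ?thesis by (metis add_right_mono not_le)
  qed
  then show ?thesis using d(1) by blast
qed

lemma curve_length_small:
  fixes p :: "real \<Rightarrow> 'a::metric_space"
  assumes p: "continuous_on {0..1} p" and fin: "curve_length 0 1 p < \<infinity>" and x: "0 \<le> x" "x \<le> 1" and
      e: "e > 0"
  shows "\<exists>d>0. \<forall>u v. u \<le> x \<and> x \<le> v \<and> v - u < d \<and> 0 \<le> u \<and> v \<le> 1 \<longrightarrow> curve_length u v p < ennreal e"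
proof -
  obtain d1 where d1: "d1 > 0" "\<And>v. x \<le> v \<and> v \<le> 1 \<and> v - x < d1 \<Longrightarrow> curve_length x v p < ennreal (e / 2)"
    using curve_length_right_continuous[OF p fin x, of "e / 2"] e by auto
  have "continuous_on {0..1} (reversein p)"
    unfolding reversein_def by (rule continuous_on_compose2[OF p]) (auto intro!: continuous_intros)
  then obtain d2 where d2: "d2 > 0" "\<And>v. 1 - x \<le> v \<and> v \<le> 1 \<and> v - (1 - x) < d2 \<Longrightarrow>
      curve_length (1 - x) v (reversein p) < ennreal (e / 2)"
    using curve_length_right_continuous[of "reversein p" "1 - x" "e / 2"] e x fin by auto
  have "curve_length u v p < ennreal e"
    if uv: "u \<le> x" "x \<le> v" "v - u < min d1 d2" "0 \<le> u" "v \<le> 1" for u v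
  proof -
    have "curve_length u x p < ennreal (e / 2)"
      using d2(2)[of "1 - u"] curve_length_reversein[of x u p] uv by auto
    moreover have "curve_length x v p < ennreal (e / 2)" using d1(2)[of v] uv by auto
    ultimately have "curve_length u x p + curve_length x v p < ennreal (e / 2) + ennreal (e / 2)"
      by (rule add_strict_mono)
    then show ?thesis using curve_length_add[OF uv(1,2), of p] e by (simp flip: ennreal_plus)
  qed
  then show ?thesis using d1 d2 by (intro exI[of _ "min d1 d2"]) auto
qed

section \<open>Arc length along a rectifiable path\<close>

definition arclen :: "(real \<Rightarrow> 'a::metric_space) \<Rightarrow> real \<Rightarrow> real" where
  "arclen p t = enn2real (curve_length 0 t p)"

locale rectifiable_path =
  fixes p :: "real \<Rightarrow> 'a::metric_space"
  assumes cont: "continuous_on {0..1} p" and finite_length: "curve_length 0 1 p < \<infinity>"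
begin

lemma curve_length_arclen:
  assumes "0 \<le> s" "s \<le> t" "t \<le> 1"
  shows "curve_length s t p = ennreal (arclen p t - arclen p s)" "arclen p s \<le> arclen p t"
proof -
  have fin: "curve_length 0 u p < \<infinity>" if "u \<le> 1" for u
    using le_less_trans[OF curve_length_mono[of 0 0 u 1 p] finite_length] that by simp
  have eq: "curve_length 0 t p = curve_length 0 s p + curve_length s t p"
    using assms by (intro curve_length_add)
  have fst: "curve_length s t p < \<infinity>"
    using le_less_trans[OF curve_length_mono[of 0 s t 1 p] finite_length] assms by simp
  have "arclen p t = arclen p s + enn2real (curve_length s t p)"
    unfolding arclen_def eq using fin[of s] fst assms by (intro enn2real_plus) auto
  then show "curve_length s t p = ennreal (arclen p t - arclen p s)" "arclen p s \<le> arclen p t"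
    using fst by auto
qed

lemma arclen_0 [simp]: "arclen p 0 = 0"
  by (simp add: arclen_def)

lemma arclen_1: "curve_length 0 1 p = ennreal (arclen p 1)"
  using curve_length_arclen[of 0 1] by simp

lemma arclen_nonneg: "0 \<le> arclen p t"
  by (simp add: arclen_def)

lemma dist_le_arclen:
  assumes "0 \<le> s" "s \<le> t" "t \<le> 1"
  shows "dist (p s) (p t) \<le> arclen p t - arclen p s"
  using dist_le_curve_length[of s s t t p] curve_length_arclen[OF assms] assms by simp

lemma continuous_on_arclen: "continuous_on {0..1} (arclen p)"
  unfolding continuous_on_iff
proof (intro ballI allI impI)
  fix x e :: real assume x: "x \<in> {0..1}" and e: "e > 0"
  obtain d where d: "d > 0" "\<And>u v. u \<le> x \<and> x \<le> v \<and> v - u < d \<and> 0 \<le> u \<and> v \<le> 1 \<Longrightarrow> curve_length u v p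
      < ennreal e"
    using curve_length_small[OF cont finite_length, of x e] x e by auto
  have "dist (arclen p y) (arclen p x) < e" if y: "y \<in> {0..1}" "dist y x < d" for y
  proof (cases "y \<le> x")
    case True
    then show ?thesis using d(2)[of y x] curve_length_arclen[of y x] x y by (auto simp:
        dist_real_def ennreal_less_iff)
  next
    case False
    then show ?thesis using d(2)[of x y] curve_length_arclen[of x y] x y by (auto simp:
        dist_real_def ennreal_less_iff)
  qed
  then show "\<exists>d>0. \<forall>y\<in>{0..1}. dist y x < d \<longrightarrow> dist (arclen p y) (arclen p x) < e" using d(1) by blast
qed

lemma arclen_surj:
  assumes "0 \<le> l" "l \<le> arclen p 1"
  obtains t where "t \<in> {0..1}" "arclen p t = l"
  using IVT'[of "arclen p" 0 l 1] assms continuous_on_arclen by auto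

end

lemma diameter_le_metric:
  assumes "S \<noteq> {}" "\<And>x y. x \<in> S \<Longrightarrow> y \<in> S \<Longrightarrow> dist x y \<le> d"
  shows "diameter S \<le> d"
  using assms by (auto simp: diameter_def intro!: cSUP_least)

lemma curve_length_dist_le:
  assumes "curve_length a b p \<le> ennreal l" "0 \<le> l" "s \<in> {a..b}" "t \<in> {a..b}"
  shows "dist (p s) (p t) \<le> l"
proof -
  have "ennreal (dist (p (min s t)) (p (max s t))) \<le> curve_length a b p"
    using assms by (intro dist_le_curve_length) auto
  also have "\<dots> \<le> ennreal l" by (rule assms)
  finally have "dist (p (min s t)) (p (max s t)) \<le> l" using assms(2) by simp
  then show ?thesis by (simp add: min_def max_def dist_commute split: if_splits)
qed

lemma diameter_image_le_curve_length:
  assumes "curve_length a b p \<le> ennreal l" "0 \<le> l" "a \<le> b"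
  shows "diameter (p ` {a..b}) \<le> l"
  using assms by (intro diameter_le_metric) (auto intro!: curve_length_dist_le)

section \<open>Rectifiable loops and lassos in a geodesic space\<close>

lemma (in based_space) pclass_tau:
  assumes x: "x \<in> topspace T"
  shows "pclass (\<tau> x) = \<one>\<^bsub>fundamental_group T b\<^esub>"
proof -
  let ?H = "homotopic_pathsin T"
  have "?H (joinin (joinin (\<lambda>_. b) (\<tau> x)) (reversein (\<tau> x))) (joinin (\<tau> x) (reversein (\<tau> x)))"
    using x by (intro homotopic_pathsin_join homotopic_pathsin_lid homotopic_pathsin_refl)
      (auto simp: tau pathin_reversein)
  also have "?H \<dots> (\<lambda>_. \<tau> x 0)"
    using x by (intro homotopic_pathsin_rinv tau)
  finally show ?thesis
    using x const_loopsin[OF base] based_loop[of "\<tau> x"] unfolding pclass_def one_fundamental_group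
    by (intro loop_class_eq_if_homotopic) (auto simp: tau tau_base)
qed

locale pointed_geodesic =
  fixes X :: "'a::metric_space set" and b :: 'a
  assumes compact: "compact X" and geodesic: "geodesic_space X" and base_in: "b \<in> X"
begin

abbreviation "\<G> \<equiv> fundamental_group (top_of_set X) b"

definition rect :: "(real \<Rightarrow> 'a) \<Rightarrow> bool" where
  "rect p \<longleftrightarrow> pathin (top_of_set X) p \<and> curve_length 0 1 p < \<infinity>"

definition geo :: "'a \<Rightarrow> 'a \<Rightarrow> real \<Rightarrow> 'a" where
  "geo x y = (SOME g. geodesic_on X 0 1 g \<and> g 0 = x \<and> g 1 = y)"

text \<open>Geodesics as connecting paths have finite length, so the loop that represents the class
  of a rectifiable path is again rectifiable. The constant path at \<open>b\<close> is what
  \<open>tau_base\<close> asks for.\<close>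

definition tau :: "'a \<Rightarrow> real \<Rightarrow> 'a" where
  "tau x = (if x = b then (\<lambda>_. b) else geo b x)"

lemma pathin_X: "pathin (top_of_set X) p \<longleftrightarrow> continuous_on {0..1} p \<and> p ` {0..1} \<subseteq> X"
  by (auto simp: pathin_def)

lemma geo:
  assumes "x \<in> X" "y \<in> X"
  shows "pathin (top_of_set X) (geo x y)" "geo x y 0 = x" "geo x y 1 = y"
    "curve_length 0 1 (geo x y) = ennreal (dist x y)"
proof -
  have "\<exists>g. geodesic_on X 0 1 g \<and> g 0 = x \<and> g 1 = y"
    using geodesic assms by (auto simp: geodesic_space_def pathstart_def pathfinish_def)
  from someI_ex[OF this] have "geodesic_on X 0 1 (geo x y) \<and> geo x y 0 = x \<and> geo x y 1 = y"
    by (simp add: geo_def)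
  then show "pathin (top_of_set X) (geo x y)" "geo x y 0 = x" "geo x y 1 = y"
    "curve_length 0 1 (geo x y) = ennreal (dist x y)"
    by (auto simp: pathin_X geodesic_on_def)
qed

lemma rect_pathin: "rect p \<Longrightarrow> pathin (top_of_set X) p"
  by (simp add: rect_def)

lemma rect_geo: "x \<in> X \<Longrightarrow> y \<in> X \<Longrightarrow> rect (geo x y)"
  by (simp add: rect_def geo)

lemma rect_in_X: "rect p \<Longrightarrow> t \<in> {0..1} \<Longrightarrow> p t \<in> X"
  using pathin_topspace[of "top_of_set X" p t] by (simp add: rect_def)

lemma rect_join: "rect p \<Longrightarrow> rect q \<Longrightarrow> p 1 = q 0 \<Longrightarrow> rect (joinin p q)"
  by (auto simp: rect_def pathin_joinin curve_length_joinin)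

lemma rect_reverse: "rect p \<Longrightarrow> rect (reversein p)"
  by (auto simp: rect_def pathin_reversein)

lemma rect_const: "x \<in> X \<Longrightarrow> rect (\<lambda>_. x)"
  by (simp add: rect_def)

lemma rect_subpath: "rect p \<Longrightarrow> 0 \<le> s \<Longrightarrow> s \<le> t \<Longrightarrow> t \<le> 1 \<Longrightarrow> rect (subpathin s t p)"
  using le_less_trans[OF curve_length_mono[of 0 s t 1 p]]
  by (auto simp: rect_def pathin_subpathin curve_length_subpathin)

lemma rect_tau: "x \<in> X \<Longrightarrow> rect (tau x)"
  by (simp add: tau_def rect_geo rect_const base_in)

sublocale base: based_space "top_of_set X" b tau
  by unfold_locales (auto simp: tau_def geo base_in)

definition rect_classes :: "(real \<Rightarrow> 'a) set set" where
  "rect_classes = base.pclass ` {p. rect p \<and> p 0 = b \<and> p 1 = b}"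

lemma pclass_rect:
  assumes p: "rect p"
  shows "base.pclass p \<in> rect_classes"
proof -
  let ?q = "joinin (joinin (tau (p 0)) p) (reversein (tau (p 1)))"
  have "p 0 \<in> X" "p 1 \<in> X" using rect_in_X[OF p] by auto
  then have "rect ?q" "?q 0 = b" "?q 1 = b"
    using p base.tau by (auto intro!: rect_join rect_reverse rect_tau)
  moreover have "base.pclass ?q = base.pclass p"
    using base.pclass_loop[OF base.based_loop[OF rect_pathin[OF p]]] by (simp add: base.pclass_def)
  ultimately show ?thesis unfolding rect_classes_def by (intro image_eqI[of _ _ ?q]) auto
qed

lemma subgroup_rect_classes: "subgroup rect_classes \<G>"
proof (rule base.subgroupI)
  show "rect_classes \<subseteq> carrier \<G>"
    unfolding rect_classes_def using base.pclass_closed rect_pathin by blast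
  show "rect_classes \<noteq> {}" using pclass_rect[OF rect_const[OF base_in]] by blast
  fix a assume "a \<in> rect_classes"
  then obtain p where p: "rect p" "p 0 = b" "p 1 = b" "a = base.pclass p" by (auto simp:
      rect_classes_def)
  show "inv\<^bsub>\<G>\<^esub> a \<in> rect_classes"
    using pclass_rect[OF rect_reverse[OF p(1)]] p base.pclass_reverse[OF rect_pathin[OF p(1)]] by simp
  fix a' assume "a' \<in> rect_classes"
  then obtain q where q: "rect q" "q 0 = b" "q 1 = b" "a' = base.pclass q" by (auto simp:
      rect_classes_def)
  show "a \<otimes>\<^bsub>\<G>\<^esub> a' \<in> rect_classes"
    using pclass_rect[OF rect_join[OF p(1) q(1)]] p q base.pclass_join[OF rect_pathin[OF p(1)]
        rect_pathin[OF q(1)]]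
    by simp
qed

definition lasso_classes :: "real \<Rightarrow> (real \<Rightarrow> 'a) set set" where
  "lasso_classes r = {base.pclass \<gamma> \<otimes>\<^bsub>\<G>\<^esub> base.pclass \<beta> \<otimes>\<^bsub>\<G>\<^esub> inv\<^bsub>\<G>\<^esub> base.pclass \<gamma> | \<gamma> \<beta>.
     rect \<gamma> \<and> \<gamma> 0 = b \<and> pathin (top_of_set X) \<beta> \<and> \<beta> 0 = \<gamma> 1 \<and> \<beta> 1 = \<gamma> 1 \<and> curve_length 0 1 \<beta> <
         ennreal r}"

lemma lasso_classesE:
  assumes "a \<in> lasso_classes r"
  obtains \<gamma> \<beta> where "rect \<gamma>" "\<gamma> 0 = b" "pathin (top_of_set X) \<beta>" "\<beta> 0 = \<gamma> 1" "\<beta> 1 = \<gamma> 1"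
    "curve_length 0 1 \<beta> < ennreal r" "a = base.pclass \<gamma> \<otimes>\<^bsub>\<G>\<^esub> base.pclass \<beta> \<otimes>\<^bsub>\<G>\<^esub> inv\<^bsub>\<G>\<^esub> base.pclass \<gamma>"
  using assms unfolding lasso_classes_def by blast

lemma lasso_loop:
  assumes "pathin (top_of_set X) \<gamma>" "\<gamma> 0 = b" "pathin (top_of_set X) \<beta>" "\<beta> 0 = \<gamma> 1" "\<beta> 1 = \<gamma> 1"
  shows "\<gamma> +++ \<beta> +++ reversepath \<gamma> \<in> loopsin (top_of_set X) b"
  using assms unfolding joinpaths_eq_joinin reversepath_eq_reversein
  by (auto simp: loopsin_def pathin_joinin pathin_reversein)

lemma lasso_class:
  assumes "pathin (top_of_set X) \<gamma>" "\<gamma> 0 = b" "pathin (top_of_set X) \<beta>" "\<beta> 0 = \<gamma> 1" "\<beta> 1 = \<gamma> 1"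
  shows "loop_class (top_of_set X) b (\<gamma> +++ \<beta> +++ reversepath \<gamma>) =
    base.pclass \<gamma> \<otimes>\<^bsub>\<G>\<^esub> base.pclass \<beta> \<otimes>\<^bsub>\<G>\<^esub> inv\<^bsub>\<G>\<^esub> base.pclass \<gamma>"
proof -
  have "loop_class (top_of_set X) b (\<gamma> +++ \<beta> +++ reversepath \<gamma>) = base.pclass (joinin \<gamma> (joinin \<beta>
      (reversein \<gamma>)))"
    using base.pclass_loop[OF lasso_loop[OF assms]] by (simp add: joinpaths_eq_joinin
        reversepath_eq_reversein)
  also have "\<dots> = base.pclass \<gamma> \<otimes>\<^bsub>\<G>\<^esub> (base.pclass \<beta> \<otimes>\<^bsub>\<G>\<^esub> base.pclass (reversein \<gamma>))"
    using assms by (simp add: base.pclass_join pathin_joinin pathin_reversein)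
  finally show ?thesis using assms by (simp add: base.pclass_reverse base.m_assoc)
qed

lemma path_X: "path p \<and> path_image p \<subseteq> X \<longleftrightarrow> pathin (top_of_set X) p"
  by (simp add: pathin_X path_def path_image_def)

lemma finite_path_from_iff: "finite_path_from X b \<gamma> \<longleftrightarrow> rect \<gamma> \<and> \<gamma> 0 = b"
  using path_X[of \<gamma>] by (auto simp: finite_path_from_def rect_def pathstart_def)

lemma loop_in_iff: "loop_in X \<beta> \<longleftrightarrow> pathin (top_of_set X) \<beta> \<and> \<beta> 1 = \<beta> 0"
  using path_X[of \<beta>] by (auto simp: loop_in_def pathstart_def pathfinish_def)

lemma lasso_group_eq: "lasso_group X b r = generate \<G> (lasso_classes r)"
proof -
  have "loop_class (top_of_set X) b ` (\<Union>l\<in>{..<ennreal r}. lassos X b l) = lasso_classes r"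
  proof (intro subset_antisym subsetI)
    fix a assume "a \<in> loop_class (top_of_set X) b ` (\<Union>l\<in>{..<ennreal r}. lassos X b l)"
    then obtain \<gamma> \<beta> where a: "a = loop_class (top_of_set X) b (\<gamma> +++ \<beta> +++ reversepath \<gamma>)"
      and \<gamma>: "finite_path_from X b \<gamma>" and \<beta>: "loop_in X \<beta>" "pathstart \<beta> = pathfinish \<gamma>"
          "curve_length 0 1 \<beta> < ennreal r"
      by (auto simp: lassos_def)
    have "rect \<gamma>" "\<gamma> 0 = b" "pathin (top_of_set X) \<beta>" "\<beta> 0 = \<gamma> 1" "\<beta> 1 = \<gamma> 1"
      using \<gamma> \<beta> by (auto simp: finite_path_from_iff loop_in_iff pathstart_def pathfinish_def)
    then show "a \<in> lasso_classes r"
      unfolding a lasso_classes_def using \<beta>(3) by (subst lasso_class) (auto intro: rect_pathin)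
  next
    fix a assume "a \<in> lasso_classes r"
    then obtain \<gamma> \<beta> where \<gamma>: "rect \<gamma>" "\<gamma> 0 = b" and \<beta>: "pathin (top_of_set X) \<beta>" "\<beta> 0 = \<gamma> 1" "\<beta> 1
        = \<gamma> 1"
      and l: "curve_length 0 1 \<beta> < ennreal r" and a: "a = base.pclass \<gamma> \<otimes>\<^bsub>\<G>\<^esub> base.pclass \<beta> \<otimes>\<^bsub>\<G>\<^esub> inv\<^bsub>\<G>\<^esub>
          base.pclass \<gamma>"
      by (rule lasso_classesE)
    have "\<gamma> +++ \<beta> +++ reversepath \<gamma> \<in> lassos X b (curve_length 0 1 \<beta>)"
      unfolding lassos_def using \<gamma> \<beta>
      by (intro CollectI exI[of _ \<gamma>] exI[of _ \<beta>]) (simp add: finite_path_from_iff loop_in_iff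
          pathstart_def pathfinish_def)
    moreover have "a = loop_class (top_of_set X) b (\<gamma> +++ \<beta> +++ reversepath \<gamma>)"
      using a \<gamma> \<beta> by (simp add: lasso_class rect_pathin)
    ultimately show "a \<in> loop_class (top_of_set X) b ` (\<Union>l\<in>{..<ennreal r}. lassos X b l)" using l
        by blast
  qed
  then show ?thesis by (simp add: lasso_group_def)
qed

lemma finite_length_rect: "pathin (top_of_set X) \<beta> \<Longrightarrow> curve_length 0 1 \<beta> < ennreal r \<Longrightarrow> rect \<beta>"
  using less_trans[of "curve_length 0 1 \<beta>" "ennreal r" \<infinity>] by (simp add: rect_def)

lemma lasso_classes_rect: "lasso_classes r \<subseteq> rect_classes"
proof
  fix a assume "a \<in> lasso_classes r"
  then obtain \<gamma> \<beta> where "rect \<gamma>" "rect \<beta>" and a: "a = base.pclass \<gamma> \<otimes>\<^bsub>\<G>\<^esub> base.pclass \<beta> \<otimes>\<^bsub>\<G>\<^esub> inv\<^bsub>\<G>\<^esub>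
      base.pclass \<gamma>"
    unfolding lasso_classes_def using finite_length_rect by blast
  then show "a \<in> rect_classes"
    unfolding a by (intro subgroup.m_closed[OF subgroup_rect_classes] subgroup.m_inv_closed[OF
        subgroup_rect_classes] pclass_rect)
qed

lemma lasso_classes_carrier: "lasso_classes r \<subseteq> carrier \<G>"
  using lasso_classes_rect subgroup.subset[OF subgroup_rect_classes] by blast

lemma lasso_group_rect: "lasso_group X b r \<subseteq> rect_classes"
  unfolding lasso_group_eq using lasso_classes_rect subgroup_rect_classes by (rule
      base.generate_subgroup_incl)

lemma subgroup_lasso_group: "subgroup (lasso_group X b r) \<G>"
  unfolding lasso_group_eq using lasso_classes_carrier by (rule base.generate_is_subgroup)

lemma lasso_group_mono:
  assumes "r \<le> s"
  shows "lasso_group X b r \<subseteq> lasso_group X b s"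
proof -
  have "curve_length 0 1 \<beta> < ennreal s" if "curve_length 0 1 \<beta> < ennreal r" for \<beta> :: "real \<Rightarrow> 'a"
    using that assms by (meson ennreal_leI less_le_trans)
  then have "lasso_classes r \<subseteq> lasso_classes s" unfolding lasso_classes_def by blast
  then show ?thesis unfolding lasso_group_eq by (rule base.mono_generate)
qed

text \<open>The tail \<open>tau (\<beta> 0)\<close> has trivial class, so the lasso formed with it
  has the same class as \<beta>. Thus short loops anywhere in \<open>X\<close> count as members,
  without explicit tails.\<close>

lemma small_loop_in_lasso_group:
  assumes \<beta>: "pathin (top_of_set X) \<beta>" "\<beta> 1 = \<beta> 0" and l: "curve_length 0 1 \<beta> < ennreal r"
  shows "base.pclass \<beta> \<in> lasso_group X b r"
proof -
  have x: "\<beta> 0 \<in> X" using \<beta> by (auto simp: pathin_X)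
  have "base.pclass (tau (\<beta> 0)) \<otimes>\<^bsub>\<G>\<^esub> base.pclass \<beta> \<otimes>\<^bsub>\<G>\<^esub> inv\<^bsub>\<G>\<^esub> base.pclass (tau (\<beta> 0)) \<in> lasso_classes r"
    unfolding lasso_classes_def using x l \<beta> rect_tau[OF x] base.tau[of "\<beta> 0"]
    by (intro CollectI exI[of _ "tau (\<beta> 0)"] exI[of _ \<beta>]) simp
  then have "base.pclass \<beta> \<in> lasso_classes r"
    using x \<beta> base.pclass_tau[of "\<beta> 0"] by simp
  then show ?thesis unfolding lasso_group_eq by (rule generate.incl)
qed

text \<open>Conjugation by a rectifiable loop only prolongs the tail of a lasso. A tail must have
  finite length, which is why \<open>g\<close> ranges over \<open>rect_classes\<close> and not over
  all of \<open>\<G>\<close>.\<close>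

lemma conj_lasso_classes:
  assumes g: "g \<in> rect_classes" and h: "h \<in> lasso_classes r"
  shows "g \<otimes>\<^bsub>\<G>\<^esub> h \<otimes>\<^bsub>\<G>\<^esub> inv\<^bsub>\<G>\<^esub> g \<in> lasso_classes r"
proof -
  obtain p where p: "rect p" "p 0 = b" "p 1 = b" "g = base.pclass p" using g by (auto simp:
      rect_classes_def)
  obtain \<gamma> \<beta> where \<gamma>: "rect \<gamma>" "\<gamma> 0 = b" and \<beta>: "pathin (top_of_set X) \<beta>" "\<beta> 0 = \<gamma> 1" "\<beta> 1 = \<gamma> 1"
    and l: "curve_length 0 1 \<beta> < ennreal r" and h: "h = base.pclass \<gamma> \<otimes>\<^bsub>\<G>\<^esub> base.pclass \<beta> \<otimes>\<^bsub>\<G>\<^esub> inv\<^bsub>\<G>\<^esub>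
        base.pclass \<gamma>"
    using h by (rule lasso_classesE)
  have "base.pclass (joinin p \<gamma>) = g \<otimes>\<^bsub>\<G>\<^esub> base.pclass \<gamma>"
    using p \<gamma> by (simp add: base.pclass_join rect_pathin)
  then have "g \<otimes>\<^bsub>\<G>\<^esub> h \<otimes>\<^bsub>\<G>\<^esub> inv\<^bsub>\<G>\<^esub> g =
      base.pclass (joinin p \<gamma>) \<otimes>\<^bsub>\<G>\<^esub> base.pclass \<beta> \<otimes>\<^bsub>\<G>\<^esub> inv\<^bsub>\<G>\<^esub> base.pclass (joinin p \<gamma>)"
    unfolding h using \<gamma> \<beta> p by (simp add: base.m_assoc base.inv_mult_group rect_pathin)
  moreover have "rect (joinin p \<gamma>)" using p \<gamma> by (auto intro: rect_join)
  ultimately show ?thesis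
    unfolding lasso_classes_def using p \<beta> l
    by (intro CollectI exI[of _ "joinin p \<gamma>"] exI[of _ \<beta>]) simp
qed

section \<open>The quotient of rectifiable classes by short lassos\<close>

definition rect_group :: "(real \<Rightarrow> 'a) set monoid" where
  "rect_group = \<G>\<lparr>carrier := rect_classes\<rparr>"

lemma group_rect_group: "group rect_group"
  unfolding rect_group_def by (rule base.subgroup_imp_group[OF subgroup_rect_classes])

lemma rect_group_simps [simp]:
  "carrier rect_group = rect_classes" "mult rect_group = mult \<G>" "one rect_group = one \<G>"
  by (simp_all add: rect_group_def)

lemma inv_rect_group: "a \<in> rect_classes \<Longrightarrow> inv\<^bsub>rect_group\<^esub> a = inv\<^bsub>\<G>\<^esub> a"
  unfolding rect_group_def by (rule base.m_inv_consistent[OF subgroup_rect_classes])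

lemma normal_lasso_group: "lasso_group X b r \<lhd> rect_group"
proof -
  interpret RG: group rect_group by (rule group_rect_group)
  have "generate rect_group (lasso_classes r) \<lhd> rect_group"
    by (rule RG.normal_generateI) (simp_all add: lasso_classes_rect conj_lasso_classes inv_rect_group)
  then show ?thesis
    unfolding lasso_group_eq rect_group_def
    using base.generate_consistent[OF lasso_classes_rect subgroup_rect_classes] by simp
qed

lemma conj_lasso_group:
  "g \<in> rect_classes \<Longrightarrow> h \<in> lasso_group X b r \<Longrightarrow> g \<otimes>\<^bsub>\<G>\<^esub> h \<otimes>\<^bsub>\<G>\<^esub> inv\<^bsub>\<G>\<^esub> g \<in> lasso_group X b r"
  using normal.inv_op_closed2[OF normal_lasso_group] by (simp add: inv_rect_group)

definition lasso_quotient :: "real \<Rightarrow> (real \<Rightarrow> 'a) set set monoid" where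
  "lasso_quotient r = rect_group Mod (lasso_group X b r)"

definition quotient_class :: "real \<Rightarrow> (real \<Rightarrow> 'a) set \<Rightarrow> (real \<Rightarrow> 'a) set set" where
  "quotient_class r a = lasso_group X b r #>\<^bsub>rect_group\<^esub> a"

lemma group_lasso_quotient: "group (lasso_quotient r)"
  unfolding lasso_quotient_def using normal_lasso_group by (rule normal.factorgroup_is_group)

lemma quotient_class_closed: "a \<in> rect_classes \<Longrightarrow> quotient_class r a \<in> carrier (lasso_quotient r)"
  and quotient_class_mult: "a \<in> rect_classes \<Longrightarrow> a' \<in> rect_classes \<Longrightarrow>
    quotient_class r (a \<otimes>\<^bsub>\<G>\<^esub> a') = quotient_class r a \<otimes>\<^bsub>lasso_quotient r\<^esub> quotient_class r a'"
  using normal.r_coset_hom_Mod[OF normal_lasso_group[of r]]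
  unfolding lasso_quotient_def quotient_class_def hom_def by auto

lemma quotient_class_eq_one:
  assumes "a \<in> rect_classes"
  shows "quotient_class r a = \<one>\<^bsub>lasso_quotient r\<^esub> \<longleftrightarrow> a \<in> lasso_group X b r"
proof -
  have "subgroup (lasso_group X b r) rect_group"
    using normal_lasso_group by (simp add: normal_def)
  then show ?thesis
    using group.coset_join1[OF group_rect_group] group.coset_join2[OF group_rect_group] assms
    unfolding lasso_quotient_def quotient_class_def by auto
qed

lemma quotient_class_eq_iff:
  assumes a: "a \<in> rect_classes" "a' \<in> rect_classes"
  shows "quotient_class r a = quotient_class r a' \<longleftrightarrow> a \<otimes>\<^bsub>\<G>\<^esub> inv\<^bsub>\<G>\<^esub> a' \<in> lasso_group X b r"
proof -
  interpret Q: group "lasso_quotient r" by (rule group_lasso_quotient)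
  note sub = subgroup_rect_classes
  have cl: "a \<in> carrier \<G>" "a' \<in> carrier \<G>" using a subgroup.subset[OF sub] by auto
  have i: "inv\<^bsub>\<G>\<^esub> a' \<in> rect_classes" using subgroup.m_inv_closed[OF sub a(2)] .
  have d: "a \<otimes>\<^bsub>\<G>\<^esub> inv\<^bsub>\<G>\<^esub> a' \<in> rect_classes" using subgroup.m_closed[OF sub a(1) i] .
  have "a = a \<otimes>\<^bsub>\<G>\<^esub> inv\<^bsub>\<G>\<^esub> a' \<otimes>\<^bsub>\<G>\<^esub> a'" using cl by (simp add: base.m_assoc)
  then have "quotient_class r a = quotient_class r (a \<otimes>\<^bsub>\<G>\<^esub> inv\<^bsub>\<G>\<^esub> a') \<otimes>\<^bsub>lasso_quotient r\<^esub> quotient_class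
      r a'"
    using quotient_class_mult[OF d a(2), of r] by simp
  then have "quotient_class r a = quotient_class r a' \<longleftrightarrow> quotient_class r (a \<otimes>\<^bsub>\<G>\<^esub> inv\<^bsub>\<G>\<^esub> a') =
      \<one>\<^bsub>lasso_quotient r\<^esub>"
    using quotient_class_closed[OF a(2), of r] quotient_class_closed[OF d, of r] by (metis
        Q.r_cancel_one')
  then show ?thesis using quotient_class_eq_one[OF d] by simp
qed

end

section \<open>Sampling paths in Rips complexes\<close>

lemma (in simplicial_complex) based_complex_exists:
  assumes b: "{b} \<in> K" and conn: "\<And>v. {v} \<in> K \<Longrightarrow> \<exists>vs. chain K vs \<and> hd vs = b \<and> last vs = v"
  shows "\<exists>\<tau>. based_complex K b \<tau>"
proof -
  have ex: "\<exists>p. pathin \<R> p \<and> p 0 = vertex b \<and> p 1 = f" if f: "f \<in> topspace \<R>" for f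
  proof -
    obtain v where v: "f v > 0" using ex_pos[OF f] by blast
    note sup = topspace_support[OF f]
    have vs: "v \<in> support f" using support_pos[OF f] v by blast
    then have "{v} \<in> K" using face[OF sup(1), of "{v}"] by simp
    then obtain vs where vs': "chain K vs" "hd vs = b" "last vs = v" using conn by blast
    have ne: "vs \<noteq> []" using vs'(1) by (simp add: chain_def)
    have "pathin \<R> (linear_path (vertex v) f)"
      using vertex_simplex[OF finite_simplex[OF sup(1)] vs] sup by (intro pathin_linear_path)
    then have "pathin \<R> (joinin (edge_path vs) (linear_path (vertex v) f))"
      using edge_path_ends[OF ne] vs' by (intro pathin_joinin pathin_edge_path) auto
    then show ?thesis using edge_path_ends[OF ne] vs' by force
  qed
  define \<tau> where "\<tau> f = (if f = vertex b then (\<lambda>_. vertex b) else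
    (SOME p. pathin \<R> p \<and> p 0 = vertex b \<and> p 1 = f))" for f
  have "pathin \<R> (\<tau> f) \<and> \<tau> f 0 = vertex b \<and> \<tau> f 1 = f" if "f \<in> topspace \<R>" for f
    using someI_ex[OF ex[OF that]] that by (auto simp: \<tau>_def)
  then have "based_complex K b \<tau>"
    by unfold_locales (auto simp: \<tau>_def vertex_topspace[OF b])
  then show ?thesis by blast
qed

context pointed_geodesic
begin

lemma bounded_subset_X: "U \<subseteq> X \<Longrightarrow> bounded U"
  using compact compact_imp_bounded bounded_subset by blast

lemma dist_less_diameter: "U \<subseteq> X \<Longrightarrow> diameter U < s \<Longrightarrow> x \<in> U \<Longrightarrow> y \<in> U \<Longrightarrow> dist x y < s"
  using diameter_bounded_bound[OF bounded_subset_X] by (meson le_less_trans)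

lemma ripsI:
  assumes "\<sigma> \<subseteq> X" "finite \<sigma>" "\<sigma> \<noteq> {}" "\<And>x y. x \<in> \<sigma> \<Longrightarrow> y \<in> \<sigma> \<Longrightarrow> dist x y < s"
  shows "\<sigma> \<in> rips X s"
proof -
  let ?D = "(\<lambda>(x, y). dist x y) ` (\<sigma> \<times> \<sigma>)"
  have fin: "finite ?D" "?D \<noteq> {}" using assms by auto
  have "diameter \<sigma> \<le> Max ?D"
    using assms fin by (intro diameter_le_metric Max_ge) auto
  also have "Max ?D < s" using fin assms(4) by (subst Max_less_iff) auto
  finally show ?thesis using assms by (simp add: rips_def)
qed

lemma rips_mono: "s \<le> s' \<Longrightarrow> rips X s \<subseteq> rips X s'"
  by (auto simp: rips_def)

lemma simplicial_complex_rips: "simplicial_complex (rips X s)"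
proof
  fix \<sigma> \<tau> assume "\<sigma> \<in> rips X s" and \<tau>: "\<tau> \<subseteq> \<sigma>" "\<tau> \<noteq> {}"
  then have \<sigma>: "\<sigma> \<subseteq> X" "finite \<sigma>" "diameter \<sigma> < s" by (auto simp: rips_def)
  have "diameter \<tau> \<le> diameter \<sigma>" using \<tau> \<sigma> by (intro diameter_subset bounded_subset_X) auto
  then show "\<tau> \<in> rips X s" using \<tau> \<sigma> finite_subset by (auto simp: rips_def)
qed (auto simp: rips_def)

definition small_sets :: "real \<Rightarrow> 'a set set" where
  "small_sets s = {U. U \<subseteq> X \<and> diameter U < s}"

lemma small_sets_nbhd:
  assumes x: "x \<in> X" and s: "s > 0"
  shows "\<exists>V U. openin (top_of_set X) V \<and> x \<in> V \<and> U \<in> small_sets s \<and> V \<subseteq> U"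
proof -
  \<comment> \<open>Radius \<open>s / 3\<close> bounds the diameter by \<open>2 * s / 3\<close>,
    which is strictly below \<open>s\<close>.\<close>
  let ?V = "X \<inter> ball x (s / 3)"
  have "diameter ?V \<le> 2 * s / 3"
  proof (rule diameter_le_metric)
    fix y z assume "y \<in> ?V" "z \<in> ?V"
    then have "dist x y < s / 3" "dist x z < s / 3" by auto
    then show "dist y z \<le> 2 * s / 3" using dist_triangle3[of y z x] by linarith
  qed (use x s in auto)
  then have "?V \<in> small_sets s" using s by (auto simp: small_sets_def)
  moreover have "openin (top_of_set X) ?V" by auto
  ultimately show ?thesis using x s by (intro exI[of _ ?V]) auto
qed

text \<open>Fine subdivisions were constructed for the cover of a local cocycle. The constant
  cocycle makes them available before a fundamental group of a Rips complex has been set up;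
  connectedness of the complex relies on them.\<close>

lemma local_cocycle_trivial:
  assumes "s > 0"
  shows "local_cocycle \<G> (top_of_set X) (small_sets s) (\<lambda>_ _. \<one>\<^bsub>\<G>\<^esub>)"
  by unfold_locales (use small_sets_nbhd assms in auto)

lemma sampling_exists:
  assumes "s > 0" "e > 0" "pathin (top_of_set X) p"
  obtains ts where "ts \<noteq> []" "sorted_wrt (<) ts" "hd ts = 0" "last ts = 1" "set ts \<subseteq> {0..1}"
    "\<And>i. Suc i < length ts \<Longrightarrow> ts ! Suc i - ts ! i < e \<and> (\<exists>U\<in>small_sets s. p ` {ts ! i..ts ! Suc i}
        \<subseteq> U)"
  using local_cocycle.subdivision_exists[OF local_cocycle_trivial[OF assms(1)] assms(3,2)] by metis

lemma chain_sample:
  assumes s: "s > 0" and ts: "ts \<noteq> []" "sorted ts" "p ` set ts \<subseteq> X"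
    and small: "\<And>i. Suc i < length ts \<Longrightarrow> \<exists>U\<in>small_sets s. p ` {ts ! i..ts ! Suc i} \<subseteq> U"
  shows "chain (rips X s) (map p ts)"
  unfolding chain_def
proof (intro conjI ballI allI impI)
  fix v assume "v \<in> set (map p ts)"
  then show "{v} \<in> rips X s" using ts s by (intro ripsI) auto
next
  fix i assume i: "Suc i < length (map p ts)"
  then obtain U where U: "U \<in> small_sets s" "p ` {ts ! i..ts ! Suc i} \<subseteq> U" using small[of i] by auto
  have "ts ! i \<le> ts ! Suc i" using i ts(2) by (auto simp: sorted_nth_mono)
  then have "p (ts ! i) \<in> U" "p (ts ! Suc i) \<in> U" using U by auto
  then show "{map p ts ! i, map p ts ! Suc i} \<in> rips X s"
    using i U dist_less_diameter[of U s] s by (intro ripsI) (auto simp: small_sets_def)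
qed (use ts in auto)

definition rips_tau :: "real \<Rightarrow> ('a \<Rightarrow> real) \<Rightarrow> real \<Rightarrow> 'a \<Rightarrow> real" where
  "rips_tau s = (SOME \<tau>. based_complex (rips X s) b \<tau>)"

lemma based_complex_rips:
  assumes s: "s > 0"
  shows "based_complex (rips X s) b (rips_tau s)"
proof -
  interpret simplicial_complex "rips X s" by (rule simplicial_complex_rips)
  have "\<exists>vs. chain (rips X s) vs \<and> hd vs = b \<and> last vs = v" if v: "{v} \<in> rips X s" for v
  proof -
    have v: "v \<in> X" using v by (simp add: rips_def)
    note g = geo[OF base_in v]
    obtain ts where ts: "ts \<noteq> []" "sorted_wrt (<) ts" "hd ts = 0" "last ts = 1" "set ts \<subseteq> {0..1}"
      "\<And>i. Suc i < length ts \<Longrightarrow> ts ! Suc i - ts ! i < 1 \<and> (\<exists>U\<in>small_sets s. geo b v ` {ts ! i..ts !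
          Suc i} \<subseteq> U)"
      using sampling_exists[OF s zero_less_one g(1)] by blast
    have "chain (rips X s) (map (geo b v) ts)"
    proof (intro chain_sample s)
      show "geo b v ` set ts \<subseteq> X" using ts(5) g(1) unfolding pathin_X by blast
    qed (use ts in \<open>auto simp: strict_sorted_imp_sorted\<close>)
    then show ?thesis using ts g by (intro exI[of _ "map (geo b v) ts"]) (auto simp: hd_map last_map)
  qed
  moreover have "{b} \<in> rips X s" using s base_in by (intro ripsI) auto
  ultimately show ?thesis
    unfolding rips_tau_def by (intro someI_ex[of "\<lambda>\<tau>. based_complex (rips X s) b \<tau>"]
        based_complex_exists) auto
qed

fun fill :: "'a list \<Rightarrow> real \<Rightarrow> 'a" where
  "fill (x # y # ys) = joinin (geo x y) (fill (y # ys))"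
| "fill [x] = (\<lambda>_. x)"
| "fill [] = (\<lambda>_. b)"

lemma fill:
  assumes "vs \<noteq> []" "set vs \<subseteq> X"
  shows "rect (fill vs) \<and> fill vs 0 = hd vs \<and> fill vs 1 = last vs"
  using assms
proof (induction vs rule: fill.induct)
  case (1 x y ys)
  then have "rect (joinin (geo x y) (fill (y # ys)))"
    by (intro rect_join) (auto simp: rect_geo geo)
  then show ?case using 1 by (auto simp: geo)
qed (auto simp: rect_const)

end

section \<open>Transport into the fundamental group of one Rips complex\<close>

locale rips_scale = pointed_geodesic X b for X :: "'a::metric_space set" and b +
  fixes s :: real
  assumes s_pos: "s > 0"
begin

abbreviation "\<P> \<equiv> fundamental_group (realisation (rips X s)) (vertex b)"

sublocale rips: based_complex "rips X s" b "rips_tau s"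
  by (rule based_complex_rips[OF s_pos])

lemma small_triple: "U \<in> small_sets s \<Longrightarrow> x \<in> U \<Longrightarrow> y \<in> U \<Longrightarrow> z \<in> U \<Longrightarrow> {x, y, z} \<in> rips X s"
  using dist_less_diameter[of U s] by (intro ripsI) (auto simp: small_sets_def)

sublocale sampling: local_cocycle \<P> "top_of_set X" "small_sets s" rips.edge_class
proof
  fix U x y assume "U \<in> small_sets s" "x \<in> U" "y \<in> U"
  then show "rips.edge_class x y \<in> carrier \<P>"
    using small_triple[of U x y y] by (intro rips.edge_class_closed) simp
next
  fix U x y z assume "U \<in> small_sets s" "x \<in> U" "y \<in> U" "z \<in> U"
  then show "rips.edge_class x y \<otimes>\<^bsub>\<P>\<^esub> rips.edge_class y z = rips.edge_class x z"
    by (intro rips.edge_class_mult small_triple)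
qed (use small_sets_nbhd s_pos in auto)

abbreviation "\<Psi> \<equiv> sampling.transport"

lemma transport_eq_pclass:
  assumes p: "pathin (top_of_set X) p" and ts: "ts \<noteq> []" "sorted ts" "set ts \<subseteq> {0..1}" "hd ts = 0"
      "last ts = 1"
    and small: "\<And>i. Suc i < length ts \<Longrightarrow> \<exists>U\<in>small_sets s. p ` {ts ! i..ts ! Suc i} \<subseteq> U"
  shows "chain (rips X s) (map p ts)" "\<Psi> p = rips.pclass (edge_path (map p ts))"
    "\<Psi> p = cocycle_prod \<P> rips.edge_class (map p ts)"
proof -
  show ch: "chain (rips X s) (map p ts)"
    using p ts image_mono[OF ts(3), of p] by (intro chain_sample s_pos small) (auto simp: pathin_X)
  show "\<Psi> p = cocycle_prod \<P> rips.edge_class (map p ts)"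
    using ts by (intro sampling.transport_cocycle_prod[OF p] small) auto
  then show "\<Psi> p = rips.pclass (edge_path (map p ts))" using rips.pclass_edge_path[OF ch] by simp
qed

lemma transport_eq_rips_class:
  assumes p: "p \<in> loopsin (top_of_set X) b" and ts: "ts \<noteq> []" "sorted ts" "set ts \<subseteq> {0..1}" "hd ts
      = 0" "last ts = 1"
    and small: "\<And>i. Suc i < length ts \<Longrightarrow> \<exists>U\<in>small_sets s. p ` {ts ! i..ts ! Suc i} \<subseteq> U"
  shows "edge_path (map p ts) \<in> loopsin (realisation (rips X s)) (vertex b)" "\<Psi> p = rips_class X b
      s (map p ts)"
proof -
  have p': "pathin (top_of_set X) p" "p 0 = b" "p 1 = b" using p by (auto simp: loopsin_def)
  note * = transport_eq_pclass[OF p'(1) ts small]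
  have "edge_path (map p ts) 0 = vertex b" "edge_path (map p ts) 1 = vertex b"
    using edge_path_ends[of "map p ts"] ts p' by (auto simp: hd_map last_map)
  then show 1: "edge_path (map p ts) \<in> loopsin (realisation (rips X s)) (vertex b)"
    using rips.pathin_edge_path[OF *(1)] by (simp add: loopsin_def)
  show "\<Psi> p = rips_class X b s (map p ts)"
    using *(2) rips.pclass_loop[OF 1] by (simp add: rips_class_def)
qed

lemma transport_geo:
  assumes "x \<in> X" "y \<in> X" "dist x y < s"
  shows "\<Psi> (geo x y) = rips.edge_class x y"
proof -
  note g = geo[OF assms(1,2)]
  have "diameter (geo x y ` {0..1}) \<le> dist x y"
    using g(4) by (intro diameter_image_le_curve_length) auto
  then have "geo x y ` {0..1} \<in> small_sets s"
    using assms g(1) by (simp add: small_sets_def pathin_X)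
  from sampling.transport_small[OF g(1) this] show ?thesis by (simp add: g)
qed

lemma transport_fill:
  assumes "chain (rips X s) vs"
  shows "\<Psi> (fill vs) = cocycle_prod \<P> rips.edge_class vs"
  using assms
proof (induction vs rule: fill.induct)
  case (1 x y ys)
  then have ch: "chain (rips X s) (y # ys)" "{x, y} \<in> rips X s" by (auto simp: chain_Cons2)
  then have X: "x \<in> X" "y \<in> X" "set (y # ys) \<subseteq> X" by (auto simp: rips_def chain_def)
  have "dist x y < s" using dist_less_diameter[of "{x, y}"] ch(2) by (auto simp: rips_def)
  then have "\<Psi> (fill (x # y # ys)) = rips.edge_class x y \<otimes>\<^bsub>\<P>\<^esub> \<Psi> (fill (y # ys))"
    using fill[of "y # ys"] X geo[OF X(1,2)]
    by (simp add: sampling.transport_join rect_pathin transport_geo)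
  then show ?case using 1 ch by simp
next
  case (2 x)
  then have "x \<in> X" by (simp add: chain_def rips_def)
  then show ?case by simp
qed (simp add: chain_def)

theorem transport_surj:
  "carrier \<P> = \<Psi> ` {p. rect p \<and> p 0 = b \<and> p 1 = b}"
proof
  show "\<Psi> ` {p. rect p \<and> p 0 = b \<and> p 1 = b} \<subseteq> carrier \<P>"
    using sampling.transport_closed rect_pathin by blast
  show "carrier \<P> \<subseteq> \<Psi> ` {p. rect p \<and> p 0 = b \<and> p 1 = b}"
  proof
    fix a assume "a \<in> carrier \<P>"
    then obtain q where q: "pathin (realisation (rips X s)) q" "q 0 = vertex b" "q 1 = vertex b"
        "a = rips.pclass q"
      unfolding rips.carrier_pclass by (auto simp: loopsin_def)
    obtain vs where vs: "chain (rips X s) vs" "hd vs = b" "last vs = b"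
      "rips.pclass q = cocycle_prod \<P> rips.edge_class vs"
      using rips.path_class_edge_path[OF q(1-3)] by blast
    have "vs \<noteq> []" "set vs \<subseteq> X" using vs(1) by (auto simp: chain_def rips_def)
    then show "a \<in> \<Psi> ` {p. rect p \<and> p 0 = b \<and> p 1 = b}"
      using fill[of vs] vs q(4) transport_fill[OF vs(1)] by (intro image_eqI[of _ _ "fill vs"]) auto
  qed
qed

text \<open>Three arcs of equal length are each shorter than \<open>s\<close>, so they are small
  sets and their end points span a simplex. The product around its boundary telescopes.\<close>

lemma transport_small_loop:
  assumes \<beta>: "pathin (top_of_set X) \<beta>" "\<beta> 1 = \<beta> 0" and l: "curve_length 0 1 \<beta> < ennreal (3 * s)"
  shows "\<Psi> \<beta> = \<one>\<^bsub>\<P>\<^esub>"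
proof -
  interpret rectifiable_path \<beta>
    using \<beta> finite_length_rect[OF \<beta>(1) l] by unfold_locales (auto simp: pathin_X rect_def)
  define L where "L = arclen \<beta> 1"
  have L: "L < 3 * s" "0 \<le> L"
    using l arclen_1 s_pos by (auto simp: L_def ennreal_less_iff arclen_nonneg)
  have small: "\<beta> ` {u..v} \<in> small_sets s" if uv: "0 \<le> u" "u \<le> v" "v \<le> 1" "arclen \<beta> v - arclen \<beta> u
      < s" for u v
  proof -
    have "diameter (\<beta> ` {u..v}) \<le> arclen \<beta> v - arclen \<beta> u"
      using curve_length_arclen[OF uv(1-3)] uv by (intro diameter_image_le_curve_length) auto
    moreover have "\<beta> ` {u..v} \<subseteq> X" using \<beta>(1) uv by (auto simp: pathin_X)
    ultimately show ?thesis using uv(4) by (simp add: small_sets_def)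
  qed
  show ?thesis
  \<comment> \<open>Splitting off short loops ensures \<open>L > 0\<close> in the second case;
    without this the two cut points found by arc length might come in the wrong order.\<close>
  proof (cases "L < s")
    case True
    have "\<beta> ` {0..1} \<in> small_sets s" using small[of 0 1] True by (simp add: L_def)
    from sampling.transport_small[OF \<beta>(1) this] sampling.c_refl[OF this, of "\<beta> 0"] \<beta>(2)
    show ?thesis by simp
  next
    case False
    obtain t1 where t1: "t1 \<in> {0..1}" "arclen \<beta> t1 = L / 3" using arclen_surj[of "L / 3"] L by
        (auto simp: L_def)
    obtain t2 where t2: "t2 \<in> {0..1}" "arclen \<beta> t2 = 2 * L / 3" using arclen_surj[of "2 * L / 3"]
        L by (auto simp: L_def)
    have le: "t1 \<le> t2"
      using curve_length_arclen(2)[of t2 t1] t1 t2 False s_pos by (cases "t1 \<le> t2") auto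
    let ?x = "\<beta> 0" and ?y = "\<beta> t1" and ?z = "\<beta> t2"
    have sm: "\<beta> ` {0..t1} \<in> small_sets s" "\<beta> ` {t1..t2} \<in> small_sets s" "\<beta> ` {t2..1} \<in> small_sets s"
      using t1 t2 le L by (auto intro!: small simp: L_def[symmetric])
    have "\<Psi> \<beta> = cocycle_prod \<P> rips.edge_class (map \<beta> [0, t1, t2, 1])"
      using t1 t2 le sm by (intro sampling.transport_cocycle_prod \<beta>(1)) (auto simp:
          less_Suc_eq_0_disj nth_Cons')
    also have "\<dots> = rips.edge_class ?x ?y \<otimes>\<^bsub>\<P>\<^esub> (rips.edge_class ?y ?z \<otimes>\<^bsub>\<P>\<^esub> rips.edge_class ?z ?x)"
    proof -
      have "rips.edge_class ?z ?x \<in> carrier \<P>"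
        using \<beta>(2) t2 by (intro sampling.c_closed[OF sm(3)]) (auto intro: image_eqI[of _ _ 1])
      then show ?thesis using \<beta>(2) by simp
    qed
    also have "\<dots> = \<one>\<^bsub>\<P>\<^esub>"
    proof -
      have d: "dist ?x ?y < s" "dist ?y ?z < s" "dist ?z ?x < s"
        using dist_le_arclen[of 0 t1] dist_le_arclen[of t1 t2] dist_le_arclen[of t2 1] t1 t2 le L \<beta>(2)
        by (auto simp: L_def[symmetric])
      have X: "?x \<in> X" "?y \<in> X" "?z \<in> X" using \<beta>(1) t1 t2 by (auto simp: pathin_X)
      have K: "{?y, ?z, ?x} \<in> rips X s" "{?x, ?y, ?x} \<in> rips X s" "{?x} \<in> rips X s"
        using d X s_pos by (auto intro!: ripsI simp: dist_commute)
      have "rips.edge_class ?x ?x = \<one>\<^bsub>\<P>\<^esub>"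
        unfolding rips.edge_class_def using rips.vertex_topspace[OF K(3)] by simp
      then show ?thesis using rips.edge_class_mult[OF K(1)] rips.edge_class_mult[OF K(2)] by simp
    qed
    finally show ?thesis .
  qed
qed

lemma transport_eq_if_pclass_eq:
  assumes "p \<in> loopsin (top_of_set X) b" "q \<in> loopsin (top_of_set X) b" "base.pclass p =
      base.pclass q"
  shows "\<Psi> p = \<Psi> q"
  using assms by (intro sampling.transport_homotopic) (simp add: base.pclass_loop loop_class_eq_iff)

text \<open>\<Psi> is a function of paths, while lasso groups consist of classes, so the induction
  over \<open>generate\<close> carries a representing loop along. The trivial \<open>N\<close>
  yields the vanishing of \<Psi> on the lasso group; later \<open>N\<close> is the subgroup
  generated by the critical classes.\<close>

lemma transport_lasso_group_subgroup:
  assumes N: "subgroup N \<P>"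
    and lasso: "\<And>\<gamma> \<beta>. rect \<gamma> \<Longrightarrow> rect \<beta> \<Longrightarrow> \<beta> 1 = \<beta> 0 \<Longrightarrow> curve_length 0 1 \<beta> < ennreal l \<Longrightarrow>
      \<Psi> \<gamma> \<otimes>\<^bsub>\<P>\<^esub> \<Psi> \<beta> \<otimes>\<^bsub>\<P>\<^esub> inv\<^bsub>\<P>\<^esub> \<Psi> \<gamma> \<in> N"
    and a: "a \<in> lasso_group X b l"
  shows "\<exists>p\<in>loopsin (top_of_set X) b. base.pclass p = a \<and> \<Psi> p \<in> N"
proof -
  have lasso_in: "\<exists>p\<in>loopsin (top_of_set X) b. base.pclass p = h \<and> \<Psi> p \<in> N" if h: "h \<in>
      lasso_classes l" for h
  proof -
    obtain \<gamma> \<beta> where \<gamma>: "rect \<gamma>" "\<gamma> 0 = b" and \<beta>: "pathin (top_of_set X) \<beta>" "\<beta> 0 = \<gamma> 1" "\<beta> 1 = \<gamma> 1"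
      and len: "curve_length 0 1 \<beta> < ennreal l" and h: "h = base.pclass \<gamma> \<otimes>\<^bsub>\<G>\<^esub> base.pclass \<beta> \<otimes>\<^bsub>\<G>\<^esub> inv\<^bsub>\<G>\<^esub>
          base.pclass \<gamma>"
      using h by (rule lasso_classesE)
    note lp = lasso_loop[OF rect_pathin[OF \<gamma>(1)] \<gamma>(2) \<beta>]
    have "\<Psi> (\<gamma> +++ \<beta> +++ reversepath \<gamma>) = \<Psi> \<gamma> \<otimes>\<^bsub>\<P>\<^esub> \<Psi> \<beta> \<otimes>\<^bsub>\<P>\<^esub> inv\<^bsub>\<P>\<^esub> \<Psi> \<gamma>"
      using \<gamma> \<beta> unfolding joinpaths_eq_joinin reversepath_eq_reversein
      by (simp add: sampling.transport_join sampling.transport_reverse rect_pathin pathin_joinin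
          pathin_reversein rips.m_assoc)
    moreover have "\<Psi> \<gamma> \<otimes>\<^bsub>\<P>\<^esub> \<Psi> \<beta> \<otimes>\<^bsub>\<P>\<^esub> inv\<^bsub>\<P>\<^esub> \<Psi> \<gamma> \<in> N"
      using lasso[OF \<gamma>(1) finite_length_rect[OF \<beta>(1) len] _ len] \<beta> by simp
    ultimately show ?thesis
      using lasso_class[OF rect_pathin[OF \<gamma>(1)] \<gamma>(2) \<beta>] base.pclass_loop[OF lp] h by (intro
          bexI[OF _ lp]) simp
  qed
  show ?thesis
    using a[unfolded lasso_group_eq]
  proof (induction a rule: generate.induct)
    case one
    then show ?case
      using const_loopsin[OF base.base] base_in subgroup.one_closed[OF N] by (intro bexI[of _ "\<lambda>_.
          b"]) auto
  next
    case (incl h)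
    then show ?case by (rule lasso_in)
  next
    case (inv h)
    then obtain p where p: "p \<in> loopsin (top_of_set X) b" "base.pclass p = h" "\<Psi> p \<in> N" using
        lasso_in by blast
    then have "base.pclass (reversein p) = inv\<^bsub>\<G>\<^esub> h" "\<Psi> (reversein p) \<in> N"
      using subgroup.m_inv_closed[OF N p(3)] by (auto simp: loopsin_def base.pclass_reverse
          sampling.transport_reverse)
    then show ?case using reversein_loopsin[OF p(1)] by blast
  next
    case (eng h h')
    then obtain p q where p: "p \<in> loopsin (top_of_set X) b" "base.pclass p = h" "\<Psi> p \<in> N"
      and q: "q \<in> loopsin (top_of_set X) b" "base.pclass q = h'" "\<Psi> q \<in> N" by blast
    then have "base.pclass (joinin p q) = h \<otimes>\<^bsub>\<G>\<^esub> h'" "\<Psi> (joinin p q) \<in> N"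
      using subgroup.m_closed[OF N p(3) q(3)] by (auto simp: loopsin_def base.pclass_join
          sampling.transport_join)
    then show ?case using joinin_loopsin[OF p(1) q(1)] by blast
  qed
qed

text \<open>The edge cocycle given by geodesics modulo short lassos detects all rectifiable loops
  outside the lasso group.\<close>

lemma null_sample_imp_lasso_group:
  assumes p: "rect p" "p 0 = b" "p 1 = b" and null: "\<Psi> p = \<one>\<^bsub>\<P>\<^esub>"
  shows "base.pclass p \<in> lasso_group X b (3 * s)"
proof -
  let ?Q = "lasso_quotient (3 * s)" and ?q = "quotient_class (3 * s)"
  interpret Q: group ?Q by (rule group_lasso_quotient)
  interpret rectifiable_path p
    using p(1) by unfold_locales (auto simp: pathin_X rect_def)
  have pp: "pathin (top_of_set X) p" using p(1) by (rule rect_pathin)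
  define c where "c x y = ?q (base.pclass (geo x y))" for x y
  \<comment> \<open>The pieces must have length, not merely diameter, below \<open>s\<close>.
    Uniform continuity of arc length converts this into a bound on the parameter mesh.\<close>
  have "uniformly_continuous_on {0..1} (arclen p)"
    by (intro compact_uniformly_continuous continuous_on_arclen compact_Icc)
  then obtain e where e: "e > 0" "\<And>u v. u \<in> {0..1} \<Longrightarrow> v \<in> {0..1} \<Longrightarrow> dist v u < e \<Longrightarrow> dist (arclen p v)
      (arclen p u) < s"
    unfolding uniformly_continuous_on_def using s_pos by metis
  obtain ts where ts: "ts \<noteq> []" "sorted_wrt (<) ts" "hd ts = 0" "last ts = 1" "set ts \<subseteq> {0..1}"
    and sm: "\<And>i. Suc i < length ts \<Longrightarrow> ts ! Suc i - ts ! i < e \<and> (\<exists>U\<in>small_sets s. p ` {ts ! i..ts !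
        Suc i} \<subseteq> U)"
    using sampling_exists[OF s_pos e(1) pp] by blast
  have sorted: "sorted ts" using ts(2) by (rule strict_sorted_imp_sorted)
  have len: "curve_length (ts ! i) (ts ! Suc i) p < ennreal s" if i: "Suc i < length ts" for i
  proof -
    have "ts ! i \<in> set ts" "ts ! Suc i \<in> set ts" "ts ! i \<le> ts ! Suc i"
      using i sorted by (auto simp: sorted_nth_mono)
    then show ?thesis
      using e(2)[of "ts ! i" "ts ! Suc i"] sm[OF i] ts(5) curve_length_arclen[of "ts ! i" "ts !
          Suc i"] s_pos
      by (auto simp: dist_real_def ennreal_less_iff subset_iff)
  qed
  have c_closed: "c u v \<in> carrier ?Q" if "u \<in> X" "v \<in> X" for u v
    unfolding c_def using that by (intro quotient_class_closed pclass_rect rect_geo)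
  \<comment> \<open>A piece of \<open>p\<close> and the geodesic over it bound a loop of length
    below \<open>2 * s\<close>, so they agree modulo the lasso group.\<close>
  have same: "c (p u) (p v) = ?q (base.pclass (subpathin u v p))"
    if uv: "0 \<le> u" "u \<le> v" "v \<le> 1" and l: "curve_length u v p < ennreal s" for u v
  proof -
    have X: "p u \<in> X" "p v \<in> X" using uv pp by (auto simp: pathin_X)
    have r: "rect (subpathin u v p)" "rect (geo (p u) (p v))"
      using uv p X by (auto intro: rect_subpath rect_geo)
    let ?l = "joinin (geo (p u) (p v)) (reversein (subpathin u v p))"
    have cat: "geo (p u) (p v) 1 = reversein (subpathin u v p) 0" using geo[OF X] by simp
    have "curve_length 0 1 ?l = ennreal (dist (p u) (p v)) + curve_length u v p"
      using curve_length_joinin[of "geo (p u) (p v)" "reversein (subpathin u v p)"] cat geo[OF X] uv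
      by (simp add: curve_length_subpathin)
    also have "\<dots> \<le> curve_length u v p + curve_length u v p"
      using uv by (intro add_right_mono dist_le_curve_length) auto
    also have "\<dots> < ennreal s + ennreal s" using l l by (rule add_strict_mono)
    also have "\<dots> \<le> ennreal (3 * s)" using s_pos by (simp flip: ennreal_plus)
    finally have "curve_length 0 1 ?l < ennreal (3 * s)" .
    moreover have "pathin (top_of_set X) ?l" "?l 1 = ?l 0"
      using rect_join[OF r(2) rect_reverse[OF r(1)] cat] geo[OF X] by (auto simp: rect_pathin)
    ultimately have "base.pclass ?l \<in> lasso_group X b (3 * s)" by (intro small_loop_in_lasso_group)
    then have "base.pclass (geo (p u) (p v)) \<otimes>\<^bsub>\<G>\<^esub> inv\<^bsub>\<G>\<^esub> base.pclass (subpathin u v p) \<in> lasso_group X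
        b (3 * s)"
      using r cat by (simp add: base.pclass_join base.pclass_reverse rect_pathin pathin_reversein)
    then show ?thesis
      unfolding c_def using r by (simp add: quotient_class_eq_iff pclass_rect)
  qed
  have tele: "zs \<noteq> [] \<Longrightarrow> sorted zs \<Longrightarrow> set zs \<subseteq> {0..1} \<Longrightarrow>
      (\<And>i. Suc i < length zs \<Longrightarrow> curve_length (zs ! i) (zs ! Suc i) p < ennreal s) \<Longrightarrow>
      cocycle_prod ?Q c (map p zs) = ?q (base.pclass (subpathin (hd zs) (last zs) p))" for zs
  proof (induction zs rule: induct_list012)
    case (2 x)
    have "base.pclass (subpathin x x p) = \<one>\<^bsub>\<G>\<^esub>"
      using 2 pp by (simp add: subpathin_def pathin_X image_subset_iff)
    then show ?case
      using quotient_class_eq_one[of "\<one>\<^bsub>\<G>\<^esub>" "3 * s"] subgroup.one_closed[OF subgroup_rect_classes]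
        subgroup.one_closed[OF subgroup_lasso_group] by simp
  next
    case (3 x y zs)
    have xy: "0 \<le> x" "x \<le> y" "y \<le> last (y # zs)" "last (y # zs) \<le> 1" "y \<le> 1" "0 \<le> y"
      using 3(4,5) last_in_set[of "y # zs"] by auto
    have l: "curve_length x y p < ennreal s" using 3(6)[of 0] by simp
    have "cocycle_prod ?Q c (map p (y # zs)) = ?q (base.pclass (subpathin y (last (y # zs)) p))"
    proof -
      have "curve_length ((y # zs) ! i) ((y # zs) ! Suc i) p < ennreal s" if "Suc i < length (y #
          zs)" for i
        using 3(6)[of "Suc i"] that by simp
      then show ?thesis using 3(2) 3(4,5) by simp
    qed
    then have "cocycle_prod ?Q c (map p (x # y # zs)) =
        ?q (base.pclass (subpathin x y p)) \<otimes>\<^bsub>?Q\<^esub> ?q (base.pclass (subpathin y (last (y # zs)) p))"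
      using same[OF xy(1,2,5) l] by simp
    also have "\<dots> = ?q (base.pclass (subpathin x y p) \<otimes>\<^bsub>\<G>\<^esub> base.pclass (subpathin y (last (y # zs)) p))"
      using p(1) xy by (intro quotient_class_mult[symmetric] pclass_rect rect_subpath) auto
    also have "\<dots> = ?q (base.pclass (subpathin x (last (y # zs)) p))"
      using base.pclass_subpath_join[OF pp, of x y "last (y # zs)"] xy by simp
    finally show ?case by simp
  qed simp
  note sample = transport_eq_rips_class[OF _ ts(1) sorted ts(5,3,4), of p]
  have loop: "p \<in> loopsin (top_of_set X) b" using pp p by (simp add: loopsin_def)
  have ep: "edge_path (map p ts) \<in> loopsin (realisation (rips X s)) (vertex b)"
    "\<Psi> p = rips_class X b s (map p ts)"
    using sample[OF loop] sm by blast+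
  have chain: "chain (rips X s) (map p ts)"
    using transport_eq_pclass(1)[OF pp ts(1) sorted ts(5,3,4)] sm by blast
  have chain_b: "chain (rips X s) [b]" using s_pos base_in by (auto simp: chain_def intro!: ripsI)
  have "loop_class (realisation (rips X s)) (vertex b) (edge_path (map p ts)) =
      loop_class (realisation (rips X s)) (vertex b) (edge_path [b])"
    using null ep by (simp add: rips_class_def one_fundamental_group)
  then have hom: "homotopic_pathsin (realisation (rips X s)) (edge_path (map p ts)) (edge_path [b])"
    using ep(1) const_loopsin[OF rips.base] by (simp add: loop_class_eq_iff)
  have "cocycle_prod ?Q c (map p ts) = cocycle_prod ?Q c [b]"
  proof (rule rips.edge_path_homotopic_cocycle_prod[OF group_lasso_quotient _ _ chain chain_b hom])
    fix u v assume "{u, v} \<in> rips X s"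
    then show "c u v \<in> carrier ?Q" by (intro c_closed) (auto simp: rips_def)
  next
    fix u v w assume K: "{u, v, w} \<in> rips X s"
    then have X: "u \<in> X" "v \<in> X" "w \<in> X" by (auto simp: rips_def)
    have d: "dist u v < s" "dist v w < s" "dist u w < s"
      using K dist_less_diameter[of "{u, v, w}" s] by (auto simp: rips_def)
    \<comment> \<open>The multiplicativity of \<open>c\<close> on a simplex amounts to this
      perimeter being below \<open>3 * s\<close>.\<close>
    let ?l = "joinin (joinin (geo u v) (geo v w)) (reversein (geo u w))"
    have r: "rect (geo u v)" "rect (geo v w)" "rect (geo u w)" using X by (auto intro: rect_geo)
    have ends: "geo u v 0 = u" "geo u v 1 = v" "geo v w 0 = v" "geo v w 1 = w" "geo u w 0 = u"
        "geo u w 1 = w"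
      using X by (auto simp: geo)
    have "curve_length 0 1 ?l = ennreal (dist u v + dist v w + dist u w)"
      using X ends by (simp add: curve_length_joinin geo(4))
    also have "\<dots> < ennreal (3 * s)" using d s_pos by (intro ennreal_lessI) auto
    finally have "curve_length 0 1 ?l < ennreal (3 * s)" .
    moreover have "pathin (top_of_set X) ?l" "?l 1 = ?l 0"
      using r ends by (auto intro!: pathin_joinin pathin_reversein simp: rect_pathin)
    ultimately have "base.pclass ?l \<in> lasso_group X b (3 * s)" by (intro small_loop_in_lasso_group)
    then have "base.pclass (geo u v) \<otimes>\<^bsub>\<G>\<^esub> base.pclass (geo v w) \<otimes>\<^bsub>\<G>\<^esub> inv\<^bsub>\<G>\<^esub> base.pclass (geo u w) \<in>
        lasso_group X b (3 * s)"
      using r ends by (simp add: base.pclass_join base.pclass_reverse rect_pathin pathin_reversein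
          pathin_joinin)
    then show "c u v \<otimes>\<^bsub>?Q\<^esub> c v w = c u w"
      unfolding c_def using r
      by (simp add: pclass_rect quotient_class_eq_iff subgroup.m_closed[OF subgroup_rect_classes]
          flip: quotient_class_mult)
  qed
  then have "?q (base.pclass p) = \<one>\<^bsub>?Q\<^esub>"
    using tele[OF ts(1) sorted ts(5) len] ts by simp
  then show ?thesis using quotient_class_eq_one pclass_rect[OF p(1)] by blast
qed

theorem transport_eq_one_iff:
  assumes p: "rect p" "p 0 = b" "p 1 = b"
  shows "\<Psi> p = \<one>\<^bsub>\<P>\<^esub> \<longleftrightarrow> base.pclass p \<in> lasso_group X b (3 * s)"
proof
  assume "base.pclass p \<in> lasso_group X b (3 * s)"
  from transport_lasso_group_subgroup[OF rips.triv_subgroup _ this]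
  obtain q where "q \<in> loopsin (top_of_set X) b" "base.pclass q = base.pclass p" "\<Psi> q = \<one>\<^bsub>\<P>\<^esub>"
    using transport_small_loop by (auto simp: rect_pathin)
  then show "\<Psi> p = \<one>\<^bsub>\<P>\<^esub>"
    using transport_eq_if_pclass_eq[of q p] p by (simp add: loopsin_def rect_pathin)
qed (use null_sample_imp_lasso_group[OF p] in blast)

end

section \<open>Bonding maps, samples and critical triangles\<close>

text \<open>Conjugate elements are trivial together. The form without inverses is the one in which
  changes of base point and rotations of samples produce the relation.\<close>

lemma (in group) intertwined_eq_one_iff:
  assumes "a \<in> carrier G" "x \<in> carrier G" "y \<in> carrier G" "a \<otimes> x = y \<otimes> a"
  shows "x = \<one> \<longleftrightarrow> y = \<one>"
  using assms by (metis l_cancel_one r_cancel_one)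

lemma (in group) inv_mult_cancel: "x \<in> carrier G \<Longrightarrow> y \<in> carrier G \<Longrightarrow> inv x \<otimes> (x \<otimes> y) = y"
  by (simp flip: m_assoc)

lemma continuous_map_realisation_mono:
  assumes "K \<subseteq> K'"
  shows "continuous_map (realisation K) (realisation K') id"
  unfolding continuous_map_def
proof (intro conjI allI impI)
  show "id \<in> topspace (realisation K) \<rightarrow> topspace (realisation K')"
    using assms by (auto simp: topspace_realisation)
  fix U assume U: "openin (realisation K') U"
  show "openin (realisation K) {x \<in> topspace (realisation K). id x \<in> U}"
    unfolding openin_realisation
  proof (intro conjI ballI)
    fix \<sigma> assume \<sigma>: "\<sigma> \<in> K"
    then have "{x \<in> topspace (realisation K). id x \<in> U} \<inter> realised_simplex \<sigma> = U \<inter> realised_simplex \<sigma>"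
      by (auto simp: topspace_realisation)
    then show "openin (top_of_set (realised_simplex \<sigma>)) ({x \<in> topspace (realisation K). id x \<in> U}
        \<inter> realised_simplex \<sigma>)"
      using U \<sigma> assms by (auto simp: openin_realisation)
  qed (auto simp: topspace_realisation)
qed

section \<open>Comparison of two scales\<close>

locale two_scales = lo: rips_scale X b s + hi: rips_scale X b s'
  for X :: "'a::metric_space set" and b and s and s' +
  assumes scales: "s \<le> s'"
begin

lemma id_continuous: "continuous_map (realisation (rips X s)) (realisation (rips X s')) id"
  by (rule continuous_map_realisation_mono[OF lo.rips_mono[OF scales]])

lemma bonding_loop_class:
  "q \<in> loopsin (realisation (rips X s)) (vertex b) \<Longrightarrow>
    bonding_map X b s' (loop_class (realisation (rips X s)) (vertex b) q) =
    loop_class (realisation (rips X s')) (vertex b) q \<and> q \<in> loopsin (realisation (rips X s'))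
        (vertex b)"
  using pathin_compose[OF _ id_continuous, of q]
  by (auto simp: bonding_map_def induced_map_loop_class[OF _ id_continuous] loopsin_def)

text \<open>Sets of diameter below \<open>s\<close> also have diameter below \<open>s'\<close>, so
  one sample computes both transports, and the inclusion fixes its edge path.\<close>

lemma bonding_transport:
  assumes p: "p \<in> loopsin (top_of_set X) b"
  shows "bonding_map X b s' (lo.\<Psi> p) = hi.\<Psi> p"
proof -
  have "pathin (top_of_set X) p" using p by (simp add: loopsin_def)
  then obtain ts where ts: "ts \<noteq> []" "sorted_wrt (<) ts" "hd ts = 0" "last ts = 1" "set ts \<subseteq> {0..1}"
    and sm: "\<And>i. Suc i < length ts \<Longrightarrow> ts ! Suc i - ts ! i < 1 \<and> (\<exists>U\<in>lo.small_sets s. p ` {ts !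
        i..ts ! Suc i} \<subseteq> U)"
    using lo.sampling_exists[OF lo.s_pos zero_less_one] by blast
  have sorted: "sorted ts" using ts(2) by (rule strict_sorted_imp_sorted)
  have "lo.small_sets s \<subseteq> lo.small_sets s'" using scales by (auto simp: lo.small_sets_def)
  then have sm': "\<exists>U\<in>lo.small_sets s'. p ` {ts ! i..ts ! Suc i} \<subseteq> U" if "Suc i < length ts" for i
    using sm[OF that] by blast
  note L = lo.transport_eq_rips_class[OF p ts(1) sorted ts(5,3,4)]
  note H = hi.transport_eq_rips_class[OF p ts(1) sorted ts(5,3,4)]
  show ?thesis
    using L sm H sm' bonding_loop_class by (simp add: rips_class_def)
qed

lemma bonding_hom: "bonding_map X b s' \<in> hom (rips_group X b s) (rips_group X b s')"
proof (rule homI)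
  fix x assume "x \<in> carrier (rips_group X b s)"
  then obtain p where p: "p \<in> loopsin (realisation (rips X s)) (vertex b)" "x = loop_class
      (realisation (rips X s)) (vertex b) p"
    by (auto simp: rips_group_def carrier_fundamental_group)
  then show "bonding_map X b s' x \<in> carrier (rips_group X b s')"
    using bonding_loop_class[OF p(1)] by (auto simp: rips_group_def carrier_fundamental_group)
  fix y assume "y \<in> carrier (rips_group X b s)"
  then obtain q where q: "q \<in> loopsin (realisation (rips X s)) (vertex b)" "y = loop_class
      (realisation (rips X s)) (vertex b) q"
    by (auto simp: rips_group_def carrier_fundamental_group)
  show "bonding_map X b s' (x \<otimes>\<^bsub>rips_group X b s\<^esub> y) = bonding_map X b s' x \<otimes>\<^bsub>rips_group X b s'\<^esub>
      bonding_map X b s' y"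
    using bonding_loop_class[OF p(1)] bonding_loop_class[OF q(1)] bonding_loop_class[OF
        joinin_loopsin[OF p(1) q(1)]]
    unfolding p(2) q(2) rips_group_def by (simp add: mult_fundamental_group p q)
qed

lemma rect_loop: "lo.rect p \<Longrightarrow> p 0 = b \<Longrightarrow> p 1 = b \<Longrightarrow> p \<in> loopsin (top_of_set X) b"
  by (simp add: loopsin_def lo.rect_pathin)

text \<open>Surjectivity is automatic, because at either scale every class is \<Psi> of a
  rectifiable loop at \<open>b\<close>. Injectivity says that a loop trivial at \<open>s'\<close> is
  already trivial at \<open>s\<close>; the opposite inclusion of lasso groups always holds.\<close>

theorem bonding_iso_iff:
  "bonding_map X b s' \<in> iso (rips_group X b s) (rips_group X b s') \<longleftrightarrow>
    lasso_group X b (3 * s') \<subseteq> lasso_group X b (3 * s)"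
proof
  assume iso: "bonding_map X b s' \<in> iso (rips_group X b s) (rips_group X b s')"
  then have inj: "inj_on (bonding_map X b s') (carrier lo.\<P>)"
    by (simp add: iso_def bij_betw_def rips_group_def)
  show "lasso_group X b (3 * s') \<subseteq> lasso_group X b (3 * s)"
  proof
    fix a assume a: "a \<in> lasso_group X b (3 * s')"
    then obtain p where p: "lo.rect p" "p 0 = b" "p 1 = b" "a = lo.base.pclass p"
      using lo.lasso_group_rect by (auto simp: lo.rect_classes_def)
    have c: "(\<lambda>_. b) \<in> loopsin (top_of_set X) b" using lo.base_in by (simp add: const_loopsin)
    have "hi.\<Psi> p = \<one>\<^bsub>hi.\<P>\<^esub>" using hi.transport_eq_one_iff[OF p(1-3)] a p(4) by simp
    also have "\<dots> = hi.\<Psi> (\<lambda>_. b)" using lo.base_in by simp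
    finally have "bonding_map X b s' (lo.\<Psi> p) = bonding_map X b s' (lo.\<Psi> (\<lambda>_. b))"
      using rect_loop[OF p(1-3)] c by (simp add: bonding_transport)
    moreover have "lo.\<Psi> p \<in> carrier lo.\<P>" "lo.\<Psi> (\<lambda>_. b) \<in> carrier lo.\<P>"
      using lo.rect_pathin[OF p(1)] lo.base_in by (auto intro!: lo.sampling.transport_closed)
    ultimately have "lo.\<Psi> p = lo.\<Psi> (\<lambda>_. b)" using inj by (simp add: inj_on_eq_iff)
    then have "lo.\<Psi> p = \<one>\<^bsub>lo.\<P>\<^esub>" using lo.base_in by simp
    then show "a \<in> lasso_group X b (3 * s)" using lo.transport_eq_one_iff[OF p(1-3)] p(4) by simp
  qed
next
  assume L: "lasso_group X b (3 * s') \<subseteq> lasso_group X b (3 * s)"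
  have "bij_betw (bonding_map X b s') (carrier lo.\<P>) (carrier hi.\<P>)"
    unfolding bij_betw_def
  proof
    show "bonding_map X b s' ` carrier lo.\<P> = carrier hi.\<P>"
      unfolding lo.transport_surj hi.transport_surj image_image
      using bonding_transport rect_loop by (intro image_cong) auto
    show "inj_on (bonding_map X b s') (carrier lo.\<P>)"
    proof (rule inj_onI)
      fix x y assume x: "x \<in> carrier lo.\<P>" and y: "y \<in> carrier lo.\<P>" and eq: "bonding_map X b s' x
          = bonding_map X b s' y"
      obtain p where p: "lo.rect p" "p 0 = b" "p 1 = b" "x = lo.\<Psi> p" using x unfolding
          lo.transport_surj by blast
      obtain q where q: "lo.rect q" "q 0 = b" "q 1 = b" "y = lo.\<Psi> q" using y unfolding
          lo.transport_surj by blast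
      let ?w = "joinin p (reversein q)"
      have w: "lo.rect ?w" "?w 0 = b" "?w 1 = b"
        using p q by (auto intro!: lo.rect_join lo.rect_reverse)
      have cl: "hi.\<Psi> p \<in> carrier hi.\<P>" "hi.\<Psi> q \<in> carrier hi.\<P>"
        using p(1) q(1) by (auto intro!: hi.sampling.transport_closed lo.rect_pathin)
      have "hi.\<Psi> p = hi.\<Psi> q" using eq p q rect_loop by (simp add: bonding_transport)
      then have "hi.\<Psi> ?w = \<one>\<^bsub>hi.\<P>\<^esub>"
        using p q cl by (simp add: hi.sampling.transport_join hi.sampling.transport_reverse
            lo.rect_pathin pathin_reversein hi.rips.r_inv)
      then have "lo.\<Psi> ?w = \<one>\<^bsub>lo.\<P>\<^esub>"
        using L hi.transport_eq_one_iff[OF w] lo.transport_eq_one_iff[OF w] by blast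
      then have "x \<otimes>\<^bsub>lo.\<P>\<^esub> inv\<^bsub>lo.\<P>\<^esub> y = \<one>\<^bsub>lo.\<P>\<^esub>"
        using p q by (simp add: lo.sampling.transport_join lo.sampling.transport_reverse
            lo.rect_pathin pathin_reversein)
      then show "x = y" using x y by (metis lo.rips.inv_equality lo.rips.inv_inv lo.rips.inv_closed)
    qed
  qed
  then show "bonding_map X b s' \<in> iso (rips_group X b s) (rips_group X b s')"
    using bonding_hom by (simp add: iso_def rips_group_def)
qed

end

section \<open>Lassos along a closed curve, and fillings\<close>

context pointed_geodesic
begin

lemma two_scales: "0 < s \<Longrightarrow> s \<le> s' \<Longrightarrow> two_scales X b s s'"
  by unfold_locales auto

text \<open>Cutting at \<open>t\<close> turns the shifted loop into the second part of \<alpha>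
  followed by the first, which is \<alpha> conjugated by its first part.\<close>

lemma shiftpath_loop:
  assumes \<alpha>: "rect \<alpha>" "\<alpha> 1 = \<alpha> 0" and t: "t \<in> {0..1}"
  shows "curve_length 0 1 (shiftpath t \<alpha>) = curve_length 0 1 \<alpha>" "rect (shiftpath t \<alpha>)"
    "shiftpath t \<alpha> 0 = \<alpha> t" "shiftpath t \<alpha> 1 = \<alpha> t"
    "base.pclass (shiftpath t \<alpha>) =
      inv\<^bsub>\<G>\<^esub> base.pclass (subpathin 0 t \<alpha>) \<otimes>\<^bsub>\<G>\<^esub> base.pclass \<alpha> \<otimes>\<^bsub>\<G>\<^esub> base.pclass (subpathin 0 t \<alpha>)"
proof -
  let ?q = "shiftpath t \<alpha>"
  have fst: "?q u = \<alpha> (1 * u + t)" if "u \<le> 1 - t" for u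
    using that by (simp add: shiftpath_def add.commute)
  have snd: "?q u = \<alpha> (1 * u + (t - 1))" if "1 - t \<le> u" for u
  proof (cases "u = 1 - t")
    case True
    show ?thesis unfolding True using \<alpha>(2) by (simp add: shiftpath_def)
  next
    case False
    then show ?thesis using that by (simp add: shiftpath_def algebra_simps)
  qed
  show ends: "?q 0 = \<alpha> t" "?q 1 = \<alpha> t"
    using fst[of 0] snd[of 1] t by auto
  have "curve_length 0 1 ?q = curve_length 0 (1 - t) ?q + curve_length (1 - t) 1 ?q"
    using t by (intro curve_length_add) auto
  also have "curve_length 0 (1 - t) ?q = curve_length 0 (1 - t) (\<lambda>u. \<alpha> (1 * u + t))"
    by (intro curve_length_cong fst) auto
  also have "\<dots> = curve_length t 1 \<alpha>" by (intro curve_length_affine) auto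
  also have "curve_length (1 - t) 1 ?q = curve_length (1 - t) 1 (\<lambda>u. \<alpha> (1 * u + (t - 1)))"
    by (intro curve_length_cong snd) auto
  also have "\<dots> = curve_length 0 t \<alpha>" by (intro curve_length_affine) auto
  finally show len: "curve_length 0 1 ?q = curve_length 0 1 \<alpha>"
    using curve_length_add[of 0 t 1 \<alpha>] t by (simp add: add.commute)
  have "path \<alpha> \<and> path_image \<alpha> \<subseteq> X" "pathfinish \<alpha> = pathstart \<alpha>"
    using \<alpha> path_X[of \<alpha>] by (auto simp: rect_def pathstart_def pathfinish_def)
  then have "path ?q \<and> path_image ?q \<subseteq> X"
    using t by (simp add: path_shiftpath path_image_shiftpath)
  then have pq: "pathin (top_of_set X) ?q" by (simp only: path_X)
  then show "rect ?q" using len \<alpha>(1) by (simp add: rect_def)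
  have p\<alpha>: "pathin (top_of_set X) \<alpha>" using \<alpha>(1) by (rule rect_pathin)
  have sub: "pathin (top_of_set X) (subpathin u v \<alpha>)" if "u \<in> {0..1}" "v \<in> {0..1}" for u v
    using that by (intro pathin_subpathin p\<alpha>)
  have "base.pclass ?q = base.pclass (subpathin 0 (1 - t) ?q) \<otimes>\<^bsub>\<G>\<^esub> base.pclass (subpathin (1 - t) 1 ?q)"
    using base.pclass_subpath_join[OF pq, of 0 "1 - t" 1] t by simp
  also have "base.pclass (subpathin 0 (1 - t) ?q) = base.pclass (subpathin t 1 \<alpha>)"
  proof (rule base.pclass_cong[symmetric, OF sub])
    fix u :: real assume u: "u \<in> {0..1}"
    then have "u * (1 - t) \<le> 1 - t" using t by (intro mult_left_le_one_le) auto
    then show "subpathin t 1 \<alpha> u = subpathin 0 (1 - t) ?q u" by (simp add: subpathin_def fst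
        add.commute)
  qed (use t in auto)
  also have "base.pclass (subpathin (1 - t) 1 ?q) = base.pclass (subpathin 0 t \<alpha>)"
  proof (rule base.pclass_cong[symmetric, OF sub])
    fix u :: real assume u: "u \<in> {0..1}"
    then have "0 \<le> u * t" using t by simp
    then show "subpathin 0 t \<alpha> u = subpathin (1 - t) 1 ?q u" by (simp add: subpathin_def snd)
  qed (use t in auto)
  finally have q: "base.pclass ?q = base.pclass (subpathin t 1 \<alpha>) \<otimes>\<^bsub>\<G>\<^esub> base.pclass (subpathin 0 t \<alpha>)" .
  have \<alpha>_eq: "base.pclass \<alpha> = base.pclass (subpathin 0 t \<alpha>) \<otimes>\<^bsub>\<G>\<^esub> base.pclass (subpathin t 1 \<alpha>)"
    using base.pclass_subpath_join[OF p\<alpha>, of 0 t 1] t by simp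
  have cl: "base.pclass (subpathin 0 t \<alpha>) \<in> carrier \<G>" "base.pclass (subpathin t 1 \<alpha>) \<in> carrier \<G>"
    using t by (auto intro!: base.pclass_closed sub)
  show "base.pclass ?q =
      inv\<^bsub>\<G>\<^esub> base.pclass (subpathin 0 t \<alpha>) \<otimes>\<^bsub>\<G>\<^esub> base.pclass \<alpha> \<otimes>\<^bsub>\<G>\<^esub> base.pclass (subpathin 0 t \<alpha>)"
    unfolding q \<alpha>_eq using cl by (simp add: base.m_assoc[symmetric])
qed

lemma lasso_group_conj_iff:
  assumes g: "g \<in> rect_classes" and h: "h \<in> carrier \<G>"
  shows "g \<otimes>\<^bsub>\<G>\<^esub> h \<otimes>\<^bsub>\<G>\<^esub> inv\<^bsub>\<G>\<^esub> g \<in> lasso_group X b r \<longleftrightarrow> h \<in> lasso_group X b r"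
proof
  have gc: "g \<in> carrier \<G>" using g subgroup.subset[OF subgroup_rect_classes] by blast
  assume "g \<otimes>\<^bsub>\<G>\<^esub> h \<otimes>\<^bsub>\<G>\<^esub> inv\<^bsub>\<G>\<^esub> g \<in> lasso_group X b r"
  from conj_lasso_group[OF subgroup.m_inv_closed[OF subgroup_rect_classes g] this]
  have "inv\<^bsub>\<G>\<^esub> g \<otimes>\<^bsub>\<G>\<^esub> (g \<otimes>\<^bsub>\<G>\<^esub> h \<otimes>\<^bsub>\<G>\<^esub> inv\<^bsub>\<G>\<^esub> g) \<otimes>\<^bsub>\<G>\<^esub> g \<in> lasso_group X b r"
    using gc by simp
  also have "inv\<^bsub>\<G>\<^esub> g \<otimes>\<^bsub>\<G>\<^esub> (g \<otimes>\<^bsub>\<G>\<^esub> h \<otimes>\<^bsub>\<G>\<^esub> inv\<^bsub>\<G>\<^esub> g) \<otimes>\<^bsub>\<G>\<^esub> g = (inv\<^bsub>\<G>\<^esub> g \<otimes>\<^bsub>\<G>\<^esub> g) \<otimes>\<^bsub>\<G>\<^esub> h \<otimes>\<^bsub>\<G>\<^esub> (inv\<^bsub>\<G>\<^esub> g \<otimes>\<^bsub>\<G>\<^esub> g)"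
    using gc h by (simp only: base.m_assoc base.m_closed base.inv_closed)
  finally show "h \<in> lasso_group X b r" using gc h by simp
qed (rule conj_lasso_group[OF g])

lemma curve_lassosE:
  assumes p: "p \<in> curve_lassos X b \<alpha>" and \<alpha>: "rect \<alpha>" "\<alpha> 1 = \<alpha> 0"
  obtains \<gamma> t where "rect \<gamma>" "\<gamma> 0 = b" "t \<in> {0..1}" "\<gamma> 1 = \<alpha> t" "p = joinin \<gamma> (joinin (shiftpath t
      \<alpha>) (reversein \<gamma>))"
    "p \<in> loopsin (top_of_set X) b" "rect p"
proof -
  from p obtain \<gamma> t where g: "rect \<gamma>" "\<gamma> 0 = b" "t \<in> {0..1}" "\<gamma> 1 = \<alpha> t"
    and p': "p = joinin \<gamma> (joinin (shiftpath t \<alpha>) (reversein \<gamma>))"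
    by (auto simp: curve_lassos_def finite_path_from_iff pathfinish_def joinpaths_eq_joinin
        reversepath_eq_reversein)
  note sh = shiftpath_loop[OF \<alpha> g(3)]
  have "rect p" unfolding p' using g sh by (intro rect_join rect_reverse) auto
  then show thesis using that[OF g p'] g sh p' by (auto simp: loopsin_def rect_pathin)
qed

text \<open>Another tail or another point of attachment changes the class by conjugation with
  rectifiable classes, under which the lasso group is invariant. Hence membership depends on
  \<alpha> alone, and "some" and "each" agree.\<close>

lemma curve_lasso_iff:
  assumes p: "p \<in> curve_lassos X b \<alpha>" and \<alpha>: "rect \<alpha>" "\<alpha> 1 = \<alpha> 0"
  shows "loop_class (top_of_set X) b p \<in> lasso_group X b r \<longleftrightarrow> base.pclass \<alpha> \<in> lasso_group X b r"
proof -
  obtain \<gamma> t where g: "rect \<gamma>" "\<gamma> 0 = b" "t \<in> {0..1}" "\<gamma> 1 = \<alpha> t" "p = joinin \<gamma> (joinin (shiftpath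
      t \<alpha>) (reversein \<gamma>))"
    "p \<in> loopsin (top_of_set X) b" "rect p"
    using curve_lassosE[OF assms] by metis
  note sh = shiftpath_loop[OF \<alpha> g(3)]
  have r: "base.pclass \<gamma> \<in> rect_classes" "base.pclass (subpathin 0 t \<alpha>) \<in> rect_classes"
      "base.pclass \<alpha> \<in> rect_classes"
    using g(1,3) \<alpha>(1) by (simp_all add: pclass_rect rect_subpath)
  have c: "base.pclass \<gamma> \<in> carrier \<G>" "base.pclass (subpathin 0 t \<alpha>) \<in> carrier \<G>" "base.pclass \<alpha> \<in>
      carrier \<G>"
    using r subgroup.subset[OF subgroup_rect_classes] by auto
  have "loop_class (top_of_set X) b p = base.pclass \<gamma> \<otimes>\<^bsub>\<G>\<^esub> (base.pclass (shiftpath t \<alpha>) \<otimes>\<^bsub>\<G>\<^esub> inv\<^bsub>\<G>\<^esub>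
      base.pclass \<gamma>)"
    using base.pclass_loop[OF g(6)] g sh
    by (simp add: base.pclass_join base.pclass_reverse rect_pathin pathin_joinin pathin_reversein)
  also have "\<dots> = base.pclass \<gamma> \<otimes>\<^bsub>\<G>\<^esub> (inv\<^bsub>\<G>\<^esub> base.pclass (subpathin 0 t \<alpha>) \<otimes>\<^bsub>\<G>\<^esub> base.pclass \<alpha> \<otimes>\<^bsub>\<G>\<^esub>
      inv\<^bsub>\<G>\<^esub> (inv\<^bsub>\<G>\<^esub> base.pclass (subpathin 0 t \<alpha>))) \<otimes>\<^bsub>\<G>\<^esub> inv\<^bsub>\<G>\<^esub> base.pclass \<gamma>"
    unfolding sh(5) using c by (simp add: base.m_assoc)
  finally have p: "loop_class (top_of_set X) b p = base.pclass \<gamma> \<otimes>\<^bsub>\<G>\<^esub>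
    (inv\<^bsub>\<G>\<^esub> base.pclass (subpathin 0 t \<alpha>) \<otimes>\<^bsub>\<G>\<^esub> base.pclass \<alpha> \<otimes>\<^bsub>\<G>\<^esub>
      inv\<^bsub>\<G>\<^esub> (inv\<^bsub>\<G>\<^esub> base.pclass (subpathin 0 t \<alpha>))) \<otimes>\<^bsub>\<G>\<^esub> inv\<^bsub>\<G>\<^esub> base.pclass \<gamma>" .
  have "inv\<^bsub>\<G>\<^esub> base.pclass (subpathin 0 t \<alpha>) \<in> rect_classes"
    using r(2) by (rule subgroup.m_inv_closed[OF subgroup_rect_classes])
  from lasso_group_conj_iff[OF this c(3), of r] lasso_group_conj_iff[OF r(1), of _ r] show ?thesis
    unfolding p using c by simp
qed

text \<open>Rules out that a statement about every \<alpha>-lasso holds vacuously.\<close>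

lemma curve_lassos_nonempty:
  assumes \<alpha>: "rect \<alpha>"
  shows "curve_lassos X b \<alpha> \<noteq> {}"
proof -
  have "\<alpha> 0 \<in> X" using rect_in_X[OF \<alpha>] by simp
  then have "finite_path_from X b (tau (\<alpha> 0))" "pathfinish (tau (\<alpha> 0)) = \<alpha> 0"
    using base.tau[of "\<alpha> 0"] rect_tau by (auto simp: finite_path_from_iff pathfinish_def)
  then show ?thesis unfolding curve_lassos_def by fastforce
qed

lemma filling_length:
  assumes "filling X [x1, x2, x3, x1] \<alpha>"
  shows "rect \<alpha>" "\<alpha> 1 = \<alpha> 0" "curve_length 0 1 \<alpha> = ennreal (dist x1 x2 + dist x2 x3 + dist x3 x1)"
proof -
  from assms obtain ts where loop: "loop_in X \<alpha>" and ts: "length ts = 4" "sorted_wrt (<) ts" "hd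
      ts = 0" "last ts = 1"
    and pts: "\<And>i. i < 4 \<Longrightarrow> \<alpha> (ts ! i) = [x1, x2, x3, x1] ! i"
    and geod: "\<And>i. Suc i < 4 \<Longrightarrow> geodesic_on X (ts ! i) (ts ! Suc i) \<alpha>"
    unfolding filling_def by (auto simp: eval_nat_numeral)
  obtain a c d e where "ts = [a, c, d, e]"
    using ts(1) by (auto simp: eval_nat_numeral length_Suc_conv)
  then have tse: "ts = [0, c, d, 1]" "0 < c" "c < d" "d < 1" using ts by auto
  have at: "\<alpha> 0 = x1" "\<alpha> c = x2" "\<alpha> d = x3" "\<alpha> 1 = x1"
    using pts[of 0] pts[of 1] pts[of 2] pts[of 3] tse(1) by (auto simp: eval_nat_numeral)
  have len: "curve_length 0 c \<alpha> = ennreal (dist x1 x2)" "curve_length c d \<alpha> = ennreal (dist x2 x3)"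
    "curve_length d 1 \<alpha> = ennreal (dist x3 x1)"
    using geod[of 0] geod[of 1] geod[of 2] tse(1) at by (auto simp: geodesic_on_def eval_nat_numeral)
  show l: "curve_length 0 1 \<alpha> = ennreal (dist x1 x2 + dist x2 x3 + dist x3 x1)"
    using curve_length_add[of 0 c 1 \<alpha>] curve_length_add[of c d 1 \<alpha>] tse len by (simp add: add.assoc)
  show "\<alpha> 1 = \<alpha> 0" using at by simp
  show "rect \<alpha>" using loop l by (simp add: rect_def loop_in_iff)
qed

end

section \<open>Samples, attached discs and critical triangles\<close>

context rips_scale
begin

lemma transport_loop_eq_one_iff:
  assumes \<beta>: "rect \<beta>" "\<beta> 1 = \<beta> 0"
  shows "\<Psi> \<beta> = \<one>\<^bsub>\<P>\<^esub> \<longleftrightarrow> base.pclass \<beta> \<in> lasso_group X b (3 * s)"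
proof -
  let ?t = "tau (\<beta> 0)"
  let ?q = "joinin (joinin ?t \<beta>) (reversein ?t)"
  have x: "\<beta> 0 \<in> X" using rect_in_X[OF \<beta>(1)] by simp
  have t: "rect ?t" "?t 0 = b" "?t 1 = \<beta> 0" using x base.tau[of "\<beta> 0"] by (auto simp: rect_tau)
  have q: "rect ?q" "?q 0 = b" "?q 1 = b" using t \<beta> by (auto intro!: rect_join rect_reverse)
  have pq: "base.pclass ?q = base.pclass \<beta>"
    using base.pclass_loop[OF base.based_loop[OF rect_pathin[OF \<beta>(1)]]] \<beta>(2) by (simp add:
        base.pclass_def)
  have c: "\<Psi> ?t \<in> carrier \<P>" "\<Psi> \<beta> \<in> carrier \<P>"
    using t \<beta> by (auto intro!: sampling.transport_closed simp: rect_pathin)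
  have "\<Psi> ?q = \<Psi> ?t \<otimes>\<^bsub>\<P>\<^esub> \<Psi> \<beta> \<otimes>\<^bsub>\<P>\<^esub> inv\<^bsub>\<P>\<^esub> \<Psi> ?t"
    using t \<beta> by (simp add: sampling.transport_join sampling.transport_reverse rect_pathin
        pathin_joinin pathin_reversein)
  then have "\<Psi> ?q = \<one>\<^bsub>\<P>\<^esub> \<longleftrightarrow> \<Psi> \<beta> = \<one>\<^bsub>\<P>\<^esub>"
    using c rips.intertwined_eq_one_iff[of "\<Psi> ?t" "\<Psi> \<beta>" "\<Psi> ?q"] by (simp add: rips.m_assoc)
  then show ?thesis using transport_eq_one_iff[OF q] pq by simp
qed

lemma based_sample_class:
  assumes p: "p \<in> loopsin (top_of_set X) b" and ts: "based_sample s p ts"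
  shows "rips_class X b s (sample_loop p ts) = \<Psi> p"
proof -
  have pp: "pathin (top_of_set X) p" "p 0 = b" "p 1 = b" using p by (auto simp: loopsin_def)
  have t: "ts \<noteq> []" "sorted_wrt (<) ts" "set ts \<subseteq> {0..1}" "hd ts = 0"
    and sm: "\<And>i. Suc i < length ts \<Longrightarrow> diameter (p ` {ts ! i..ts ! Suc i}) < s"
    and lst: "diameter (p ` ({0..0} \<union> {last ts..1})) < s"
    using ts by (auto simp: based_sample_def sample_def)
  have in01: "t \<in> {0..1}" if "t \<in> set ts" for t using t(3) that by blast
  have X: "p ` {u..v} \<subseteq> X" if "0 \<le> u" "v \<le> 1" for u v
    using pp(1) that by (auto simp: pathin_X)
  \<comment> \<open>A based sample starts at 0 but need not end at 1. After 1 is appended, the last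
    piece is small by the wrap-around condition, and \<open>p 1 = p 0\<close> makes the vertex list
    equal to the sample loop.\<close>
  let ?zs = "ts @ [1]"
  have "\<exists>U\<in>small_sets s. p ` {?zs ! i..?zs ! Suc i} \<subseteq> U" if i: "Suc i < length ?zs" for i
  proof (cases "Suc i < length ts")
    case True
    then have "p ` {ts ! i..ts ! Suc i} \<in> small_sets s"
      using sm[OF True] X in01[of "ts ! i"] in01[of "ts ! Suc i"] by (simp add: small_sets_def)
    then show ?thesis using True by (intro bexI[of _ "p ` {ts ! i..ts ! Suc i}"]) (auto simp:
        nth_append)
  next
    case False
    then have i': "i = length ts - 1" using i by simp
    then have "?zs ! i = last ts" "?zs ! Suc i = 1"
      using t(1) by (auto simp: nth_append last_conv_nth)
    moreover have "p ` ({0..0} \<union> {last ts..1}) \<in> small_sets s"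
      using lst X[of 0 0] X[of "last ts" 1] in01[of "last ts"] t(1) by (auto simp: small_sets_def
          image_Un)
    ultimately show ?thesis by (intro bexI[of _ "p ` ({0..0} \<union> {last ts..1})"]) auto
  qed
  moreover have "sorted ?zs" using strict_sorted_imp_sorted[OF t(2)] in01 by (auto simp:
      sorted_append)
  ultimately have "\<Psi> p = rips_class X b s (map p ?zs)"
    using t in01 by (intro transport_eq_rips_class(2)[OF p]) auto
  moreover have "map p ?zs = sample_loop p ts" using pp t by (simp add: sample_loop_def)
  ultimately show ?thesis by simp
qed

lemma based_sample_exists:
  assumes p: "pathin (top_of_set X) p" "p 1 = p 0" and e: "e > 0"
  obtains ts where "based_sample e p ts"
proof -
  obtain ts where ts: "ts \<noteq> []" "sorted_wrt (<) ts" "hd ts = 0" "last ts = 1" "set ts \<subseteq> {0..1}"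
    and sm: "\<And>i. Suc i < length ts \<Longrightarrow> ts ! Suc i - ts ! i < 1 \<and> (\<exists>U\<in>small_sets e. p ` {ts ! i..ts !
        Suc i} \<subseteq> U)"
    using sampling_exists[OF e zero_less_one p(1)] by blast
  have "diameter (p ` {ts ! i..ts ! Suc i}) < e" if i: "Suc i < length ts" for i
  proof -
    obtain U where U: "U \<subseteq> X" "diameter U < e" "p ` {ts ! i..ts ! Suc i} \<subseteq> U"
      using sm[OF i] by (auto simp: small_sets_def)
    then show ?thesis using diameter_subset[OF U(3) bounded_subset_X[OF U(1)]] by simp
  qed
  moreover have "diameter (p ` ({0..0} \<union> {1..1})) < e"
    using p(2) e by simp
  ultimately show thesis using that[of ts] ts by (simp add: based_sample_def sample_def)
qed

text \<open>An unbased sample may start away from parameter 0. Its edge loop is then a rotation of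
  one based at \<open>p 0\<close>, and the lift \<open>F (hd ts)\<close> conjugates its class to
  \<open>\<Psi> p\<close>. Triviality is not affected.\<close>

lemma sample_loop_class:
  assumes p: "pathin (top_of_set X) p" "p 1 = p 0" and ts: "sample e p ts" and e: "e \<le> s"
  shows "chain (rips X s) (sample_loop p ts)"
    "rips.pclass (edge_path (sample_loop p ts)) = \<one>\<^bsub>\<P>\<^esub> \<longleftrightarrow> \<Psi> p = \<one>\<^bsub>\<P>\<^esub>"
proof -
  let ?c = rips.edge_class
  have t: "ts \<noteq> []" "sorted_wrt (<) ts" "set ts \<subseteq> {0..1}"
    and sm: "\<And>i. Suc i < length ts \<Longrightarrow> diameter (p ` {ts ! i..ts ! Suc i}) < e"
    and ends: "diameter (p ` ({0..hd ts} \<union> {last ts..1})) < e"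
    using ts by (auto simp: sample_def)
  have sorted: "sorted ts" using t(2) by (rule strict_sorted_imp_sorted)
  have in01: "t \<in> {0..1}" if "t \<in> set ts" for t using t(3) that by blast
  have h: "0 \<le> hd ts" "hd ts \<le> 1" "0 \<le> last ts" "last ts \<le> 1"
    using in01[OF hd_in_set[OF t(1)]] in01[OF last_in_set[OF t(1)]] by auto
  have X: "p ` {u..v} \<subseteq> X" if "0 \<le> u" "v \<le> 1" for u v
    using p(1) that by (auto simp: pathin_X)
  have small: "\<exists>U\<in>small_sets s. p ` {ts ! i..ts ! Suc i} \<subseteq> U" if i: "Suc i < length ts" for i
    using sm[OF i] e X[of "ts ! i" "ts ! Suc i"] in01[of "ts ! i"] in01[of "ts ! Suc i"] i
    by (intro bexI[of _ "p ` {ts ! i..ts ! Suc i}"]) (auto simp: small_sets_def)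
  \<comment> \<open>The wrap-around condition puts the two arcs next to the base parameter into one
    small set, so \<open>p 0\<close> and both extreme sample points are pairwise adjacent.\<close>
  define U where "U = p ` ({0..hd ts} \<union> {last ts..1})"
  have U: "U \<in> small_sets s"
    using ends e X[of 0 "hd ts"] X[of "last ts" 1] h by (auto simp: U_def small_sets_def image_Un)
  have in_U: "p 0 \<in> U" "p 1 \<in> U" "p (hd ts) \<in> U" "p (last ts) \<in> U" using h by (auto simp: U_def)
  note cU = sampling.c_closed[OF U]
  have ch1: "chain (rips X s) (map p ts)"
    using t X[of 0 1] by (intro chain_sample s_pos sorted small) auto
  have "{p (last ts)} \<in> rips X s" "{p (hd ts)} \<in> rips X s" "{p (last ts), p (hd ts)} \<in> rips X s"
    using small_triple[OF U in_U(4,4,4)] small_triple[OF U in_U(3,3,3)] small_triple[OF U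
        in_U(4,3,3)] by simp_all
  then have ch2: "chain (rips X s) [p (last ts), p (hd ts)]"
    unfolding chain_Cons2 by (simp add: chain_def)
  have eq: "sample_loop p ts = map p ts @ tl [p (last ts), p (hd ts)]" by (simp add: sample_loop_def)
  show ch: "chain (rips X s) (sample_loop p ts)"
    unfolding eq using ch1 ch2 t(1) by (intro chain_append) (auto simp: last_map)
  obtain F where F: "sampling.lift p 0 1 F" "F 0 = \<one>\<^bsub>\<P>\<^esub>" "F 1 = \<Psi> p"
    using sampling.transport_lift[OF p(1)] by blast
  let ?P = "cocycle_prod \<P> ?c (map p ts)"
  have P: "?P \<in> carrier \<P>" "F (last ts) = F (hd ts) \<otimes>\<^bsub>\<P>\<^esub> ?P"
    using sampling.lift_cocycle_prod[OF F(1) t(1) sorted t(3) small] by auto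
  have cl: "F (hd ts) \<in> carrier \<P>" "F (last ts) \<in> carrier \<P>" "\<Psi> p \<in> carrier \<P>"
    using sampling.lift_closed[OF F(1)] h p(1) by (auto intro: sampling.transport_closed)
  have "F (hd ts) = F 0 \<otimes>\<^bsub>\<P>\<^esub> ?c (p 0) (p (hd ts))"
    using h by (intro sampling.lift_step[OF F(1) U]) (auto simp: U_def)
  then have hd: "F (hd ts) = ?c (p 0) (p (hd ts))" using F(2) cU[OF in_U(1,3)] by simp
  have lst: "\<Psi> p = F (last ts) \<otimes>\<^bsub>\<P>\<^esub> ?c (p (last ts)) (p 0)"
    unfolding F(3)[symmetric] p(2)[symmetric] using h by (intro sampling.lift_step[OF F(1) U])
        (auto simp: U_def)
  have "rips.pclass (edge_path (sample_loop p ts)) = cocycle_prod \<P> ?c (map p ts @ tl [p (last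
      ts), p (hd ts)])"
    using rips.pclass_edge_path[OF ch] by (simp add: eq)
  also have "\<dots> = ?P \<otimes>\<^bsub>\<P>\<^esub> cocycle_prod \<P> ?c [p (last ts), p (hd ts)]"
    using ch1 ch2 t(1) unfolding chain_def
    by (intro cocycle_prod_append rips.is_group rips.edge_class_closed) (auto simp: last_map)
  also have "cocycle_prod \<P> ?c [p (last ts), p (hd ts)] = ?c (p (last ts)) (p 0) \<otimes>\<^bsub>\<P>\<^esub> F (hd ts)"
    using hd sampling.c_mult[OF U in_U(4,1,3)] cU[OF in_U(4,3)] by simp
  finally have pc: "F (hd ts) \<otimes>\<^bsub>\<P>\<^esub> rips.pclass (edge_path (sample_loop p ts)) = \<Psi> p \<otimes>\<^bsub>\<P>\<^esub> F (hd ts)"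
    unfolding lst P(2) using P(1) cl cU[OF in_U(4,1)] by (simp add: rips.m_assoc)
  have ep: "rips.pclass (edge_path (sample_loop p ts)) \<in> carrier \<P>"
    using rips.pathin_edge_path[OF ch] by simp
  show "rips.pclass (edge_path (sample_loop p ts)) = \<one>\<^bsub>\<P>\<^esub> \<longleftrightarrow> \<Psi> p = \<one>\<^bsub>\<P>\<^esub>"
    using rips.intertwined_eq_one_iff[OF cl(1) ep cl(3) pc] .
qed

text \<open>The right-hand side mentions neither \<open>ts\<close> nor \<open>e\<close>: the
  existential choice of an \<open>(r / 2)\<close>-sample in the notion of a critical triangle does
  not influence the outcome.\<close>

lemma attached_sample_kernel:
  assumes p: "pathin (top_of_set X) p" "p 1 = p 0" and ts: "sample e p ts" and e: "e \<le> s"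
  shows "(let T = attach_disc_along (rips X s) (sample_loop p ts); c = Inl (vertex b)
      in kernel (rips_group X b s) (fundamental_group T c) (induced_map T c Inl) \<noteq> {\<one>\<^bsub>rips_group X
          b s\<^esub>}) \<longleftrightarrow>
    \<Psi> p \<noteq> \<one>\<^bsub>\<P>\<^esub>"
proof -
  note sl = sample_loop_class[OF assms]
  have "sample_loop p ts \<noteq> []" "hd (sample_loop p ts) = last (sample_loop p ts)"
    using ts by (auto simp: sample_loop_def sample_def hd_append hd_map)
  then have "edge_path (sample_loop p ts) 1 = edge_path (sample_loop p ts) 0"
    by (simp add: edge_path_ends)
  from rips.attach_disc_kernel[OF rips.pathin_edge_path[OF sl(1)] this] sl(2)
  show ?thesis
    by (simp add: attach_disc_along_def circle_map_def Let_def rips_group_def)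
qed

text \<open>An essential filling cannot be shorter than \<open>3 * s\<close>, yet each side is at
  most \<open>s\<close>. So all three sides must equal \<open>s\<close>.\<close>

theorem critical_triangle_essential:
  assumes crit: "critical_triangle_via X b s x1 x2 x3 \<alpha>"
  shows "dist x1 x2 = s" "dist x2 x3 = s" "dist x3 x1 = s" "rect \<alpha>" "\<alpha> 1 = \<alpha> 0"
    "curve_length 0 1 \<alpha> = ennreal (3 * s)" "base.pclass \<alpha> \<notin> lasso_group X b (3 * s)"
proof -
  from crit obtain ts where closed: "{x1, x2, x3} \<in> closed_rips X s" and fill: "filling X [x1, x2,
      x3, x1] \<alpha>"
    and ts: "sample (s / 2) \<alpha> ts" and ker: "let T = attach_disc_along (rips X s) (sample_loop \<alpha>
        ts); c = Inl (vertex b)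
      in kernel (rips_group X b s) (fundamental_group T c) (induced_map T c Inl) \<noteq> {\<one>\<^bsub>rips_group X
          b s\<^esub>}"
    unfolding critical_triangle_via_def by blast
  note fl = filling_length[OF fill]
  show \<alpha>: "rect \<alpha>" "\<alpha> 1 = \<alpha> 0" using fl by auto
  have "\<Psi> \<alpha> \<noteq> \<one>\<^bsub>\<P>\<^esub>"
    using ker attached_sample_kernel[OF rect_pathin[OF \<alpha>(1)] \<alpha>(2) ts] s_pos by simp
  then show notin: "base.pclass \<alpha> \<notin> lasso_group X b (3 * s)"
    using transport_loop_eq_one_iff[OF \<alpha>] by simp
  have d: "dist x y \<le> s" if "x \<in> {x1, x2, x3}" "y \<in> {x1, x2, x3}" for x y
    using diameter_bounded_bound[OF bounded_subset_X that] closed by (auto simp: closed_rips_def)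
  then have le: "dist x1 x2 \<le> s" "dist x2 x3 \<le> s" "dist x3 x1 \<le> s" by auto
  have "\<not> curve_length 0 1 \<alpha> < ennreal (3 * s)"
    using small_loop_in_lasso_group[OF rect_pathin[OF \<alpha>(1)] \<alpha>(2)] notin by blast
  then have "3 * s \<le> dist x1 x2 + dist x2 x3 + dist x3 x1"
    using s_pos unfolding fl(3) by (simp add: ennreal_less_iff del: ennreal_plus)
  with le show "dist x1 x2 = s" "dist x2 x3 = s" "dist x3 x1 = s" by auto
  then show "curve_length 0 1 \<alpha> = ennreal (3 * s)" using fl(3) by simp
qed

end

section \<open>Essential loops of critical length\<close>

locale essential_loop = rips_scale X b r for X :: "'a::metric_space set" and b r +
  fixes \<alpha> :: "real \<Rightarrow> 'a"
  assumes rect: "rect \<alpha>" and closed_loop: "\<alpha> 1 = \<alpha> 0" and len: "curve_length 0 1 \<alpha> = ennreal (3 * r)"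
    and essential: "base.pclass \<alpha> \<notin> lasso_group X b (3 * r)"
begin

sublocale rectifiable_path \<alpha>
  using rect by unfold_locales (auto simp: rect_def pathin_X)

lemma arclen_end: "arclen \<alpha> 1 = 3 * r"
  using len arclen_1 s_pos arclen_nonneg[of 1] by simp

lemma in_X: "t \<in> {0..1} \<Longrightarrow> \<alpha> t \<in> X"
  using rect_in_X[OF rect] .

text \<open>A chord shorter than both arcs would split the loop into two loops shorter than
  \<open>3 * r\<close>.\<close>

lemma dist_eq_arclen:
  assumes st: "0 \<le> u" "u \<le> v" "v \<le> 1"
  shows "dist (\<alpha> u) (\<alpha> v) = min (arclen \<alpha> v - arclen \<alpha> u) (3 * r - (arclen \<alpha> v - arclen \<alpha> u))"
proof (rule antisym)
  have a: "arclen \<alpha> u \<le> arclen \<alpha> v" "arclen \<alpha> v \<le> 3 * r" "0 \<le> arclen \<alpha> u"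
    using curve_length_arclen(2)[of u v] curve_length_arclen(2)[of v 1] st arclen_end
        arclen_nonneg by auto
  have d1: "dist (\<alpha> u) (\<alpha> v) \<le> arclen \<alpha> v - arclen \<alpha> u" using dist_le_arclen[OF st] .
  have "dist (\<alpha> u) (\<alpha> v) \<le> dist (\<alpha> 0) (\<alpha> u) + dist (\<alpha> v) (\<alpha> 1)"
    using dist_triangle[of "\<alpha> u" "\<alpha> v" "\<alpha> 0"] closed_loop by (simp add: dist_commute)
  also have "\<dots> \<le> 3 * r - (arclen \<alpha> v - arclen \<alpha> u)"
    using dist_le_arclen[of 0 u] dist_le_arclen[of v 1] st arclen_end by simp
  finally show "dist (\<alpha> u) (\<alpha> v) \<le> min (arclen \<alpha> v - arclen \<alpha> u) (3 * r - (arclen \<alpha> v - arclen \<alpha> u))"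
    using d1 by simp
  let ?d = "dist (\<alpha> u) (\<alpha> v)" and ?k = "geo (\<alpha> u) (\<alpha> v)"
  have X: "\<alpha> u \<in> X" "\<alpha> v \<in> X" using st by (auto intro: in_X)
  note k = geo[OF X] and rk = rect_geo[OF X]
  let ?p = "subpathin 0 u \<alpha>" and ?q = "subpathin u v \<alpha>" and ?r = "subpathin v 1 \<alpha>"
  have r: "rect ?p" "rect ?q" "rect ?r" using st rect by (auto intro: rect_subpath)
  note pr = r[THEN rect_pathin] rk[THEN rect_pathin]
  have split: "base.pclass \<alpha> = (base.pclass ?p \<otimes>\<^bsub>\<G>\<^esub> base.pclass ?q) \<otimes>\<^bsub>\<G>\<^esub> base.pclass ?r"
    using base.pclass_subpath_join[OF rect_pathin[OF rect], of 0 v 1]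
      base.pclass_subpath_join[OF rect_pathin[OF rect], of 0 u v] st by simp
  \<comment> \<open>The chord closes the arc from \<open>u\<close> to \<open>v\<close> to the loop
    \<open>?l1\<close> and replaces this arc in \<open>?l2\<close>. If it is shorter than the
    complementary arc, \<open>?l1\<close> is shorter than \<open>3 * r\<close>; if it is shorter
    than the arc itself, \<open>?l2\<close> is. The loop \<alpha> is \<open>?l1\<close>, conjugated
    by the initial part, times \<open>?l2\<close>.\<close>
  let ?l1 = "joinin ?q (reversein ?k)" and ?l2 = "joinin (joinin ?p ?k) ?r"
  have l1: "pathin (top_of_set X) ?l1" "?l1 1 = ?l1 0"
    using pr k by (auto intro!: pathin_joinin pathin_reversein)
  have l2: "pathin (top_of_set X) ?l2" "?l2 1 = ?l2 0"
    using pr k closed_loop by (auto intro!: pathin_joinin)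
  have c1: "curve_length 0 1 ?l1 = ennreal (arclen \<alpha> v - arclen \<alpha> u + ?d)"
    using k st a by (simp add: curve_length_joinin curve_length_subpathin curve_length_arclen)
  have c2: "curve_length 0 1 ?l2 = ennreal (3 * r - (arclen \<alpha> v - arclen \<alpha> u) + ?d)"
  proof -
    have "curve_length 0 1 ?l2 = ennreal (arclen \<alpha> u) + ennreal ?d + ennreal (3 * r - arclen \<alpha> v)"
      using k st by (simp add: curve_length_joinin curve_length_subpathin curve_length_arclen
          arclen_end)
    also have "\<dots> = ennreal (arclen \<alpha> u + ?d + (3 * r - arclen \<alpha> v))" using a by simp
    finally show ?thesis by (simp add: algebra_simps)
  qed
  show "min (arclen \<alpha> v - arclen \<alpha> u) (3 * r - (arclen \<alpha> v - arclen \<alpha> u)) \<le> ?d"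
  proof (rule ccontr)
    assume "\<not> ?thesis"
    then have "curve_length 0 1 ?l1 < ennreal (3 * r)" "curve_length 0 1 ?l2 < ennreal (3 * r)"
      unfolding c1 c2 using a s_pos by (auto intro!: ennreal_lessI simp del: ennreal_plus)
    then have L: "base.pclass ?l1 \<in> lasso_group X b (3 * r)" "base.pclass ?l2 \<in> lasso_group X b (3
        * r)"
      using l1 l2 by (auto intro: small_loop_in_lasso_group)
    have e1: "base.pclass ?l1 = base.pclass ?q \<otimes>\<^bsub>\<G>\<^esub> inv\<^bsub>\<G>\<^esub> base.pclass ?k"
      using pr k by (simp add: base.pclass_join base.pclass_reverse pathin_reversein)
    have e2: "base.pclass ?l2 = base.pclass ?p \<otimes>\<^bsub>\<G>\<^esub> base.pclass ?k \<otimes>\<^bsub>\<G>\<^esub> base.pclass ?r"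
      using pr k by (simp add: base.pclass_join pathin_joinin)
    have "base.pclass \<alpha> = (base.pclass ?p \<otimes>\<^bsub>\<G>\<^esub> base.pclass ?l1 \<otimes>\<^bsub>\<G>\<^esub> inv\<^bsub>\<G>\<^esub> base.pclass ?p) \<otimes>\<^bsub>\<G>\<^esub>
        base.pclass ?l2"
    proof -
      let ?P = "base.pclass ?p" and ?Q = "base.pclass ?q" and ?R = "base.pclass ?r" and ?K =
          "base.pclass ?k"
      have c: "?P \<in> carrier \<G>" "?Q \<in> carrier \<G>" "?R \<in> carrier \<G>" "?K \<in> carrier \<G>" using pr by auto
      show ?thesis
        unfolding e1 e2 split using c by (simp add: base.m_assoc base.inv_mult_cancel)
    qed
    also have "\<dots> \<in> lasso_group X b (3 * r)"
      using L r by (intro subgroup.m_closed[OF subgroup_lasso_group] conj_lasso_group pclass_rect)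
    finally show False using essential by simp
  qed
qed

theorem geodesic_circle: "geodesic_circle X \<alpha>"
proof -
  \<comment> \<open>The arc-length parametrisation of \<alpha>. The choice of \<open>t\<close> is
    immaterial, since parameters with the same arc length have points at distance 0.\<close>
  define e where "e l = \<alpha> (SOME t. t \<in> {0..1} \<and> arclen \<alpha> t = l)" for l
  have e: "\<exists>t\<in>{0..1}. arclen \<alpha> t = l \<and> e l = \<alpha> t" if l: "l \<in> {0..3 * r}" for l
  proof -
    have "\<exists>t. t \<in> {0..1} \<and> arclen \<alpha> t = l" using arclen_surj[of l] l arclen_end by auto
    from someI_ex[OF this] show ?thesis unfolding e_def by blast
  qed
  have d: "dist (\<alpha> u) (\<alpha> v) = min \<bar>arclen \<alpha> u - arclen \<alpha> v\<bar> (3 * r - \<bar>arclen \<alpha> u - arclen \<alpha> v\<bar>)"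
    if "u \<in> {0..1}" "v \<in> {0..1}" for u v
  proof (cases "u \<le> v")
    case True
    then show ?thesis using dist_eq_arclen[of u v] curve_length_arclen(2)[of u v] that by (simp
        add: abs_if)
  next
    case False
    then show ?thesis using dist_eq_arclen[of v u] curve_length_arclen(2)[of v u] that by (simp
        add: abs_if dist_commute)
  qed
  have "isometric_circle X (3 * r) e"
    unfolding isometric_circle_def
  proof (intro conjI ballI)
    show "e ` {0..3 * r} \<subseteq> X" using e in_X by force
    fix l m assume "l \<in> {0..3 * r}" "m \<in> {0..3 * r}"
    then obtain u v where "u \<in> {0..1}" "arclen \<alpha> u = l" "e l = \<alpha> u" "v \<in> {0..1}" "arclen \<alpha> v = m"
        "e m = \<alpha> v"
      using e by metis
    then show "dist (e l) (e m) = min \<bar>l - m\<bar> (3 * r - \<bar>l - m\<bar>)" using d[of u v] by simp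
  qed (use s_pos in simp)
  moreover have "mono_on {0..1} (arclen \<alpha>)"
    by (rule mono_onI) (use curve_length_arclen(2) in auto)
  moreover have "\<alpha> t = e (arclen \<alpha> t)" if t: "t \<in> {0..1}" for t
  proof -
    have "arclen \<alpha> t \<in> {0..3 * r}"
      using curve_length_arclen(2)[of t 1] t arclen_end arclen_nonneg by auto
    then obtain u where "u \<in> {0..1}" "arclen \<alpha> u = arclen \<alpha> t" "e (arclen \<alpha> t) = \<alpha> u" using e by blast
    then show ?thesis using d[OF t, of u] s_pos by simp
  qed
  ultimately show ?thesis
    unfolding geodesic_circle_def using continuous_on_arclen arclen_end
    by (intro exI[of _ "3 * r"] exI[of _ e] exI[of _ "arclen \<alpha>"]) simp
qed

lemma transport_essential: "\<Psi> \<alpha> \<noteq> \<one>\<^bsub>\<P>\<^esub>"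
  using transport_loop_eq_one_iff[OF rect closed_loop] essential by simp

text \<open>\<alpha> is shorter than \<open>3 * (r + e)\<close>, so it belongs to every later lasso
  group but not to the one at \<open>r\<close>.\<close>

theorem right_critical: "right_critical X b r"
  unfolding right_critical_def
proof (intro conjI allI impI notI)
  fix e :: real assume e: "e > 0" and iso: "bonding_map X b (r + e) \<in> iso (rips_group X b r)
      (rips_group X b (r + e))"
  interpret two_scales X b r "r + e" using e s_pos by (intro two_scales) auto
  have "curve_length 0 1 \<alpha> < ennreal (3 * (r + e))"
    unfolding len using e s_pos by (intro ennreal_lessI) auto
  then have "base.pclass \<alpha> \<in> lasso_group X b (3 * (r + e))"
    using rect closed_loop by (intro small_loop_in_lasso_group) (auto simp: rect_pathin)
  then show False using iso essential unfolding bonding_iso_iff by blast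
qed (use s_pos in simp)

text \<open>Each third of \<alpha> has length \<open>r\<close>, which is also the distance of its
  ends. So the thirds are geodesics and \<alpha> fills its own triangle.\<close>

lemma equidistant_filling:
  assumes t: "t2 \<in> {0..1}" "t3 \<in> {0..1}" "arclen \<alpha> t2 = r" "arclen \<alpha> t3 = 2 * r"
  shows "filling X [\<alpha> 0, \<alpha> t2, \<alpha> t3, \<alpha> 0] \<alpha>" "distinct [\<alpha> 0, \<alpha> t2, \<alpha> t3]"
    "{\<alpha> 0, \<alpha> t2, \<alpha> t3} \<in> closed_rips X r" "critical_triangle_via X b r (\<alpha> 0) (\<alpha> t2) (\<alpha> t3) \<alpha>"
proof -
  have lt: "0 < t2" "t2 < t3" "t3 < 1"
    using t s_pos arclen_end curve_length_arclen(2)[of t3 t2] order_le_less[of 0 t2]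
        order_le_less[of t3 1]
    by (auto simp: not_less[symmetric])
  have d: "dist (\<alpha> 0) (\<alpha> t2) = r" "dist (\<alpha> t2) (\<alpha> t3) = r" "dist (\<alpha> t3) (\<alpha> 0) = r"
    using dist_eq_arclen[of 0 t2] dist_eq_arclen[of t2 t3] dist_eq_arclen[of 0 t3] lt t s_pos by
        (auto simp: dist_commute)
  have X: "\<alpha> 0 \<in> X" "\<alpha> t2 \<in> X" "\<alpha> t3 \<in> X" using t in_X by auto
  have cont: "continuous_on {u..v} \<alpha>" "\<alpha> ` {u..v} \<subseteq> X" if "0 \<le> u" "v \<le> 1" for u v
    using that rect continuous_on_subset[of "{0..1}" \<alpha> "{u..v}"] by (auto simp: rect_def pathin_X)
  have g: "geodesic_on X 0 t2 \<alpha>" "geodesic_on X t2 t3 \<alpha>" "geodesic_on X t3 1 \<alpha>"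
    unfolding geodesic_on_def using lt t d closed_loop arclen_end by (auto simp: cont
        curve_length_arclen)
  show fill: "filling X [\<alpha> 0, \<alpha> t2, \<alpha> t3, \<alpha> 0] \<alpha>"
    unfolding filling_def
  proof (intro conjI exI[of _ "[0, t2, t3, 1]"])
    show "loop_in X \<alpha>" using rect closed_loop by (simp add: loop_in_iff rect_pathin)
    show "\<forall>i<length [\<alpha> 0, \<alpha> t2, \<alpha> t3, \<alpha> 0]. \<alpha> ([0, t2, t3, 1] ! i) = [\<alpha> 0, \<alpha> t2, \<alpha> t3, \<alpha> 0] ! i"
      using closed_loop by (auto simp: less_Suc_eq)
    show "\<forall>i. Suc i < length [\<alpha> 0, \<alpha> t2, \<alpha> t3, \<alpha> 0] \<longrightarrow> geodesic_on X ([0, t2, t3, 1] ! i) ([0, t2,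
        t3, 1] ! Suc i) \<alpha>"
      using g by (auto simp: less_Suc_eq)
  qed (use lt in auto)
  show dis: "distinct [\<alpha> 0, \<alpha> t2, \<alpha> t3]" using d s_pos by auto
  have "diameter {\<alpha> 0, \<alpha> t2, \<alpha> t3} \<le> r"
    using d s_pos by (intro diameter_le_metric) (auto simp: dist_commute)
  then show cr: "{\<alpha> 0, \<alpha> t2, \<alpha> t3} \<in> closed_rips X r" using X by (simp add: closed_rips_def)
  obtain ts where "based_sample (r / 2) \<alpha> ts"
    using based_sample_exists[OF rect_pathin[OF rect] closed_loop, of "r / 2"] s_pos by auto
  then have ts: "sample (r / 2) \<alpha> ts" by (simp add: based_sample_def)
  show "critical_triangle_via X b r (\<alpha> 0) (\<alpha> t2) (\<alpha> t3) \<alpha>"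
    unfolding critical_triangle_via_def
    using fill dis cr ts attached_sample_kernel[OF rect_pathin[OF rect] closed_loop ts]
        transport_essential s_pos by auto
qed

lemma essential_loop_shiftpath:
  assumes t: "t \<in> {0..1}"
  shows "essential_loop X b r (shiftpath t \<alpha>)"
proof
  note sh = shiftpath_loop[OF rect closed_loop t]
  show "rect (shiftpath t \<alpha>)" "shiftpath t \<alpha> 1 = shiftpath t \<alpha> 0" "curve_length 0 1 (shiftpath t
      \<alpha>) = ennreal (3 * r)"
    using sh len by auto
  let ?g = "base.pclass (subpathin 0 t \<alpha>)"
  have g: "?g \<in> rect_classes" using rect t by (intro pclass_rect rect_subpath) auto
  then have gc: "?g \<in> carrier \<G>" using subgroup.subset[OF subgroup_rect_classes] by blast
  have "base.pclass \<alpha> \<in> carrier \<G>" using rect by (simp add: rect_pathin)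
  from lasso_group_conj_iff[OF subgroup.m_inv_closed[OF subgroup_rect_classes g] this, of "3 * r"]
  show "base.pclass (shiftpath t \<alpha>) \<notin> lasso_group X b (3 * r)"
    unfolding sh(5) using essential gc by simp
qed

lemma equidistant_triple:
  assumes t: "t1 \<in> {0..1}" "t2 \<in> {0..1}" "t3 \<in> {0..1}"
    and a: "arclen \<alpha> t1 < arclen \<alpha> t2" "arclen \<alpha> t2 < arclen \<alpha> t3"
    and eq: "dist (\<alpha> t1) (\<alpha> t2) = dist (\<alpha> t2) (\<alpha> t3)" "dist (\<alpha> t2) (\<alpha> t3) = dist (\<alpha> t3) (\<alpha> t1)"
  shows "{\<alpha> t1, \<alpha> t2, \<alpha> t3} \<in> closed_rips X r \<and> critical_triangle X b r {\<alpha> t1, \<alpha> t2, \<alpha> t3}"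
proof -
  have lt: "t1 < t2" "t2 < t3"
    using a curve_length_arclen(2)[of t2 t1] curve_length_arclen(2)[of t3 t2] t by (auto simp:
        not_less[symmetric])
  have le: "arclen \<alpha> t3 \<le> 3 * r" "0 \<le> arclen \<alpha> t1"
    using curve_length_arclen(2)[of t3 1] t arclen_end arclen_nonneg by auto
  let ?u = "arclen \<alpha> t2 - arclen \<alpha> t1" and ?v = "arclen \<alpha> t3 - arclen \<alpha> t2"
  have "min ?u (3 * r - ?u) = min ?v (3 * r - ?v)" "min ?v (3 * r - ?v) = min (?u + ?v) (3 * r -
      (?u + ?v))"
    using eq dist_eq_arclen[of t1 t2] dist_eq_arclen[of t2 t3] dist_eq_arclen[of t1 t3] t lt
    by (auto simp: dist_commute)
  \<comment> \<open>The equations have one other formal branch, \<open>?v = 3 * r - ?u\<close>. It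
    would place the first and third point at distance 0 while the others are apart. With
    \<open>?u = ?v\<close>, the remaining equation leaves only \<open>r\<close>.\<close>
  then have uv: "?u = r" "?v = r" using a le by (auto simp: min_def split: if_splits)
  \<comment> \<open>Rotating the start of \<alpha> to \<open>t1\<close> brings the triple to arc
    lengths 0, \<open>r\<close> and \<open>2 * r\<close>, the case already treated.\<close>
  let ?\<alpha> = "shiftpath t1 \<alpha>"
  interpret S: essential_loop X b r ?\<alpha> by (rule essential_loop_shiftpath[OF t(1)])
  have sh: "?\<alpha> u = \<alpha> (1 * u + t1)" if "u \<le> 1 - t1" for u
    using that by (simp add: shiftpath_def add.commute)
  have al: "arclen ?\<alpha> (v - t1) = arclen \<alpha> v - arclen \<alpha> t1" if v: "t1 \<le> v" "v \<le> 1" for v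
  proof -
    have "curve_length 0 (v - t1) ?\<alpha> = curve_length 0 (v - t1) (\<lambda>u. \<alpha> (1 * u + t1))"
      using v by (intro curve_length_cong sh) auto
    also have "\<dots> = curve_length t1 v \<alpha>" by (intro curve_length_affine) auto
    finally show ?thesis using curve_length_arclen[of t1 v] v t by (simp add: arclen_def[of ?\<alpha>])
  qed
  have "?\<alpha> 0 = \<alpha> t1" "?\<alpha> (t2 - t1) = \<alpha> t2" "?\<alpha> (t3 - t1) = \<alpha> t3"
    using sh[of 0] sh[of "t2 - t1"] sh[of "t3 - t1"] t lt by auto
  moreover have "t2 - t1 \<in> {0..1}" "t3 - t1 \<in> {0..1}" "arclen ?\<alpha> (t2 - t1) = r" "arclen ?\<alpha> (t3 -
      t1) = 2 * r"
    using al[of t2] al[of t3] uv t lt by auto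
  note S.equidistant_filling[OF this]
  ultimately show ?thesis unfolding critical_triangle_def by auto
qed

theorem equidistant_critical:
  assumes x: "x1 \<in> path_image \<alpha>" "x2 \<in> path_image \<alpha>" "x3 \<in> path_image \<alpha>" "distinct [x1, x2, x3]"
    and eq: "dist x1 x2 = dist x2 x3" "dist x2 x3 = dist x3 x1"
  shows "{x1, x2, x3} \<in> closed_rips X r \<and> critical_triangle X b r {x1, x2, x3}"
proof -
  obtain t1 t2 t3 where t: "t1 \<in> {0..1}" "t2 \<in> {0..1}" "t3 \<in> {0..1}" "x1 = \<alpha> t1" "x2 = \<alpha> t2" "x3 =
      \<alpha> t3"
    using x by (auto simp: path_image_def)
  have ne: "arclen \<alpha> u \<noteq> arclen \<alpha> v" if "u \<in> {0..1}" "v \<in> {0..1}" "\<alpha> u \<noteq> \<alpha> v" for u v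
  proof (cases "u \<le> v")
    case True
    then show ?thesis using dist_le_arclen[of u v] that by auto
  next
    case False
    then show ?thesis using dist_le_arclen[of v u] that by auto
  qed
  have "\<alpha> t1 \<noteq> \<alpha> t2" "\<alpha> t2 \<noteq> \<alpha> t3" "\<alpha> t1 \<noteq> \<alpha> t3" using x(4) t(4-6) by simp_all
  then have "arclen \<alpha> t1 \<noteq> arclen \<alpha> t2" "arclen \<alpha> t2 \<noteq> arclen \<alpha> t3" "arclen \<alpha> t1 \<noteq> arclen \<alpha> t3"
    using ne[OF t(1,2)] ne[OF t(2,3)] ne[OF t(1,3)] by blast+
  \<comment> \<open>Arc length separates distinct points, so they are met in one of six orders; the
    conditions on distances are symmetric under all of them.\<close>
  then consider "arclen \<alpha> t1 < arclen \<alpha> t2" "arclen \<alpha> t2 < arclen \<alpha> t3"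
    | "arclen \<alpha> t1 < arclen \<alpha> t3" "arclen \<alpha> t3 < arclen \<alpha> t2"
    | "arclen \<alpha> t2 < arclen \<alpha> t1" "arclen \<alpha> t1 < arclen \<alpha> t3"
    | "arclen \<alpha> t2 < arclen \<alpha> t3" "arclen \<alpha> t3 < arclen \<alpha> t1"
    | "arclen \<alpha> t3 < arclen \<alpha> t1" "arclen \<alpha> t1 < arclen \<alpha> t2"
    | "arclen \<alpha> t3 < arclen \<alpha> t2" "arclen \<alpha> t2 < arclen \<alpha> t1" by linarith
  moreover define D where "D = dist x1 x2"
  have D: "dist x1 x2 = D" "dist x2 x3 = D" "dist x3 x1 = D" "dist x2 x1 = D" "dist x3 x2 = D"
      "dist x1 x3 = D"
    using eq by (auto simp: D_def dist_commute)
  ultimately show ?thesis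
  proof cases
    case 1
    then show ?thesis using equidistant_triple[OF t(1) t(2) t(3)] D[unfolded t(4-6)] unfolding
        t(4-6) by (simp add: insert_commute)
  next
    case 2
    then show ?thesis using equidistant_triple[OF t(1) t(3) t(2)] D[unfolded t(4-6)] unfolding
        t(4-6) by (simp add: insert_commute)
  next
    case 3
    then show ?thesis using equidistant_triple[OF t(2) t(1) t(3)] D[unfolded t(4-6)] unfolding
        t(4-6) by (simp add: insert_commute)
  next
    case 4
    then show ?thesis using equidistant_triple[OF t(2) t(3) t(1)] D[unfolded t(4-6)] unfolding
        t(4-6) by (simp add: insert_commute)
  next
    case 5
    then show ?thesis using equidistant_triple[OF t(3) t(1) t(2)] D[unfolded t(4-6)] unfolding
        t(4-6) by (simp add: insert_commute)
  next
    case 6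
    then show ?thesis using equidistant_triple[OF t(3) t(2) t(1)] D[unfolded t(4-6)] unfolding
        t(4-6) by (simp add: insert_commute)
  qed
qed

end

section \<open>The kernel of the bonding map after a critical value\<close>

context pointed_geodesic
begin

text \<open>Away from critical values lasso groups are constant on a short interval to the left and
  to the right of each scale; bisection extends this to the whole interval.\<close>

lemma noncritical_lasso_group:
  assumes uv: "0 < u" "u \<le> v" and nc: "\<And>x. u \<le> x \<Longrightarrow> x \<le> v \<Longrightarrow> \<not> critical_value X b x"
  shows "lasso_group X b (3 * v) \<subseteq> lasso_group X b (3 * u)"
proof -
  have "u \<le> u \<and> v \<le> v \<longrightarrow> lasso_group X b (3 * v) \<subseteq> lasso_group X b (3 * u)"
  proof (rule Bolzano[of u v "\<lambda>a w. u \<le> a \<and> w \<le> v \<longrightarrow> lasso_group X b (3 * w) \<subseteq> lasso_group X b (3 *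
      a)", OF uv(2)])
    fix x assume x: "u \<le> x" "x \<le> v"
    have "\<not> right_critical X b x" "\<not> left_critical X b x" using nc[OF x] by (auto simp:
        critical_value_def)
    then obtain e2 where e2: "e2 > 0" "bonding_map X b (x + e2) \<in> iso (rips_group X b x)
        (rips_group X b (x + e2))"
      using x uv by (auto simp: right_critical_def)
    \<comment> \<open>Failure of left criticality produces isomorphisms from scales arbitrarily
      close to \<open>x\<close>; one with \<open>e < x\<close> keeps the lower scale
      positive.\<close>
    have "\<exists>e>0. e < x \<and> bonding_map X b x \<in> iso (rips_group X b (x - e)) (rips_group X b x)"
    proof (rule ccontr)
      assume "\<not> ?thesis"
      then have "\<forall>\<^sub>F e in at_right 0. bonding_map X b x \<notin> iso (rips_group X b (x - e)) (rips_group
          X b x)"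
        using x uv unfolding eventually_at_right_field by (intro exI[of _ x]) auto
      then show False using \<open>\<not> left_critical X b x\<close> x uv by (simp add: left_critical_def)
    qed
    then obtain e1 where e1: "e1 > 0" "e1 < x" "bonding_map X b x \<in> iso (rips_group X b (x - e1))
        (rips_group X b x)"
      by blast
    have "two_scales X b x (x + e2)" "two_scales X b (x - e1) x" using e1 e2 x uv by (auto intro!:
        two_scales)
    then have L: "lasso_group X b (3 * (x + e2)) \<subseteq> lasso_group X b (3 * x)"
      "lasso_group X b (3 * x) \<subseteq> lasso_group X b (3 * (x - e1))"
      using e1 e2 by (simp_all add: two_scales.bonding_iso_iff)
    have "lasso_group X b (3 * w) \<subseteq> lasso_group X b (3 * a)" if "a \<le> x" "x \<le> w" "w - a < min e1
        e2" for a w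
      using lasso_group_mono[of "3 * w" "3 * (x + e2)"] L lasso_group_mono[of "3 * (x - e1)" "3 *
          a"] that by auto
    then show "\<exists>d>0. \<forall>a w. a \<le> x \<and> x \<le> w \<and> w - a < d \<longrightarrow> u \<le> a \<and> w \<le> v \<longrightarrow>
        lasso_group X b (3 * w) \<subseteq> lasso_group X b (3 * a)"
      using e1 e2 by (intro exI[of _ "min e1 e2"]) auto
  qed auto
  then show ?thesis by simp
qed

text \<open>A product involves finitely many lassos, each bounded by a strict inequality, so some
  smaller scale already suffices for all of them. This permits a critical upper scale
  \<open>r'\<close>, where constancy is available only strictly below.\<close>

lemma lasso_group_left_continuous:
  assumes a: "a \<in> lasso_group X b (3 * r')" and u: "u < r'" "0 < u"
  obtains s where "u \<le> s" "s < r'" "a \<in> lasso_group X b (3 * s)"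
proof -
  have lasso: "\<exists>s. u \<le> s \<and> s < r' \<and> h \<in> lasso_classes (3 * s)" if "h \<in> lasso_classes (3 * r')" for h
  proof -
    obtain \<gamma> \<beta> where h: "rect \<gamma>" "\<gamma> 0 = b" "pathin (top_of_set X) \<beta>" "\<beta> 0 = \<gamma> 1" "\<beta> 1 = \<gamma> 1"
      and l: "curve_length 0 1 \<beta> < ennreal (3 * r')"
      and eq: "h = base.pclass \<gamma> \<otimes>\<^bsub>\<G>\<^esub> base.pclass \<beta> \<otimes>\<^bsub>\<G>\<^esub> inv\<^bsub>\<G>\<^esub> base.pclass \<gamma>"
      using \<open>h \<in> lasso_classes (3 * r')\<close> by (rule lasso_classesE)
    define x where "x = enn2real (curve_length 0 1 \<beta>)"
    have x: "curve_length 0 1 \<beta> = ennreal x" "0 \<le> x"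
      using less_trans[OF l ennreal_less_top] by (simp_all add: x_def)
    then have "x < 3 * r'" using l by (simp add: ennreal_less_iff)
    then obtain y where "x / 3 < y" "y < r'" using dense[of "x / 3" r'] by auto
    then have y: "x < 3 * y" "y < r'" by auto
    have "curve_length 0 1 \<beta> < ennreal (3 * max u y)"
      unfolding x(1) using y x(2) by (intro ennreal_lessI) auto
    then have "h \<in> lasso_classes (3 * max u y)" unfolding lasso_classes_def eq using h by blast
    then show ?thesis using u y by (intro exI[of _ "max u y"]) auto
  qed
  have "\<exists>s. u \<le> s \<and> s < r' \<and> a \<in> lasso_group X b (3 * s)"
    using a[unfolded lasso_group_eq]
  proof (induction a rule: generate.induct)
    case one
    then show ?case using u subgroup.one_closed[OF subgroup_lasso_group] by (intro exI[of _ u]) auto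
  next
    case (incl h)
    then show ?case using lasso[of h] generate.incl[of h] unfolding lasso_group_eq by blast
  next
    case (inv h)
    then show ?case using lasso[of h] generate.inv[of h] unfolding lasso_group_eq by blast
  next
    case (eng h h')
    then obtain s s' where s: "u \<le> s" "s < r'" "h \<in> lasso_group X b (3 * s)"
      "u \<le> s'" "s' < r'" "h' \<in> lasso_group X b (3 * s')" by blast
    then have "h \<in> lasso_group X b (3 * max s s')" "h' \<in> lasso_group X b (3 * max s s')"
      using lasso_group_mono[of "3 * s" "3 * max s s'"] lasso_group_mono[of "3 * s'" "3 * max s
          s'"] by auto
    then show ?case using s subgroup.m_closed[OF subgroup_lasso_group] by (intro exI[of _ "max s
        s'"]) auto
  qed
  then show thesis using that by blast
qed

lemma fill_length_le:
  assumes "vs \<noteq> []" "set vs \<subseteq> X" "\<And>i. Suc i < length vs \<Longrightarrow> dist (vs ! i) (vs ! Suc i) \<le> d" "0 \<le> d"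
  shows "curve_length 0 1 (fill vs) \<le> ennreal (d * (length vs - 1))"
  using assms
proof (induction vs rule: fill.induct)
  case (1 x y ys)
  have "dist ((y # ys) ! i) ((y # ys) ! Suc i) \<le> d" if "Suc i < length (y # ys)" for i
    using "1.prems"(3)[of "Suc i"] that by simp
  then have IH: "curve_length 0 1 (fill (y # ys)) \<le> ennreal (d * length ys)"
    using 1 by simp
  have d: "dist x y \<le> d" using "1.prems"(3)[of 0] by simp
  have X: "x \<in> X" "y \<in> X" using "1.prems"(2) by auto
  have "curve_length 0 1 (fill (x # y # ys)) = ennreal (dist x y) + curve_length 0 1 (fill (y # ys))"
    using geo[OF X] fill[of "y # ys"] "1.prems"(2) by (simp add: curve_length_joinin)
  also have "\<dots> \<le> ennreal d + ennreal (d * length ys)"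
    using d IH by (intro add_mono ennreal_leI)
  also have "\<dots> = ennreal (d * (length (x # y # ys) - 1))"
    using "1.prems"(4) by (simp add: algebra_simps flip: ennreal_plus)
  finally show ?case .
qed auto

end

lemma (in rectifiable_path) equal_pieces:
  assumes "arclen p 1 > 0" "N > 0"
  obtains t :: "nat \<Rightarrow> real" where "t 0 = 0" "t N = 1" "\<And>i. i \<le> N \<Longrightarrow> t i \<in> {0..1}"
    "\<And>i. i \<le> N \<Longrightarrow> arclen p (t i) = i * arclen p 1 / N" "\<And>i. i < N \<Longrightarrow> t i < t (Suc i)"
proof -
  have "\<exists>t\<in>{0..1}. arclen p t = i * arclen p 1 / N" if "i \<le> N" for i
  proof -
    have "i * arclen p 1 / N \<le> arclen p 1"
      using that assms by (simp add: field_simps mult_right_mono)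
    moreover have "0 \<le> i * arclen p 1 / N" using assms by simp
    ultimately obtain t where "t \<in> {0..1}" "arclen p t = i * arclen p 1 / N" using arclen_surj by
        blast
    then show ?thesis by blast
  qed
  then obtain u where u: "\<And>i. i \<le> N \<Longrightarrow> u i \<in> {0..1} \<and> arclen p (u i) = i * arclen p 1 / N" by metis
  \<comment> \<open>A path may pause at its ends, so the lengths 0 and \<open>arclen p 1\<close> do
    not single out the parameters 0 and 1. These two are therefore set by hand.\<close>
  define t where "t i = (if i = 0 then 0 else if i = N then 1 else u i)" for i
  have t: "t i \<in> {0..1}" "arclen p (t i) = i * arclen p 1 / N" if "i \<le> N" for i
    using u[OF that] assms(2) by (auto simp: t_def)
  have "t i < t (Suc i)" if i: "i < N" for i
  proof (rule ccontr)
    assume "\<not> ?thesis"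
    then have "arclen p (t (Suc i)) \<le> arclen p (t i)"
      using t[of i] t[of "Suc i"] i by (intro curve_length_arclen(2)) auto
    moreover have "arclen p (t (Suc i)) = arclen p (t i) + arclen p 1 / N"
      using t(2)[of i] t(2)[of "Suc i"] i by (simp add: add_divide_distrib distrib_right)
    moreover have "arclen p 1 / N > 0" using assms by simp
    ultimately show False by linarith
  qed
  then show thesis using that[of t] t assms(2) by (simp add: t_def)
qed

lemma finite_family_convergent_subsequence:
  fixes Y :: "nat \<Rightarrow> nat \<Rightarrow> 'a::metric_space"
  assumes X: "compact X" and Y: "\<And>n i. i < N \<Longrightarrow> Y n i \<in> X"
  shows "\<exists>\<phi> l. strict_mono \<phi> \<and> (\<forall>i<N. l i \<in> X \<and> (\<lambda>n. Y (\<phi> n) i) \<longlonglongrightarrow> l i)"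
  using Y
proof (induction N)
  case 0
  then show ?case by (auto intro: exI[of _ id] simp: strict_mono_def)
next
  case (Suc N)
  then obtain \<phi> l where \<phi>: "strict_mono \<phi>" and l: "\<And>i. i < N \<Longrightarrow> l i \<in> X \<and> (\<lambda>n. Y (\<phi> n) i) \<longlonglongrightarrow> l i"
    by (metis less_SucI)
  have "\<forall>n. Y (\<phi> n) N \<in> X" using Suc.prems by simp
  then obtain x \<psi> where x: "x \<in> X" "strict_mono \<psi>" "((\<lambda>n. Y (\<phi> n) N) \<circ> \<psi>) \<longlonglongrightarrow> x"
    using X[unfolded compact_eq_seq_compact_metric seq_compact_def] by metis
  have "(\<lambda>n. Y ((\<phi> \<circ> \<psi>) n) i) \<longlonglongrightarrow> l i" if "i < N" for i
    using LIMSEQ_subseq_LIMSEQ[OF conjunct2[OF l[OF that]] x(2)] by (simp add: comp_def)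
  then show ?case
    using l x \<phi> strict_mono_compose[of \<phi> \<psi>]
    by (intro exI[of _ "\<phi> \<circ> \<psi>"] exI[of _ "l(N := x)"]) (auto simp: less_Suc_eq comp_def)
qed

text \<open>Commuting squares let a rung slide along two parallel vertex sequences. If both
  sequences close up, the first and last rung coincide and the two products are conjugate.\<close>

lemma cocycle_prod_ladder:
  assumes G: "group G" and ne: "is \<noteq> []"
    and cl: "\<And>i. i \<in> set is \<Longrightarrow> c (u i) (v i) \<in> carrier G"
    and sq: "\<And>k. Suc k < length is \<Longrightarrow> c (u (is ! k)) (u (is ! Suc k)) \<in> carrier G \<and> c (v (is ! k))
        (v (is ! Suc k)) \<in> carrier G \<and>
      c (u (is ! k)) (u (is ! Suc k)) \<otimes>\<^bsub>G\<^esub> c (u (is ! Suc k)) (v (is ! Suc k)) =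
      c (u (is ! k)) (v (is ! k)) \<otimes>\<^bsub>G\<^esub> c (v (is ! k)) (v (is ! Suc k))"
  shows "cocycle_prod G c (map u is) \<in> carrier G \<and> cocycle_prod G c (map v is) \<in> carrier G \<and>
    cocycle_prod G c (map u is) \<otimes>\<^bsub>G\<^esub> c (u (last is)) (v (last is)) =
    c (u (hd is)) (v (hd is)) \<otimes>\<^bsub>G\<^esub> cocycle_prod G c (map v is)"
  using ne cl sq
proof (induction "is" rule: induct_list012)
  case (2 x)
  interpret group G by fact
  show ?case using 2 by simp
next
  case (3 x y zs)
  interpret group G by fact
  let ?U = "cocycle_prod G c (map u (y # zs))" and ?V = "cocycle_prod G c (map v (y # zs))"
  let ?w = "c (u (last (y # zs))) (v (last (y # zs)))"
  have IH: "?U \<in> carrier G" "?V \<in> carrier G" "?U \<otimes>\<^bsub>G\<^esub> ?w = c (u y) (v y) \<otimes>\<^bsub>G\<^esub> ?V"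
  proof -
    have "c (u i) (v i) \<in> carrier G" if "i \<in> set (y # zs)" for i using 3(4)[of i] that by simp
    moreover note 3(5)[of "Suc k" for k]
    ultimately show "?U \<in> carrier G" "?V \<in> carrier G" "?U \<otimes>\<^bsub>G\<^esub> ?w = c (u y) (v y) \<otimes>\<^bsub>G\<^esub> ?V"
      using 3(2) by simp_all
  qed
  have S: "c (u x) (u y) \<in> carrier G" "c (v x) (v y) \<in> carrier G"
    "c (u x) (u y) \<otimes>\<^bsub>G\<^esub> c (u y) (v y) = c (u x) (v x) \<otimes>\<^bsub>G\<^esub> c (v x) (v y)"
    using 3(5)[of 0] by simp_all
  have W: "?w \<in> carrier G" "c (u x) (v x) \<in> carrier G" "c (u y) (v y) \<in> carrier G"
    using 3(4)[of "last (y # zs)"] 3(4)[of x] 3(4)[of y] last_in_set[of "y # zs"] by auto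
  have "c (u x) (u y) \<otimes>\<^bsub>G\<^esub> ?U \<otimes>\<^bsub>G\<^esub> ?w = (c (u x) (u y) \<otimes>\<^bsub>G\<^esub> c (u y) (v y)) \<otimes>\<^bsub>G\<^esub> ?V"
    unfolding m_assoc[OF S(1) IH(1) W(1)] IH(3) using m_assoc[OF S(1) W(3) IH(2)] by simp
  also have "\<dots> = c (u x) (v x) \<otimes>\<^bsub>G\<^esub> (c (v x) (v y) \<otimes>\<^bsub>G\<^esub> ?V)"
    unfolding S(3) using IH S W by (simp add: m_assoc)
  finally show ?case using IH S by simp
qed simp

section \<open>Limits of shrinking loops, and the critical classes\<close>

context rips_scale
begin

text \<open>The shorter loop is a limit of finite samples of ever shorter counterexamples.\<close>

lemma loop_shortening:
  "\<exists>s'>s. \<forall>\<beta>. rect \<beta> \<and> \<beta> 1 = \<beta> 0 \<and> curve_length 0 1 \<beta> < ennreal (3 * s') \<longrightarrow>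
    (\<exists>\<beta>' g. rect \<beta>' \<and> \<beta>' 1 = \<beta>' 0 \<and> curve_length 0 1 \<beta>' \<le> ennreal (3 * s) \<and> g \<in> carrier \<P> \<and>
      \<Psi> \<beta> \<otimes>\<^bsub>\<P>\<^esub> g = g \<otimes>\<^bsub>\<P>\<^esub> \<Psi> \<beta>')"
proof (rule ccontr)
  assume neg: "\<not> ?thesis"
  define good where "good \<beta> \<longleftrightarrow> (\<exists>\<beta>' g. rect \<beta>' \<and> \<beta>' 1 = \<beta>' 0 \<and> curve_length 0 1 \<beta>' \<le> ennreal (3 *
      s) \<and> g \<in> carrier \<P> \<and>
      \<Psi> \<beta> \<otimes>\<^bsub>\<P>\<^esub> g = g \<otimes>\<^bsub>\<P>\<^esub> \<Psi> \<beta>')" for \<beta>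
  have "\<exists>\<beta>. rect \<beta> \<and> \<beta> 1 = \<beta> 0 \<and> curve_length 0 1 \<beta> < ennreal (3 * (s + 1 / Suc n)) \<and> \<not> good \<beta>" for n
  proof -
    have "s + 1 / Suc n > s" by simp
    then show ?thesis using neg unfolding good_def by blast
  qed
  then obtain B where B: "\<And>n. rect (B n)" "\<And>n. B n 1 = B n 0"
    "\<And>n. curve_length 0 1 (B n) < ennreal (3 * (s + 1 / Suc n))" "\<And>n. \<not> good (B n)" by metis
  \<comment> \<open>All loops in the sequence are shorter than \<open>3 * (s + 1)\<close>, so
    cutting them into \<open>N\<close> equal pieces makes each piece shorter than
    \<open>s / 4\<close>.\<close>
  obtain N :: nat where N: "12 * (s + 1) / s < N" using reals_Archimedean2 by blast
  have Npos: "N > 0" using N s_pos by (metis divide_pos_pos add_pos_pos less_trans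
      of_nat_0_less_iff zero_less_one mult_pos_pos zero_less_numeral)
  have N4: "3 * (s + 1) / N < s / 4" using N Npos s_pos by (simp add: field_simps)
  have rp: "rectifiable_path (B n)" for n
    using B(1)[of n] by unfold_locales (auto simp: rect_def pathin_X)
  have len: "3 * s < arclen (B n) 1" "arclen (B n) 1 < 3 * (s + 1 / Suc n)" for n
  proof -
    interpret rectifiable_path "B n" by (rule rp)
    show "arclen (B n) 1 < 3 * (s + 1 / Suc n)"
      using B(3)[of n] arclen_1 arclen_nonneg[of 1] by (simp add: ennreal_less_iff)
    \<comment> \<open>A loop of length at most \<open>3 * s\<close> would be good with itself as the
      replacement and the neutral element as \<open>g\<close>.\<close>
    have "\<not> curve_length 0 1 (B n) \<le> ennreal (3 * s)"
      using B(1,2,4)[of n] rips.one_closed rips.l_one rips.r_one sampling.transport_closed[OF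
          rect_pathin[OF B(1)[of n]]]
      unfolding good_def by metis
    then show "3 * s < arclen (B n) 1" using arclen_1 by (simp add: ennreal_leI not_le[symmetric])
        (metis ennreal_leI not_le)
  qed
  have "\<exists>t :: nat \<Rightarrow> real. t 0 = 0 \<and> t N = 1 \<and> (\<forall>i\<le>N. t i \<in> {0..1}) \<and>
    (\<forall>i\<le>N. arclen (B n) (t i) = i * arclen (B n) 1 / N) \<and> (\<forall>i<N. t i < t (Suc i))" for n
  proof -
    have "arclen (B n) 1 > 0" using len(1)[of n] s_pos by simp
    from rectifiable_path.equal_pieces[OF rp this Npos] show ?thesis by metis
  qed
  then obtain t :: "nat \<Rightarrow> nat \<Rightarrow> real" where t: "\<And>n. t n 0 = 0" "\<And>n. t n N = 1"
    "\<And>n i. i \<le> N \<Longrightarrow> t n i \<in> {0..1}" "\<And>n i. i \<le> N \<Longrightarrow> arclen (B n) (t n i) = i * arclen (B n) 1 / N"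
    "\<And>n i. i < N \<Longrightarrow> t n i < t n (Suc i)" by metis
  define Y where "Y n i = B n (t n i)" for n i
  have YX: "Y n i \<in> X" if "i < Suc N" for n i
    using rect_in_X[OF B(1)] t(3)[of i n] that by (simp add: Y_def)
  have piece: "arclen (B n) (t n (Suc i)) - arclen (B n) (t n i) = arclen (B n) 1 / N" if "i < N"
      for n i
    using t(4)[of "Suc i" n] t(4)[of i n] that by (simp add: field_simps)
  have piece_less: "arclen (B n) 1 / N < s / 4" for n
  proof -
    have "3 / (1 + real n) \<le> 3" by (simp add: divide_le_eq)
    then have "arclen (B n) 1 \<le> 3 * (s + 1)" using len(2)[of n] by simp
    then show ?thesis using N4 Npos by (meson divide_right_mono le_less_trans of_nat_0_le_iff)
  qed
  have dY: "dist (Y n i) (Y n (Suc i)) \<le> arclen (B n) 1 / N" if "i < N" for n i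
    unfolding Y_def piece[OF that, symmetric]
    using t(3)[of i n] t(3)[of "Suc i" n] t(5)[OF that, of n] that by (intro
        rectifiable_path.dist_le_arclen[OF rp]) auto
  obtain \<phi> l where \<phi>: "strict_mono \<phi>" and l: "\<And>i. i < Suc N \<Longrightarrow> l i \<in> X \<and> (\<lambda>n. Y (\<phi> n) i) \<longlonglongrightarrow> l i"
    using finite_family_convergent_subsequence[OF compact, of "Suc N" Y] YX by blast
  \<comment> \<open>The pieces have equal length, so each limit edge obeys its own bound
    \<open>3 * s / N\<close>; the closed polygon through the limit points then has length at most
    \<open>3 * s\<close>.\<close>
  have dl: "dist (l i) (l (Suc i)) \<le> 3 * s / N" if i: "i < N" for i
  proof (rule LIMSEQ_le)
    show "(\<lambda>n. dist (Y (\<phi> n) i) (Y (\<phi> n) (Suc i))) \<longlonglongrightarrow> dist (l i) (l (Suc i))"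
      using l[of i] l[of "Suc i"] i by (intro tendsto_dist) auto
    have "(\<lambda>n. 3 * (s + 1 / Suc n) / N) \<longlonglongrightarrow> 3 * (s + 0) / N"
      using Npos by (intro tendsto_intros LIMSEQ_Suc lim_1_over_n) auto
    then show "(\<lambda>n. 3 * (s + 1 / Suc n) / N) \<longlonglongrightarrow> 3 * s / N" by simp
    show "\<exists>M. \<forall>n\<ge>M. dist (Y (\<phi> n) i) (Y (\<phi> n) (Suc i)) \<le> 3 * (s + 1 / Suc n) / N"
    proof (intro exI[of _ 0] allI impI)
      fix n
      have "n \<le> \<phi> n" using seq_suble[OF \<phi>] .
      then have "1 / real (Suc (\<phi> n)) \<le> 1 / Suc n" by (simp add: frac_le)
      then have "arclen (B (\<phi> n)) 1 / N \<le> 3 * (s + 1 / Suc n) / N"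
        using len(2)[of "\<phi> n"] by (intro divide_right_mono) auto
      then show "dist (Y (\<phi> n) i) (Y (\<phi> n) (Suc i)) \<le> 3 * (s + 1 / Suc n) / N"
        using dY[OF i, of "\<phi> n"] by linarith
    qed
  qed
  have "(\<lambda>n. Y (\<phi> n) N) = (\<lambda>n. Y (\<phi> n) 0)" using B(2) by (simp add: Y_def t)
  then have lN: "l N = l 0" using l[of N] l[of 0] LIMSEQ_unique by (metis zero_less_Suc lessI)
  have "\<forall>\<^sub>F n in sequentially. \<forall>i\<in>{..<Suc N}. dist (Y (\<phi> n) i) (l i) < s / 4"
  proof (intro eventually_ball_finite ballI)
    fix i assume "i \<in> {..<Suc N}"
    then have "(\<lambda>n. Y (\<phi> n) i) \<longlonglongrightarrow> l i" using l by simp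
    from tendstoD[OF this, of "s / 4"] show "\<forall>\<^sub>F n in sequentially. dist (Y (\<phi> n) i) (l i) < s / 4"
      using s_pos by simp
  qed simp
  then obtain n where n: "\<And>i. i < Suc N \<Longrightarrow> dist (Y (\<phi> n) i) (l i) < s / 4"
    using eventually_happens'[OF sequentially_bot] by fastforce
  let ?m = "\<phi> n" and ?is = "[0..<Suc N]"
  let ?\<beta> = "B ?m" and ?\<beta>' = "fill (map l ?is)"
  have lX: "set (map l ?is) \<subseteq> X" using l by auto
  have is_nth: "?is ! k = k" if "k < Suc N" for k
    using that nth_upt[of 0 k "Suc N"] by (simp del: upt_Suc)
  have s4: "3 * s / N < s / 4" using N4 by (metis (no_types, lifting) divide_right_mono
      le_less_trans of_nat_0_le_iff mult_left_mono less_imp_le less_add_one zero_le_numeral)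
  \<comment> \<open>Each cell of the ladder is cut along the diagonal from \<open>Y ?m i\<close> to
    \<open>l (Suc i)\<close>. The four sides are below \<open>s / 4\<close> and the diagonal below
    \<open>s / 2\<close>, so both triangles are simplices.\<close>
  have K: "{Y ?m i, Y ?m (Suc i), l (Suc i)} \<in> rips X s" "{Y ?m i, l i, l (Suc i)} \<in> rips X s" if
      i: "i < N" for i
  proof -
    have "dist (Y ?m i) (Y ?m (Suc i)) < s / 4" "dist (l i) (l (Suc i)) < s / 4"
      using le_less_trans[OF dY[OF i] piece_less] le_less_trans[OF dl[OF i] s4] by blast+
    moreover have "dist (Y ?m i) (l i) < s / 4" "dist (Y ?m (Suc i)) (l (Suc i)) < s / 4" using n
        i by auto
    moreover have "dist (Y ?m i) (l (Suc i)) \<le> dist (Y ?m i) (l i) + dist (l i) (l (Suc i))" by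
        (rule dist_triangle)
    ultimately have "dist (Y ?m i) (l (Suc i)) < s" "dist (Y ?m i) (Y ?m (Suc i)) < s" "dist (l i)
        (l (Suc i)) < s"
      "dist (Y ?m i) (l i) < s" "dist (Y ?m (Suc i)) (l (Suc i)) < s" using s_pos by auto
    then show "{Y ?m i, Y ?m (Suc i), l (Suc i)} \<in> rips X s" "{Y ?m i, l i, l (Suc i)} \<in> rips X s"
      using YX[of i ?m] YX[of "Suc i" ?m] l[of i] l[of "Suc i"] i s_pos
      by (auto intro!: ripsI simp: dist_commute)
  qed
  have faces: "{Y ?m i, Y ?m (Suc i)} \<in> rips X s" "{l i, l (Suc i)} \<in> rips X s" if i: "i < N" for i
    using rips.face[OF K(1)[OF i], of "{Y ?m i, Y ?m (Suc i)}"] rips.face[OF K(2)[OF i], of "{l i,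
        l (Suc i)}"] by auto
  have rungs: "{Y ?m i, l i} \<in> rips X s" if i: "i < Suc N" for i
    using n[OF i] YX[OF i, of ?m] l[OF i] s_pos by (intro ripsI) (auto simp: dist_commute)
  have ladder: "cocycle_prod \<P> rips.edge_class (map (Y ?m) ?is) \<otimes>\<^bsub>\<P>\<^esub> rips.edge_class (Y ?m (last
      ?is)) (l (last ?is)) =
      rips.edge_class (Y ?m (hd ?is)) (l (hd ?is)) \<otimes>\<^bsub>\<P>\<^esub> cocycle_prod \<P> rips.edge_class (map l ?is)"
  proof (rule cocycle_prod_ladder[THEN conjunct2, THEN conjunct2])
    show "?is \<noteq> []" by simp
    show "rips.edge_class (Y ?m i) (l i) \<in> carrier \<P>" if "i \<in> set ?is" for i
      using that by (intro rips.edge_class_closed rungs) auto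
    fix k assume "Suc k < length ?is"
    then have k: "k < N" by simp
    show "rips.edge_class (Y ?m (?is ! k)) (Y ?m (?is ! Suc k)) \<in> carrier \<P> \<and>
      rips.edge_class (l (?is ! k)) (l (?is ! Suc k)) \<in> carrier \<P> \<and>
      rips.edge_class (Y ?m (?is ! k)) (Y ?m (?is ! Suc k)) \<otimes>\<^bsub>\<P>\<^esub> rips.edge_class (Y ?m (?is ! Suc
          k)) (l (?is ! Suc k)) =
      rips.edge_class (Y ?m (?is ! k)) (l (?is ! k)) \<otimes>\<^bsub>\<P>\<^esub> rips.edge_class (l (?is ! k)) (l (?is !
          Suc k))"
      using k K[OF k] faces[OF k] by (simp add: is_nth rips.edge_class_closed rips.edge_class_mult
          del: upt_Suc)
  qed (rule rips.is_group)
  have "chain (rips X s) (map l ?is)"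
    unfolding chain_def
  proof (intro conjI ballI allI impI)
    fix v assume "v \<in> set (map l ?is)"
    then show "{v} \<in> rips X s" using lX s_pos by (intro ripsI) auto
  next
    fix i assume "Suc i < length (map l ?is)"
    then show "{map l ?is ! i, map l ?is ! Suc i} \<in> rips X s"
      using faces(2)[of i] by (simp add: is_nth del: upt_Suc)
  qed simp
  then have \<Psi>': "\<Psi> ?\<beta>' = cocycle_prod \<P> rips.edge_class (map l ?is)" by (rule transport_fill)
  have \<Psi>: "\<Psi> ?\<beta> = cocycle_prod \<P> rips.edge_class (map (Y ?m) ?is)"
  proof -
    let ?ts = "map (t ?m) ?is"
    have "t ?m i \<le> t ?m j" if "i \<le> j" "j \<le> N" for i j
      using that
    proof (induction j rule: dec_induct)
      case (step k)
      then show ?case using t(5)[of k ?m] by simp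
    qed simp
    then have "sorted ?ts" by (auto simp: sorted_iff_nth_mono is_nth simp del: upt_Suc)
    moreover have "\<exists>U\<in>small_sets s. ?\<beta> ` {?ts ! i..?ts ! Suc i} \<subseteq> U" if "Suc i < length ?ts" for i
    proof -
      have i: "i < N" using that by simp
      have ti: "t ?m i \<in> {0..1}" "t ?m (Suc i) \<in> {0..1}" "t ?m i < t ?m (Suc i)" using t(3,5) i by
          auto
      have "diameter (?\<beta> ` {t ?m i..t ?m (Suc i)}) \<le> arclen ?\<beta> 1 / N"
        using rectifiable_path.curve_length_arclen(1)[OF rp, of "t ?m i" "t ?m (Suc i)" ?m] ti
            piece[OF i, of ?m]
          len(1)[of ?m] s_pos
        by (intro diameter_image_le_curve_length) auto
      also have "\<dots> < s / 4" by (rule piece_less)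
      also have "\<dots> < s" using s_pos by simp
      finally have "?\<beta> ` {t ?m i..t ?m (Suc i)} \<in> small_sets s"
        using rect_pathin[OF B(1)[of ?m]] ti by (auto simp: small_sets_def pathin_X image_subset_iff)
      then show ?thesis using i by (auto simp: is_nth simp del: upt_Suc)
    qed
    ultimately have "\<Psi> ?\<beta> = cocycle_prod \<P> rips.edge_class (map ?\<beta> ?ts)"
      using t by (intro sampling.transport_cocycle_prod rect_pathin B) (auto simp: hd_map last_map
          simp del: upt_Suc)
    also have "map ?\<beta> ?ts = map (Y ?m) ?is" by (simp add: Y_def)
    finally show ?thesis .
  qed
  \<comment> \<open>Both vertex sequences are closed, so the rung at 0 is also the rung at
    \<open>N\<close> and conjugates one value into the other.\<close>
  have g: "rips.edge_class (Y ?m 0) (l 0) \<in> carrier \<P>" by (intro rips.edge_class_closed rungs) simp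
  have "Y ?m N = Y ?m 0" using B(2)[of ?m] by (simp add: Y_def t)
  then have "\<Psi> ?\<beta> \<otimes>\<^bsub>\<P>\<^esub> rips.edge_class (Y ?m 0) (l 0) = rips.edge_class (Y ?m 0) (l 0) \<otimes>\<^bsub>\<P>\<^esub> \<Psi> ?\<beta>'"
    using ladder lN hd_upt[of 0 "Suc N"] unfolding \<Psi> \<Psi>' by (simp add: last_upt del: upt_Suc)
  moreover have "rect ?\<beta>'" "?\<beta>' 1 = ?\<beta>' 0"
    using fill[of "map l ?is"] lX lN by (auto simp: hd_map last_map simp del: upt_Suc)
  moreover have "curve_length 0 1 ?\<beta>' \<le> ennreal (3 * s)"
  proof -
    have "curve_length 0 1 ?\<beta>' \<le> ennreal (3 * s / N * (length (map l ?is) - 1))"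
      using dl lX s_pos by (intro fill_length_le) (auto simp: is_nth simp del: upt_Suc)
    also have "3 * s / N * (length (map l ?is) - 1) = 3 * s" using Npos by simp
    finally show ?thesis .
  qed
  ultimately have "good ?\<beta>" unfolding good_def using g by blast
  then show False using B(4) by blast
qed

definition critical_classes :: "(real \<Rightarrow> 'a \<Rightarrow> real) set set" where
  "critical_classes = {rips_class X b s (sample_loop p ts) | p ts.
     (\<exists>x1 x2 x3 \<alpha>'. critical_triangle X b s {x1, x2, x3} \<and> distinct [x1, x2, x3] \<and>
        filling X [x1, x2, x3, x1] \<alpha>' \<and> p \<in> curve_lassos X b \<alpha>') \<and> based_sample s p ts}"

text \<open>\<open>critical_triangle\<close> forgets the order of the vertices and the filling that
  witness it. The side lengths survive, so every filling of every ordering has length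
  \<open>3 * s\<close>, whether or not it is itself essential.\<close>

lemma critical_filling_length:
  assumes "critical_triangle X b s {x1, x2, x3}" "distinct [x1, x2, x3]" "filling X [x1, x2, x3,
      x1] \<alpha>"
  shows "curve_length 0 1 \<alpha> = ennreal (3 * s)"
proof -
  obtain y1 y2 y3 \<alpha>' where y: "{x1, x2, x3} = {y1, y2, y3}" and via: "critical_triangle_via X b s
      y1 y2 y3 \<alpha>'"
    using assms(1) unfolding critical_triangle_def by blast
  note d = critical_triangle_essential(1-3)[OF via]
  have "dist u v = s" if "u \<in> {y1, y2, y3}" "v \<in> {y1, y2, y3}" "u \<noteq> v" for u v
    using that d by (auto simp: dist_commute)
  then have "dist x1 x2 = s" "dist x2 x3 = s" "dist x3 x1 = s"
    using assms(2) unfolding y[symmetric] by auto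
  then show ?thesis using filling_length(3)[OF assms(3)] by simp
qed

lemma critical_classesE:
  assumes "a \<in> critical_classes"
  obtains p \<alpha> where "a = \<Psi> p" "p \<in> curve_lassos X b \<alpha>" "rect \<alpha>" "\<alpha> 1 = \<alpha> 0"
    "curve_length 0 1 \<alpha> = ennreal (3 * s)" "p \<in> loopsin (top_of_set X) b" "rect p"
proof -
  obtain p ts x1 x2 x3 \<alpha> where a: "a = rips_class X b s (sample_loop p ts)" and bs: "based_sample
      s p ts"
    and c: "critical_triangle X b s {x1, x2, x3}" "distinct [x1, x2, x3]" "filling X [x1, x2, x3,
        x1] \<alpha>"
    and p: "p \<in> curve_lassos X b \<alpha>"
    using assms unfolding critical_classes_def by blast
  note fl = filling_length[OF c(3)]
  obtain "p \<in> loopsin (top_of_set X) b" "rect p" using curve_lassosE[OF p fl(1,2)] by metis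
  then show thesis
    using that[OF _ p fl(1,2) critical_filling_length[OF c]] based_sample_class[OF _ bs] a by simp
qed

lemma critical_classes_carrier: "critical_classes \<subseteq> carrier \<P>"
proof
  fix a assume "a \<in> critical_classes"
  then obtain p where "a = \<Psi> p" "rect p" using critical_classesE by metis
  then show "a \<in> carrier \<P>" by (simp add: rect_pathin)
qed

text \<open>Surjectivity of \<Psi> with a prescribed end point: any conjugating element of
  \<open>\<P>\<close> can be realised by the tail of a lasso attached at \<open>x\<close>.\<close>

lemma transport_from_base:
  assumes h: "h \<in> carrier \<P>" and x: "x \<in> X"
  obtains \<gamma> where "rect \<gamma>" "\<gamma> 0 = b" "\<gamma> 1 = x" "\<Psi> \<gamma> = h"
proof -
  have t: "rect (tau x)" "tau x 0 = b" "tau x 1 = x" using x base.tau[of x] by (auto simp: rect_tau)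
  then have tc: "\<Psi> (tau x) \<in> carrier \<P>" by (simp add: rect_pathin)
  then have "h \<otimes>\<^bsub>\<P>\<^esub> inv\<^bsub>\<P>\<^esub> \<Psi> (tau x) \<in> carrier \<P>" using h by simp
  then obtain \<rho> where \<rho>: "rect \<rho>" "\<rho> 0 = b" "\<rho> 1 = b" "\<Psi> \<rho> = h \<otimes>\<^bsub>\<P>\<^esub> inv\<^bsub>\<P>\<^esub> \<Psi> (tau x)"
    unfolding transport_surj by (elim imageE CollectE conjE) simp
  have "\<Psi> (joinin \<rho> (tau x)) = h"
    using \<rho> t h tc by (simp add: sampling.transport_join rect_pathin rips.m_assoc)
  then show thesis using that[of "joinin \<rho> (tau x)"] rect_join[OF \<rho>(1) t(1)] \<rho> t by simp
qed

text \<open>Loops shorter than \<open>3 * s\<close> have trivial value, so \<beta> has length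
  exactly \<open>3 * s\<close> and is essential. It therefore fills a critical triangle formed by
  its own points, and \<open>h\<close> is absorbed into the tail of a lasso.\<close>

lemma essential_conj_in_critical_classes:
  assumes \<beta>: "rect \<beta>" "\<beta> 1 = \<beta> 0" "curve_length 0 1 \<beta> \<le> ennreal (3 * s)" and ne: "\<Psi> \<beta> \<noteq> \<one>\<^bsub>\<P>\<^esub>"
    and h: "h \<in> carrier \<P>"
  shows "h \<otimes>\<^bsub>\<P>\<^esub> \<Psi> \<beta> \<otimes>\<^bsub>\<P>\<^esub> inv\<^bsub>\<P>\<^esub> h \<in> critical_classes"
proof -
  have "\<not> curve_length 0 1 \<beta> < ennreal (3 * s)"
    using transport_small_loop[OF rect_pathin[OF \<beta>(1)] \<beta>(2)] ne by blast
  then have len: "curve_length 0 1 \<beta> = ennreal (3 * s)" using \<beta>(3) by simp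
  interpret E: essential_loop X b s \<beta>
    using \<beta> len ne transport_loop_eq_one_iff[OF \<beta>(1,2)] by unfold_locales auto
  have "0 \<le> s" "s \<le> arclen \<beta> 1" "2 * s \<le> arclen \<beta> 1" using E.arclen_end s_pos by auto
  moreover from this obtain t2 where t2: "t2 \<in> {0..1}" "arclen \<beta> t2 = s" using E.arclen_surj by blast
  moreover from calculation obtain t3 where t3: "t3 \<in> {0..1}" "arclen \<beta> t3 = 2 * s"
    using E.arclen_surj[of "2 * s"] by (metis mult_nonneg_nonneg zero_le_numeral)
  ultimately have t: "t2 \<in> {0..1}" "t3 \<in> {0..1}" "arclen \<beta> t2 = s" "arclen \<beta> t3 = 2 * s" by blast+
  note ef = E.equidistant_filling[OF t]
  have crit: "critical_triangle X b s {\<beta> 0, \<beta> t2, \<beta> t3}" using ef(4) unfolding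
      critical_triangle_def by blast
  have "\<beta> 0 \<in> X" using E.in_X by simp
  then obtain \<gamma> where \<gamma>: "rect \<gamma>" "\<gamma> 0 = b" "\<gamma> 1 = \<beta> 0" "\<Psi> \<gamma> = h" using transport_from_base[OF h]
      by blast
  let ?p = "joinin \<gamma> (joinin (shiftpath 0 \<beta>) (reversein \<gamma>))"
  have p: "?p \<in> curve_lassos X b \<beta>"
    unfolding curve_lassos_def joinpaths_eq_joinin reversepath_eq_reversein
    using \<gamma> by (intro CollectI exI[of _ \<gamma>] exI[of _ 0]) (simp add: finite_path_from_iff
        pathfinish_def)
  obtain lp: "?p \<in> loopsin (top_of_set X) b" "rect ?p" using curve_lassosE[OF p \<beta>(1,2)] by metis
  have sh: "rect (shiftpath 0 \<beta>)" "shiftpath 0 \<beta> 0 = \<beta> 0" "shiftpath 0 \<beta> 1 = \<beta> 0"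
    using shiftpath_loop[OF \<beta>(1,2), of 0] by auto
  have "\<Psi> (shiftpath 0 \<beta>) = \<Psi> \<beta>"
    by (rule sampling.transport_cong[OF rect_pathin[OF \<beta>(1)]]) (auto simp: shiftpath_def)
  then have "\<Psi> ?p = h \<otimes>\<^bsub>\<P>\<^esub> \<Psi> \<beta> \<otimes>\<^bsub>\<P>\<^esub> inv\<^bsub>\<P>\<^esub> h"
    using \<gamma> sh h \<beta>(1)
    by (simp add: sampling.transport_join sampling.transport_reverse rect_pathin pathin_joinin
        pathin_reversein rips.m_assoc)
  moreover obtain ts where ts: "based_sample s ?p ts"
    using based_sample_exists[OF rect_pathin[OF lp(2)] _ s_pos] lp(1) by (auto simp: loopsin_def)
  moreover have "rips_class X b s (sample_loop ?p ts) \<in> critical_classes"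
    unfolding critical_classes_def using crit ef(1,2) p ts by blast
  ultimately show ?thesis using based_sample_class[OF lp(1) ts] by simp
qed

text \<open>The element \<open>g\<close> that compares a loop with its shortened version joins the
  tail as a further conjugating factor. The result is either trivial or one of the
  generators.\<close>

lemma short_lasso_in_generated:
  assumes short: "\<And>\<beta>. rect \<beta> \<Longrightarrow> \<beta> 1 = \<beta> 0 \<Longrightarrow> curve_length 0 1 \<beta> < ennreal (3 * s') \<Longrightarrow>
    \<exists>\<beta>' g. rect \<beta>' \<and> \<beta>' 1 = \<beta>' 0 \<and> curve_length 0 1 \<beta>' \<le> ennreal (3 * s) \<and> g \<in> carrier \<P> \<and> \<Psi> \<beta> \<otimes>\<^bsub>\<P>\<^esub>
        g = g \<otimes>\<^bsub>\<P>\<^esub> \<Psi> \<beta>'"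
    and a: "a \<in> lasso_group X b (3 * s')"
  shows "\<exists>p\<in>loopsin (top_of_set X) b. base.pclass p = a \<and> \<Psi> p \<in> generate \<P> critical_classes"
proof (rule transport_lasso_group_subgroup[OF _ _ a])
  let ?N = "generate \<P> critical_classes"
  show sub: "subgroup ?N \<P>" by (rule rips.generate_is_subgroup[OF critical_classes_carrier])
  fix \<gamma> \<beta> assume \<gamma>: "rect \<gamma>" and \<beta>: "rect \<beta>" "\<beta> 1 = \<beta> 0" "curve_length 0 1 \<beta> < ennreal (3 * s')"
  obtain \<beta>' g where \<beta>': "rect \<beta>'" "\<beta>' 1 = \<beta>' 0" "curve_length 0 1 \<beta>' \<le> ennreal (3 * s)"
    and g: "g \<in> carrier \<P>" "\<Psi> \<beta> \<otimes>\<^bsub>\<P>\<^esub> g = g \<otimes>\<^bsub>\<P>\<^esub> \<Psi> \<beta>'"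
    using short[OF \<beta>] by auto
  have c: "\<Psi> \<gamma> \<in> carrier \<P>" "\<Psi> \<beta> \<in> carrier \<P>" "\<Psi> \<beta>' \<in> carrier \<P>"
    using \<gamma> \<beta>(1) \<beta>'(1) by (auto simp: rect_pathin)
  have "\<Psi> \<beta> = g \<otimes>\<^bsub>\<P>\<^esub> \<Psi> \<beta>' \<otimes>\<^bsub>\<P>\<^esub> inv\<^bsub>\<P>\<^esub> g"
    using g c by (metis rips.inv_solve_right rips.m_closed)
  then have eq: "\<Psi> \<gamma> \<otimes>\<^bsub>\<P>\<^esub> \<Psi> \<beta> \<otimes>\<^bsub>\<P>\<^esub> inv\<^bsub>\<P>\<^esub> \<Psi> \<gamma> =
      (\<Psi> \<gamma> \<otimes>\<^bsub>\<P>\<^esub> g) \<otimes>\<^bsub>\<P>\<^esub> \<Psi> \<beta>' \<otimes>\<^bsub>\<P>\<^esub> inv\<^bsub>\<P>\<^esub> (\<Psi> \<gamma> \<otimes>\<^bsub>\<P>\<^esub> g)"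
    using g c by (simp add: rips.m_assoc rips.inv_mult_group)
  show "\<Psi> \<gamma> \<otimes>\<^bsub>\<P>\<^esub> \<Psi> \<beta> \<otimes>\<^bsub>\<P>\<^esub> inv\<^bsub>\<P>\<^esub> \<Psi> \<gamma> \<in> ?N"
  proof (cases "\<Psi> \<beta>' = \<one>\<^bsub>\<P>\<^esub>")
    case True
    then show ?thesis unfolding eq using c g subgroup.one_closed[OF sub] by simp
  next
    case False
    then show ?thesis
      unfolding eq using essential_conj_in_critical_classes[OF \<beta>' False] c g by (intro
          generate.incl) simp
  qed
qed

theorem kernel_bonding_map:
  assumes cons: "consecutive_critical_values X b s r'"
  shows "kernel (rips_group X b s) (rips_group X b r') (bonding_map X b r') = generate (rips_group
      X b s) critical_classes"
proof -
  have sr: "s < r'" and nc: "\<And>x. s < x \<Longrightarrow> x < r' \<Longrightarrow> \<not> critical_value X b x"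
    using cons unfolding consecutive_critical_values_def by blast+
  interpret T: two_scales X b s r' using sr s_pos by (intro two_scales) auto
  let ?ker = "kernel \<P> T.hi.\<P> (bonding_map X b r')"
  have in_ker: "\<Psi> p \<in> ?ker \<longleftrightarrow> base.pclass p \<in> lasso_group X b (3 * r')" if p: "rect p" "p 0 = b" "p
      1 = b" for p
    using p T.hi.transport_eq_one_iff[OF p] T.bonding_transport[OF T.rect_loop[OF p]] by (simp
        add: kernel_def rect_pathin)
  have "?ker = generate \<P> critical_classes"
  proof
    show "generate \<P> critical_classes \<subseteq> ?ker"
    proof (rule rips.generate_subgroup_incl)
      show "subgroup ?ker \<P>"
        using T.bonding_hom T.hi.rips.is_group rips.is_group unfolding rips_group_def
        by (intro group_hom.subgroup_kernel) (simp add: group_hom_def group_hom_axioms_def)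
      show "critical_classes \<subseteq> ?ker"
      proof
        fix a assume "a \<in> critical_classes"
        then obtain p \<alpha> where p: "a = \<Psi> p" "p \<in> curve_lassos X b \<alpha>" "rect \<alpha>" "\<alpha> 1 = \<alpha> 0"
          "curve_length 0 1 \<alpha> = ennreal (3 * s)" "p \<in> loopsin (top_of_set X) b" "rect p"
          by (rule critical_classesE)
        have "curve_length 0 1 \<alpha> < ennreal (3 * r')" unfolding p(5) using sr s_pos by (intro
            ennreal_lessI) auto
        then have "base.pclass \<alpha> \<in> lasso_group X b (3 * r')"
          using p by (intro small_loop_in_lasso_group) (auto simp: rect_pathin)
        then have "base.pclass p \<in> lasso_group X b (3 * r')"
          using curve_lasso_iff[OF p(2-4)] base.pclass_loop[OF p(6)] by simp
        then show "a \<in> ?ker" using in_ker[OF p(7)] p(1,6) by (simp add: loopsin_def)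
      qed
    qed
    show "?ker \<subseteq> generate \<P> critical_classes"
    proof
      fix a assume a: "a \<in> ?ker"
      then obtain p where p: "rect p" "p 0 = b" "p 1 = b" "a = \<Psi> p"
        using transport_surj by (auto simp: kernel_def)
      obtain s' where s': "s' > s" and short: "\<And>\<beta>. rect \<beta> \<Longrightarrow> \<beta> 1 = \<beta> 0 \<Longrightarrow> curve_length 0 1 \<beta> <
          ennreal (3 * s') \<Longrightarrow>
        \<exists>\<beta>' g. rect \<beta>' \<and> \<beta>' 1 = \<beta>' 0 \<and> curve_length 0 1 \<beta>' \<le> ennreal (3 * s) \<and> g \<in> carrier \<P> \<and> \<Psi> \<beta>
            \<otimes>\<^bsub>\<P>\<^esub> g = g \<otimes>\<^bsub>\<P>\<^esub> \<Psi> \<beta>'"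
        using loop_shortening by blast
      \<comment> \<open>\<open>u\<close> stays strictly above the critical value \<open>s\<close>
        and below \<open>r'\<close>, so scales between \<open>u\<close> and \<open>v\<close> are not
        critical; \<open>u \<le> s'\<close> keeps it in the range where loops can be
        shortened.\<close>
      define u where "u = min s' ((s + r') / 2)"
      have u: "s < u" "u < r'" "u \<le> s'" "0 < u" using s' sr s_pos by (auto simp: u_def min_def)
      have "base.pclass p \<in> lasso_group X b (3 * r')" using in_ker[OF p(1-3)] a p(4) by simp
      then obtain v where v: "u \<le> v" "v < r'" "base.pclass p \<in> lasso_group X b (3 * v)"
        using lasso_group_left_continuous[OF _ u(2,4)] by blast
      have "lasso_group X b (3 * v) \<subseteq> lasso_group X b (3 * u)"
        using u v nc by (intro noncritical_lasso_group) auto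
      also have "\<dots> \<subseteq> lasso_group X b (3 * s')" using u by (intro lasso_group_mono) simp
      finally have "base.pclass p \<in> lasso_group X b (3 * s')" using v(3) by blast
      from short_lasso_in_generated[OF short this] obtain q where q: "q \<in> loopsin (top_of_set X) b"
        "base.pclass q = base.pclass p" "\<Psi> q \<in> generate \<P> critical_classes" by blast
      then show "a \<in> generate \<P> critical_classes"
        using transport_eq_if_pclass_eq[OF q(1) _ q(2)] p by (simp add: loopsin_def rect_pathin)
    qed
  qed
  then show ?thesis by (simp add: rips_group_def)
qed

theorem essential_loop_characterisation:
  assumes \<alpha>: "loop_in X \<alpha>" "curve_length 0 1 \<alpha> = ennreal (3 * s)"
  shows "(\<exists>p\<in>curve_lassos X b \<alpha>. loop_class (top_of_set X) b p \<notin> lasso_group X b (3 * s)) \<longleftrightarrow>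
      essential_loop X b s \<alpha>"
    "(\<forall>p\<in>curve_lassos X b \<alpha>. loop_class (top_of_set X) b p \<notin> lasso_group X b (3 * s)) \<longleftrightarrow>
      essential_loop X b s \<alpha>"
proof -
  have r: "rect \<alpha>" "\<alpha> 1 = \<alpha> 0" using \<alpha> by (auto simp: loop_in_iff rect_def)
  have "essential_loop X b s \<alpha> \<longleftrightarrow> base.pclass \<alpha> \<notin> lasso_group X b (3 * s)"
    using r \<alpha>(2) rips_scale_axioms by (simp add: essential_loop_def essential_loop_axioms_def)
  then show "(\<exists>p\<in>curve_lassos X b \<alpha>. loop_class (top_of_set X) b p \<notin> lasso_group X b (3 * s)) \<longleftrightarrow>
      essential_loop X b s \<alpha>"
    "(\<forall>p\<in>curve_lassos X b \<alpha>. loop_class (top_of_set X) b p \<notin> lasso_group X b (3 * s)) \<longleftrightarrow>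
      essential_loop X b s \<alpha>"
    using curve_lasso_iff[OF _ r, of _ "3 * s"] curve_lassos_nonempty[OF r(1)] by auto
qed

end

theorem theorem7p14:
  fixes X :: "'a::metric_space set" and b :: 'a and r :: real
  assumes "compact X" and "geodesic_space X" and "b \<in> X" and "r > 0"
  shows
    "(\<forall>x1 x2 x3 \<alpha>. critical_triangle_via X b r x1 x2 x3 \<alpha> \<longrightarrow>
        (dist x1 x2 = r \<and> dist x2 x3 = r \<and> dist x3 x1 = r) \<and>
        (\<forall>p \<in> curve_lassos X b \<alpha>. loop_class (top_of_set X) b p \<notin> lasso_group X b (3 * r)) \<and>
        curve_length 0 1 \<alpha> = ennreal (3 * r))
     \<and>
     (\<forall>r'. consecutive_critical_values X b r r' \<longrightarrow>
        kernel (rips_group X b r) (rips_group X b r') (bonding_map X b r') =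
        generate (rips_group X b r)
          {rips_class X b r (sample_loop p ts) | p ts.
             (\<exists>x1 x2 x3 \<alpha>'. critical_triangle X b r {x1, x2, x3} \<and> distinct [x1, x2, x3] \<and>
                filling X [x1, x2, x3, x1] \<alpha>' \<and> p \<in> curve_lassos X b \<alpha>') \<and>
             based_sample r p ts})
     \<and>
     (\<forall>\<alpha>. loop_in X \<alpha> \<and> curve_length 0 1 \<alpha> = ennreal (3 * r) \<longrightarrow>
        ((\<exists>p \<in> curve_lassos X b \<alpha>. loop_class (top_of_set X) b p \<notin> lasso_group X b (3 * r)) \<longleftrightarrow>
         (\<forall>p \<in> curve_lassos X b \<alpha>. loop_class (top_of_set X) b p \<notin> lasso_group X b (3 * r)))
        \<and>
        ((\<exists>p \<in> curve_lassos X b \<alpha>. loop_class (top_of_set X) b p \<notin> lasso_group X b (3 * r)) \<longrightarrow>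
           geodesic_circle X \<alpha> \<and>
           critical_value X b r \<and>
           (\<forall>x1 \<in> path_image \<alpha>. \<forall>x2 \<in> path_image \<alpha>. \<forall>x3 \<in> path_image \<alpha>.
              distinct [x1, x2, x3] \<and> dist x1 x2 = dist x2 x3 \<and> dist x2 x3 = dist x3 x1 \<longrightarrow>
              {x1, x2, x3} \<in> closed_rips X r \<and> critical_triangle X b r {x1, x2, x3})))"
proof -
  interpret rips_scale X b r
    using assms by unfold_locales
  have 1: "(dist x1 x2 = r \<and> dist x2 x3 = r \<and> dist x3 x1 = r) \<and>
      (\<forall>p \<in> curve_lassos X b \<alpha>. loop_class (top_of_set X) b p \<notin> lasso_group X b (3 * r)) \<and>
      curve_length 0 1 \<alpha> = ennreal (3 * r)"
    if "critical_triangle_via X b r x1 x2 x3 \<alpha>" for x1 x2 x3 \<alpha>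
    using critical_triangle_essential[OF that] curve_lasso_iff[of _ \<alpha> "3 * r"] by blast
  have 3: "((\<exists>p \<in> curve_lassos X b \<alpha>. loop_class (top_of_set X) b p \<notin> lasso_group X b (3 * r)) \<longleftrightarrow>
       (\<forall>p \<in> curve_lassos X b \<alpha>. loop_class (top_of_set X) b p \<notin> lasso_group X b (3 * r))) \<and>
      ((\<exists>p \<in> curve_lassos X b \<alpha>. loop_class (top_of_set X) b p \<notin> lasso_group X b (3 * r)) \<longrightarrow>
      geodesic_circle X \<alpha> \<and> critical_value X b r \<and>
      (\<forall>x1 \<in> path_image \<alpha>. \<forall>x2 \<in> path_image \<alpha>. \<forall>x3 \<in> path_image \<alpha>.
        distinct [x1, x2, x3] \<and> dist x1 x2 = dist x2 x3 \<and> dist x2 x3 = dist x3 x1 \<longrightarrow>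
        {x1, x2, x3} \<in> closed_rips X r \<and> critical_triangle X b r {x1, x2, x3}))"
    if \<alpha>: "loop_in X \<alpha>" "curve_length 0 1 \<alpha> = ennreal (3 * r)" for \<alpha>
  proof (rule conjI; ((rule impI)?; (intro conjI)?))
    show "(\<exists>p \<in> curve_lassos X b \<alpha>. loop_class (top_of_set X) b p \<notin> lasso_group X b (3 * r)) \<longleftrightarrow>
       (\<forall>p \<in> curve_lassos X b \<alpha>. loop_class (top_of_set X) b p \<notin> lasso_group X b (3 * r))"
      using essential_loop_characterisation[OF \<alpha>] by simp
  next
    assume "\<exists>p \<in> curve_lassos X b \<alpha>. loop_class (top_of_set X) b p \<notin> lasso_group X b (3 * r)"
    then interpret essential_loop X b r \<alpha>
      using essential_loop_characterisation(1)[OF \<alpha>] by simp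
    show "geodesic_circle X \<alpha>" by (rule geodesic_circle)
    show "critical_value X b r" using right_critical by (simp add: critical_value_def)
    show "\<forall>x1 \<in> path_image \<alpha>. \<forall>x2 \<in> path_image \<alpha>. \<forall>x3 \<in> path_image \<alpha>.
        distinct [x1, x2, x3] \<and> dist x1 x2 = dist x2 x3 \<and> dist x2 x3 = dist x3 x1 \<longrightarrow>
        {x1, x2, x3} \<in> closed_rips X r \<and> critical_triangle X b r {x1, x2, x3}"
      using equidistant_critical by blast
  qed
  show ?thesis
    by (intro conjI; intro allI impI)
      (rule 1, assumption, rule kernel_bonding_map[unfolded critical_classes_def], assumption, elim conjE, rule 3)
qed

end
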